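(* If $q$ is not a root of $1$, then every right coideal subalgebra $\mathbf U\supseteq\mathbf k[H]$ of $U_q(\mathfrak{sl}_{n+1})$ has a decomposition $$\mathbf U=\mathbf U^-\otimes_{\mathbf k[F]}\mathbf k[H]\otimes_{\mathbf k[G]}\mathbf U^+$$ (as a subspace $\mathbf U^-\cdot\mathbf k[H]\cdot\mathbf U^+$ with respect to the triangular decomposition), where $\mathbf U^+\supseteq\mathbf k[G]$ and $\mathbf U^-\supseteq\mathbf k[F]$ are right coideal subalgebras of $U_q^+(\mathfrak{sl}_{n+1})$ and $U_q^-(\mathfrak{sl}_{n+1})$, respectively. If $q$ has finite multiplicative order $t>2$, then this is the case for $\Gamma$-homogeneous right coideal subalgebras $\mathbf U\supseteq\mathbf k[H]$ of $u_q(\mathfrak{sl}_{n+1})$ (with $\mathbf U^\pm$ right coideal subalgebras of $u_q^\pm(\mathfrak{sl}_{n+1})$).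
   Context: Let $\mathbf k$ be a field, $n\ge1$, $q\in\mathbf k$, $q\ne0,\pm1$. Let $G$ be a commutative group, $g_1,\dots,g_n\in G$, $\chi^1,\dots,\chi^n:G\to\mathbf k^*$ characters such that $p_{ij}:=\chi^i(g_j)$ satisfy $p_{ii}=q$, $p_{i\,i+1}p_{i+1\,i}=q^{-1}$, $p_{ij}p_{ji}=1$ for $|i-j|>1$. Let $F$ be an abelian group generated by $f_1,\dots,f_n$ having characters $\chi^i_-$ with $\chi^i_-(f_j)=p_{ji}^{-1}$. Extend $\chi^i$ to $G\times F$ by $\chi^i(f_j)=p_{ji}$, and put $\chi^i_-=(\chi^i)^{-1}$ on $G\times F$. Let $H=(G\times F)/N$, where $N$ is a subgroup with $\chi^i(N)=1$ for all $i$, such that $G,F$ embed in $H$. Let $X=\{x_1,\dots,x_n\}$, $X^-=\{x_1^-,\dots,x_n^-\}$; $H\langle X\cup X^-\rangle$ is the skew group algebra with $g^{-1}x_ig=\chi^i(g)x_i$, $g^{-1}x_i^-g=\chi^i(g)^{-1}x_i^-$ ($g\in H$), a Hopf algebra with group-like $g\in H$ and $\Delta(x_i)=x_i\otimes1+g_i\otimes x_i$, $\Delta(x_i^-)=x_i^-\otimes1+f_i\otimes x_i^-$. For a word $u$ in $X\cup X^-$ let $g_u\in H$ and $\chi^u$ be obtained by replacing $x_i\mapsto g_i,\chi^i$ and $x_i^-\mapsto f_i,(\chi^i)^{-1}$; put $[u,v]=uv-\chi^u(g_v)vu$, extended bilinearly to elements homogeneous in each variable. $U_q(\mathfrak{sl}_{n+1})$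 is the quotient of $H\langle X\cup X^-\rangle$ by $[[x_i,x_{i+1}],x_{i+1}]=[x_i,[x_i,x_{i+1}]]=0$, $[x_i,x_j]=0$ ($|i-j|>1$), the same relations with all $x_i$ replaced by $x_i^-$, and $[x_i,x_j^-]=\delta_i^j(1-g_if_i)$. If $q$ has finite multiplicative order $t>2$, $u_q(\mathfrak{sl}_{n+1})$ is the quotient of $H\langle X\cup X^-\rangle$ by $[x_i,x_j^-]=\delta_i^j(1-g_if_i)$ and by $\mathbf\Lambda$, $\mathbf\Lambda^-$, the biggest Hopf ideals contained in the ideal of $G\langle X\rangle$ generated by all $x_ix_j$, resp. in the ideal of $F\langle X^-\rangle$ generated by all $x_i^-x_j^-$. $U_q^+(\mathfrak{sl}_{n+1})$, $u_q^+(\mathfrak{sl}_{n+1})$ (resp. $U_q^-$, $u_q^-$) denote the subalgebras generated by $G$ and $X$ (resp. by $F$ and $X^-$). One has the triangular decomposition $U_q(\mathfrak{sl}_{n+1})=U_q^-(\mathfrak{sl}_{n+1})\otimes_{\mathbf k[F]}\mathbf k[H]\otimes_{\mathbf k[G]}U_q^+(\mathfrak{sl}_{n+1})$ given by multiplication, and similarly for $u_q$. Both algebras are graded by the free abelian group $\Gamma$ on $x_1,\dots,x_n$ with $\deg x_i=x_i$, $\deg x_i^-=-x_i$, $\deg H=0$. A right coideal subalgebra of a Hopf algebra $A$ is a (unital) subalgebra $\mathbf U$ with $\Delta(\mathbf U)\subseteq\mathbf U\otimes A$. *)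

theory Defs
  imports "HOL-Algebra.QuotRing" "HOL-Algebra.Subrings" "HOL-Algebra.Free_Abelian_Groups"
    "HOL-Library.Poly_Mapping"
begin

text \<open>
  The free vector space on a type \<open>'s\<close> over a field \<open>'k\<close> is the type \<open>'s \<Rightarrow>\<^sub>0 'k\<close> of finitely
  supported functions; the free vector space on a set of generators consists of those with
  keys in that set.  An algebra over \<open>'k\<close> is a HOL-Algebra ring together with the
  field \<^const>\<open>smult\<close>.
\<close>

section \<open>Free vector spaces\<close>

definition pm_scale :: "'k::field \<Rightarrow> ('s \<Rightarrow>\<^sub>0 'k) \<Rightarrow> ('s \<Rightarrow>\<^sub>0 'k)" where
  "pm_scale c p = Poly_Mapping.map ((*) c) p"

lemma lookup_pm_scale: "Poly_Mapping.lookup (pm_scale c p) s = c * Poly_Mapping.lookup p s"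
  by (simp add: pm_scale_def Poly_Mapping.map.rep_eq when_def)

lemma vector_space_pm_scale: "vector_space (pm_scale :: 'k::field \<Rightarrow> ('s \<Rightarrow>\<^sub>0 'k) \<Rightarrow> _)"
  by unfold_locales
    (auto intro!: poly_mapping_eqI simp: lookup_pm_scale lookup_add algebra_simps)

abbreviation pm_span :: "('s \<Rightarrow>\<^sub>0 'k::field) set \<Rightarrow> ('s \<Rightarrow>\<^sub>0 'k) set" where
  "pm_span \<equiv> Modules.module.span pm_scale"

definition lin_ext :: "('s \<Rightarrow> ('t \<Rightarrow>\<^sub>0 'k)) \<Rightarrow> ('s \<Rightarrow>\<^sub>0 'k::field) \<Rightarrow> ('t \<Rightarrow>\<^sub>0 'k)" where
  "lin_ext f p = (\<Sum>s\<in>Poly_Mapping.keys p. pm_scale (Poly_Mapping.lookup p s) (f s))"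

definition bil_ext ::
  "('s \<Rightarrow> 't \<Rightarrow> ('r \<Rightarrow>\<^sub>0 'k)) \<Rightarrow> ('s \<Rightarrow>\<^sub>0 'k::field) \<Rightarrow> ('t \<Rightarrow>\<^sub>0 'k) \<Rightarrow> ('r \<Rightarrow>\<^sub>0 'k)" where
  "bil_ext f p q = (\<Sum>s\<in>Poly_Mapping.keys p. \<Sum>t\<in>Poly_Mapping.keys q. pm_scale (Poly_Mapping.lookup p s * Poly_Mapping.lookup q t) (f s t))"


section \<open>Tensor products\<close>

text \<open>
  For subspaces \<open>M\<close>, \<open>N\<close> of an algebra \<open>Q\<close>, the tensor product of \<open>M\<close> and \<open>N\<close> over the ground
  field is realised inside the tensor square of \<open>Q\<close>: the classes, modulo the bilinearity
  relations, of the formal combinations of pairs from \<open>M \<times> N\<close>.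
\<close>

definition tens_rel :: "('k::field, 'a, 'm) module_scheme \<Rightarrow> ('a \<times> 'a \<Rightarrow>\<^sub>0 'k) set" where
  "tens_rel Q = pm_span
    ({Poly_Mapping.single (x \<oplus>\<^bsub>Q\<^esub> x', y) 1 - Poly_Mapping.single (x, y) 1 - Poly_Mapping.single (x', y) 1 | x x' y.
        x \<in> carrier Q \<and> x' \<in> carrier Q \<and> y \<in> carrier Q}
   \<union> {Poly_Mapping.single (x, y \<oplus>\<^bsub>Q\<^esub> y') 1 - Poly_Mapping.single (x, y) 1 - Poly_Mapping.single (x, y') 1 | x y y'.
        x \<in> carrier Q \<and> y \<in> carrier Q \<and> y' \<in> carrier Q}
   \<union> {Poly_Mapping.single (c \<odot>\<^bsub>Q\<^esub> x, y) 1 - Poly_Mapping.single (x, y) c | c x y. x \<in> carrier Q \<and> y \<in> carrier Q}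
   \<union> {Poly_Mapping.single (x, c \<odot>\<^bsub>Q\<^esub> y) 1 - Poly_Mapping.single (x, y) c | c x y. x \<in> carrier Q \<and> y \<in> carrier Q})"

definition tens_class ::
  "('k::field, 'a, 'm) module_scheme \<Rightarrow> ('a \<times> 'a \<Rightarrow>\<^sub>0 'k) \<Rightarrow> ('a \<times> 'a \<Rightarrow>\<^sub>0 'k) set" where
  "tens_class Q p = (+) p ` tens_rel Q"

definition tens ::
  "('k::field, 'a, 'm) module_scheme \<Rightarrow> 'a set \<Rightarrow> 'a set \<Rightarrow> ('a \<times> 'a \<Rightarrow>\<^sub>0 'k) set set" where
  "tens Q M N = {tens_class Q p | p. Poly_Mapping.keys p \<subseteq> M \<times> N}"

text \<open>
  \<open>tens3 Q R S L M P\<close> is the balanced tensor product of \<open>L\<close>, \<open>M\<close> and \<open>P\<close>, the first two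
  over the subalgebra \<open>R\<close> and the last two over the subalgebra \<open>S\<close>; all actions are given by
  the multiplication of \<open>Q\<close>, and \<open>L\<close>, \<open>M\<close>, \<open>P\<close> are assumed to be stable under them.
\<close>

definition tens3_rel ::
  "('k::field, 'a, 'm) module_scheme \<Rightarrow> 'a set \<Rightarrow> 'a set \<Rightarrow> 'a set \<Rightarrow> 'a set \<Rightarrow> 'a set
    \<Rightarrow> ('a \<times> 'a \<times> 'a \<Rightarrow>\<^sub>0 'k) set" where
  "tens3_rel Q R S L M P = pm_span
    ({Poly_Mapping.single (x \<oplus>\<^bsub>Q\<^esub> x', y, z) 1 - Poly_Mapping.single (x, y, z) 1 - Poly_Mapping.single (x', y, z) 1 | x x' y z.
        x \<in> L \<and> x' \<in> L \<and> y \<in> M \<and> z \<in> P}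
   \<union> {Poly_Mapping.single (x, y \<oplus>\<^bsub>Q\<^esub> y', z) 1 - Poly_Mapping.single (x, y, z) 1 - Poly_Mapping.single (x, y', z) 1 | x y y' z.
        x \<in> L \<and> y \<in> M \<and> y' \<in> M \<and> z \<in> P}
   \<union> {Poly_Mapping.single (x, y, z \<oplus>\<^bsub>Q\<^esub> z') 1 - Poly_Mapping.single (x, y, z) 1 - Poly_Mapping.single (x, y, z') 1 | x y z z'.
        x \<in> L \<and> y \<in> M \<and> z \<in> P \<and> z' \<in> P}
   \<union> {Poly_Mapping.single (c \<odot>\<^bsub>Q\<^esub> x, y, z) 1 - Poly_Mapping.single (x, y, z) c | c x y z. x \<in> L \<and> y \<in> M \<and> z \<in> P}
   \<union> {Poly_Mapping.single (x, c \<odot>\<^bsub>Q\<^esub> y, z) 1 - Poly_Mapping.single (x, y, z) c | c x y z. x \<in> L \<and> y \<in> M \<and> z \<in> P}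
   \<union> {Poly_Mapping.single (x, y, c \<odot>\<^bsub>Q\<^esub> z) 1 - Poly_Mapping.single (x, y, z) c | c x y z. x \<in> L \<and> y \<in> M \<and> z \<in> P}
   \<union> {Poly_Mapping.single (x \<otimes>\<^bsub>Q\<^esub> r, y, z) 1 - Poly_Mapping.single (x, r \<otimes>\<^bsub>Q\<^esub> y, z) 1 | x y z r.
        x \<in> L \<and> y \<in> M \<and> z \<in> P \<and> r \<in> R}
   \<union> {Poly_Mapping.single (x, y \<otimes>\<^bsub>Q\<^esub> s, z) 1 - Poly_Mapping.single (x, y, s \<otimes>\<^bsub>Q\<^esub> z) 1 | x y z s.
        x \<in> L \<and> y \<in> M \<and> z \<in> P \<and> s \<in> S})"

definition tens3 ::
  "('k::field, 'a, 'm) module_scheme \<Rightarrow> 'a set \<Rightarrow> 'a set \<Rightarrow> 'a set \<Rightarrow> 'a set \<Rightarrow> 'a set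
    \<Rightarrow> ('a \<times> 'a \<times> 'a \<Rightarrow>\<^sub>0 'k) set set" where
  "tens3 Q R S L M P =
    {(+) p ` tens3_rel Q R S L M P | p. Poly_Mapping.keys p \<subseteq> L \<times> M \<times> P}"

definition mult3_formal ::
  "('k::field, 'a, 'm) module_scheme \<Rightarrow> ('a \<times> 'a \<times> 'a \<Rightarrow>\<^sub>0 'k) \<Rightarrow> 'a" where
  "mult3_formal Q p =
    finsum Q (\<lambda>(x, y, z). Poly_Mapping.lookup p (x, y, z) \<odot>\<^bsub>Q\<^esub> (x \<otimes>\<^bsub>Q\<^esub> y \<otimes>\<^bsub>Q\<^esub> z)) (Poly_Mapping.keys p)"

definition mult3 ::
  "('k::field, 'a, 'm) module_scheme \<Rightarrow> ('a \<times> 'a \<times> 'a \<Rightarrow>\<^sub>0 'k) set \<Rightarrow> 'a" where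
  "mult3 Q C = the_elem (mult3_formal Q ` C)"


section \<open>Hopf algebras\<close>

record (overloaded) ('k, 'a) hopf = "('k::zero, 'a) module" +
  comult :: "'a \<Rightarrow> ('a \<times> 'a \<Rightarrow>\<^sub>0 'k) set"
  counit :: "'a \<Rightarrow> 'k"
  antipode :: "'a \<Rightarrow> 'a"

definition subalg :: "('k::field, 'a, 'm) module_scheme \<Rightarrow> 'a set \<Rightarrow> bool" where
  "subalg Q B \<longleftrightarrow> subring B Q \<and> (\<forall>c. \<forall>b\<in>B. c \<odot>\<^bsub>Q\<^esub> b \<in> B)"

definition gen_subalg :: "('k::field, 'a, 'm) module_scheme \<Rightarrow> 'a set \<Rightarrow> 'a set" where
  "gen_subalg Q S = subalg Q hull S"

text \<open>
  Right coideal subalgebras \<open>U\<close> of a Hopf subalgebra \<open>B\<close> of \<open>Q\<close> (possibly all of \<open>Q\<close>), and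
  Hopf ideals \<open>J\<close> of \<open>B\<close>.  The tensor square of \<open>B\<close> is regarded as a subspace of that of \<open>Q\<close>.
\<close>

definition right_coideal_subalg ::
  "('k::field, 'a, 'm) hopf_scheme \<Rightarrow> 'a set \<Rightarrow> 'a set \<Rightarrow> bool" where
  "right_coideal_subalg Q B U \<longleftrightarrow>
    subalg Q U \<and> U \<subseteq> B \<and> (\<forall>u\<in>U. comult Q u \<in> tens Q U B)"

definition hopf_ideal :: "('k::field, 'a, 'm) hopf_scheme \<Rightarrow> 'a set \<Rightarrow> 'a set \<Rightarrow> bool" where
  "hopf_ideal Q B J \<longleftrightarrow>
    ideal J (Q\<lparr>carrier := B\<rparr>) \<and>
    (\<forall>a\<in>J. comult Q a \<in> {tens_class Q (p + r) | p r.
        Poly_Mapping.keys p \<subseteq> J \<times> B \<and> Poly_Mapping.keys r \<subseteq> B \<times> J}) \<and>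
    (\<forall>a\<in>J. counit Q a = 0) \<and>
    (\<forall>a\<in>J. antipode Q a \<in> J)"

text \<open>
  As for the multiplication of \<^const>\<open>FactRing\<close>, unions over all representatives are used to
  transport the operations to the quotient by a Hopf ideal.
\<close>

definition quot_mod :: "('k::field, 'a, 'm) hopf_scheme \<Rightarrow> 'a set \<Rightarrow> ('k, 'a set) module" where
  "quot_mod A I = ring.extend (A Quot I)
    (module.fields (\<lambda>c C. \<Union>a\<in>C. I +>\<^bsub>A\<^esub> (c \<odot>\<^bsub>A\<^esub> a)))"

definition quot_hopf :: "('k::field, 'a, 'm) hopf_scheme \<Rightarrow> 'a set \<Rightarrow> ('k, 'a set) hopf" where
  "quot_hopf A I = module.extend (quot_mod A I) (hopf.fields
    (\<lambda>C. \<Union>a\<in>C. \<Union>t\<in>comult A a.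
       tens_class (quot_mod A I) (lin_ext (\<lambda>(b, b'). Poly_Mapping.single (I +>\<^bsub>A\<^esub> b, I +>\<^bsub>A\<^esub> b') 1) t))
    (\<lambda>C. the_elem (counit A ` C))
    (\<lambda>C. \<Union>a\<in>C. I +>\<^bsub>A\<^esub> antipode A a))"


section \<open>The data\<close>

record ('g, 'f, 'k) datum =
  rk :: nat
  qpar :: 'k
  GG :: "'g monoid"
  FF :: "'f monoid"
  NN :: "('g \<times> 'f) set"
  gel :: "nat \<Rightarrow> 'g"
  fel :: "nat \<Rightarrow> 'f"
  chiG :: "nat \<Rightarrow> 'g \<Rightarrow> 'k"
  chiF :: "nat \<Rightarrow> 'f \<Rightarrow> 'k" \<comment> \<open>the characters \<open>\<chi>\<^sup>i\<^sub>-\<close> of \<open>F\<close>\<close>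

definition is_character :: "'g monoid \<Rightarrow> ('g \<Rightarrow> 'k::field) \<Rightarrow> bool" where
  "is_character G c \<longleftrightarrow> (\<forall>a\<in>carrier G. c a \<noteq> 0) \<and>
    (\<forall>a\<in>carrier G. \<forall>b\<in>carrier G. c (a \<otimes>\<^bsub>G\<^esub> b) = c a * c b)"

definition idx :: "('g, 'f, 'k) datum \<Rightarrow> nat set" where
  "idx D = {1..rk D}"

definition pp :: "('g, 'f, 'k) datum \<Rightarrow> nat \<Rightarrow> nat \<Rightarrow> 'k" where
  "pp D i j = chiG D i (gel D j)"

text \<open>On \<open>F\<close> the extended character \<open>\<chi>\<^sup>i\<close> is \<open>(\<chi>\<^sup>i\<^sub>-)\<^sup>-\<^sup>1\<close>, so that \<open>\<chi>\<^sup>i(f\<^sub>j) = p\<^sub>j\<^sub>i\<close>.\<close>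

definition chiGF :: "('g, 'f, 'k::field) datum \<Rightarrow> nat \<Rightarrow> 'g \<times> 'f \<Rightarrow> 'k" where
  "chiGF D i = (\<lambda>(a, b). chiG D i a * inverse (chiF D i b))"

definition HH :: "('g, 'f, 'k) datum \<Rightarrow> ('g \<times> 'f) set monoid" where
  "HH D = (GG D \<times>\<times> FF D) Mod NN D"

definition inG :: "('g, 'f, 'k) datum \<Rightarrow> 'g \<Rightarrow> ('g \<times> 'f) set" where
  "inG D a = NN D #>\<^bsub>GG D \<times>\<times> FF D\<^esub> (a, \<one>\<^bsub>FF D\<^esub>)"

definition inF :: "('g, 'f, 'k) datum \<Rightarrow> 'f \<Rightarrow> ('g \<times> 'f) set" where
  "inF D b = NN D #>\<^bsub>GG D \<times>\<times> FF D\<^esub> (\<one>\<^bsub>GG D\<^esub>, b)"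

definition chiH :: "('g, 'f, 'k::field) datum \<Rightarrow> nat \<Rightarrow> ('g \<times> 'f) set \<Rightarrow> 'k" where
  "chiH D i h = the_elem (chiGF D i ` h)"

definition quantum_datum :: "('g, 'f, 'k::field) datum \<Rightarrow> bool" where
  "quantum_datum D \<longleftrightarrow>
    1 \<le> rk D \<and> qpar D \<noteq> 0 \<and> qpar D \<noteq> 1 \<and> qpar D \<noteq> - 1 \<and>
    comm_group (GG D) \<and> (\<forall>i\<in>idx D. gel D i \<in> carrier (GG D)) \<and>
    (\<forall>i\<in>idx D. is_character (GG D) (chiG D i)) \<and>
    (\<forall>i\<in>idx D. pp D i i = qpar D) \<and>
    (\<forall>i. i \<in> idx D \<and> i + 1 \<in> idx D \<longrightarrow> pp D i (i + 1) * pp D (i + 1) i = inverse (qpar D)) \<and>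
    (\<forall>i\<in>idx D. \<forall>j\<in>idx D. \<bar>int i - int j\<bar> > 1 \<longrightarrow> pp D i j * pp D j i = 1) \<and>
    comm_group (FF D) \<and> (\<forall>i\<in>idx D. fel D i \<in> carrier (FF D)) \<and>
    generate (FF D) (fel D ` idx D) = carrier (FF D) \<and>
    (\<forall>i\<in>idx D. is_character (FF D) (chiF D i)) \<and>
    (\<forall>i\<in>idx D. \<forall>j\<in>idx D. chiF D i (fel D j) = inverse (pp D j i)) \<and>
    subgroup (NN D) (GG D \<times>\<times> FF D) \<and>
    (\<forall>i\<in>idx D. \<forall>x\<in>NN D. chiGF D i x = 1) \<and>
    inj_on (inG D) (carrier (GG D)) \<and> inj_on (inF D) (carrier (FF D))"


section \<open>The skew group algebra\<close>

datatype letter = Pos nat | Neg nat \<comment> \<open>\<open>x\<^sub>i\<close> and \<open>x\<^sub>i\<^sup>-\<close>\<close>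

type_synonym ('g, 'f) skew_basis = "('g \<times> 'f) set \<times> letter list"
type_synonym ('g, 'f, 'k) skew_elem = "('g, 'f) skew_basis \<Rightarrow>\<^sub>0 'k"

fun lgrp :: "('g, 'f, 'k) datum \<Rightarrow> letter \<Rightarrow> ('g \<times> 'f) set" where
  "lgrp D (Pos i) = inG D (gel D i)"
| "lgrp D (Neg i) = inF D (fel D i)"

fun lchar :: "('g, 'f, 'k::field) datum \<Rightarrow> letter \<Rightarrow> ('g \<times> 'f) set \<Rightarrow> 'k" where
  "lchar D (Pos i) h = chiH D i h"
| "lchar D (Neg i) h = inverse (chiH D i h)"

definition wgrp :: "('g, 'f, 'k) datum \<Rightarrow> letter list \<Rightarrow> ('g \<times> 'f) set" where
  "wgrp D w = foldr (\<lambda>y h. lgrp D y \<otimes>\<^bsub>HH D\<^esub> h) w \<one>\<^bsub>HH D\<^esub>"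

definition wchar :: "('g, 'f, 'k::field) datum \<Rightarrow> letter list \<Rightarrow> ('g \<times> 'f) set \<Rightarrow> 'k" where
  "wchar D w h = prod_list (map (\<lambda>y. lchar D y h) w)"

definition letters :: "('g, 'f, 'k) datum \<Rightarrow> letter set" where
  "letters D = Pos ` idx D \<union> Neg ` idx D"

text \<open>
  The pair \<open>(h, w)\<close> stands for the basis element \<open>h w\<close>, with the group element on the left;
  the relation \<open>h\<^sup>-\<^sup>1 x h = \<chi>(h) x\<close> gives \<open>w h = \<chi>\<^sup>w(h) h w\<close>.
\<close>

definition basis_mult :: "('g, 'f, 'k::field) datum \<Rightarrow>
    ('g, 'f) skew_basis \<Rightarrow> ('g, 'f) skew_basis \<Rightarrow> ('g, 'f, 'k) skew_elem" where
  "basis_mult D s t = Poly_Mapping.single (fst s \<otimes>\<^bsub>HH D\<^esub> fst t, snd s @ snd t) (wchar D (snd s) (fst t))"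

definition grp :: "('g \<times> 'f) set \<Rightarrow> ('g, 'f, 'k::field) skew_elem" where
  "grp h = Poly_Mapping.single (h, []) 1"

definition lett :: "('g, 'f, 'k) datum \<Rightarrow> letter \<Rightarrow> ('g, 'f, 'k::field) skew_elem" where
  "lett D y = Poly_Mapping.single (\<one>\<^bsub>HH D\<^esub>, [y]) 1"

definition skew_mod :: "('g, 'f, 'k::field) datum \<Rightarrow> ('k, ('g, 'f, 'k) skew_elem) module" where
  "skew_mod D = \<lparr>
     carrier = {a. Poly_Mapping.keys a \<subseteq> carrier (HH D) \<times> lists (letters D)},
     monoid.mult = bil_ext (basis_mult D),
     one = grp \<one>\<^bsub>HH D\<^esub>,
     ring.zero = 0,
     add = (+),
     smult = pm_scale\<rparr>"

text \<open>
  The coproduct and the antipode are the algebra homomorphism, resp. antihomomorphism,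
  determined by the values on generators.  For the coproduct this is carried out with formal
  combinations of pairs, using the product \<open>(a \<otimes> b)(c \<otimes> d) = ac \<otimes> bd\<close>.
\<close>

definition pair_mult :: "('k::field, 'a, 'm) module_scheme \<Rightarrow>
    ('a \<times> 'a \<Rightarrow>\<^sub>0 'k) \<Rightarrow> ('a \<times> 'a \<Rightarrow>\<^sub>0 'k) \<Rightarrow> ('a \<times> 'a \<Rightarrow>\<^sub>0 'k)" where
  "pair_mult Q = bil_ext (\<lambda>(a, b) (c, d). Poly_Mapping.single (a \<otimes>\<^bsub>Q\<^esub> c, b \<otimes>\<^bsub>Q\<^esub> d) 1)"

primrec delta_word :: "('g, 'f, 'k::field) datum \<Rightarrow> letter list \<Rightarrow>
    (('g, 'f, 'k) skew_elem \<times> ('g, 'f, 'k) skew_elem \<Rightarrow>\<^sub>0 'k)" where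
  "delta_word D [] = Poly_Mapping.single (\<one>\<^bsub>skew_mod D\<^esub>, \<one>\<^bsub>skew_mod D\<^esub>) 1"
| "delta_word D (y # w) = pair_mult (skew_mod D)
     (Poly_Mapping.single (lett D y, \<one>\<^bsub>skew_mod D\<^esub>) 1 + Poly_Mapping.single (grp (lgrp D y), lett D y) 1)
     (delta_word D w)"

definition delta_basis :: "('g, 'f, 'k::field) datum \<Rightarrow> ('g, 'f) skew_basis \<Rightarrow>
    (('g, 'f, 'k) skew_elem \<times> ('g, 'f, 'k) skew_elem \<Rightarrow>\<^sub>0 'k)" where
  "delta_basis D = (\<lambda>(h, w). pair_mult (skew_mod D) (Poly_Mapping.single (grp h, grp h) 1) (delta_word D w))"

primrec anti_word ::
    "('g, 'f, 'k::field) datum \<Rightarrow> letter list \<Rightarrow> ('g, 'f, 'k) skew_elem" where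
  "anti_word D [] = \<one>\<^bsub>skew_mod D\<^esub>"
| "anti_word D (y # w) =
     anti_word D w \<otimes>\<^bsub>skew_mod D\<^esub> (- (grp (inv\<^bsub>HH D\<^esub> (lgrp D y)) \<otimes>\<^bsub>skew_mod D\<^esub> lett D y))"

definition anti_basis ::
    "('g, 'f, 'k::field) datum \<Rightarrow> ('g, 'f) skew_basis \<Rightarrow> ('g, 'f, 'k) skew_elem" where
  "anti_basis D = (\<lambda>(h, w). anti_word D w \<otimes>\<^bsub>skew_mod D\<^esub> grp (inv\<^bsub>HH D\<^esub> h))"

definition skew :: "('g, 'f, 'k::field) datum \<Rightarrow> ('k, ('g, 'f, 'k) skew_elem) hopf" where
  "skew D = module.extend (skew_mod D) (hopf.fields
     (\<lambda>a. tens_class (skew_mod D) (lin_ext (delta_basis D) a))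
     (\<lambda>a. \<Sum>(h, w)\<in>Poly_Mapping.keys a. if w = [] then Poly_Mapping.lookup a (h, w) else 0)
     (lin_ext (anti_basis D)))"

text \<open>The subalgebras \<open>G\<langle>X\<rangle>\<close> and \<open>F\<langle>X\<^sup>-\<rangle>\<close> of the skew group algebra.\<close>

definition GX :: "('g, 'f, 'k::field) datum \<Rightarrow> ('g, 'f, 'k) skew_elem set" where
  "GX D = {a. Poly_Mapping.keys a \<subseteq> inG D ` carrier (GG D) \<times> lists (Pos ` idx D)}"

definition FX :: "('g, 'f, 'k::field) datum \<Rightarrow> ('g, 'f, 'k) skew_elem set" where
  "FX D = {a. Poly_Mapping.keys a \<subseteq> inF D ` carrier (FF D) \<times> lists (Neg ` idx D)}"


section \<open>Defining relations\<close>

text \<open>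
  The bilinear extension of \<open>[u, v] = uv - \<chi>\<^sup>u(g\<^sub>v) vu\<close> from words; it is only applied to
  linear combinations of words (without group-like factors).
\<close>

definition bracket :: "('g, 'f, 'k::field) datum \<Rightarrow>
    ('g, 'f, 'k) skew_elem \<Rightarrow> ('g, 'f, 'k) skew_elem \<Rightarrow> ('g, 'f, 'k) skew_elem" where
  "bracket D = bil_ext (\<lambda>s t. basis_mult D s t -
     pm_scale (wchar D (snd s) (wgrp D (snd t))) (basis_mult D t s))"

definition serre_rels ::
    "('g, 'f, 'k::field) datum \<Rightarrow> (nat \<Rightarrow> letter) \<Rightarrow> ('g, 'f, 'k) skew_elem set" where
  "serre_rels D L = (let x = (\<lambda>i. lett D (L i)) in
     {bracket D (bracket D (x i) (x (i + 1))) (x (i + 1)) | i. i \<in> idx D \<and> i + 1 \<in> idx D}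
   \<union> {bracket D (x i) (bracket D (x i) (x (i + 1))) | i. i \<in> idx D \<and> i + 1 \<in> idx D}
   \<union> {bracket D (x i) (x j) | i j. i \<in> idx D \<and> j \<in> idx D \<and> \<bar>int i - int j\<bar> > 1})"

definition mixed_rels :: "('g, 'f, 'k::field) datum \<Rightarrow> ('g, 'f, 'k) skew_elem set" where
  "mixed_rels D = {bracket D (lett D (Pos i)) (lett D (Neg j)) -
       (if i = j then \<one>\<^bsub>skew D\<^esub> - grp (inG D (gel D i) \<otimes>\<^bsub>HH D\<^esub> inF D (fel D i)) else 0)
     | i j. i \<in> idx D \<and> j \<in> idx D}"

definition Uq_ideal :: "('g, 'f, 'k::field) datum \<Rightarrow> ('g, 'f, 'k) skew_elem set" where
  "Uq_ideal D = Idl\<^bsub>skew D\<^esub> (serre_rels D Pos \<union> serre_rels D Neg \<union> mixed_rels D)"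

definition Lambda_pos :: "('g, 'f, 'k::field) datum \<Rightarrow> ('g, 'f, 'k) skew_elem set" where
  "Lambda_pos D = (GREATEST J. hopf_ideal (skew D) (GX D) J \<and>
     J \<subseteq> Idl\<^bsub>(skew D)\<lparr>carrier := GX D\<rparr>\<^esub>
       {lett D (Pos i) \<otimes>\<^bsub>skew D\<^esub> lett D (Pos j) | i j. i \<in> idx D \<and> j \<in> idx D})"

definition Lambda_neg :: "('g, 'f, 'k::field) datum \<Rightarrow> ('g, 'f, 'k) skew_elem set" where
  "Lambda_neg D = (GREATEST J. hopf_ideal (skew D) (FX D) J \<and>
     J \<subseteq> Idl\<^bsub>(skew D)\<lparr>carrier := FX D\<rparr>\<^esub>
       {lett D (Neg i) \<otimes>\<^bsub>skew D\<^esub> lett D (Neg j) | i j. i \<in> idx D \<and> j \<in> idx D})"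

definition uq_ideal :: "('g, 'f, 'k::field) datum \<Rightarrow> ('g, 'f, 'k) skew_elem set" where
  "uq_ideal D = Idl\<^bsub>skew D\<^esub> (mixed_rels D \<union> Lambda_pos D \<union> Lambda_neg D)"


section \<open>Quotients of the skew group algebra\<close>

text \<open>
  Here \<open>I\<close> is one of \<^const>\<open>Uq_ideal\<close> and \<^const>\<open>uq_ideal\<close>, giving \<open>U\<^sub>q(sl\<^sub>n\<^sub>+\<^sub>1)\<close> and \<open>u\<^sub>q(sl\<^sub>n\<^sub>+\<^sub>1)\<close>.
\<close>

definition skew_quot :: "('g, 'f, 'k::field) datum \<Rightarrow> ('g, 'f, 'k) skew_elem set \<Rightarrow>
    ('k, ('g, 'f, 'k) skew_elem set) hopf" where
  "skew_quot D I = quot_hopf (skew D) I"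

abbreviation Uq :: "('g, 'f, 'k::field) datum \<Rightarrow> ('k, ('g, 'f, 'k) skew_elem set) hopf" where
  "Uq D \<equiv> skew_quot D (Uq_ideal D)"

abbreviation uq :: "('g, 'f, 'k::field) datum \<Rightarrow> ('k, ('g, 'f, 'k) skew_elem set) hopf" where
  "uq D \<equiv> skew_quot D (uq_ideal D)"

text \<open>The image of the group algebra \<open>k[K]\<close> of a subgroup \<open>K\<close> of \<open>H\<close>.\<close>

definition grp_alg :: "('g, 'f, 'k::field) datum \<Rightarrow> ('g, 'f, 'k) skew_elem set \<Rightarrow>
    ('g \<times> 'f) set set \<Rightarrow> ('g, 'f, 'k) skew_elem set set" where
  "grp_alg D I K = {I +>\<^bsub>skew D\<^esub> a | a. Poly_Mapping.keys a \<subseteq> K \<times> {[]}}"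

abbreviation "kH D I \<equiv> grp_alg D I (carrier (HH D))"
abbreviation "kG D I \<equiv> grp_alg D I (inG D ` carrier (GG D))"
abbreviation "kF D I \<equiv> grp_alg D I (inF D ` carrier (FF D))"

definition pos_part :: "('g, 'f, 'k::field) datum \<Rightarrow> ('g, 'f, 'k) skew_elem set \<Rightarrow>
    ('g, 'f, 'k) skew_elem set set" where
  "pos_part D I = gen_subalg (skew_quot D I) ((+>\<^bsub>skew D\<^esub>) I `
     (grp ` inG D ` carrier (GG D) \<union> lett D ` Pos ` idx D))"

definition neg_part :: "('g, 'f, 'k::field) datum \<Rightarrow> ('g, 'f, 'k) skew_elem set \<Rightarrow>
    ('g, 'f, 'k) skew_elem set set" where
  "neg_part D I = gen_subalg (skew_quot D I) ((+>\<^bsub>skew D\<^esub>) I `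
     (grp ` inF D ` carrier (FF D) \<union> lett D ` Neg ` idx D))"

fun ldeg :: "letter \<Rightarrow> (nat \<Rightarrow>\<^sub>0 int)" where
  "ldeg (Pos i) = frag_of i"
| "ldeg (Neg i) = - frag_of i"

definition homog_comp :: "('g, 'f, 'k::field) datum \<Rightarrow> ('g, 'f, 'k) skew_elem set \<Rightarrow> (nat \<Rightarrow>\<^sub>0 int) \<Rightarrow>
    ('g, 'f, 'k) skew_elem set set" where
  "homog_comp D I \<gamma> =
    {I +>\<^bsub>skew D\<^esub> a | a. a \<in> carrier (skew D) \<and> (\<forall>(h, w)\<in>Poly_Mapping.keys a. sum_list (map ldeg w) = \<gamma>)}"

definition Gamma_homogeneous :: "('g, 'f, 'k::field) datum \<Rightarrow> ('g, 'f, 'k) skew_elem set \<Rightarrow>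
    ('g, 'f, 'k) skew_elem set set \<Rightarrow> bool" where
  "Gamma_homogeneous D I U \<longleftrightarrow> (\<forall>u\<in>U. \<exists>S v.
     finite S \<and> S \<subseteq> carrier (free_Abelian_group (idx D)) \<and>
     (\<forall>\<gamma>\<in>S. v \<gamma> \<in> U \<inter> homog_comp D I \<gamma>) \<and> u = finsum (skew_quot D I) v S)"

text \<open>
  The multiplication map from the balanced tensor product of \<open>U\<^sup>-\<close>, \<open>k[H]\<close> and \<open>U\<^sup>+\<close> is a
  bijection onto \<open>U\<close>; in particular \<open>U\<close> is the span \<open>U\<^sup>- k[H] U\<^sup>+\<close> of the products.
\<close>

definition has_triangular_decomp :: "('g, 'f, 'k::field) datum \<Rightarrow> ('g, 'f, 'k) skew_elem set \<Rightarrow>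
    ('g, 'f, 'k) skew_elem set set \<Rightarrow> bool" where
  "has_triangular_decomp D I U \<longleftrightarrow> (\<exists>Um Up.
     right_coideal_subalg (skew_quot D I) (neg_part D I) Um \<and> kF D I \<subseteq> Um \<and>
     right_coideal_subalg (skew_quot D I) (pos_part D I) Up \<and> kG D I \<subseteq> Up \<and>
     bij_betw (mult3 (skew_quot D I))
       (tens3 (skew_quot D I) (kF D I) (kG D I) Um (kH D I) Up) U)"

end

theory Submission
  imports Defs "HOL-Library.Sublist" "HOL-Library.Multiset"
begin

text \<open>
  Modulo the defining relations every element is a combination of \<open>h u v\<close> with \<open>h\<close> in \<open>H\<close>, \<open>u\<close> a negative
  and \<open>v\<close> a positive word, and the relations that remain between such elements are generated by a
  subspace \<open>J\<^sup>-\<close> of negative and a subspace \<open>J\<^sup>+\<close> of positive words, both stable under the skew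
  derivations coming from the coproduct.  For a right coideal subalgebra, applying functionals to
  the second tensor factor of a coproduct does not leave the subalgebra.  If \<open>a\<close> is a homogeneous
  element, the functionals supported on the longest negative words \<open>u\<close> (which then go with the
  longest words \<open>v\<close>) split the top part of \<open>a\<close> into its factors, up to \<open>J\<^sup>-\<close> and \<open>J\<^sup>+\<close>; hence this
  part lies in \<open>H U\<^sup>- U\<^sup>+\<close>, and induction gives the same for \<open>a\<close>.  When \<open>q\<close> is not a root of \<open>1\<close>, the
  conjugation action of \<open>H\<close> separates the degrees, because the Cartan matrix is invertible, so
  that homogeneity is automatic.
\<close>

section \<open>Linear algebra of finitely supported functions\<close>

text \<open>Computations take place with preimages in the skew group algebra, where the coproduct of
  a word is explicit. A functional can be applied to the second tensor factor only if it vanishes on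
  the defining ideal, and the difficulty is to have enough of these. They come from a normal form
  map \<open>nu\<close>, which kills the mixed relations because it is built from a representation
  satisfying them, and which sends the whole ideal into a space \<open>K\<close> of triangular
  elements made from J^- and J^+ alone; a functional vanishing on \<open>K\<close>, composed with
  \<open>nu\<close>, therefore descends. Stability of J^- and J^+ under the skew derivations is what
  makes \<open>K\<close> plus the mixed ideal a two-sided ideal. For the Serre relations it holds
  because the derivations annihilate them, one of the places where the values of p_ii and p_ij p_ji
  enter; for the biggest Hopf ideals it is read off from the coideal condition. Longest negative
  words are paired with longest positive ones since the degree fixes the difference of their index
  multisets.\<close>

interpretation pm: vector_space "pm_scale :: 'k::field \<Rightarrow> ('s \<Rightarrow>\<^sub>0 'k) \<Rightarrow> ('s \<Rightarrow>\<^sub>0 'k)"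
  by (rule vector_space_pm_scale)

section \<open>Linear maps and linear functionals as predicates\<close>

definition lin :: "(('s \<Rightarrow>\<^sub>0 'k::field) \<Rightarrow> ('t \<Rightarrow>\<^sub>0 'k)) \<Rightarrow> bool" where
  "lin f \<longleftrightarrow> (\<forall>a b. f (a + b) = f a + f b) \<and> (\<forall>c a. f (pm_scale c a) = pm_scale c (f a))"

definition lfun :: "(('s \<Rightarrow>\<^sub>0 'k::field) \<Rightarrow> 'k) \<Rightarrow> bool" where
  "lfun f \<longleftrightarrow> (\<forall>a b. f (a + b) = f a + f b) \<and> (\<forall>c a. f (pm_scale c a) = c * f a)"

lemma linI: "\<lbrakk>\<And>a b. f (a + b) = f a + f b; \<And>c a. f (pm_scale c a) = pm_scale c (f a)\<rbrakk> \<Longrightarrow> lin f"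
  by (simp add: lin_def)

lemma lin_add: "lin f \<Longrightarrow> f (a + b) = f a + f b"
  and lin_scale: "lin f \<Longrightarrow> f (pm_scale c a) = pm_scale c (f a)"
  by (auto simp: lin_def)

lemma lfun_add: "lfun f \<Longrightarrow> f (a + b) = f a + f b"
  and lfun_scale: "lfun f \<Longrightarrow> f (pm_scale c a) = c * f a"
  by (auto simp: lfun_def)

lemma pm_scale_simps [simp]:
  "pm_scale 0 a = 0" "pm_scale c 0 = 0" "pm_scale 1 a = a"
  "pm_scale c (pm_scale d a) = pm_scale (c * d) a"
  by (simp_all)

lemma pm_scale_single [simp]: "pm_scale c (Poly_Mapping.single s d) = Poly_Mapping.single s (c * d)"
  by (rule poly_mapping_eqI) (simp add: lookup_pm_scale lookup_single when_def)

lemma pm_scale_minus1: "pm_scale (- 1) a = - a"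
  by (simp add: pm.scale_minus_left)

lemma lin_zero: "lin f \<Longrightarrow> f 0 = 0"
  using lin_scale[of f 0 0] by simp

lemma lfun_zero: "lfun f \<Longrightarrow> f 0 = 0"
  using lfun_scale[of f 0 0] by simp

lemma lin_uminus: "lin f \<Longrightarrow> f (- a) = - f a"
  using lin_scale[of f "- 1" a] by (simp add: pm_scale_minus1)

lemma lfun_uminus: "lfun f \<Longrightarrow> f (- a) = - f a"
  using lfun_scale[of f "- 1" a] by (simp add: pm_scale_minus1)

lemma lin_diff: "lin f \<Longrightarrow> f (a - b) = f a - f b"
  using lin_add[of f a "- b"] lin_uminus[of f b] by simp

lemma lfun_diff: "lfun f \<Longrightarrow> f (a - b) = f a - f b"
  using lfun_add[of f a "- b"] lfun_uminus[of f b] by simp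

lemma lin_sum: "lin f \<Longrightarrow> f (sum g A) = (\<Sum>x\<in>A. f (g x))"
  by (induction A rule: infinite_finite_induct) (auto simp: lin_zero lin_add)

lemma lfun_sum: "lfun f \<Longrightarrow> f (sum g A) = (\<Sum>x\<in>A. f (g x))"
  by (induction A rule: infinite_finite_induct) (auto simp: lfun_zero lfun_add)

lemma lin_comp: "lin f \<Longrightarrow> lin g \<Longrightarrow> lin (\<lambda>x. f (g x))"
  by (simp add: lin_def)

lemma lfun_comp: "lfun f \<Longrightarrow> lin g \<Longrightarrow> lfun (\<lambda>x. f (g x))"
  by (simp add: lin_def lfun_def)

lemma lin_plus: "lin f \<Longrightarrow> lin g \<Longrightarrow> lin (\<lambda>x. f x + g x)"
  by (simp add: lin_def pm.scale_right_distrib algebra_simps)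

lemma lin_minus: "lin f \<Longrightarrow> lin g \<Longrightarrow> lin (\<lambda>x. f x - g x)"
  by (simp add: lin_def pm.scale_right_diff_distrib algebra_simps)

lemma lin_scaled: "lin f \<Longrightarrow> lin (\<lambda>x. pm_scale c (f x))"
  by (simp add: lin_def pm.scale_right_distrib mult.commute)

lemma lin_id: "lin (\<lambda>x. x)"
  by (simp add: lin_def)

lemma lin_const0: "lin (\<lambda>x. 0)"
  by (simp add: lin_def)

lemma lin_sum_fun: "(\<And>i. i \<in> A \<Longrightarrow> lin (f i)) \<Longrightarrow> lin (\<lambda>x. \<Sum>i\<in>A. f i x)"
  by (induction A rule: infinite_finite_induct) (auto simp: lin_const0 intro: lin_plus)

lemma lfun_lookup: "lfun (\<lambda>a. Poly_Mapping.lookup a s)"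
  by (simp add: lfun_def lookup_add lookup_pm_scale)

lemma lfun_mult: "lfun f \<Longrightarrow> lfun (\<lambda>x. c * f x)"
  by (simp add: lfun_def algebra_simps)

lemma subspace_vimage: "lin f \<Longrightarrow> pm.subspace W \<Longrightarrow> pm.subspace {a. f a \<in> W}"
  by (auto simp: pm.subspace_def lin_zero lin_add lin_scale)

lemma subspace_fun_kernel: "lfun f \<Longrightarrow> pm.subspace {a. f a = 0}"
  by (auto simp: pm.subspace_def lfun_zero lfun_add lfun_scale)

lemma lin_ext_superset:
  assumes "finite T" "Poly_Mapping.keys p \<subseteq> T"
  shows "lin_ext f p = (\<Sum>s\<in>T. pm_scale (Poly_Mapping.lookup p s) (f s))"
  unfolding lin_ext_def using assms
  by (intro sum.mono_neutral_left) (auto simp: in_keys_iff)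

lemma lin_lin_ext:
  fixes f :: "'s \<Rightarrow> ('t \<Rightarrow>\<^sub>0 'k::field)"
  shows "lin (lin_ext f)"
proof (rule linI)
  fix a b :: "'s \<Rightarrow>\<^sub>0 'k"
  let ?T = "Poly_Mapping.keys a \<union> Poly_Mapping.keys b"
  have T: "finite ?T" "Poly_Mapping.keys (a + b) \<subseteq> ?T"
    using keys_add[of a b] by auto
  show "lin_ext f (a + b) = lin_ext f a + lin_ext f b"
    using T by (simp add: lin_ext_superset[of ?T] lookup_add pm.scale_left_distrib sum.distrib)
next
  fix c :: 'k and a :: "'s \<Rightarrow>\<^sub>0 'k"
  have "Poly_Mapping.keys (pm_scale c a) \<subseteq> Poly_Mapping.keys a"
    by (auto simp: in_keys_iff lookup_pm_scale)
  then show "lin_ext f (pm_scale c a) = pm_scale c (lin_ext f a)"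
    by (simp add: lin_ext_superset[of "Poly_Mapping.keys a"] lookup_pm_scale pm.scale_sum_right)
qed

lemmas lin_ext_add = lin_add[OF lin_lin_ext]
  and lin_ext_diff = lin_diff[OF lin_lin_ext]
  and lin_ext_scale = lin_scale[OF lin_lin_ext]
  and lin_ext_sum = lin_sum[OF lin_lin_ext]
  and lin_ext_zero [simp] = lin_zero[OF lin_lin_ext]

lemma lin_ext_single [simp]: "lin_ext f (Poly_Mapping.single s c) = pm_scale c (f s)"
  by (cases "c = 0") (auto simp: lin_ext_def)

lemma lin_ext_cong:
  "(\<And>s. s \<in> Poly_Mapping.keys p \<Longrightarrow> f s = g s) \<Longrightarrow> lin_ext f p = lin_ext g p"
  by (simp add: lin_ext_def)

lemma pm_expand: "a = (\<Sum>s\<in>Poly_Mapping.keys a. Poly_Mapping.single s (Poly_Mapping.lookup a s))"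
  by (rule poly_mapping_eqI)
    (auto simp: lookup_sum lookup_single when_def in_keys_iff sum.delta')

lemma lin_eq_lin_ext:
  assumes f: "lin f"
  shows "f a = lin_ext (\<lambda>s. f (Poly_Mapping.single s 1)) a"
proof -
  have "f (Poly_Mapping.single s c) = pm_scale c (f (Poly_Mapping.single s 1))" for s c
    using lin_scale[OF f, of c "Poly_Mapping.single s 1"] by simp
  then have "f (\<Sum>s\<in>Poly_Mapping.keys a. Poly_Mapping.single s (Poly_Mapping.lookup a s)) =
      lin_ext (\<lambda>s. f (Poly_Mapping.single s 1)) a"
    unfolding lin_sum[OF f] lin_ext_def by (intro sum.cong refl) blast
  then show ?thesis by (simp flip: pm_expand)
qed

lemma lin_ext_single_id: "lin_ext (\<lambda>s. Poly_Mapping.single s 1) a = a"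
  by (subst lin_eq_lin_ext[OF lin_id, of a]) simp

lemma lin_eq_on_keys:
  assumes "lin f" "lin g"
    and "\<And>s. s \<in> Poly_Mapping.keys a \<Longrightarrow> f (Poly_Mapping.single s 1) = g (Poly_Mapping.single s 1)"
  shows "f a = g a"
  unfolding lin_eq_lin_ext[OF assms(1), of a] lin_eq_lin_ext[OF assms(2), of a]
  by (rule lin_ext_cong) (rule assms(3))

lemma lin_mem_on_keys:
  assumes "lin f" "pm.subspace W"
    and "\<And>s. s \<in> Poly_Mapping.keys a \<Longrightarrow> f (Poly_Mapping.single s 1) \<in> W"
  shows "f a \<in> W"
  unfolding lin_eq_lin_ext[OF assms(1), of a] lin_ext_def
  by (intro pm.subspace_sum pm.subspace_scale assms)

lemma lin_ext_mem:
  "pm.subspace W \<Longrightarrow> (\<And>s. s \<in> Poly_Mapping.keys a \<Longrightarrow> f s \<in> W) \<Longrightarrow> lin_ext f a \<in> W"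
  unfolding lin_ext_def by (intro pm.subspace_sum pm.subspace_scale) auto

lemma lfun_eq_on_keys:
  assumes "lfun f" "lfun g"
    and "\<And>s. s \<in> Poly_Mapping.keys a \<Longrightarrow> f (Poly_Mapping.single s 1) = g (Poly_Mapping.single s 1)"
  shows "f a = g a"
proof -
  have "f (Poly_Mapping.single s c) = c * f (Poly_Mapping.single s 1)"
    "g (Poly_Mapping.single s c) = c * g (Poly_Mapping.single s 1)" for s c
    using lfun_scale[OF assms(1), of c "Poly_Mapping.single s 1"]
      lfun_scale[OF assms(2), of c "Poly_Mapping.single s 1"] by auto
  then have "f (\<Sum>s\<in>Poly_Mapping.keys a. Poly_Mapping.single s (Poly_Mapping.lookup a s)) =
        g (\<Sum>s\<in>Poly_Mapping.keys a. Poly_Mapping.single s (Poly_Mapping.lookup a s))"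
    unfolding lfun_sum[OF assms(1)] lfun_sum[OF assms(2)]
    by (intro sum.cong refl) (metis assms(3))
  then show ?thesis by (simp flip: pm_expand)
qed

lemma lfun_zero_on_keys:
  assumes "lfun f" "\<And>s. s \<in> Poly_Mapping.keys a \<Longrightarrow> f (Poly_Mapping.single s 1) = 0"
  shows "f a = 0"
  using lfun_eq_on_keys[OF assms(1), of "\<lambda>_. 0" a] assms(2) by (simp add: lfun_def)

lemma lin_comp_lin_ext: "lin f \<Longrightarrow> f (lin_ext g a) = lin_ext (\<lambda>s. f (g s)) a"
  by (simp add: lin_ext_def lin_sum lin_scale)

lemma subspace_keys: "pm.subspace {a. Poly_Mapping.keys a \<subseteq> X}"
  unfolding pm.subspace_def
  by (auto simp: subset_iff in_keys_iff lookup_pm_scale lookup_add) (metis add_0)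

lemma span_lin_mem:
  assumes "lin f" "pm.subspace W" "\<And>x. x \<in> B \<Longrightarrow> f x \<in> W" "a \<in> pm.span B"
  shows "f a \<in> W"
  using pm.span_subspace_induct[OF assms(4) subspace_vimage[OF assms(1,2)]] assms(3) by auto

lemma span_lfun_zero:
  assumes "lfun f" "\<And>x. x \<in> B \<Longrightarrow> f x = 0" "a \<in> pm.span B"
  shows "f a = 0"
  using pm.span_subspace_induct[OF assms(3) subspace_fun_kernel[OF assms(1)]] assms(2) by auto

lemma bil_ext_eq: "bil_ext f p q = lin_ext (\<lambda>s. lin_ext (f s) q) p"
  by (simp add: bil_ext_def lin_ext_def pm.scale_sum_right)

lemma lin_bil_left: "lin (\<lambda>p. bil_ext f p q)"
  unfolding bil_ext_eq by (rule lin_lin_ext)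

lemma lin_bil_right: "lin (\<lambda>q. bil_ext f p q)"
  unfolding bil_ext_eq lin_ext_def[of _ p]
  by (intro lin_sum_fun lin_scaled lin_lin_ext)

lemma bil_ext_single [simp]:
  "bil_ext f (Poly_Mapping.single s c) (Poly_Mapping.single t d) = pm_scale (c * d) (f s t)"
  by (simp add: bil_ext_eq)

section \<open>Restriction of an element to part of the basis\<close>

definition restr :: "('s \<Rightarrow> bool) \<Rightarrow> ('s \<Rightarrow>\<^sub>0 'k::field) \<Rightarrow> ('s \<Rightarrow>\<^sub>0 'k)" where
  "restr P = lin_ext (\<lambda>s. if P s then Poly_Mapping.single s 1 else 0)"

lemma lin_restr: "lin (restr P)"
  unfolding restr_def by (rule lin_lin_ext)

lemma restr_single [simp]:
  "restr P (Poly_Mapping.single s c) = (if P s then Poly_Mapping.single s c else 0)"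
  by (simp add: restr_def)

lemma lookup_restr: "Poly_Mapping.lookup (restr P a) s = (if P s then Poly_Mapping.lookup a s else 0)"
proof (rule lfun_eq_on_keys[of "\<lambda>a. Poly_Mapping.lookup (restr P a) s"])
  show "lfun (\<lambda>a. Poly_Mapping.lookup (restr P a) s)"
    by (rule lfun_comp[OF lfun_lookup lin_restr])
  show "lfun (\<lambda>a. if P s then Poly_Mapping.lookup a s else 0)"
    by (simp add: lfun_def lookup_add lookup_pm_scale)
qed (auto simp: lookup_single when_def)

lemma keys_restr: "Poly_Mapping.keys (restr P a) = {s \<in> Poly_Mapping.keys a. P s}"
  by (auto simp: in_keys_iff lookup_restr split: if_splits)

lemma restr_id: "(\<And>s. s \<in> Poly_Mapping.keys a \<Longrightarrow> P s) \<Longrightarrow> restr P a = a"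
  by (rule poly_mapping_eqI) (auto simp: lookup_restr in_keys_iff)

lemma restr_none: "(\<And>s. s \<in> Poly_Mapping.keys a \<Longrightarrow> \<not> P s) \<Longrightarrow> restr P a = 0"
  by (rule poly_mapping_eqI) (auto simp: lookup_restr in_keys_iff)

lemma restr_restr: "restr P (restr Q a) = restr (\<lambda>s. P s \<and> Q s) a"
  by (rule poly_mapping_eqI) (auto simp: lookup_restr)

lemma sum_restr_fibres:
  assumes "finite T" "\<And>s. s \<in> Poly_Mapping.keys a \<Longrightarrow> d s \<in> T"
  shows "(\<Sum>t\<in>T. restr (\<lambda>s. d s = t) a) = a"
  using assms
  by (intro poly_mapping_eqI) (auto simp: lookup_sum lookup_restr in_keys_iff sum.delta')

lemma pm_induct [consumes 1, case_names zero single add]: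
  fixes a :: "'s \<Rightarrow>\<^sub>0 'k::field"
  assumes "Poly_Mapping.keys a \<subseteq> X"
    and "P 0" and "\<And>s c. s \<in> X \<Longrightarrow> P (Poly_Mapping.single s c)"
    and "\<And>a b. \<lbrakk>Poly_Mapping.keys a \<subseteq> X; Poly_Mapping.keys b \<subseteq> X; P a; P b\<rbrakk> \<Longrightarrow> P (a + b)"
  shows "P a"
proof -
  have "P (\<Sum>s\<in>A. Poly_Mapping.single s (Poly_Mapping.lookup a s)) \<and>
      Poly_Mapping.keys (\<Sum>s\<in>A. Poly_Mapping.single s (Poly_Mapping.lookup a s)) \<subseteq> X"
    if "finite A" "A \<subseteq> X" for A
    using that
  proof (induction A)
    case (insert s A)
    let ?u = "Poly_Mapping.single s (Poly_Mapping.lookup a s)"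
    let ?v = "\<Sum>s\<in>A. Poly_Mapping.single s (Poly_Mapping.lookup a s)"
    have u: "Poly_Mapping.keys ?u \<subseteq> X" "P ?u"
      using insert.prems assms(3) by auto
    have v: "Poly_Mapping.keys ?v \<subseteq> X" "P ?v"
      using insert.IH insert.prems by auto
    have "Poly_Mapping.keys (?u + ?v) \<subseteq> X"
      using keys_add[of ?u ?v] u(1) v(1) by (meson Un_least subset_trans)
    with assms(4)[OF u(1) v(1) u(2) v(2)] show ?case
      unfolding sum.insert[OF insert.hyps] by blast
  qed (simp add: assms(2))
  from this[of "Poly_Mapping.keys a"] assms(1) show ?thesis
    by (simp flip: pm_expand)
qed

text \<open>The functional is obtained as a linear map into the free space on the one-point type
  \<open>unit\<close>, so that its linearity is inherited from \<open>lin_ext\<close>.\<close>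

definition fun_ext :: "('s \<Rightarrow> 'k) \<Rightarrow> ('s \<Rightarrow>\<^sub>0 'k::field) \<Rightarrow> 'k" where
  "fun_ext f a = Poly_Mapping.lookup (lin_ext (\<lambda>s. Poly_Mapping.single () (f s)) a) ()"

lemma lfun_fun_ext: "lfun (fun_ext f)"
  unfolding fun_ext_def by (rule lfun_comp[OF lfun_lookup lin_lin_ext])

lemma fun_ext_single [simp]: "fun_ext f (Poly_Mapping.single s c) = c * f s"
  by (simp add: fun_ext_def)

subsection \<open>Relative dual bases\<close>

lemma lfun_extend:
  fixes B :: "('s \<Rightarrow>\<^sub>0 'k::field) set"
  assumes "pm.independent B"
  shows "\<exists>g. lfun g \<and> (\<forall>x\<in>B. g x = f x)"
proof -
  interpret P: vector_space_pair "pm_scale :: 'k \<Rightarrow> ('s \<Rightarrow>\<^sub>0 'k) \<Rightarrow> _" "(*) :: 'k \<Rightarrow> 'k \<Rightarrow> 'k"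
    by unfold_locales (auto simp: algebra_simps)
  from P.linear_independent_extend[OF assms, of f]
  obtain g where g: "Vector_Spaces.linear pm_scale (*) g" "\<forall>x\<in>B. g x = f x" by blast
  from g(1) have "lfun g"
    unfolding Vector_Spaces.linear_def module_hom_def module_hom_axioms_def lfun_def by blast
  with g(2) show ?thesis by blast
qed

text \<open>A basis of \<open>W\<close> is extended by vectors of \<open>V\<close>; the added
  vectors form \<open>E\<close>, and the functionals are their coordinate functions. Being
  coordinates complementary to \<open>W\<close>, they vanish on \<open>W\<close>, which is what lets
  them descend to a quotient.\<close>

lemma relative_dual_basis:
  fixes W V :: "('s \<Rightarrow>\<^sub>0 'k::field) set"
  assumes W: "pm.subspace W"
  obtains E \<phi> where "E \<subseteq> V" "\<And>e. lfun (\<phi> e)" "\<And>e w. e \<in> E \<Longrightarrow> w \<in> W \<Longrightarrow> \<phi> e w = 0"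
    "\<And>e e'. e \<in> E \<Longrightarrow> e' \<in> E \<Longrightarrow> \<phi> e e' = (if e = e' then 1 else 0)"
    "\<And>v. v \<in> V \<Longrightarrow> \<exists>F. finite F \<and> F \<subseteq> E \<and> (\<forall>e\<in>E - F. \<phi> e v = 0) \<and>
        v - (\<Sum>e\<in>F. pm_scale (\<phi> e v) e) \<in> W"
proof -
  obtain BW where BW: "BW \<subseteq> W" "pm.independent BW" "W \<subseteq> pm.span BW"
    using pm.maximal_independent_subset[of W] by blast
  obtain B where B: "BW \<subseteq> B" "B \<subseteq> W \<union> V" "pm.independent B" "W \<union> V \<subseteq> pm.span B"
    using pm.maximal_independent_subset_extend[of BW "W \<union> V"] BW by blast
  define E where "E = B - BW"
  \<comment> \<open>A vector of \<open>E\<close> inside \<open>W\<close> would depend on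
    \<open>BW\<close>. Hence the added vectors, which lie in the union of \<open>W\<close> and
    \<open>V\<close>, come from \<open>V\<close>.\<close>
  have notW: "e \<notin> W" if "e \<in> E" for e
  proof
    assume "e \<in> W"
    then have "e \<in> pm.span BW" using BW(3) by blast
    moreover have "BW \<subseteq> B - {e}" using that B(1) by (auto simp: E_def)
    ultimately have "e \<in> pm.span (B - {e})" using pm.span_mono by blast
    then show False using B(3) that by (auto simp: E_def pm.dependent_def)
  qed
  have "\<exists>\<phi>. lfun \<phi> \<and> (\<forall>x\<in>B. \<phi> x = (if x = e then 1 else 0))" for e
    using lfun_extend[OF B(3), of "\<lambda>x. if x = e then 1 else 0"] by blast
  then obtain \<phi> where \<phi>: "\<And>e. lfun (\<phi> e)" "\<And>e x. x \<in> B \<Longrightarrow> \<phi> e x = (if x = e then 1 else 0)"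
    by metis
  show thesis
  proof (rule that)
    show "E \<subseteq> V" using notW B(2) by (auto simp: E_def)
    show "lfun (\<phi> e)" for e by (rule \<phi>)
    show "\<phi> e w = 0" if "e \<in> E" "w \<in> W" for e w
    proof (rule span_lfun_zero[OF \<phi>(1)])
      show "w \<in> pm.span BW" using that BW by auto
      show "\<phi> e x = 0" if "x \<in> BW" for x
        using that \<open>e \<in> E\<close> B(1) \<phi>(2)[of x e] by (auto simp: E_def)
    qed
    show "\<phi> e e' = (if e = e' then 1 else 0)" if "e \<in> E" "e' \<in> E" for e e'
      using that \<phi>(2)[of e' e] by (auto simp: E_def)
    fix v assume "v \<in> V"
    then have "v \<in> pm.span B" using B(4) by blast
    then obtain T c where T: "finite T" "T \<subseteq> B" "v = (\<Sum>b\<in>T. pm_scale (c b) b)"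
      by (auto simp: pm.span_explicit)
    have \<phi>v: "\<phi> e v = (if e \<in> T then c e else 0)" for e
    proof -
      have "\<phi> e v = (\<Sum>b\<in>T. c b * \<phi> e b)"
        by (simp add: T(3) lfun_sum[OF \<phi>(1)] lfun_scale[OF \<phi>(1)])
      also have "\<dots> = (\<Sum>b\<in>T. if b = e then c b else 0)"
        using T(2) by (intro sum.cong) (auto simp: \<phi>(2) subset_iff)
      finally show ?thesis using T(1) by simp
    qed
    have h1: "v = (\<Sum>b\<in>T \<inter> E. pm_scale (c b) b) + (\<Sum>b\<in>T - E. pm_scale (c b) b)"
      unfolding T(3) using T(1) by (rule sum.Int_Diff)
    have h2: "(\<Sum>e\<in>T \<inter> E. pm_scale (\<phi> e v) e) = (\<Sum>b\<in>T \<inter> E. pm_scale (c b) b)"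
      by (intro sum.cong) (auto simp: \<phi>v)
    have "(\<Sum>b\<in>T - E. pm_scale (c b) b) \<in> W"
      using T(2) BW(1) W
      by (intro pm.subspace_sum pm.subspace_scale W) (auto simp: E_def)
    moreover have "v - (\<Sum>e\<in>T \<inter> E. pm_scale (\<phi> e v) e) = (\<Sum>b\<in>T - E. pm_scale (c b) b)"
      unfolding h2 by (subst h1) simp
    ultimately have "v - (\<Sum>e\<in>T \<inter> E. pm_scale (\<phi> e v) e) \<in> W" by simp
    then show "\<exists>F. finite F \<and> F \<subseteq> E \<and> (\<forall>e\<in>E - F. \<phi> e v = 0) \<and>
        v - (\<Sum>e\<in>F. pm_scale (\<phi> e v) e) \<in> W"
      using T(1) by (intro exI[of _ "T \<inter> E"]) (auto simp: \<phi>v)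
  qed
qed

section \<open>The skew group algebra\<close>

locale qd =
  fixes D :: "('g, 'f, 'k::field) datum"
  assumes qd: "quantum_datum D"
begin

abbreviation H where "H \<equiv> carrier (HH D)"
abbreviation hm (infixl "\<cdot>" 70) where "hm \<equiv> monoid.mult (HH D)"
abbreviation eH where "eH \<equiv> \<one>\<^bsub>HH D\<^esub>"
abbreviation hinv where "hinv h \<equiv> inv\<^bsub>HH D\<^esub> h"
abbreviation W where "W \<equiv> lists (letters D)"
abbreviation bs :: "('g \<times> 'f) set \<Rightarrow> letter list \<Rightarrow> ('g, 'f, 'k) skew_elem" where
  "bs h w \<equiv> Poly_Mapping.single (h, w) 1"
abbreviation mul (infixl "\<star>" 70) where "mul \<equiv> bil_ext (basis_mult D)"
abbreviation wl where "wl w \<equiv> bs eH w"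
definition CS :: "('g, 'f, 'k) skew_elem set" where
  "CS = {a. Poly_Mapping.keys a \<subseteq> H \<times> W}"

lemma GG: "comm_group (GG D)" and FF: "comm_group (FF D)"
  using qd by (auto simp: quantum_datum_def)

sublocale GG: comm_group "GG D" by (rule GG)
sublocale FF: comm_group "FF D" by (rule FF)
sublocale GF: comm_group "GG D \<times>\<times> FF D"
proof -
  interpret P: group "GG D \<times>\<times> FF D"
    by (rule DirProd_group) unfold_locales
  show "comm_group (GG D \<times>\<times> FF D)"
    by (rule P.group_comm_groupI) (auto simp: DirProd_def GG.m_comm FF.m_comm)
qed

lemma NN_subgroup: "subgroup (NN D) (GG D \<times>\<times> FF D)"
  using qd by (auto simp: quantum_datum_def)

sublocale NN: normal "NN D" "GG D \<times>\<times> FF D"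
  using NN_subgroup by (rule GF.subgroup_imp_normal)

sublocale HG: comm_group "HH D"
  unfolding HH_def using GF.abelian_FactGroup NN_subgroup by blast

lemma HH_elem: "h \<in> H \<Longrightarrow> \<exists>x\<in>carrier (GG D \<times>\<times> FF D). h = NN D #>\<^bsub>GG D \<times>\<times> FF D\<^esub> x"
  by (auto simp: HH_def carrier_FactGroup)

lemma coset_in_H: "x \<in> carrier (GG D \<times>\<times> FF D) \<Longrightarrow> NN D #>\<^bsub>GG D \<times>\<times> FF D\<^esub> x \<in> H"
  by (auto simp: HH_def carrier_FactGroup)

lemma coset_mult:
  "\<lbrakk>x \<in> carrier (GG D \<times>\<times> FF D); y \<in> carrier (GG D \<times>\<times> FF D)\<rbrakk> \<Longrightarrow>
   (NN D #>\<^bsub>GG D \<times>\<times> FF D\<^esub> x) \<cdot> (NN D #>\<^bsub>GG D \<times>\<times> FF D\<^esub> y) =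
    NN D #>\<^bsub>GG D \<times>\<times> FF D\<^esub> (x \<otimes>\<^bsub>GG D \<times>\<times> FF D\<^esub> y)"
  by (simp add: HH_def NN.rcos_sum)

lemma inG_closed: "a \<in> carrier (GG D) \<Longrightarrow> inG D a \<in> H"
  and inF_closed: "b \<in> carrier (FF D) \<Longrightarrow> inF D b \<in> H"
  by (auto simp: inG_def inF_def intro!: coset_in_H)

lemma inG_mult: "\<lbrakk>a \<in> carrier (GG D); b \<in> carrier (GG D)\<rbrakk> \<Longrightarrow> inG D (a \<otimes>\<^bsub>GG D\<^esub> b) = inG D a \<cdot> inG D b"
  by (simp add: inG_def coset_mult)

lemma inF_mult: "\<lbrakk>a \<in> carrier (FF D); b \<in> carrier (FF D)\<rbrakk> \<Longrightarrow> inF D (a \<otimes>\<^bsub>FF D\<^esub> b) = inF D a \<cdot> inF D b"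
  by (simp add: inF_def coset_mult)

abbreviation HGs where "HGs \<equiv> inG D ` carrier (GG D)"
abbreviation HFs where "HFs \<equiv> inF D ` carrier (FF D)"

lemma HGs_subgroup: "subgroup HGs (HH D)"
proof -
  interpret h: group_hom "GG D" "HH D" "inG D"
    by unfold_locales (auto simp: hom_def inG_closed inG_mult)
  show ?thesis by (rule h.img_is_subgroup)
qed

lemma HFs_subgroup: "subgroup HFs (HH D)"
proof -
  interpret h: group_hom "FF D" "HH D" "inF D"
    by unfold_locales (auto simp: hom_def inF_closed inF_mult)
  show ?thesis by (rule h.img_is_subgroup)
qed

lemma chiG_char: "i \<in> idx D \<Longrightarrow> is_character (GG D) (chiG D i)"
  and chiF_char: "i \<in> idx D \<Longrightarrow> is_character (FF D) (chiF D i)"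
  and gel_closed: "i \<in> idx D \<Longrightarrow> gel D i \<in> carrier (GG D)"
  and fel_closed: "i \<in> idx D \<Longrightarrow> fel D i \<in> carrier (FF D)"
  and chiF_fel: "i \<in> idx D \<Longrightarrow> j \<in> idx D \<Longrightarrow> chiF D i (fel D j) = inverse (pp D j i)"
  and chiGF_NN: "i \<in> idx D \<Longrightarrow> x \<in> NN D \<Longrightarrow> chiGF D i x = 1"
  and pp_diag: "i \<in> idx D \<Longrightarrow> pp D i i = qpar D"
  and pp_adj: "i \<in> idx D \<Longrightarrow> i + 1 \<in> idx D \<Longrightarrow> pp D i (i + 1) * pp D (i + 1) i = inverse (qpar D)"
  and pp_far: "i \<in> idx D \<Longrightarrow> j \<in> idx D \<Longrightarrow> \<bar>int i - int j\<bar> > 1 \<Longrightarrow> pp D i j * pp D j i = 1"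
  and q_nz: "qpar D \<noteq> 0"
  using qd by (auto simp: quantum_datum_def)

lemma char_one: "group G \<Longrightarrow> is_character G c \<Longrightarrow> c \<one>\<^bsub>G\<^esub> = 1"
  unfolding is_character_def
  by (metis group.is_monoid monoid.l_one monoid.one_closed mult_cancel_right1)

lemma chiGF_char: "i \<in> idx D \<Longrightarrow> is_character (GG D \<times>\<times> FF D) (chiGF D i)"
  using chiG_char[of i] chiF_char[of i]
  by (auto simp: is_character_def chiGF_def)

text \<open>The extended character is trivial on \<open>NN D\<close>, hence constant on each coset,
  and the \<open>the_elem\<close> in the definition of \<open>chiH\<close> denotes this
  constant.\<close>

lemma chiH_coset:
  assumes i: "i \<in> idx D" and x: "x \<in> carrier (GG D \<times>\<times> FF D)"
  shows "chiH D i (NN D #>\<^bsub>GG D \<times>\<times> FF D\<^esub> x) = chiGF D i x"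
proof -
  have eq: "chiGF D i (n \<otimes>\<^bsub>GG D \<times>\<times> FF D\<^esub> x) = chiGF D i x" if "n \<in> NN D" for n
    using chiGF_char[OF i] chiGF_NN[OF i that] x NN.subset that
    by (auto simp: is_character_def simp del: carrier_DirProd mult_DirProd)
  have "NN D #>\<^bsub>GG D \<times>\<times> FF D\<^esub> x \<noteq> {}"
    using GF.rcos_self[OF x NN_subgroup] by blast
  moreover have "chiGF D i y = chiGF D i x" if "y \<in> NN D #>\<^bsub>GG D \<times>\<times> FF D\<^esub> x" for y
    using that eq unfolding r_coset_def by blast
  ultimately show ?thesis
    unfolding chiH_def by (rule the_elem_image_unique)
qed

lemma chiH_char: "i \<in> idx D \<Longrightarrow> is_character (HH D) (chiH D i)"
  unfolding is_character_def
proof (intro conjI ballI)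
  assume i: "i \<in> idx D"
  note c = chiGF_char[OF i, unfolded is_character_def]
  show "chiH D i a \<noteq> 0" if "a \<in> H" for a
    using HH_elem[OF that] c by (auto simp: chiH_coset[OF i] simp del: carrier_DirProd)
  show "chiH D i (a \<cdot> b) = chiH D i a * chiH D i b" if "a \<in> H" "b \<in> H" for a b
    using HH_elem[OF that(1)] HH_elem[OF that(2)] c
    by (auto simp: chiH_coset[OF i] coset_mult simp del: carrier_DirProd mult_DirProd)
qed

lemma letters_cases: "y \<in> letters D \<Longrightarrow> (\<And>i. i \<in> idx D \<Longrightarrow> y = Pos i \<Longrightarrow> P) \<Longrightarrow> (\<And>i. i \<in> idx D \<Longrightarrow> y = Neg i \<Longrightarrow> P) \<Longrightarrow> P"
  by (auto simp: letters_def)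

lemma Pos_letters [simp]: "Pos i \<in> letters D \<longleftrightarrow> i \<in> idx D"
  and Neg_letters [simp]: "Neg i \<in> letters D \<longleftrightarrow> i \<in> idx D"
  by (auto simp: letters_def)

lemma lgrp_closed [simp]: "y \<in> letters D \<Longrightarrow> lgrp D y \<in> H"
  by (auto elim!: letters_cases simp: inG_closed inF_closed gel_closed fel_closed)

lemma lchar_nz [simp]: "y \<in> letters D \<Longrightarrow> h \<in> H \<Longrightarrow> lchar D y h \<noteq> 0"
  using chiH_char by (auto elim!: letters_cases simp: is_character_def)

lemma lchar_mult: "y \<in> letters D \<Longrightarrow> h \<in> H \<Longrightarrow> k \<in> H \<Longrightarrow> lchar D y (h \<cdot> k) = lchar D y h * lchar D y k"
  using chiH_char by (auto elim!: letters_cases simp: is_character_def)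

lemma lchar_one [simp]: "y \<in> letters D \<Longrightarrow> lchar D y eH = 1"
  using char_one[OF HG.is_group chiH_char] by (auto elim!: letters_cases)

lemma chiH_inG: "i \<in> idx D \<Longrightarrow> a \<in> carrier (GG D) \<Longrightarrow> chiH D i (inG D a) = chiG D i a"
  using char_one[OF FF.is_group chiF_char] unfolding inG_def by (simp add: chiH_coset chiGF_def)

lemma chiH_inF: "i \<in> idx D \<Longrightarrow> b \<in> carrier (FF D) \<Longrightarrow> chiH D i (inF D b) = inverse (chiF D i b)"
  using char_one[OF GG.is_group chiG_char] unfolding inF_def by (simp add: chiH_coset chiGF_def)

lemma chiH_lgrp [simp]:
  assumes "i \<in> idx D" "j \<in> idx D"
  shows "chiH D i (inG D (gel D j)) = pp D i j" "chiH D i (inF D (fel D j)) = pp D j i"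
  using assms by (simp_all add: chiH_inG chiH_inF gel_closed fel_closed chiF_fel, simp_all add: pp_def)

lemma pp_nz: "i \<in> idx D \<Longrightarrow> j \<in> idx D \<Longrightarrow> pp D i j \<noteq> 0"
  using lchar_nz[of "Pos i" "lgrp D (Pos j)"] lgrp_closed[of "Pos j"] by simp

lemma wchar_Nil [simp]: "wchar D [] h = 1"
  and wchar_Cons [simp]: "wchar D (y # w) h = lchar D y h * wchar D w h"
  and wchar_append [simp]: "wchar D (u @ v) h = wchar D u h * wchar D v h"
  by (simp_all add: wchar_def)

lemma wchar_nz [simp]: "w \<in> W \<Longrightarrow> h \<in> H \<Longrightarrow> wchar D w h \<noteq> 0"
  by (induction w) auto

lemma wchar_one [simp]: "w \<in> W \<Longrightarrow> wchar D w eH = 1"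
  by (induction w) auto

lemma wchar_mult: "w \<in> W \<Longrightarrow> h \<in> H \<Longrightarrow> k \<in> H \<Longrightarrow> wchar D w (h \<cdot> k) = wchar D w h * wchar D w k"
  by (induction w) (auto simp: lchar_mult)

lemma wgrp_Nil [simp]: "wgrp D [] = eH"
  and wgrp_Cons [simp]: "wgrp D (y # w) = lgrp D y \<cdot> wgrp D w"
  by (simp_all add: wgrp_def)

lemma wgrp_closed [simp]: "w \<in> W \<Longrightarrow> wgrp D w \<in> H"
  by (induction w) auto

lemma wgrp_append: "u \<in> W \<Longrightarrow> v \<in> W \<Longrightarrow> wgrp D (u @ v) = wgrp D u \<cdot> wgrp D v"
  by (induction u) (auto simp: HG.m_assoc)

lemma wchar_mset: "mset u = mset v \<Longrightarrow> wchar D u h = wchar D v h"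
  unfolding wchar_def by (metis mset_map prod_mset_prod_list)

text \<open>Commutativity of \<open>HH D\<close> makes the group element of a word independent of
  the order of its letters. Together with the same fact for characters this lets a multihomogeneous
  element be treated like a single word.\<close>

lemma wgrp_mset: "mset u = mset v \<Longrightarrow> u \<in> W \<Longrightarrow> wgrp D u = wgrp D v"
proof (induction u arbitrary: v)
  case (Cons y u)
  then obtain v1 v2 where v: "v = v1 @ y # v2"
    by (metis in_set_conv_decomp list.set_intros(1) mset_eq_setD)
  have vW: "v \<in> W" using Cons.prems
    by (metis lists_eq_set mem_Collect_eq mset_eq_setD)
  with v have W: "v1 \<in> W" "y \<in> letters D" "v2 \<in> W" by auto
  have "wgrp D u = wgrp D (v1 @ v2)"
    using Cons v by auto
  then show ?case using W by (simp add: v wgrp_append HG.m_lcomm)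
qed simp

subsection \<open>Multiplication\<close>

lemma basis_mult_pair [simp]:
  "basis_mult D (h, w) (h', w') = Poly_Mapping.single (h \<cdot> h', w @ w') (wchar D w h')"
  by (simp add: basis_mult_def)

lemmas lin_mul_left = lin_bil_left[of "basis_mult D"]
  and lin_mul_right = lin_bil_right[of "basis_mult D"]

lemmas mul_add_left = lin_add[OF lin_mul_left]
  and mul_add_right = lin_add[OF lin_mul_right]
  and mul_diff_left = lin_diff[OF lin_mul_left]
  and mul_diff_right = lin_diff[OF lin_mul_right]
  and mul_uminus_left = lin_uminus[OF lin_mul_left]
  and mul_uminus_right = lin_uminus[OF lin_mul_right]
  and mul_scale_left = lin_scale[OF lin_mul_left]
  and mul_scale_right = lin_scale[OF lin_mul_right]
  and mul_sum_left = lin_sum[OF lin_mul_left]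
  and mul_sum_right = lin_sum[OF lin_mul_right]
  and mul_zero_left [simp] = lin_zero[OF lin_mul_left]
  and mul_zero_right [simp] = lin_zero[OF lin_mul_right]

lemmas mul_linear = mul_add_left mul_add_right mul_diff_left mul_diff_right
  mul_uminus_left mul_uminus_right mul_scale_left mul_scale_right

lemma CS_subspace: "pm.subspace CS"
  unfolding CS_def by (rule subspace_keys)

lemmas CS_add = pm.subspace_add[OF CS_subspace]
  and CS_diff = pm.subspace_diff[OF CS_subspace]
  and CS_scale = pm.subspace_scale[OF CS_subspace]
  and CS_zero [simp] = pm.subspace_0[OF CS_subspace]
  and CS_sum = pm.subspace_sum[OF CS_subspace]
  and CS_neg = pm.subspace_neg[OF CS_subspace]

lemma CS_single [simp]: "h \<in> H \<Longrightarrow> w \<in> W \<Longrightarrow> Poly_Mapping.single (h, w) c \<in> CS"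
  by (auto simp: CS_def)

lemma CS_lin_eq:
  assumes "a \<in> CS" "lin f" "lin g" "\<And>h w. h \<in> H \<Longrightarrow> w \<in> W \<Longrightarrow> f (bs h w) = g (bs h w)"
  shows "f a = g a"
proof (rule lin_eq_on_keys[OF assms(2,3)])
  fix s assume "s \<in> Poly_Mapping.keys a"
  then have "fst s \<in> H" "snd s \<in> W" using assms(1) by (auto simp: CS_def)
  then show "f (Poly_Mapping.single s 1) = g (Poly_Mapping.single s 1)"
    using assms(4)[of "fst s" "snd s"] by simp
qed

lemma CS_lin_mem:
  assumes "a \<in> CS" "lin f" "pm.subspace V" "\<And>h w. h \<in> H \<Longrightarrow> w \<in> W \<Longrightarrow> f (bs h w) \<in> V"
  shows "f a \<in> V"
proof (rule lin_mem_on_keys[OF assms(2,3)])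
  fix s assume "s \<in> Poly_Mapping.keys a"
  then have "fst s \<in> H" "snd s \<in> W" using assms(1) by (auto simp: CS_def)
  then show "f (Poly_Mapping.single s 1) \<in> V"
    using assms(4)[of "fst s" "snd s"] by simp
qed

lemma mul_closed [simp]:
  assumes "a \<in> CS" "b \<in> CS" shows "a \<star> b \<in> CS"
  by (rule CS_lin_mem[OF assms(1) lin_mul_left CS_subspace],
      rule CS_lin_mem[OF assms(2) lin_mul_right CS_subspace]) simp

lemma mul_assoc:
  assumes "a \<in> CS" "b \<in> CS" "c \<in> CS"
  shows "a \<star> b \<star> c = a \<star> (b \<star> c)"
proof (rule CS_lin_eq[OF assms(1)])
  show "lin (\<lambda>a. a \<star> b \<star> c)" by (intro lin_comp[OF lin_mul_left] lin_mul_left)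
  show "lin (\<lambda>a. a \<star> (b \<star> c))" by (rule lin_mul_left)
  fix h w assume h: "h \<in> H" "w \<in> W"
  show "bs h w \<star> b \<star> c = bs h w \<star> (b \<star> c)"
  proof (rule CS_lin_eq[OF assms(2)])
    show "lin (\<lambda>b. bs h w \<star> b \<star> c)" by (intro lin_comp[OF lin_mul_left] lin_mul_right)
    show "lin (\<lambda>b. bs h w \<star> (b \<star> c))" by (intro lin_comp[OF lin_mul_right] lin_mul_left)
    fix h' w' assume h': "h' \<in> H" "w' \<in> W"
    show "bs h w \<star> bs h' w' \<star> c = bs h w \<star> (bs h' w' \<star> c)"
    proof (rule CS_lin_eq[OF assms(3)])
      show "lin (\<lambda>c. bs h w \<star> bs h' w' \<star> c)" by (rule lin_mul_right)
      show "lin (\<lambda>c. bs h w \<star> (bs h' w' \<star> c))" by (intro lin_comp[OF lin_mul_right] lin_mul_right)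
    qed (use h h' in \<open>simp add: HG.m_assoc wchar_mult mult_ac\<close>)
  qed
qed

lemma grp_eq: "grp h = bs h []" by (simp add: grp_def)
lemma lett_eq: "lett D y = wl [y]" by (simp add: lett_def)

lemma mul_one_left [simp]: assumes "a \<in> CS" shows "wl [] \<star> a = a"
  by (rule CS_lin_eq[OF assms lin_mul_right lin_id]) simp

lemma mul_one_right [simp]: assumes "a \<in> CS" shows "a \<star> wl [] = a"
  by (rule CS_lin_eq[OF assms lin_mul_left lin_id]) simp

lemma skew_simps [simp]:
  "carrier (skew D) = CS" "monoid.mult (skew D) = mul" "one (skew D) = wl []"
  "ring.zero (skew D) = 0" "add (skew D) = (+)" "smult (skew D) = pm_scale"
  "carrier (skew_mod D) = CS" "monoid.mult (skew_mod D) = mul" "one (skew_mod D) = wl []"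
  "ring.zero (skew_mod D) = 0" "add (skew_mod D) = (+)" "smult (skew_mod D) = pm_scale"
  "comult (skew D) = (\<lambda>a. tens_class (skew_mod D) (lin_ext (delta_basis D) a))"
  "counit (skew D) = (\<lambda>a. \<Sum>(h, w)\<in>Poly_Mapping.keys a. if w = [] then Poly_Mapping.lookup a (h, w) else 0)"
  "antipode (skew D) = lin_ext (anti_basis D)"
  by (simp_all add: skew_def skew_mod_def module.extend_def hopf.fields_def CS_def grp_def)

lemma skew_ring: "ring (skew D)"
proof (rule ringI)
  show "abelian_group (skew D)"
    by (rule abelian_groupI)
      (auto simp: CS_add algebra_simps intro!: bexI[of _ "- _"] CS_neg)
  show "Group.monoid (skew D)"
    by (rule monoidI) (auto simp: mul_assoc)
qed (auto simp: mul_linear)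

sublocale SR: ring "skew D" by (rule skew_ring)

lemma a_minus_skew: "a \<in> CS \<Longrightarrow> \<ominus>\<^bsub>skew D\<^esub> a = - a"
  using SR.minus_equality[of "- a" a] CS_neg by simp

lemma additive_subgroup_subspace:
  assumes "pm.subspace V" "V \<subseteq> CS" shows "subgroup V (add_monoid (skew D))"
proof (rule SR.add.subgroupI)
  show "\<ominus>\<^bsub>skew D\<^esub> a \<in> V" if "a \<in> V" for a
    using that assms by (auto simp: a_minus_skew subset_iff pm.subspace_neg)
qed (use assms in \<open>auto simp: pm.subspace_add dest: pm.subspace_0\<close>)

definition ideal2 :: "('g, 'f, 'k) skew_elem set \<Rightarrow> bool" where
  "ideal2 J \<longleftrightarrow> pm.subspace J \<and> J \<subseteq> CS \<and> (\<forall>a\<in>J. \<forall>x\<in>CS. x \<star> a \<in> J \<and> a \<star> x \<in> J)"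

text \<open>Ring ideals are automatically subspaces, because the scalar multiple c a is the product
  of a with the ring element c 1.\<close>

lemma ideal2_ideal: "ideal2 J \<longleftrightarrow> ideal J (skew D)"
proof
  assume "ideal2 J" then show "ideal J (skew D)"
    by (intro idealI skew_ring additive_subgroup_subspace) (auto simp: ideal2_def)
next
  assume "ideal J (skew D)"
  then interpret I: ideal J "skew D" .
  have sub: "J \<subseteq> CS" using I.a_subset by simp
  have "pm_scale c a \<in> J" if "a \<in> J" for c a
  proof -
    have "pm_scale c (wl []) \<star> a \<in> J"
      using I.I_l_closed[OF that, of "pm_scale c (wl [])"] by simp
    then show ?thesis
      using mul_one_left[OF subsetD[OF sub that]] unfolding mul_scale_left by simp
  qed
  then have "pm.subspace J"
    using I.additive_subgroup_axioms additive_subgroup.zero_closed[OF I.is_additive_subgroup]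
      additive_subgroup.a_closed[OF I.is_additive_subgroup]
    by (auto simp: pm.subspace_def)
  with sub I.I_l_closed I.I_r_closed show "ideal2 J" by (auto simp: ideal2_def)
qed

text \<open>Group elements and letters generate the algebra, so closure under multiplication by
  these on both sides suffices. A word is built up from its front for left and from its back for
  right multiplication.\<close>

lemma ideal2_span_mul:
  assumes "pm.subspace J" "J \<subseteq> CS"
    and l: "\<And>a h. a \<in> J \<Longrightarrow> h \<in> H \<Longrightarrow> bs h [] \<star> a \<in> J" "\<And>a y. a \<in> J \<Longrightarrow> y \<in> letters D \<Longrightarrow> wl [y] \<star> a \<in> J"
    and r: "\<And>a h. a \<in> J \<Longrightarrow> h \<in> H \<Longrightarrow> a \<star> bs h [] \<in> J" "\<And>a y. a \<in> J \<Longrightarrow> y \<in> letters D \<Longrightarrow> a \<star> wl [y] \<in> J"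
  shows "ideal2 J"
proof -
  have wl_l: "wl w \<star> a \<in> J" if "w \<in> W" "a \<in> J" for w a
    using that
  proof (induction w)
    case (Cons y w)
    then have "wl (y # w) \<star> a = wl [y] \<star> (wl w \<star> a)"
      using assms(2) by (subst mul_assoc[symmetric]) auto
    with Cons l(2) show ?case by simp
  qed (use assms(2) in auto)
  have wl_r: "a \<star> wl w \<in> J" if "w \<in> W" "a \<in> J" for w a
    using that
  proof (induction w rule: rev_induct)
    case (snoc y w)
    then have "a \<star> wl (w @ [y]) = a \<star> wl w \<star> wl [y]"
      using assms(2) by (subst mul_assoc) auto
    with snoc r(2) show ?case by simp
  qed (use assms(2) in auto)
  have "x \<star> a \<in> J" if "x \<in> CS" "a \<in> J" for x a
  proof (rule CS_lin_mem[OF that(1) lin_mul_left assms(1)])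
    fix h w assume h: "h \<in> H" "w \<in> W"
    then have "bs h w \<star> a = bs h [] \<star> (wl w \<star> a)"
      using assms(2) that by (subst mul_assoc[symmetric]) auto
    then show "bs h w \<star> a \<in> J" using l(1) wl_l that h by simp
  qed
  moreover have "a \<star> x \<in> J" if "x \<in> CS" "a \<in> J" for x a
  proof (rule CS_lin_mem[OF that(1) lin_mul_right assms(1)])
    fix h w assume h: "h \<in> H" "w \<in> W"
    then have "a \<star> bs h w = a \<star> bs h [] \<star> wl w"
      using assms(2) that by (subst mul_assoc) auto
    then show "a \<star> bs h w \<in> J" using r(1) wl_r that h by simp
  qed
  ultimately show ?thesis using assms(1,2) by (auto simp: ideal2_def)
qed

end

section \<open>Normal forms modulo the mixed relations\<close>

declare in_lists_conv_set [simp del]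
declare in_listsD [rule del] in_listsI [rule del]

context qd
begin

lemma chiH_one [simp]: "i \<in> idx D \<Longrightarrow> chiH D i eH = 1"
  using lchar_one[of "Pos i"] by simp

lemma keys_mul:
  "Poly_Mapping.keys (a \<star> b) \<subseteq>
    {(h \<cdot> h', w @ w') | h w h' w'. (h, w) \<in> Poly_Mapping.keys a \<and> (h', w') \<in> Poly_Mapping.keys b}"
proof -
  let ?X = "{(h \<cdot> h', w @ w') | h w h' w'. (h, w) \<in> Poly_Mapping.keys a \<and> (h', w') \<in> Poly_Mapping.keys b}"
  have "a \<star> b \<in> {c. Poly_Mapping.keys c \<subseteq> ?X}"
  proof (rule lin_mem_on_keys[OF lin_mul_left subspace_keys])
    fix s assume s: "s \<in> Poly_Mapping.keys a"
    show "Poly_Mapping.single s 1 \<star> b \<in> {c. Poly_Mapping.keys c \<subseteq> ?X}"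
    proof (rule lin_mem_on_keys[OF lin_mul_right subspace_keys])
      fix t assume t: "t \<in> Poly_Mapping.keys b"
      obtain h w h' w' where st: "s = (h, w)" "t = (h', w')" by (cases s, cases t)
      have "(h \<cdot> h', w @ w') \<in> ?X" using s t st by blast
      then show "Poly_Mapping.single s 1 \<star> Poly_Mapping.single t 1 \<in> {c. Poly_Mapping.keys c \<subseteq> ?X}"
        by (simp add: st)
    qed
  qed
  then show ?thesis by blast
qed

definition kset :: "('g, 'f) skew_basis set \<Rightarrow> ('g, 'f, 'k) skew_elem set" where
  "kset X = {a. Poly_Mapping.keys a \<subseteq> X}"

lemma kset_subspace: "pm.subspace (kset X)"
  unfolding kset_def by (rule subspace_keys)

lemma kset_mono: "X \<subseteq> Y \<Longrightarrow> kset X \<subseteq> kset Y"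
  by (auto simp: kset_def)

lemma CS_kset: "CS = kset (H \<times> W)"
  by (simp add: CS_def kset_def)

lemma kset_single [simp]: "(h, w) \<in> X \<Longrightarrow> Poly_Mapping.single (h, w) c \<in> kset X"
  by (auto simp: kset_def)

lemma kset_mul:
  assumes "a \<in> kset X" "b \<in> kset Y"
    and "\<And>h w h' w'. (h, w) \<in> X \<Longrightarrow> (h', w') \<in> Y \<Longrightarrow> (h \<cdot> h', w @ w') \<in> Z"
  shows "a \<star> b \<in> kset Z"
  using keys_mul[of a b] assms unfolding kset_def by fast

lemma kset_lin_mem:
  assumes "a \<in> kset X" "lin f" "pm.subspace V" "\<And>h w. (h, w) \<in> X \<Longrightarrow> f (bs h w) \<in> V"
  shows "f a \<in> V"
proof (rule lin_mem_on_keys[OF assms(2,3)])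
  fix s assume "s \<in> Poly_Mapping.keys a"
  then have "s \<in> X" using assms(1) by (auto simp: kset_def)
  then show "f (Poly_Mapping.single s 1) \<in> V"
    using assms(4)[of "fst s" "snd s"] by simp
qed

lemma kset_lin_eq:
  assumes "a \<in> kset X" "lin f" "lin g" "\<And>h w. (h, w) \<in> X \<Longrightarrow> f (bs h w) = g (bs h w)"
  shows "f a = g a"
proof (rule lin_eq_on_keys[OF assms(2,3)])
  fix s assume "s \<in> Poly_Mapping.keys a"
  then have "s \<in> X" using assms(1) by (auto simp: kset_def)
  then show "f (Poly_Mapping.single s 1) = g (Poly_Mapping.single s 1)"
    using assms(4)[of "fst s" "snd s"] by simp
qed

lemma kset_lfun_zero:
  assumes "a \<in> kset X" "lfun f" "\<And>h w. (h, w) \<in> X \<Longrightarrow> f (bs h w) = 0"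
  shows "f a = 0"
proof (rule lfun_zero_on_keys[OF assms(2)])
  fix s assume "s \<in> Poly_Mapping.keys a"
  then have "s \<in> X" using assms(1) by (auto simp: kset_def)
  then show "f (Poly_Mapping.single s 1) = 0"
    using assms(3)[of "fst s" "snd s"] by simp
qed

section \<open>Triangular words and a representation satisfying the mixed relations\<close>

abbreviation gf where "gf i \<equiv> inG D (gel D i) \<cdot> inF D (fel D i)"
abbreviation wdeg where "wdeg w \<equiv> sum_list (map ldeg w)"
abbreviation NW where "NW \<equiv> lists (Neg ` idx D)"
abbreviation PW where "PW \<equiv> lists (Pos ` idx D)"
definition TW where "TW = {u @ v | u v. u \<in> NW \<and> v \<in> PW}"

lemma NW_W: "u \<in> NW \<Longrightarrow> u \<in> W" and PW_W: "u \<in> PW \<Longrightarrow> u \<in> W" and TW_W: "u \<in> TW \<Longrightarrow> u \<in> W"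
  unfolding TW_def letters_def using lists_mono[of "Neg ` idx D" "Pos ` idx D \<union> Neg ` idx D"]
    lists_mono[of "Pos ` idx D" "Pos ` idx D \<union> Neg ` idx D"] by auto

lemma gf_closed [simp]: "i \<in> idx D \<Longrightarrow> gf i \<in> H"
  by (simp add: inG_closed inF_closed gel_closed fel_closed)

lemma inG_gel_closed [simp]: "i \<in> idx D \<Longrightarrow> inG D (gel D i) \<in> H"
  and inF_fel_closed [simp]: "i \<in> idx D \<Longrightarrow> inF D (fel D i) \<in> H"
  by (simp_all add: inG_closed inF_closed gel_closed fel_closed)

text \<open>The product x_i w after x_i has been pushed to the right through the leading negative
  letters by the mixed relation; the rewriting stops at the first positive letter or at the end of
  the word.\<close>

primrec xact :: "nat \<Rightarrow> letter list \<Rightarrow> ('g, 'f, 'k) skew_elem" where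
  "xact i [] = wl [Pos i]"
| "xact i (y # w) = (case y of Pos j \<Rightarrow> wl (Pos i # y # w)
     | Neg j \<Rightarrow> pm_scale (pp D j i) (wl [y] \<star> xact i w) + (if i = j then wl w - bs (gf i) w else 0))"

text \<open>Operators on the space of all words with group factors: negative letters act by
  multiplication, positive letters through \<open>xact\<close>. The mixed relations hold for these
  operators essentially by construction, which replaces a confluence argument for the
  rewriting.\<close>

definition Lact :: "letter \<Rightarrow> ('g, 'f, 'k) skew_elem \<Rightarrow> ('g, 'f, 'k) skew_elem" where
  "Lact y = (case y of Pos i \<Rightarrow> lin_ext (\<lambda>(h, w). pm_scale (chiH D i h) (bs h [] \<star> xact i w))
     | Neg j \<Rightarrow> (\<lambda>s. wl [y] \<star> s))"

abbreviation LAw where "LAw w s \<equiv> foldr Lact w s"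

definition act :: "('g, 'f, 'k) skew_elem \<Rightarrow> ('g, 'f, 'k) skew_elem \<Rightarrow> ('g, 'f, 'k) skew_elem" where
  "act a s = lin_ext (\<lambda>(h, w). bs h [] \<star> LAw w s) a"

lemma lin_Lact: "lin (Lact y)"
  by (cases y) (auto simp: Lact_def lin_lin_ext intro: lin_mul_right)

lemma lin_LAw: "lin (\<lambda>s. LAw w s)"
  by (induction w) (auto simp: lin_id intro: lin_comp[OF lin_Lact])

lemma lin_act_left: "lin (\<lambda>a. act a s)"
  unfolding act_def by (rule lin_lin_ext)

lemma act_bs [simp]: "act (bs h w) s = bs h [] \<star> LAw w s"
  by (simp add: act_def)

lemma xact_closed: "i \<in> idx D \<Longrightarrow> w \<in> W \<Longrightarrow> xact i w \<in> CS"
  by (induction w) (auto split: letter.splits intro!: CS_add CS_scale CS_diff)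

lemma Lact_Pos_bs [simp]: "Lact (Pos i) (bs h w) = pm_scale (chiH D i h) (bs h [] \<star> xact i w)"
  by (simp add: Lact_def)

lemma Lact_Neg: "Lact (Neg j) s = wl [Neg j] \<star> s"
  by (simp add: Lact_def)

lemma Lact_closed [simp]: "y \<in> letters D \<Longrightarrow> s \<in> CS \<Longrightarrow> Lact y s \<in> CS"
  by (rule CS_lin_mem[of s, OF _ lin_Lact CS_subspace], assumption, cases y)
    (auto simp: Lact_Neg xact_closed intro!: CS_scale)

lemma LAw_closed [simp]: "w \<in> W \<Longrightarrow> s \<in> CS \<Longrightarrow> LAw w s \<in> CS"
  by (induction w) auto

lemma chiH_mult: "i \<in> idx D \<Longrightarrow> h \<in> H \<Longrightarrow> k \<in> H \<Longrightarrow> chiH D i (h \<cdot> k) = chiH D i h * chiH D i k"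
  using lchar_mult[of "Pos i" h k] by simp

lemma Lact_grp:
  assumes "y \<in> letters D" "h \<in> H" "s \<in> CS"
  shows "Lact y (bs h [] \<star> s) = pm_scale (lchar D y h) (bs h [] \<star> Lact y s)"
proof (cases y)
  case (Neg j)
  have "Lact y (bs h [] \<star> s) = wl [y] \<star> bs h [] \<star> s"
    using assms Neg by (simp add: Lact_Neg mul_assoc del: bil_ext_single)
  also have "wl [y] \<star> bs h [] = pm_scale (lchar D y h) (bs h [] \<star> wl [y])"
    using assms by (simp add: lchar_one)
  finally show ?thesis using assms Neg
    by (simp add: Lact_Neg mul_assoc mul_scale_left del: bil_ext_single pm_scale_single)
next
  case (Pos i)
  then have i: "i \<in> idx D" using assms by simp
  show ?thesis unfolding Pos
  proof (rule CS_lin_eq[OF assms(3)])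
    show "lin (\<lambda>s. Lact (Pos i) (bs h [] \<star> s))" by (intro lin_comp[OF lin_Lact] lin_mul_right)
    show "lin (\<lambda>s. pm_scale (lchar D (Pos i) h) (bs h [] \<star> Lact (Pos i) s))"
      by (intro lin_scaled lin_comp[OF lin_mul_right] lin_Lact)
    fix h' w assume h': "h' \<in> H" "w \<in> W"
    have "bs h [] \<star> (bs h' [] \<star> xact i w) = bs (h \<cdot> h') [] \<star> xact i w"
      using assms h' i by (subst mul_assoc[symmetric]) (auto simp: xact_closed)
    then show "Lact (Pos i) (bs h [] \<star> bs h' w) = pm_scale (lchar D (Pos i) h) (bs h [] \<star> Lact (Pos i) (bs h' w))"
      using assms h' i by (simp add: mul_scale_right chiH_mult)
  qed
qed

lemma LAw_grp:
  assumes "w \<in> W" "h \<in> H" "s \<in> CS"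
  shows "LAw w (bs h [] \<star> s) = pm_scale (wchar D w h) (bs h [] \<star> LAw w s)"
  using assms by (induction w) (auto simp: Lact_grp lin_scale[OF lin_Lact])

lemma act_closed [simp]: "a \<in> CS \<Longrightarrow> s \<in> CS \<Longrightarrow> act a s \<in> CS"
  by (rule CS_lin_mem[of a, OF _ lin_act_left CS_subspace]) auto

lemma lin_act_right: "lin (\<lambda>s. act a s)"
proof -
  have "lin (\<lambda>s. bs h [] \<star> LAw w s)" for h w
    by (intro lin_comp[OF lin_mul_right] lin_LAw)
  then show ?thesis
    unfolding act_def lin_ext_def case_prod_beta by (intro lin_sum_fun lin_scaled)
qed

lemma act_mul:
  assumes "a \<in> CS" "b \<in> CS" "s \<in> CS"
  shows "act (a \<star> b) s = act a (act b s)"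
proof (rule CS_lin_eq[OF assms(1)])
  show "lin (\<lambda>a. act (a \<star> b) s)" by (intro lin_comp[OF lin_act_left] lin_mul_left)
  show "lin (\<lambda>a. act a (act b s))" by (rule lin_act_left)
  fix h w assume h: "h \<in> H" "w \<in> W"
  show "act (bs h w \<star> b) s = act (bs h w) (act b s)"
  proof (rule CS_lin_eq[OF assms(2)])
    show "lin (\<lambda>b. act (bs h w \<star> b) s)" by (intro lin_comp[OF lin_act_left] lin_mul_right)
    show "lin (\<lambda>b. act (bs h w) (act b s))" by (intro lin_comp[OF lin_act_right] lin_act_left)
    fix h' w' assume h': "h' \<in> H" "w' \<in> W"
    have "bs h w \<star> bs h' w' = pm_scale (wchar D w h') (bs (h \<cdot> h') (w @ w'))" by simp
    then have "act (bs h w \<star> bs h' w') s = pm_scale (wchar D w h') (bs (h \<cdot> h') [] \<star> LAw w (LAw w' s))"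
      by (simp only: lin_scale[OF lin_act_left] act_bs foldr_append o_apply)
    also have "bs (h \<cdot> h') [] = bs h [] \<star> bs h' []" by simp
    also have "pm_scale (wchar D w h') (bs h [] \<star> bs h' [] \<star> LAw w (LAw w' s)) = act (bs h w) (act (bs h' w') s)"
      using h h' assms by (simp add: LAw_grp mul_assoc mul_scale_right del: bil_ext_single)
    finally show "act (bs h w \<star> bs h' w') s = act (bs h w) (act (bs h' w') s)" .
  qed
qed

text \<open>For words without group factor this is the recursion of \<open>xact\<close>. With a
  group element h in front, the characters picked up when x_j^- and x_i pass h agree on both sides,
  and for i = j they cancel in the term without letters x_i, x_j^-.\<close>

lemma Lact_mixed:
  assumes "i \<in> idx D" "j \<in> idx D" "s \<in> CS"
  shows "Lact (Pos i) (wl [Neg j] \<star> s) =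
    pm_scale (pp D j i) (wl [Neg j] \<star> Lact (Pos i) s) + (if i = j then s - bs (gf i) [] \<star> s else 0)"
proof (rule CS_lin_eq[OF assms(3)])
  show "lin (\<lambda>s. Lact (Pos i) (wl [Neg j] \<star> s))" by (intro lin_comp[OF lin_Lact] lin_mul_right)
  show "lin (\<lambda>s. pm_scale (pp D j i) (wl [Neg j] \<star> Lact (Pos i) s) + (if i = j then s - bs (gf i) [] \<star> s else 0))"
    by (cases "i = j") (auto intro!: lin_plus lin_minus lin_scaled lin_comp[OF lin_mul_right] lin_mul_right lin_Lact lin_id lin_const0)
  fix h w assume h: "h \<in> H" "w \<in> W"
  let ?n = "inverse (chiH D j h)" and ?c = "chiH D i h"
  have nz: "chiH D j h \<noteq> 0" "?c \<noteq> 0" using lchar_nz[of "Pos j" h] lchar_nz[of "Pos i" h] assms h by auto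
  have x: "xact i w \<in> CS" using assms h by (simp add: xact_closed)
  have "wl [Neg j] \<star> bs h w = pm_scale ?n (bs h (Neg j # w))"
    using h by simp
  then have "Lact (Pos i) (wl [Neg j] \<star> bs h w) = pm_scale ?n (Lact (Pos i) (bs h (Neg j # w)))"
    by (simp only: lin_scale[OF lin_Lact])
  also have "\<dots> = pm_scale (?n * ?c) (bs h [] \<star> (pm_scale (pp D j i) (wl [Neg j] \<star> xact i w) + (if i = j then wl w - bs (gf i) w else 0)))"
    by simp
  also have "\<dots> = pm_scale (?n * ?c * pp D j i) (bs h [] \<star> wl [Neg j] \<star> xact i w)
      + (if i = j then bs h w - bs (h \<cdot> gf i) w else 0)"
    using assms h x nz by (auto simp: mul_linear mul_assoc pm.scale_right_distrib mult_ac simp del: bil_ext_single)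
      (auto simp: pm.scale_right_diff_distrib)
  also have "pm_scale (?n * ?c * pp D j i) (bs h [] \<star> wl [Neg j] \<star> xact i w) =
      pm_scale (?c * pp D j i) (wl [Neg j] \<star> bs h [] \<star> xact i w)"
  proof -
    have "wl [Neg j] \<star> bs h [] = pm_scale ?n (bs h [] \<star> wl [Neg j])" using h assms by simp
    then show ?thesis by (simp add: mul_scale_left mult_ac del: bil_ext_single)
  qed
  also have "\<dots> = pm_scale (pp D j i) (wl [Neg j] \<star> Lact (Pos i) (bs h w))"
    using assms h x by (simp add: mul_scale_right mul_assoc mult_ac del: bil_ext_single)
  also have "(if i = j then bs h w - bs (h \<cdot> gf i) w else 0) = (if i = j then bs h w - bs (gf i) [] \<star> bs h w else 0)"
    using assms h by (simp add: HG.m_comm)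
  finally show "Lact (Pos i) (wl [Neg j] \<star> bs h w) =
    pm_scale (pp D j i) (wl [Neg j] \<star> Lact (Pos i) (bs h w)) + (if i = j then bs h w - bs (gf i) [] \<star> bs h w else 0)" .
qed

definition mixr :: "nat \<Rightarrow> nat \<Rightarrow> ('g, 'f, 'k) skew_elem" where
  "mixr i j = wl [Pos i, Neg j] - pm_scale (pp D j i) (wl [Neg j, Pos i]) - (if i = j then wl [] - bs (gf i) [] else 0)"

lemma mixed_rels_eq: "mixed_rels D = {mixr i j | i j. i \<in> idx D \<and> j \<in> idx D}"
proof -
  have eq: "bracket D (lett D (Pos i)) (lett D (Neg j)) - (if i = j then \<one>\<^bsub>skew D\<^esub> - grp (gf i) else 0) = mixr i j"
    if "i \<in> idx D" "j \<in> idx D" for i j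
    using that by (simp add: mixr_def bracket_def lett_eq grp_eq)
  then show ?thesis unfolding mixed_rels_def
    by (intro Collect_cong arg_cong[of _ _ Ex] ext) (auto simp only: eq)
qed

lemma mixr_closed [simp]: "i \<in> idx D \<Longrightarrow> j \<in> idx D \<Longrightarrow> mixr i j \<in> CS"
  unfolding mixr_def by (auto intro!: CS_diff CS_scale)

definition I0 where "I0 = Idl\<^bsub>skew D\<^esub> (mixed_rels D)"

lemma mixed_rels_closed: "mixed_rels D \<subseteq> CS"
  by (auto simp: mixed_rels_eq)

lemma ideal2_I0: "ideal2 I0"
  unfolding I0_def ideal2_ideal using mixed_rels_closed by (intro SR.genideal_ideal) simp

lemma mixr_I0: "i \<in> idx D \<Longrightarrow> j \<in> idx D \<Longrightarrow> mixr i j \<in> I0"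
  unfolding I0_def using mixed_rels_closed SR.genideal_self[of "mixed_rels D"]
  by (auto simp: mixed_rels_eq)

lemma act_mixr:
  assumes "i \<in> idx D" "j \<in> idx D" "s \<in> CS"
  shows "act (mixr i j) s = 0"
proof -
  have "act (mixr i j) s = Lact (Pos i) (wl [Neg j] \<star> s)
    - pm_scale (pp D j i) (wl [Neg j] \<star> Lact (Pos i) s) - (if i = j then s - bs (gf i) [] \<star> s else 0)"
    using assms unfolding mixr_def
    by (simp add: lin_diff[OF lin_act_left] lin_scale[OF lin_act_left] Lact_Neg lin_zero[OF lin_act_left]
        del: pm_scale_single)
  then show ?thesis using Lact_mixed[OF assms] by simp
qed

text \<open>The annihilator of the representation is a two-sided ideal containing the mixed
  relations, so it contains the ideal they generate.\<close>

lemma act_I0: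
  assumes "a \<in> I0" "s \<in> CS"
  shows "act a s = 0"
proof -
  let ?A = "{a \<in> CS. \<forall>s\<in>CS. act a s = 0}"
  have "pm.subspace ?A"
    by (auto simp: pm.subspace_def CS_add CS_scale lin_zero[OF lin_act_left]
        lin_add[OF lin_act_left] lin_scale[OF lin_act_left])
  then have "ideal2 ?A"
    unfolding ideal2_def by (auto simp: act_mul lin_zero[OF lin_act_right])
  moreover have "mixed_rels D \<subseteq> ?A"
    by (auto simp: mixed_rels_eq act_mixr)
  ultimately have "I0 \<subseteq> ?A"
    unfolding I0_def ideal2_ideal by (rule SR.genideal_minimal)
  with assms show ?thesis by auto
qed

text \<open>Acting on 1 gives a normal form: it has triangular values, fixes triangular elements,
  vanishes on \<open>I0\<close> and changes an element only by \<open>I0\<close>. Thus the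
  triangular words with group factors give a basis of the quotient by the mixed relations.\<close>

definition nu where "nu a = act a (wl [])"

lemma lin_nu: "lin nu"
  unfolding nu_def by (rule lin_act_left)

lemma nu_I0: "a \<in> I0 \<Longrightarrow> nu a = 0"
  by (simp add: nu_def act_I0)

lemma LAw_PW: "v \<in> PW \<Longrightarrow> LAw v (wl []) = wl v"
proof (induction v)
  case (Cons y v)
  then obtain i where y: "y = Pos i" "i \<in> idx D" by auto
  have "xact i v = wl (Pos i # v)"
    using Cons.prems by (cases v) auto
  then show ?case using Cons y PW_W[of v] lchar_one[of "Pos i"] by simp
qed simp

lemma LAw_NW: "u \<in> NW \<Longrightarrow> s \<in> CS \<Longrightarrow> LAw u s = wl u \<star> s"
proof (induction u)
  case (Cons y u)
  then obtain i where y: "y = Neg i" "i \<in> idx D" by auto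
  have "LAw (y # u) s = wl [y] \<star> (wl u \<star> s)" using Cons y by (simp add: Lact_Neg)
  also have "\<dots> = wl (y # u) \<star> s"
    using Cons y NW_W[of u] by (subst mul_assoc[symmetric]) auto
  finally show ?case .
qed simp

lemma nu_tri_bs: "h \<in> H \<Longrightarrow> w \<in> TW \<Longrightarrow> nu (bs h w) = bs h w"
  by (auto simp: TW_def nu_def LAw_PW LAw_NW NW_W PW_W)

definition TR where "TR = kset (H \<times> TW)"

lemma TR_subspace: "pm.subspace TR"
  unfolding TR_def by (rule kset_subspace)

lemma nu_tri: "a \<in> TR \<Longrightarrow> nu a = a"
  by (rule kset_lin_eq[OF _ lin_nu lin_id]) (auto simp: TR_def nu_tri_bs)

lemma I0_subspace: "pm.subspace I0" and I0_CS: "I0 \<subseteq> CS"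
  and I0_left: "a \<in> I0 \<Longrightarrow> x \<in> CS \<Longrightarrow> x \<star> a \<in> I0" and I0_right: "a \<in> I0 \<Longrightarrow> x \<in> CS \<Longrightarrow> a \<star> x \<in> I0"
  using ideal2_I0 by (auto simp: ideal2_def)

lemma xact_I0: "i \<in> idx D \<Longrightarrow> w \<in> W \<Longrightarrow> xact i w - wl (Pos i # w) \<in> I0"
proof (induction w)
  case Nil
  then show ?case using pm.subspace_0[OF I0_subspace] by simp
next
  case (Cons y w)
  show ?case
  proof (cases y)
    case (Pos j)
    then show ?thesis using pm.subspace_0[OF I0_subspace] by simp
  next
    case (Neg j)
    then have j: "j \<in> idx D" and w: "w \<in> W" using Cons.prems by auto
    let ?r = "xact i w - wl (Pos i # w)"
    have r: "?r \<in> I0" using Cons w by simp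
    have "xact i (y # w) - wl (Pos i # y # w) =
      pm_scale (pp D j i) (wl [Neg j] \<star> ?r) - mixr i j \<star> wl w"
      using Neg w j Cons.prems xact_closed[of i w]
      by (auto simp: mixr_def mul_diff_right mul_diff_left mul_scale_left
          pm.scale_right_diff_distrib mul_add_left algebra_simps)
    also have "\<dots> \<in> I0"
      using w j Cons.prems
      by (intro pm.subspace_diff[OF I0_subspace pm.subspace_scale[OF I0_subspace I0_left[OF r]] I0_right[OF mixr_I0]]) auto
    finally show ?thesis .
  qed
qed

lemma Lact_I0: assumes "y \<in> letters D" "s \<in> CS" shows "Lact y s - wl [y] \<star> s \<in> I0"
proof (cases y)
  case (Neg j)
  then show ?thesis using pm.subspace_0[OF I0_subspace] by (simp add: Lact_Neg)
next
  case (Pos i)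
  then have i: "i \<in> idx D" using assms by simp
  show ?thesis
  proof (rule CS_lin_mem[OF assms(2) _ I0_subspace])
    show "lin (\<lambda>s. Lact y s - wl [y] \<star> s)" by (intro lin_minus lin_Lact lin_mul_right)
    fix h w assume h: "h \<in> H" "w \<in> W"
    have "Lact y (bs h w) - wl [y] \<star> bs h w = pm_scale (chiH D i h) (bs h [] \<star> (xact i w - wl (Pos i # w)))"
      using h i Pos by (simp add: mul_diff_right pm.scale_right_diff_distrib)
    also have "\<dots> \<in> I0" using h i xact_I0[of i w]
      by (intro pm.subspace_scale I0_subspace I0_left) auto
    finally show "Lact y (bs h w) - wl [y] \<star> bs h w \<in> I0" .
  qed
qed

lemma LAw_I0: "w \<in> W \<Longrightarrow> LAw w (wl []) - wl w \<in> I0"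
proof (induction w)
  case Nil
  then show ?case using pm.subspace_0[OF I0_subspace] by simp
next
  case (Cons y w)
  have "LAw (y # w) (wl []) - wl (y # w) = (Lact y (LAw w (wl [])) - wl [y] \<star> LAw w (wl []))
      + wl [y] \<star> (LAw w (wl []) - wl w)"
    using Cons by (simp add: mul_diff_right)
  also have "\<dots> \<in> I0" using Cons
    by (intro pm.subspace_add I0_subspace Lact_I0 I0_left) auto
  finally show ?case .
qed

lemma nu_congr: assumes "a \<in> CS" shows "nu a - a \<in> I0"
proof (rule CS_lin_mem[OF assms _ I0_subspace])
  show "lin (\<lambda>a. nu a - a)" by (intro lin_minus lin_nu lin_id)
  fix h w assume h: "h \<in> H" "w \<in> W"
  have "nu (bs h w) - bs h w = bs h [] \<star> (LAw w (wl []) - wl w)"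
    using h by (simp add: nu_def mul_diff_right)
  also have "\<dots> \<in> I0" using h by (intro I0_left LAw_I0) auto
  finally show "nu (bs h w) - bs h w \<in> I0" .
qed

section \<open>Degrees of normal forms\<close>

definition TRd where "TRd \<gamma> = kset {(h, w). h \<in> H \<and> w \<in> TW \<and> wdeg w = \<gamma>}"

lemma TRd_subspace: "pm.subspace (TRd \<gamma>)"
  unfolding TRd_def by (rule kset_subspace)

lemma TRd_TR: "TRd \<gamma> \<subseteq> TR"
  unfolding TR_def TRd_def by (intro kset_mono) auto

lemma TW_Neg: "w \<in> TW \<Longrightarrow> j \<in> idx D \<Longrightarrow> Neg j # w \<in> TW"
  unfolding TW_def mem_Collect_eq by (metis Cons_in_lists_iff append_Cons image_eqI)

lemma TW_NegD: "Neg j # w \<in> TW \<Longrightarrow> w \<in> TW \<and> j \<in> idx D"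
proof -
  assume "Neg j # w \<in> TW"
  then obtain u v where uv: "Neg j # w = u @ v" "u \<in> NW" "v \<in> PW" by (auto simp: TW_def)
  then show ?thesis
  proof (cases u)
    case (Cons a u')
    then show ?thesis using uv unfolding TW_def by auto
  qed auto
qed

lemma TW_PosD: "Pos j # w \<in> TW \<Longrightarrow> Pos j # w \<in> PW"
proof -
  assume "Pos j # w \<in> TW"
  then obtain u v where uv: "Pos j # w = u @ v" "u \<in> NW" "v \<in> PW" by (auto simp: TW_def)
  then show ?thesis by (cases u) auto
qed

lemma PW_TW: "v \<in> PW \<Longrightarrow> v \<in> TW" and NW_TW: "u \<in> NW \<Longrightarrow> u \<in> TW"
  unfolding TW_def by force+

lemma TRd_Neg: "s \<in> TRd \<gamma> \<Longrightarrow> j \<in> idx D \<Longrightarrow> wl [Neg j] \<star> s \<in> TRd (ldeg (Neg j) + \<gamma>)"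
  unfolding TRd_def
  by (rule kset_mul[of _ "{(eH, [Neg j])}"]) (auto simp: TW_Neg)

lemma TRd_grp: "s \<in> TRd \<gamma> \<Longrightarrow> h \<in> H \<Longrightarrow> bs h [] \<star> s \<in> TRd \<gamma>"
  unfolding TRd_def
  by (rule kset_mul[of _ "{(h, [])}"]) auto

lemma xact_TRd: "i \<in> idx D \<Longrightarrow> w \<in> TW \<Longrightarrow> xact i w \<in> TRd (ldeg (Pos i) + wdeg w)"
proof (induction w)
  case Nil
  then have "[Pos i] \<in> TW" by (intro PW_TW) auto
  with Nil show ?case by (auto simp: TRd_def)
next
  case (Cons y w)
  show ?case
  proof (cases y)
    case (Pos j)
    then have "Pos i # y # w \<in> TW" using Cons.prems TW_PosD by (intro PW_TW) auto
    then show ?thesis using Pos by (auto simp: TRd_def)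
  next
    case (Neg j)
    then have w: "w \<in> TW" and j: "j \<in> idx D" using Cons.prems TW_NegD by auto
    have "wl [y] \<star> xact i w \<in> TRd (ldeg (Pos i) + wdeg (y # w))"
      using TRd_Neg[OF Cons.IH[OF Cons.prems(1) w] j] Neg by (simp add: algebra_simps)
    moreover have "bs (gf i) w \<in> TRd (ldeg (Pos i) + wdeg (y # w)) \<and> wl w \<in> TRd (ldeg (Pos i) + wdeg (y # w))"
      if "i = j"
      using w that Neg j by (auto simp: TRd_def)
    ultimately show ?thesis using Neg
      by (auto intro!: pm.subspace_add[OF TRd_subspace] pm.subspace_diff[OF TRd_subspace] pm.subspace_scale[OF TRd_subspace])
  qed
qed

lemma Lact_TRd: assumes "y \<in> letters D" "s \<in> TRd \<gamma>" shows "Lact y s \<in> TRd (ldeg y + \<gamma>)"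
proof (cases y)
  case (Neg j)
  then show ?thesis using assms TRd_Neg by (simp add: Lact_Neg)
next
  case (Pos i)
  show ?thesis
    using assms(2)[unfolded TRd_def]
  proof (rule kset_lin_mem[OF _ lin_Lact TRd_subspace])
    fix h w assume "(h, w) \<in> {(h, w). h \<in> H \<and> w \<in> TW \<and> wdeg w = \<gamma>}"
    then show "Lact y (bs h w) \<in> TRd (ldeg y + \<gamma>)"
      using Pos assms(1) xact_TRd[of i w] by (auto intro!: pm.subspace_scale[OF TRd_subspace] TRd_grp)
  qed
qed

lemma LAw_TRd: "w \<in> W \<Longrightarrow> LAw w (wl []) \<in> TRd (wdeg w)"
  by (induction w) (auto simp: Lact_TRd, auto simp: TRd_def PW_TW)

text \<open>The mixed relations are homogeneous, since 1 - g_i f_i has degree 0 like x_i x_i^-; so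
  the rewriting keeps the degree.\<close>

lemma nu_TRd:
  assumes "a \<in> CS" "\<And>h w. (h, w) \<in> Poly_Mapping.keys a \<Longrightarrow> wdeg w = \<gamma>"
  shows "nu a \<in> TRd \<gamma>"
proof (rule kset_lin_mem[OF _ lin_nu TRd_subspace])
  show "a \<in> kset {(h, w). h \<in> H \<and> w \<in> W \<and> wdeg w = \<gamma>}"
    using assms by (auto simp: kset_def CS_def)
  show "nu (bs h w) \<in> TRd \<gamma>" if "(h, w) \<in> {(h, w). h \<in> H \<and> w \<in> W \<and> wdeg w = \<gamma>}" for h w
    using that LAw_TRd[of w] by (auto simp: nu_def intro!: TRd_grp)
qed

end

section \<open>Ideals generated by relations of one sign\<close>

context qd
begin

section \<open>Words of one sign and their skew derivations\<close>

definition VL :: "(nat \<Rightarrow> letter) \<Rightarrow> ('g, 'f, 'k) skew_elem set" where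
  "VL L = kset ({eH} \<times> lists (L ` idx D))"

lemma VL_subspace: "pm.subspace (VL L)"
  unfolding VL_def by (rule kset_subspace)

lemma LW_W: "L = Pos \<or> L = Neg \<Longrightarrow> w \<in> lists (L ` idx D) \<Longrightarrow> w \<in> W"
  using NW_W PW_W by auto

lemma VL_CS: "L = Pos \<or> L = Neg \<Longrightarrow> VL L \<subseteq> CS"
  unfolding VL_def CS_kset using LW_W by (intro kset_mono) auto

text \<open>The coefficient of y in the second tensor factor of the coproduct of the word, with the
  group element g_y removed from the front of the first factor; see \<open>EE_dR\<close>. Each
  occurrence of y is deleted and weighted by the characters of the letters before it at g_y.\<close>

primrec dRw :: "letter \<Rightarrow> letter list \<Rightarrow> ('g, 'f, 'k) skew_elem" where
  "dRw y [] = 0"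
| "dRw y (z # w) = pm_scale (lchar D z (lgrp D y)) (wl [z] \<star> dRw y w) + (if z = y then wl w else 0)"

text \<open>Deletion of y through the first tensor factor instead: an occurrence is weighted by the
  character of y at the group element of the letters after it; see \<open>EE'_dL\<close>.\<close>

primrec dLw :: "letter \<Rightarrow> letter list \<Rightarrow> ('g, 'f, 'k) skew_elem" where
  "dLw y [] = 0"
| "dLw y (z # w) = wl [z] \<star> dLw y w + (if z = y then pm_scale (lchar D y (wgrp D w)) (wl w) else 0)"

definition dR :: "letter \<Rightarrow> ('g, 'f, 'k) skew_elem \<Rightarrow> ('g, 'f, 'k) skew_elem" where
  "dR y = lin_ext (\<lambda>(h, w). dRw y w)"
definition dL :: "letter \<Rightarrow> ('g, 'f, 'k) skew_elem \<Rightarrow> ('g, 'f, 'k) skew_elem" where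
  "dL y = lin_ext (\<lambda>(h, w). dLw y w)"

lemma lin_dR: "lin (dR y)" and lin_dL: "lin (dL y)"
  unfolding dR_def dL_def by (rule lin_lin_ext)+

lemma dR_bs [simp]: "dR y (bs h w) = dRw y w"
  and dL_bs [simp]: "dL y (bs h w) = dLw y w"
  by (simp_all add: dR_def dL_def)

lemma VL_wl_mul: "z \<in> L ` idx D \<Longrightarrow> a \<in> VL L \<Longrightarrow> wl [z] \<star> a \<in> VL L"
  unfolding VL_def by (rule kset_mul[of _ "{(eH, [z])}"]) auto

lemma VL_wl [simp]: "w \<in> lists (L ` idx D) \<Longrightarrow> wl w \<in> VL L"
  by (auto simp: VL_def)

lemma dRw_VL: "w \<in> lists (L ` idx D) \<Longrightarrow> dRw y w \<in> VL L"
proof (induction w)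
  case (Cons z w)
  then have "wl [z] \<star> dRw y w \<in> VL L" by (intro VL_wl_mul) auto
  then show ?case using Cons.prems
    by (auto intro!: pm.subspace_add[OF VL_subspace] pm.subspace_scale[OF VL_subspace] pm.subspace_0[OF VL_subspace])
qed (simp add: pm.subspace_0[OF VL_subspace])

lemma dLw_VL: "w \<in> lists (L ` idx D) \<Longrightarrow> dLw y w \<in> VL L"
proof (induction w)
  case (Cons z w)
  then have "wl [z] \<star> dLw y w \<in> VL L" by (intro VL_wl_mul) auto
  then show ?case using Cons.prems
    by (auto intro!: pm.subspace_add[OF VL_subspace] pm.subspace_scale[OF VL_subspace] pm.subspace_0[OF VL_subspace]
        simp del: pm_scale_single)
qed (simp add: pm.subspace_0[OF VL_subspace])

definition mgr :: "letter multiset \<Rightarrow> ('g, 'f, 'k) skew_elem \<Rightarrow> ('g, 'f, 'k) skew_elem" where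
  "mgr M = restr (\<lambda>(h, w). mset w = M)"

text \<open>
  The skew derivations \<open>dR\<close> and \<open>dL\<close> describe the commutators with the letters of the other sign.
\<close>

definition goodJ :: "(nat \<Rightarrow> letter) \<Rightarrow> ('g, 'f, 'k) skew_elem set \<Rightarrow> bool" where
  "goodJ L J \<longleftrightarrow> pm.subspace J \<and> J \<subseteq> kset ({eH} \<times> (lists (L ` idx D) - {[]})) \<and>
    (\<forall>a\<in>J. \<forall>i\<in>idx D. wl [L i] \<star> a \<in> J \<and> a \<star> wl [L i] \<in> J \<and> dR (L i) a \<in> J \<and> dL (L i) a \<in> J) \<and>
    (\<forall>a\<in>J. \<forall>M. mgr M a \<in> J)"

lemma wl_grp: "w \<in> W \<Longrightarrow> h \<in> H \<Longrightarrow> wl w \<star> bs h [] = pm_scale (wchar D w h) (bs h [] \<star> wl w)"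
  by simp

lemma mul_left_comm_scale:
  assumes "a \<in> CS" "b \<in> CS" "c \<in> CS" "a \<star> b = pm_scale k (b \<star> a)"
  shows "a \<star> (b \<star> c) = pm_scale k (b \<star> (a \<star> c))"
  using mul_assoc[OF assms(1-3)] mul_assoc[OF assms(2,1,3)] by (simp add: assms(4) mul_scale_left)

lemma PW_wchar_wgrp: "u \<in> PW \<Longrightarrow> j \<in> idx D \<Longrightarrow> wchar D u (inF D (fel D j)) = chiH D j (wgrp D u)"
  by (induction u) (auto simp: chiH_mult PW_W)

text \<open>The normal form of u x_j^- for a positive word u. The factor p_jj^-1 turns the character
  of u at f_j into that of u with one x_j deleted.\<close>

definition commR :: "nat \<Rightarrow> letter list \<Rightarrow> ('g, 'f, 'k) skew_elem" where
  "commR j u = pm_scale (wchar D u (inF D (fel D j))) (wl (Neg j # u)) + dLw (Pos j) u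
     - pm_scale (wchar D u (inF D (fel D j)) * inverse (pp D j j)) (bs (gf j) [] \<star> dRw (Pos j) u)"

text \<open>The mirror formula for x_i u with a negative word u. The factor p_ii^-1 turns the value
  of the character of x_i at g_u into its value for u with one x_i^- deleted.\<close>

definition commL :: "nat \<Rightarrow> letter list \<Rightarrow> ('g, 'f, 'k) skew_elem" where
  "commL i u = pm_scale (chiH D i (wgrp D u)) (wl (u @ [Pos i]))
     + pm_scale (chiH D i (wgrp D u) * inverse (pp D i i)) (dLw (Neg i) u)
     - bs (gf i) [] \<star> dRw (Neg i) u"

text \<open>Induction on the word: the first letter is multiplied onto the formula for the shorter
  word, and one use of \<open>mixr\<close> moves it past x_j^-. When the letter is x_j itself, that
  use also supplies the new terms of both derivations.\<close>

lemma PW_commR: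
  assumes "u \<in> PW" "j \<in> idx D"
  shows "wl u \<star> wl [Neg j] - commR j u \<in> I0"
  using assms(1)
proof (induction u)
  case Nil
  then show ?case using assms pm.subspace_0[OF I0_subspace] by (simp add: commR_def)
next
  case (Cons y u)
  then obtain i where y: "y = Pos i" "i \<in> idx D" and u: "u \<in> PW" by auto
  have uW: "u \<in> W" using u PW_W by simp
  let ?f = "inF D (fel D j)"
  have dL: "dLw (Pos j) u \<in> CS" and dR: "dRw (Pos j) u \<in> CS"
    using dLw_VL[OF u] dRw_VL[OF u] VL_CS[of Pos] by auto
  have c: "commR j u \<in> CS"
    using dL dR uW assms by (auto simp: commR_def intro!: CS_add CS_diff CS_scale)
  have x: "wl [Pos i] \<star> bs (gf j) [] = pm_scale (pp D i j * pp D j i) (bs (gf j) [] \<star> wl [Pos i])"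
    using assms y by (simp add: chiH_mult)
  have e: "wl [Pos i] \<star> (bs (gf j) [] \<star> dRw (Pos j) u) =
     pm_scale (pp D i j * pp D j i) (bs (gf j) [] \<star> (wl [Pos i] \<star> dRw (Pos j) u))"
    using assms y by (intro mul_left_comm_scale[OF _ _ dR x]) auto
  have "wl (y # u) \<star> wl [Neg j] - commR j (y # u) =
     wl [Pos i] \<star> (wl u \<star> wl [Neg j] - commR j u)
     + pm_scale (wchar D u ?f) (mixr i j \<star> wl u)"
    (is "?l = ?r")
  proof -
    have "wl [Pos i] \<star> commR j u = pm_scale (wchar D u ?f) (wl (Pos i # Neg j # u)) + wl [Pos i] \<star> dLw (Pos j) u
     - pm_scale (wchar D u ?f * inverse (pp D j j) * (pp D i j * pp D j i)) (bs (gf j) [] \<star> (wl [Pos i] \<star> dRw (Pos j) u))"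
      using uW assms y unfolding commR_def
      by (simp add: mul_add_right mul_diff_right mul_scale_right e del: pm_scale_single)
    moreover have "mixr i j \<star> wl u = wl (Pos i # Neg j # u) - pm_scale (pp D j i) (wl (Neg j # Pos i # u))
       - (if i = j then wl u - bs (gf i) u else 0)"
      using uW assms y unfolding mixr_def
      by (auto simp: mul_diff_left mul_scale_left)
    moreover have "commR j (y # u) = pm_scale (pp D j i * wchar D u ?f) (wl (Neg j # Pos i # u)) + wl [Pos i] \<star> dLw (Pos j) u
      + (if i = j then pm_scale (wchar D u ?f) (wl u - bs (gf i) u) else 0)
      - pm_scale (wchar D u ?f * inverse (pp D j j) * (pp D i j * pp D j i)) (bs (gf j) [] \<star> (wl [Pos i] \<star> dRw (Pos j) u))"
    proof (cases "i = j")
      case True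
      have canc: "pp D j j * (inverse (pp D j j) * x) = x" for x
        using pp_nz[of j j] assms by (simp flip: mult.assoc)
      then show ?thesis
        using uW assms y u True unfolding commR_def
        by (simp add: PW_wchar_wgrp mul_add_right mul_scale_right pm.scale_right_distrib pm.scale_right_diff_distrib mult_ac canc)
    next
      case False
      then show ?thesis
        using uW assms y u unfolding commR_def
        by (simp add: PW_wchar_wgrp mul_add_right mul_scale_right mult_ac)
    qed
    moreover have "wl (y # u) \<star> wl [Neg j] = wl [Pos i] \<star> (wl u \<star> wl [Neg j])"
      using uW y assms by simp
    ultimately show ?thesis
      unfolding mul_diff_right
      by (simp only:) (cases "i = j"; simp add: pm.scale_right_diff_distrib pm.scale_right_distrib mult_ac)
  qed
  also have "\<dots> \<in> I0"
    using Cons.IH y assms uW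
    by (intro pm.subspace_add[OF I0_subspace I0_left pm.subspace_scale[OF I0_subspace I0_right[OF mixr_I0]]]) auto
  finally show ?case .
qed

lemma NW_commL:
  assumes "u \<in> NW" "i \<in> idx D"
  shows "wl [Pos i] \<star> wl u - commL i u \<in> I0"
  using assms(1)
proof (induction u)
  case Nil
  then show ?case using assms pm.subspace_0[OF I0_subspace] by (simp add: commL_def)
next
  case (Cons y u)
  then obtain j where y: "y = Neg j" "j \<in> idx D" and u: "u \<in> NW" by auto
  have uW: "u \<in> W" using u NW_W by simp
  have dL: "dLw (Neg i) u \<in> CS" and dR: "dRw (Neg i) u \<in> CS"
    using dLw_VL[OF u] dRw_VL[OF u] VL_CS[of Neg] by auto
  have x: "wl [Neg j] \<star> bs (gf i) [] = pm_scale (inverse (pp D i j * pp D j i)) (bs (gf i) [] \<star> wl [Neg j])"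
    using assms y by (simp add: chiH_mult mult.commute)
  have e: "wl [Neg j] \<star> (bs (gf i) [] \<star> dRw (Neg i) u) =
     pm_scale (inverse (pp D i j * pp D j i)) (bs (gf i) [] \<star> (wl [Neg j] \<star> dRw (Neg i) u))"
    using assms y by (intro mul_left_comm_scale[OF _ _ dR x]) auto
  have nz: "pp D i j \<noteq> 0" "pp D j i \<noteq> 0" "pp D i i \<noteq> 0" "chiH D i (wgrp D u) \<noteq> 0"
    using pp_nz y assms uW lchar_nz[of "Pos i" "wgrp D u"] by auto
  have "wl [Pos i] \<star> wl (y # u) - commL i (y # u) =
     pm_scale (pp D j i) (wl [Neg j] \<star> (wl [Pos i] \<star> wl u - commL i u)) + mixr i j \<star> wl u"
  proof -
    have "wl [Neg j] \<star> commL i u = pm_scale (chiH D i (wgrp D u)) (wl (Neg j # u @ [Pos i]))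
     + pm_scale (chiH D i (wgrp D u) * inverse (pp D i i)) (wl [Neg j] \<star> dLw (Neg i) u)
     - pm_scale (inverse (pp D i j * pp D j i)) (bs (gf i) [] \<star> (wl [Neg j] \<star> dRw (Neg i) u))"
      using uW assms y unfolding commL_def
      by (simp add: mul_add_right mul_diff_right mul_scale_right e del: pm_scale_single)
    moreover have "mixr i j \<star> wl u = wl (Pos i # Neg j # u) - pm_scale (pp D j i) (wl (Neg j # Pos i # u))
       - (if i = j then wl u - bs (gf i) u else 0)"
      using uW assms y unfolding mixr_def
      by (auto simp: mul_diff_left mul_scale_left)
    moreover have "commL i (y # u) = pm_scale (pp D j i * chiH D i (wgrp D u)) (wl (Neg j # u @ [Pos i]))
      + pm_scale (pp D j i * chiH D i (wgrp D u) * inverse (pp D i i)) (wl [Neg j] \<star> dLw (Neg i) u)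
      + (if i = j then wl u else 0)
      - (pm_scale (inverse (pp D i j)) (bs (gf i) [] \<star> (wl [Neg j] \<star> dRw (Neg i) u))
         + (if i = j then bs (gf i) u else 0))"
      using uW assms y u nz unfolding commL_def
      by (cases "i = j"; simp add: chiH_mult mul_add_right mul_scale_right pm.scale_right_distrib;
          simp add: field_simps)
    moreover have "wl [Pos i] \<star> wl (y # u) = wl (Pos i # Neg j # u)" "wl [Neg j] \<star> (wl [Pos i] \<star> wl u) = wl (Neg j # Pos i # u)"
      using uW y assms by simp_all
    ultimately show ?thesis
      unfolding mul_diff_right using nz(2)
      by (simp only:) (cases "i = j"; simp add: pm.scale_right_diff_distrib pm.scale_right_distrib mult_ac)
  qed
  also have "\<dots> \<in> I0"
    using Cons.IH y assms uW
    by (intro pm.subspace_add[OF I0_subspace pm.subspace_scale[OF I0_subspace I0_left] I0_right[OF mixr_I0]]) auto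
  finally show ?case .
qed

lemma mgr_lin: "lin (mgr M)"
  unfolding mgr_def by (rule lin_restr)

lemma keys_mgr: "Poly_Mapping.keys (mgr M a) = {(h, w) \<in> Poly_Mapping.keys a. mset w = M}"
  by (auto simp: mgr_def keys_restr)

lemma mgr_bs: "mgr M (bs h w) = (if mset w = M then bs h w else 0)"
  by (simp add: mgr_def)

lemma mgr_decomp: "\<exists>T. finite T \<and> (\<Sum>M\<in>T. mgr M a) = a"
proof -
  have "(\<Sum>M\<in>(\<lambda>s. mset (snd s)) ` Poly_Mapping.keys a. restr (\<lambda>s. mset (snd s) = M) a) = a"
    by (rule sum_restr_fibres) auto
  then show ?thesis
    by (intro exI[of _ "(\<lambda>s. mset (snd s)) ` Poly_Mapping.keys a"]) (simp add: mgr_def case_prod_beta')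
qed

context
  fixes L J
  assumes good: "goodJ L J" and L: "L = Pos \<or> L = Neg"
begin

lemma good_subspace: "pm.subspace J"
  and good_kset: "J \<subseteq> kset ({eH} \<times> (lists (L ` idx D) - {[]}))"
  and good_mulL: "a \<in> J \<Longrightarrow> i \<in> idx D \<Longrightarrow> wl [L i] \<star> a \<in> J"
  and good_mulR: "a \<in> J \<Longrightarrow> i \<in> idx D \<Longrightarrow> a \<star> wl [L i] \<in> J"
  and good_dR: "a \<in> J \<Longrightarrow> i \<in> idx D \<Longrightarrow> dR (L i) a \<in> J"
  and good_dL: "a \<in> J \<Longrightarrow> i \<in> idx D \<Longrightarrow> dL (L i) a \<in> J"
  and good_mgr: "a \<in> J \<Longrightarrow> mgr M a \<in> J"
  using good by (auto simp: goodJ_def)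

lemma good_VL: "J \<subseteq> VL L"
  using good_kset kset_mono[of "{eH} \<times> (lists (L ` idx D) - {[]})" "{eH} \<times> lists (L ` idx D)"]
  unfolding VL_def by blast

lemma good_CS: "J \<subseteq> CS"
  using good_VL VL_CS[OF L] by blast

text \<open>\<open>J\<close> contains the multidegree components of its elements, so a linear claim
  need only be checked on elements all of whose words are rearrangements of each other. On these the
  characters and group elements of words are constants.\<close>

lemma good_hom_induct:
  assumes "a \<in> J" "pm.subspace S" "lin f"
    and "\<And>b M. b \<in> J \<Longrightarrow> (\<And>h w. (h, w) \<in> Poly_Mapping.keys b \<Longrightarrow> h = eH \<and> w \<in> lists (L ` idx D) \<and> mset w = M) \<Longrightarrow> f b \<in> S"
  shows "f a \<in> S"
proof -
  obtain T where T: "finite T" "(\<Sum>M\<in>T. mgr M a) = a" using mgr_decomp by blast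
  have "f (mgr M a) \<in> S" for M
  proof (rule assms(4)[of _ M])
    show "mgr M a \<in> J" using good_mgr assms by simp
    show "h = eH \<and> w \<in> lists (L ` idx D) \<and> mset w = M" if "(h, w) \<in> Poly_Mapping.keys (mgr M a)" for h w
      using that assms(1) good_VL by (auto simp: keys_mgr VL_def kset_def)
  qed
  then have "(\<Sum>M\<in>T. f (mgr M a)) \<in> S" by (rule pm.subspace_sum[OF assms(2)])
  then show ?thesis by (simp flip: lin_sum[OF assms(3)] add: T)
qed

text \<open>Conjugation by h multiplies a multihomogeneous element by a scalar. The claim is linear
  in \<open>a\<close> because it says that \<open>a\<close> times h lies in the subspace h
  \<open>J\<close>.\<close>

lemma good_conj:
  assumes "a \<in> J" "h \<in> H"
  shows "\<exists>b\<in>J. a \<star> bs h [] = bs h [] \<star> b"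
proof -
  have sub: "pm.subspace ((\<lambda>b. bs h [] \<star> b) ` J)"
    unfolding pm.subspace_def
  proof (intro conjI ballI allI)
    show "0 \<in> (\<star>) (bs h []) ` J" using pm.subspace_0[OF good_subspace] mul_zero_right by (metis image_eqI)
    show "x + y \<in> (\<star>) (bs h []) ` J" if "x \<in> (\<star>) (bs h []) ` J" "y \<in> (\<star>) (bs h []) ` J" for x y
      using that pm.subspace_add[OF good_subspace] by (auto simp flip: mul_add_right)
    show "pm_scale c x \<in> (\<star>) (bs h []) ` J" if "x \<in> (\<star>) (bs h []) ` J" for c x
      using that pm.subspace_scale[OF good_subspace] by (auto simp flip: mul_scale_right)
  qed
  have "a \<star> bs h [] \<in> (\<lambda>b. bs h [] \<star> b) ` J"
  proof (rule good_hom_induct[OF assms(1) sub lin_mul_left])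
    fix b M assume b: "b \<in> J" and k: "\<And>h w. (h, w) \<in> Poly_Mapping.keys b \<Longrightarrow> h = eH \<and> w \<in> lists (L ` idx D) \<and> mset w = M"
    \<comment> \<open>\<open>v\<close> is any word occurring in \<open>b\<close>; for b = 0 its
      choice does not matter.\<close>
    obtain v where v: "b \<noteq> 0 \<Longrightarrow> (eH, v) \<in> Poly_Mapping.keys b"
      using k by (metis ex_in_conv keys_eq_empty surj_pair)
    have "b \<star> bs h [] = pm_scale (wchar D v h) (bs h [] \<star> b)"
    proof (rule lin_eq_on_keys[OF lin_mul_left, of "\<lambda>b. pm_scale (wchar D v h) (bs h [] \<star> b)"])
      show "lin (\<lambda>b. pm_scale (wchar D v h) (bs h [] \<star> b))" by (intro lin_scaled lin_mul_right)
      fix s assume s: "s \<in> Poly_Mapping.keys b"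
      obtain w where w: "s = (eH, w)" "w \<in> lists (L ` idx D)" "mset w = M" using k s by (cases s) auto
      have "mset v = M" using v k s by force
      with w have "wchar D w h = wchar D v h" by (intro wchar_mset) auto
      then show "Poly_Mapping.single s 1 \<star> bs h [] = pm_scale (wchar D v h) (bs h [] \<star> Poly_Mapping.single s 1)"
        using w LW_W[OF L w(2)] assms(2) by simp
    qed
    then show "b \<star> bs h [] \<in> (\<lambda>b. bs h [] \<star> b) ` J"
      using pm.subspace_scale[OF good_subspace b] by (auto simp flip: mul_scale_right)
  qed
  then show ?thesis by auto
qed

end

end

section \<open>The ideal assembled from relations of both signs\<close>

definition ssum :: "('s \<Rightarrow>\<^sub>0 'k::field) set \<Rightarrow> ('s \<Rightarrow>\<^sub>0 'k) set \<Rightarrow> ('s \<Rightarrow>\<^sub>0 'k) set" where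
  "ssum S T = {x + y | x y. x \<in> S \<and> y \<in> T}"

lemma subspace_ssum: "pm.subspace S \<Longrightarrow> pm.subspace T \<Longrightarrow> pm.subspace (ssum S T)"
  unfolding ssum_def by (rule pm.subspace_sums)

lemma subspace_lin_image:
  assumes "lin f" "pm.subspace V" shows "pm.subspace (f ` V)"
  unfolding pm.subspace_def
proof (intro conjI ballI allI)
  show "0 \<in> f ` V" using lin_zero[OF assms(1)] pm.subspace_0[OF assms(2)] by (metis image_eqI)
  show "x + y \<in> f ` V" if "x \<in> f ` V" "y \<in> f ` V" for x y
    using that pm.subspace_add[OF assms(2)] by (auto simp flip: lin_add[OF assms(1)])
  show "pm_scale c x \<in> f ` V" if "x \<in> f ` V" for c x
    using that pm.subspace_scale[OF assms(2)] by (auto simp flip: lin_scale[OF assms(1)])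
qed

lemma ssumI: "x \<in> S \<Longrightarrow> y \<in> T \<Longrightarrow> x + y \<in> ssum S T"
  by (auto simp: ssum_def)

locale qJ = qd D for D :: "('g, 'f, 'k::field) datum" +
  fixes Jm Jp :: "('g, 'f, 'k) skew_elem set"
  assumes Jm: "goodJ Neg Jm" and Jp: "goodJ Pos Jp"
begin

lemmas Jm_subspace = good_subspace[OF Jm disjI2[OF refl]]
  and Jp_subspace = good_subspace[OF Jp disjI1[OF refl]]

lemma Jm_CS: "r \<in> Jm \<Longrightarrow> r \<in> CS" and Jp_CS: "r \<in> Jp \<Longrightarrow> r \<in> CS"
  using good_CS[OF Jm] good_CS[OF Jp] by auto

lemma Jm_mul:
  assumes "r \<in> Jm" "i \<in> idx D"
  shows "wl [Neg i] \<star> r \<in> Jm" "r \<star> wl [Neg i] \<in> Jm" "dR (Neg i) r \<in> Jm" "dL (Neg i) r \<in> Jm"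
  using good_mulL[OF Jm _ assms] good_mulR[OF Jm _ assms] good_dR[OF Jm _ assms] good_dL[OF Jm _ assms] by auto

lemma Jp_mul:
  assumes "r \<in> Jp" "i \<in> idx D"
  shows "wl [Pos i] \<star> r \<in> Jp" "r \<star> wl [Pos i] \<in> Jp" "dR (Pos i) r \<in> Jp" "dL (Pos i) r \<in> Jp"
  using good_mulL[OF Jp _ assms] good_mulR[OF Jp _ assms] good_dR[OF Jp _ assms] good_dL[OF Jp _ assms] by auto

lemma Jm_conj: "r \<in> Jm \<Longrightarrow> h \<in> H \<Longrightarrow> \<exists>b\<in>Jm. r \<star> bs h [] = bs h [] \<star> b"
  and Jp_conj: "r \<in> Jp \<Longrightarrow> h \<in> H \<Longrightarrow> \<exists>b\<in>Jp. r \<star> bs h [] = bs h [] \<star> b"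
  using good_conj[OF Jm] good_conj[OF Jp] by auto

text \<open>Writing T^- and T^+ for the spans of negative and positive words, these elements span H
  J^- T^+ + H T^- J^+. This is the kernel of the projection from triangular elements to k[H]
  tensored with T^-/J^- and T^+/J^+.\<close>

definition Kgen where
  "Kgen = {bs h [] \<star> r \<star> wl v | h r v. h \<in> H \<and> r \<in> Jm \<and> v \<in> PW} \<union>
          {bs h [] \<star> wl u \<star> r | h u r. h \<in> H \<and> u \<in> NW \<and> r \<in> Jp}"
definition K where "K = pm.span Kgen"
definition II where "II = ssum K I0"

lemma K_subspace: "pm.subspace K" unfolding K_def by (rule pm.subspace_span)
lemma II_subspace: "pm.subspace II" unfolding II_def by (intro subspace_ssum K_subspace I0_subspace)

lemma K_II: "k \<in> K \<Longrightarrow> k \<in> II"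
  unfolding II_def using ssumI[of k K 0 I0] pm.subspace_0[OF I0_subspace] by simp

lemma I0_II: "k \<in> I0 \<Longrightarrow> k \<in> II"
  unfolding II_def using ssumI[of 0 K k I0] pm.subspace_0[OF K_subspace] by simp

lemmas II_add = pm.subspace_add[OF II_subspace] and II_scale = pm.subspace_scale[OF II_subspace]
  and II_diff = pm.subspace_diff[OF II_subspace]

lemma K1: assumes "h \<in> H" "r \<in> Jm" "d \<in> VL Pos" shows "bs h [] \<star> r \<star> d \<in> K"
proof (rule kset_lin_mem[OF assms(3)[unfolded VL_def] lin_mul_right K_subspace])
  fix h' w assume "(h', w) \<in> {eH} \<times> PW"
  then have "h' = eH" "w \<in> PW" by auto
  then show "bs h [] \<star> r \<star> bs h' w \<in> K"
    unfolding K_def using assms by (intro pm.span_base) (auto simp: Kgen_def)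
qed

lemma K2: assumes "h \<in> H" "r \<in> Jp" "d \<in> VL Neg" shows "bs h [] \<star> d \<star> r \<in> K"
proof (rule kset_lin_mem[OF assms(3)[unfolded VL_def] _ K_subspace])
  show "lin (\<lambda>d. bs h [] \<star> d \<star> r)" by (intro lin_comp[OF lin_mul_left] lin_mul_right)
  fix h' w assume "(h', w) \<in> {eH} \<times> NW"
  then have "h' = eH" "w \<in> NW" by auto
  then show "bs h [] \<star> bs h' w \<star> r \<in> K"
    unfolding K_def Kgen_def using assms by (intro pm.span_base UnI2) blast
qed

text \<open>This is \<open>PW_commR\<close> on a multihomogeneous element, where the coefficients of
  \<open>commR\<close> are constant, so that words combine into the element itself and its two
  derivatives; all three lie in \<open>Jp\<close>.\<close>

lemma Jp_comm:
  assumes r: "r \<in> Jp" and j: "j \<in> idx D"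
  obtains r1 r2 r3 z where "r1 \<in> Jp" "r2 \<in> Jp" "r3 \<in> Jp" "z \<in> I0"
    "r \<star> wl [Neg j] = wl [Neg j] \<star> r1 + r2 + bs (gf j) [] \<star> r3 + z"
proof -
  let ?S = "ssum (ssum (ssum ((\<star>) (wl [Neg j]) ` Jp) Jp) ((\<star>) (bs (gf j) []) ` Jp)) I0"
  have S: "pm.subspace ?S"
    by (intro subspace_ssum subspace_lin_image lin_mul_right Jp_subspace I0_subspace)
  have "r \<star> wl [Neg j] \<in> ?S"
  proof (rule good_hom_induct[OF Jp _ r S lin_mul_left])
    fix b M assume b: "b \<in> Jp"
      and k: "\<And>h w. (h, w) \<in> Poly_Mapping.keys b \<Longrightarrow> h = eH \<and> w \<in> PW \<and> mset w = M"
    obtain v where v: "b \<noteq> 0 \<Longrightarrow> (eH, v) \<in> Poly_Mapping.keys b"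
      using k by (metis ex_in_conv keys_eq_empty surj_pair)
    let ?c = "wchar D v (inF D (fel D j))"
    let ?f = "\<lambda>b. pm_scale ?c (wl [Neg j] \<star> b) + dL (Pos j) b - pm_scale (?c * inverse (pp D j j)) (bs (gf j) [] \<star> dR (Pos j) b)"
    have "b \<star> wl [Neg j] - ?f b \<in> I0"
    proof (rule lin_mem_on_keys[of "\<lambda>b. b \<star> wl [Neg j] - ?f b", OF _ I0_subspace])
      show "lin (\<lambda>b. b \<star> wl [Neg j] - ?f b)"
        by (intro lin_minus lin_plus lin_scaled lin_mul_left lin_mul_right lin_dL lin_comp[OF lin_mul_right lin_dR])
      fix s assume s: "s \<in> Poly_Mapping.keys b"
      obtain w where w: "s = (eH, w)" "w \<in> PW" "mset w = M" using k s by (cases s) auto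
      have "mset v = M" using v k s by force
      with w have "wchar D w (inF D (fel D j)) = ?c" by (intro wchar_mset) auto
      then have "?f (Poly_Mapping.single s 1) = commR j w"
        using w(2) j PW_W[OF w(2)] by (simp add: w(1) commR_def)
      then show "Poly_Mapping.single s 1 \<star> wl [Neg j] - ?f (Poly_Mapping.single s 1) \<in> I0"
        using PW_commR[OF w(2) j] by (simp add: w(1))
    qed
    moreover have "?f b \<in> ssum (ssum ((\<star>) (wl [Neg j]) ` Jp) Jp) ((\<star>) (bs (gf j) []) ` Jp)"
    proof -
      have "?f b = wl [Neg j] \<star> pm_scale ?c b + dL (Pos j) b + bs (gf j) [] \<star> pm_scale (- ?c * inverse (pp D j j)) (dR (Pos j) b)"
        by (simp add: mul_scale_right mul_uminus_right pm.scale_minus_left)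
      then show ?thesis
        using b j by (simp only:) (intro ssumI imageI pm.subspace_scale[OF Jp_subspace] Jp_mul)
    qed
    ultimately have "?f b + (b \<star> wl [Neg j] - ?f b) \<in> ?S" by (intro ssumI)
    then show "b \<star> wl [Neg j] \<in> ?S" by simp
  qed simp
  then show thesis using that unfolding ssum_def by blast
qed

lemma Jm_comm:
  assumes r: "r \<in> Jm" and i: "i \<in> idx D"
  obtains r1 r2 r3 z where "r1 \<in> Jm" "r2 \<in> Jm" "r3 \<in> Jm" "z \<in> I0"
    "wl [Pos i] \<star> r = r1 \<star> wl [Pos i] + r2 + bs (gf i) [] \<star> r3 + z"
proof -
  let ?S = "ssum (ssum (ssum ((\<lambda>x. x \<star> wl [Pos i]) ` Jm) Jm) ((\<star>) (bs (gf i) []) ` Jm)) I0"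
  have S: "pm.subspace ?S"
    by (intro subspace_ssum subspace_lin_image lin_mul_left lin_mul_right Jm_subspace I0_subspace)
  have "wl [Pos i] \<star> r \<in> ?S"
  proof (rule good_hom_induct[OF Jm _ r S lin_mul_right])
    fix b M assume b: "b \<in> Jm"
      and k: "\<And>h w. (h, w) \<in> Poly_Mapping.keys b \<Longrightarrow> h = eH \<and> w \<in> NW \<and> mset w = M"
    obtain v where v: "b \<noteq> 0 \<Longrightarrow> (eH, v) \<in> Poly_Mapping.keys b"
      using k by (metis ex_in_conv keys_eq_empty surj_pair)
    let ?c = "chiH D i (wgrp D v)"
    let ?f = "\<lambda>b. pm_scale ?c (b \<star> wl [Pos i]) + pm_scale (?c * inverse (pp D i i)) (dL (Neg i) b) - bs (gf i) [] \<star> dR (Neg i) b"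
    have "wl [Pos i] \<star> b - ?f b \<in> I0"
    proof (rule lin_mem_on_keys[of "\<lambda>b. wl [Pos i] \<star> b - ?f b", OF _ I0_subspace])
      show "lin (\<lambda>b. wl [Pos i] \<star> b - ?f b)"
        by (intro lin_minus lin_plus lin_scaled lin_mul_left lin_mul_right lin_dL lin_comp[OF lin_mul_right lin_dR])
      fix s assume s: "s \<in> Poly_Mapping.keys b"
      obtain w where w: "s = (eH, w)" "w \<in> NW" "mset w = M" using k s by (cases s) auto
      have "mset v = M" using v k s by force
      with w have "wgrp D w = wgrp D v" using NW_W[OF w(2)] by (intro wgrp_mset) auto
      then have "?f (Poly_Mapping.single s 1) = commL i w"
        using w(2) i NW_W[OF w(2)] by (simp add: w(1) commL_def)
      then show "wl [Pos i] \<star> Poly_Mapping.single s 1 - ?f (Poly_Mapping.single s 1) \<in> I0"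
        using NW_commL[OF w(2) i] by (simp add: w(1))
    qed
    moreover have "?f b \<in> ssum (ssum ((\<lambda>x. x \<star> wl [Pos i]) ` Jm) Jm) ((\<star>) (bs (gf i) []) ` Jm)"
    proof -
      have "?f b = pm_scale ?c b \<star> wl [Pos i] + pm_scale (?c * inverse (pp D i i)) (dL (Neg i) b) + bs (gf i) [] \<star> (- dR (Neg i) b)"
        by (simp add: mul_scale_left mul_uminus_right)
      then show ?thesis
        using b i by (simp only:) (intro ssumI imageI pm.subspace_scale[OF Jm_subspace] pm.subspace_neg[OF Jm_subspace] Jm_mul)
    qed
    ultimately have "?f b + (wl [Pos i] \<star> b - ?f b) \<in> ?S" by (intro ssumI)
    then show "wl [Pos i] \<star> b \<in> ?S" by simp
  qed simp
  then show thesis using that unfolding ssum_def by blast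
qed

lemma Kgen_CS: "Kgen \<subseteq> CS"
  unfolding Kgen_def using Jm_CS Jp_CS PW_W NW_W by auto

lemma K_CS: "K \<subseteq> CS"
  unfolding K_def by (rule pm.span_minimal[OF Kgen_CS CS_subspace])

lemma II_CS: "II \<subseteq> CS"
  unfolding II_def ssum_def using K_CS I0_CS by (auto intro!: CS_add)

lemma II_closed:
  assumes f: "lin f" and i: "\<And>a. a \<in> I0 \<Longrightarrow> f a \<in> I0"
    and g1: "\<And>h r v. h \<in> H \<Longrightarrow> r \<in> Jm \<Longrightarrow> v \<in> PW \<Longrightarrow> f (bs h [] \<star> r \<star> wl v) \<in> II"
    and g2: "\<And>h u r. h \<in> H \<Longrightarrow> u \<in> NW \<Longrightarrow> r \<in> Jp \<Longrightarrow> f (bs h [] \<star> wl u \<star> r) \<in> II"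
    and a: "a \<in> II"
  shows "f a \<in> II"
proof -
  obtain k z where kz: "k \<in> K" "z \<in> I0" "a = k + z" using a by (auto simp: II_def ssum_def)
  have "f k \<in> II"
    by (rule span_lin_mem[OF f II_subspace _ kz(1)[unfolded K_def]]) (auto simp only: Kgen_def g1 g2 Un_iff mem_Collect_eq)
  then show ?thesis using kz i[OF kz(2)] by (simp add: lin_add[OF f] II_add I0_II)
qed

lemma grp_mul: "bs h [] \<star> bs h' [] = bs (h \<cdot> h') []"
  by simp

text \<open>A letter meeting words of its own sign only extends them. A letter of the opposite sign
  is commuted through by \<open>PW_commR\<close>, \<open>NW_commL\<close>, \<open>Jp_comm\<close> or
  \<open>Jm_comm\<close>; where it passes an element of \<open>Jm\<close> or \<open>Jp\<close>, the
  derivation terms stay in that space.\<close>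

lemma ideal2_II: "ideal2 II"
proof (rule ideal2_span_mul[OF II_subspace II_CS])
  fix a h' assume a: "a \<in> II" and h': "h' \<in> H"
  show "bs h' [] \<star> a \<in> II"
  proof (rule II_closed[OF lin_mul_right _ _ _ a])
    show "bs h' [] \<star> z \<in> I0" if "z \<in> I0" for z using that h' by (intro I0_left) auto
    fix h assume h: "h \<in> H"
    show "bs h' [] \<star> (bs h [] \<star> r \<star> wl v) \<in> II" if "r \<in> Jm" "v \<in> PW" for r v
    proof -
      have "bs h' [] \<star> (bs h [] \<star> r \<star> wl v) = bs (h' \<cdot> h) [] \<star> r \<star> wl v"
        using that h h' Jm_CS PW_W by (simp add: mul_assoc flip: grp_mul del: bil_ext_single)
      then show ?thesis using that h h' by (simp only:) (intro K_II K1; simp)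
    qed
    show "bs h' [] \<star> (bs h [] \<star> wl u \<star> r) \<in> II" if "u \<in> NW" "r \<in> Jp" for u r
    proof -
      have "bs h' [] \<star> (bs h [] \<star> wl u \<star> r) = bs (h' \<cdot> h) [] \<star> wl u \<star> r"
        using that h h' Jp_CS NW_W by (simp add: mul_assoc flip: grp_mul del: bil_ext_single)
      then show ?thesis using that h h' by (simp only:) (intro K_II K2; simp)
    qed
  qed
  show "a \<star> bs h' [] \<in> II"
  proof (rule II_closed[OF lin_mul_left _ _ _ a])
    show "z \<star> bs h' [] \<in> I0" if "z \<in> I0" for z using that h' by (intro I0_right) auto
    fix h assume h: "h \<in> H"
    show "bs h [] \<star> r \<star> wl v \<star> bs h' [] \<in> II" if r: "r \<in> Jm" and v: "v \<in> PW" for r v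
    proof -
      obtain r' where r': "r' \<in> Jm" "r \<star> bs h' [] = bs h' [] \<star> r'" using Jm_conj[OF r h'] by blast
      have "bs h [] \<star> r \<star> wl v \<star> bs h' [] = bs h [] \<star> r \<star> (wl v \<star> bs h' [])"
        using h h' Jm_CS[OF r] PW_W[OF v] by (simp add: mul_assoc del: bil_ext_single)
      also have "\<dots> = pm_scale (wchar D v h') (bs h [] \<star> (r \<star> bs h' []) \<star> wl v)"
        unfolding wl_grp[OF PW_W[OF v] h'] using h h' Jm_CS[OF r] PW_W[OF v]
        by (simp add: mul_assoc mul_scale_right del: bil_ext_single)
      also have "bs h [] \<star> (r \<star> bs h' []) = bs (h \<cdot> h') [] \<star> r'"
        unfolding r' using h h' Jm_CS[OF r'(1)] by (simp add: mul_assoc flip: grp_mul del: bil_ext_single)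
      finally show ?thesis using r' h h' v by (simp only:) (intro II_scale K_II K1; simp)
    qed
    show "bs h [] \<star> wl u \<star> r \<star> bs h' [] \<in> II" if u: "u \<in> NW" and r: "r \<in> Jp" for u r
    proof -
      obtain r' where r': "r' \<in> Jp" "r \<star> bs h' [] = bs h' [] \<star> r'" using Jp_conj[OF r h'] by blast
      have "bs h [] \<star> wl u \<star> r \<star> bs h' [] = bs h [] \<star> (wl u \<star> bs h' []) \<star> r'"
        using h h' Jp_CS[OF r] Jp_CS[OF r'(1)] NW_W[OF u] by (simp add: mul_assoc r'(2) del: bil_ext_single)
      also have "\<dots> = pm_scale (wchar D u h') (bs (h \<cdot> h') [] \<star> wl u \<star> r')"
        unfolding wl_grp[OF NW_W[OF u] h'] using h h' Jp_CS[OF r'(1)] NW_W[OF u]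
        by (simp add: mul_assoc mul_scale_right mul_scale_left flip: grp_mul del: bil_ext_single)
      finally show ?thesis using r' h h' u by (simp only:) (intro II_scale K_II K2; simp)
    qed
  qed
next
  fix a y assume a: "a \<in> II" and y: "y \<in> letters D"
  have cg: "wl [y] \<star> bs h [] = pm_scale (lchar D y h) (bs h [] \<star> wl [y])" if "h \<in> H" for h
    using y that by simp
  have cg2: "wl [y] \<star> (bs h [] \<star> b \<star> c) = pm_scale (lchar D y h) (bs h [] \<star> (wl [y] \<star> b) \<star> c)"
    if "h \<in> H" "b \<in> CS" "c \<in> CS" for h b c
  proof -
    have "wl [y] \<star> (bs h [] \<star> b \<star> c) = (wl [y] \<star> bs h []) \<star> b \<star> c"
      using that y by (simp add: mul_assoc del: bil_ext_single)
    then show ?thesis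
      unfolding cg[OF that(1)] using that y by (simp add: mul_assoc mul_scale_left del: bil_ext_single)
  qed
  show "wl [y] \<star> a \<in> II"
  proof (rule II_closed[OF lin_mul_right _ _ _ a])
    show "wl [y] \<star> z \<in> I0" if "z \<in> I0" for z using that y by (intro I0_left) auto
    fix h assume h: "h \<in> H"
    show "wl [y] \<star> (bs h [] \<star> r \<star> wl v) \<in> II" if r: "r \<in> Jm" and v: "v \<in> PW" for r v
    proof -
      have "bs h [] \<star> (wl [y] \<star> r) \<star> wl v \<in> II"
      proof (cases y)
        case (Neg j)
        then show ?thesis using h r v y by (intro K_II K1 VL_wl) (auto intro: Jm_mul)
      next
        case (Pos i)
        with y have i: "i \<in> idx D" by simp
        obtain r1 r2 r3 z where rr: "r1 \<in> Jm" "r2 \<in> Jm" "r3 \<in> Jm" "z \<in> I0"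
          "wl [Pos i] \<star> r = r1 \<star> wl [Pos i] + r2 + bs (gf i) [] \<star> r3 + z" by (rule Jm_comm[OF r i])
        have "bs h [] \<star> (wl [y] \<star> r) \<star> wl v = bs h [] \<star> r1 \<star> (wl [Pos i] \<star> wl v) + bs h [] \<star> r2 \<star> wl v
            + (bs h [] \<star> bs (gf i) []) \<star> r3 \<star> wl v + bs h [] \<star> z \<star> wl v"
          unfolding Pos rr(5) using h i PW_W[OF v] Jm_CS[OF rr(1)] Jm_CS[OF rr(2)] Jm_CS[OF rr(3)] rr(4) I0_CS
          by (simp add: mul_assoc mul_add_left mul_add_right subset_iff del: bil_ext_single)
        also have "wl [Pos i] \<star> wl v = wl (Pos i # v)" using i PW_W[OF v] by simp
        also have "bs h [] \<star> r1 \<star> wl (Pos i # v) + bs h [] \<star> r2 \<star> wl v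
            + (bs h [] \<star> bs (gf i) []) \<star> r3 \<star> wl v + bs h [] \<star> z \<star> wl v \<in> II"
          unfolding grp_mul using h i v rr(1-4) PW_W[OF v]
          by (intro II_add K_II K1 VL_wl I0_II I0_left I0_right) auto
        finally show ?thesis .
      qed
      then show ?thesis using cg2[OF h Jm_CS[OF r], of "wl v"] PW_W[OF v] by (simp add: II_scale)
    qed
    show "wl [y] \<star> (bs h [] \<star> wl u \<star> r) \<in> II" if u: "u \<in> NW" and r: "r \<in> Jp" for u r
    proof -
      have "bs h [] \<star> (wl [y] \<star> wl u) \<star> r \<in> II"
      proof (cases y)
        case (Neg j)
        then have "wl [y] \<star> wl u = wl (y # u)" using y NW_W[OF u] by simp
        then show ?thesis using h r u y Neg by (simp only:) (intro K_II K2 VL_wl; auto)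
      next
        case (Pos i)
        with y have i: "i \<in> idx D" by simp
        \<comment> \<open>Here x_i passes the negative word u, not an element of \<open>Jm\<close>.
          Only the term u x_i r brings x_i next to r, where the product is again in
          \<open>Jp\<close>; the other terms keep r unchanged.\<close>
        define z where "z = wl [Pos i] \<star> wl u - commL i u"
        have z: "z \<in> I0" "wl [Pos i] \<star> wl u = commL i u + z"
          using NW_commL[OF u i] by (auto simp: z_def)
        have d: "dLw (Neg i) u \<in> VL Neg" "dRw (Neg i) u \<in> VL Neg" using dLw_VL[OF u] dRw_VL[OF u] by auto
        then have dC: "dLw (Neg i) u \<in> CS" "dRw (Neg i) u \<in> CS" using VL_CS[of Neg] by auto
        have w: "wl (u @ [Pos i]) = wl u \<star> wl [Pos i]" using i NW_W[OF u] by simp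
        have "bs h [] \<star> (wl [y] \<star> wl u) \<star> r =
           pm_scale (chiH D i (wgrp D u)) (bs h [] \<star> wl u \<star> (wl [Pos i] \<star> r))
           + pm_scale (chiH D i (wgrp D u) * inverse (pp D i i)) (bs h [] \<star> dLw (Neg i) u \<star> r)
           - (bs h [] \<star> bs (gf i) []) \<star> dRw (Neg i) u \<star> r + bs h [] \<star> z \<star> r"
          unfolding Pos z(2) commL_def w using h i NW_W[OF u] Jp_CS[OF r] z(1) I0_CS dC
          by (simp add: mul_assoc mul_linear subset_iff del: bil_ext_single)
        also have "\<dots> \<in> II"
          unfolding grp_mul using h i u r z d Jp_CS[OF r] NW_W[OF u]
          by (intro II_add[OF II_diff[OF II_add]] II_scale K_II K2 VL_wl I0_II I0_left I0_right Jp_mul) auto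
        finally show ?thesis .
      qed
      then show ?thesis using cg2[OF h _ Jp_CS[OF r], of "wl u"] NW_W[OF u] by (simp add: II_scale)
    qed
  qed
  show "a \<star> wl [y] \<in> II"
  proof (rule II_closed[OF lin_mul_left _ _ _ a])
    show "z \<star> wl [y] \<in> I0" if "z \<in> I0" for z using that y by (intro I0_right) auto
    fix h assume h: "h \<in> H"
    show "bs h [] \<star> r \<star> wl v \<star> wl [y] \<in> II" if r: "r \<in> Jm" and v: "v \<in> PW" for r v
    proof (cases y)
      case (Pos i)
      have "bs h [] \<star> r \<star> wl v \<star> wl [y] = bs h [] \<star> r \<star> (wl v \<star> wl [y])"
        using h y Jm_CS[OF r] PW_W[OF v] by (simp add: mul_assoc del: bil_ext_single)
      also have "wl v \<star> wl [y] = wl (v @ [y])" using y PW_W[OF v] by simp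
      finally show ?thesis using h r v y Pos by (simp only:) (intro K_II K1 VL_wl; auto)
    next
      case (Neg j)
      with y have j: "j \<in> idx D" by simp
      define z where "z = wl v \<star> wl [Neg j] - commR j v"
      have z: "z \<in> I0" "wl v \<star> wl [Neg j] = commR j v + z"
        using PW_commR[OF v j] by (auto simp: z_def)
      have d: "dLw (Pos j) v \<in> VL Pos" "dRw (Pos j) v \<in> VL Pos" using dLw_VL[OF v] dRw_VL[OF v] by auto
      then have dC: "dLw (Pos j) v \<in> CS" "dRw (Pos j) v \<in> CS" using VL_CS[of Pos] by auto
      obtain r' where r': "r' \<in> Jm" "r \<star> bs (gf j) [] = bs (gf j) [] \<star> r'" using Jm_conj[OF r gf_closed[OF j]] by blast
      have w: "wl (Neg j # v) = wl [Neg j] \<star> wl v" using j PW_W[OF v] by simp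
      let ?c = "wchar D v (inF D (fel D j))"
      have "bs h [] \<star> r \<star> wl v \<star> wl [y] = bs h [] \<star> r \<star> (wl v \<star> wl [Neg j])"
        using h y Jm_CS[OF r] PW_W[OF v] Neg by (simp add: mul_assoc del: bil_ext_single)
      also have "\<dots> = pm_scale ?c (bs h [] \<star> (r \<star> wl [Neg j]) \<star> wl v) + bs h [] \<star> r \<star> dLw (Pos j) v
         - pm_scale (?c * inverse (pp D j j)) (bs h [] \<star> (r \<star> bs (gf j) []) \<star> dRw (Pos j) v) + bs h [] \<star> r \<star> z"
        unfolding z(2) commR_def w using h j PW_W[OF v] Jm_CS[OF r] z(1) I0_CS dC
        by (simp add: mul_assoc mul_linear subset_iff del: bil_ext_single)
      also have "bs h [] \<star> (r \<star> bs (gf j) []) = bs (h \<cdot> gf j) [] \<star> r'"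
        unfolding r' using h j Jm_CS[OF r'(1)] by (simp add: mul_assoc flip: grp_mul del: bil_ext_single)
      also have "pm_scale ?c (bs h [] \<star> (r \<star> wl [Neg j]) \<star> wl v) + bs h [] \<star> r \<star> dLw (Pos j) v
         - pm_scale (?c * inverse (pp D j j)) (bs (h \<cdot> gf j) [] \<star> r' \<star> dRw (Pos j) v) + bs h [] \<star> r \<star> z \<in> II"
        using h j v r r' z d Jm_CS[OF r] PW_W[OF v]
        by (intro II_add[OF II_diff[OF II_add]] II_scale K_II K1 VL_wl I0_II I0_left I0_right Jm_mul) auto
      finally show ?thesis .
    qed
    show "bs h [] \<star> wl u \<star> r \<star> wl [y] \<in> II" if u: "u \<in> NW" and r: "r \<in> Jp" for u r
    proof -
      have as: "bs h [] \<star> wl u \<star> r \<star> wl [y] = bs h [] \<star> wl u \<star> (r \<star> wl [y])"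
        using h y Jp_CS[OF r] NW_W[OF u] by (simp add: mul_assoc del: bil_ext_single)
      show ?thesis
      proof (cases y)
        case (Pos i)
        then show ?thesis unfolding as using h r u y by (intro K_II K2 VL_wl) (auto intro: Jp_mul)
      next
        case (Neg j)
        with y have j: "j \<in> idx D" by simp
        obtain r1 r2 r3 z where rr: "r1 \<in> Jp" "r2 \<in> Jp" "r3 \<in> Jp" "z \<in> I0"
          "r \<star> wl [Neg j] = wl [Neg j] \<star> r1 + r2 + bs (gf j) [] \<star> r3 + z" by (rule Jp_comm[OF r j])
        have "bs h [] \<star> wl u \<star> (r \<star> wl [y]) = bs h [] \<star> (wl u \<star> wl [Neg j]) \<star> r1 + bs h [] \<star> wl u \<star> r2
            + bs h [] \<star> (wl u \<star> bs (gf j) []) \<star> r3 + bs h [] \<star> wl u \<star> z"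
          unfolding Neg rr(5) using h j NW_W[OF u] Jp_CS[OF rr(1)] Jp_CS[OF rr(2)] Jp_CS[OF rr(3)] rr(4) I0_CS
          by (simp add: mul_assoc mul_add_left mul_add_right subset_iff del: bil_ext_single)
        also have "bs h [] \<star> (wl u \<star> bs (gf j) []) = pm_scale (wchar D u (gf j)) (bs (h \<cdot> gf j) [] \<star> wl u)"
          using h j NW_W[OF u] by simp
        also have "wl u \<star> wl [Neg j] = wl (u @ [Neg j])" using j NW_W[OF u] by simp
        also have "bs h [] \<star> wl (u @ [Neg j]) \<star> r1 + bs h [] \<star> wl u \<star> r2
            + pm_scale (wchar D u (gf j)) (bs (h \<cdot> gf j) [] \<star> wl u) \<star> r3 + bs h [] \<star> wl u \<star> z \<in> II"
          unfolding mul_scale_left using h j u rr(1-4) NW_W[OF u]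
          by (intro II_add II_scale K_II K2 VL_wl I0_II I0_left I0_right) auto
        finally show ?thesis unfolding as .
      qed
    qed
  qed
qed

lemma K_TR: "K \<subseteq> TR"
  unfolding K_def
proof (rule pm.span_minimal[OF _ TR_subspace])
  have 1: "bs h [] \<star> r \<star> wl v \<in> TR" if "h \<in> H" "r \<in> VL Neg" "v \<in> PW" for h r v
    unfolding TR_def
    by (rule kset_mul[of _ "{h} \<times> NW" _ "{(eH, v)}"], rule kset_mul[of _ "{(h, [])}" _ "{eH} \<times> NW"])
      (use that in \<open>auto simp: VL_def TW_def\<close>)
  have 2: "bs h [] \<star> wl u \<star> r \<in> TR" if "h \<in> H" "r \<in> VL Pos" "u \<in> NW" for h r u
    unfolding TR_def
    by (rule kset_mul[of _ "{(h, u)}" _ "{eH} \<times> PW"])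
      (use that NW_W[OF that(3)] in \<open>auto simp: VL_def TW_def\<close>)
  show "Kgen \<subseteq> TR"
    unfolding Kgen_def using 1 2 good_VL[OF Jm] good_VL[OF Jp] by blast
qed

text \<open>\<open>nu\<close> kills \<open>I0\<close> and fixes \<open>K\<close>, which is
  triangular. In particular a triangular element of the ideal lies in \<open>K\<close>, and
  functionals that vanish on \<open>K\<close> vanish on the ideal after composition with
  \<open>nu\<close>.\<close>

lemma nu_II: "a \<in> II \<Longrightarrow> nu a \<in> K"
  unfolding II_def ssum_def using K_TR by (auto simp: lin_add[OF lin_nu] nu_I0 nu_tri subset_iff)

lemma Jm_II: "r \<in> Jm \<Longrightarrow> r \<in> II"
  using K_II[OF K1[of eH r "wl []"]] VL_wl[of "[]" Pos] by (simp add: Jm_CS)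

lemma Jp_II: "r \<in> Jp \<Longrightarrow> r \<in> II"
  using K_II[OF K2[of eH r "wl []"]] VL_wl[of "[]" Neg] by (simp add: Jp_CS)

lemma Idl_eq_II:
  assumes "R \<subseteq> CS" "mixed_rels D \<subseteq> R" "R \<subseteq> II"
    and "Jm \<subseteq> Idl\<^bsub>skew D\<^esub> R" "Jp \<subseteq> Idl\<^bsub>skew D\<^esub> R"
  shows "Idl\<^bsub>skew D\<^esub> R = II"
proof
  show "Idl\<^bsub>skew D\<^esub> R \<subseteq> II"
    using ideal2_II assms(3) unfolding ideal2_ideal by (rule SR.genideal_minimal)
  let ?I = "Idl\<^bsub>skew D\<^esub> R"
  have id: "ideal2 ?I" unfolding ideal2_ideal using assms(1) by (intro SR.genideal_ideal) simp
  have "ideal ?I (skew D)" using id by (simp add: ideal2_ideal)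
  moreover have "mixed_rels D \<subseteq> ?I" using assms(1,2) SR.genideal_self[of R] by auto
  ultimately have "I0 \<subseteq> ?I" unfolding I0_def by (rule SR.genideal_minimal)
  moreover have "K \<subseteq> ?I"
    unfolding K_def
  proof (rule pm.span_minimal)
    show "pm.subspace ?I" using id by (simp add: ideal2_def)
    show "Kgen \<subseteq> ?I"
      unfolding Kgen_def using id assms(4,5) PW_W NW_W
      by (auto simp: ideal2_def subset_iff)
  qed
  ultimately show "II \<subseteq> ?I"
    using id pm.subspace_add unfolding II_def ssum_def ideal2_def by blast
qed

end

section \<open>Contractions of the coproduct\<close>

lemma lfun_const0: "lfun (\<lambda>_. 0)"
  by (simp add: lfun_def)

text \<open>The maps id \<otimes> \<phi> and, in the next definition, \<phi> \<otimes> id, on formal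
  combinations of pairs.\<close>

definition EE :: "(('s \<Rightarrow>\<^sub>0 'k::field) \<Rightarrow> 'k) \<Rightarrow> (('s \<Rightarrow>\<^sub>0 'k) \<times> ('s \<Rightarrow>\<^sub>0 'k) \<Rightarrow>\<^sub>0 'k) \<Rightarrow> ('s \<Rightarrow>\<^sub>0 'k)" where
  "EE \<phi> = lin_ext (\<lambda>(x, y). pm_scale (\<phi> y) x)"

definition EE' :: "(('s \<Rightarrow>\<^sub>0 'k::field) \<Rightarrow> 'k) \<Rightarrow> (('s \<Rightarrow>\<^sub>0 'k) \<times> ('s \<Rightarrow>\<^sub>0 'k) \<Rightarrow>\<^sub>0 'k) \<Rightarrow> ('s \<Rightarrow>\<^sub>0 'k)" where
  "EE' \<phi> = lin_ext (\<lambda>(x, y). pm_scale (\<phi> x) y)"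

lemma lin_EE: "lin (EE \<phi>)" and lin_EE': "lin (EE' \<phi>)"
  unfolding EE_def EE'_def by (rule lin_lin_ext)+

lemma EE_single [simp]: "EE \<phi> (Poly_Mapping.single (x, y) c) = pm_scale (c * \<phi> y) x"
  and EE'_single [simp]: "EE' \<phi> (Poly_Mapping.single (x, y) c) = pm_scale (c * \<phi> x) y"
  by (simp_all add: EE_def EE'_def)

lemma EE_cong: "(\<And>x y. (x, y) \<in> Poly_Mapping.keys t \<Longrightarrow> \<phi> y = \<psi> y) \<Longrightarrow> EE \<phi> t = EE \<psi> t"
  unfolding EE_def by (rule lin_ext_cong) auto

lemma EE'_cong: "(\<And>x y. (x, y) \<in> Poly_Mapping.keys t \<Longrightarrow> \<phi> x = \<psi> x) \<Longrightarrow> EE' \<phi> t = EE' \<psi> t"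
  unfolding EE'_def by (rule lin_ext_cong) auto

lemma EE_zero: "EE (\<lambda>_. 0) t = 0"
  by (rule lin_eq_on_keys[OF lin_EE lin_const0]) (auto simp: EE_def)

lemma EE'_zero: "EE' (\<lambda>_. 0) t = 0"
  by (rule lin_eq_on_keys[OF lin_EE' lin_const0]) (auto simp: EE'_def)

context qd
begin

abbreviation dw where "dw \<equiv> delta_word D"
abbreviation PM where "PM \<equiv> pair_mult (skew_mod D)"
definition Del where "Del = lin_ext (delta_basis D)"

lemma lin_Del: "lin Del" unfolding Del_def by (rule lin_lin_ext)
lemma Del_bs [simp]: "Del (bs h w) = delta_basis D (h, w)" by (simp add: Del_def)

lemma lin_PM_left: "lin (\<lambda>t. PM t u)" and lin_PM_right: "lin (\<lambda>t. PM u t)"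
  unfolding pair_mult_def by (rule lin_bil_left lin_bil_right)+

lemma PM_single [simp]:
  "PM (Poly_Mapping.single (a, b) c) (Poly_Mapping.single (a', b') d) = Poly_Mapping.single (a \<star> a', b \<star> b') (c * d)"
  by (simp add: pair_mult_def)

lemma EE_PM: "EE \<phi> (PM (Poly_Mapping.single (x, z) 1) t) = x \<star> EE (\<lambda>b. \<phi> (z \<star> b)) t"
  by (rule lin_eq_on_keys[OF lin_comp[OF lin_EE lin_PM_right] lin_comp[OF lin_mul_right lin_EE]])
    (auto simp: mul_scale_right)

lemma EE'_PM: "EE' \<phi> (PM (Poly_Mapping.single (x, z) 1) t) = z \<star> EE' (\<lambda>b. \<phi> (x \<star> b)) t"
  by (rule lin_eq_on_keys[OF lin_comp[OF lin_EE' lin_PM_right] lin_comp[OF lin_mul_right lin_EE']])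
    (auto simp: mul_scale_right)

lemma keys_PM:
  assumes "Poly_Mapping.keys t \<subseteq> A \<times> B" "Poly_Mapping.keys u \<subseteq> A' \<times> B'"
    and "\<And>a a'. a \<in> A \<Longrightarrow> a' \<in> A' \<Longrightarrow> a \<star> a' \<in> A''" "\<And>b b'. b \<in> B \<Longrightarrow> b' \<in> B' \<Longrightarrow> b \<star> b' \<in> B''"
  shows "Poly_Mapping.keys (PM t u) \<subseteq> A'' \<times> B''"
proof -
  have "PM t u \<in> {c. Poly_Mapping.keys c \<subseteq> A'' \<times> B''}"
  proof (rule lin_mem_on_keys[OF lin_PM_left subspace_keys])
    fix s assume s: "s \<in> Poly_Mapping.keys t"
    show "PM (Poly_Mapping.single s 1) u \<in> {c. Poly_Mapping.keys c \<subseteq> A'' \<times> B''}"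
    proof (rule lin_mem_on_keys[OF lin_PM_right subspace_keys])
      fix s' assume s': "s' \<in> Poly_Mapping.keys u"
      obtain a b a' b' where ab: "s = (a, b)" "s' = (a', b')" by (cases s, cases s')
      then have "a \<in> A" "b \<in> B" "a' \<in> A'" "b' \<in> B'" using s s' assms(1,2) by auto
      with ab show "PM (Poly_Mapping.single s 1) (Poly_Mapping.single s' 1) \<in> {c. Poly_Mapping.keys c \<subseteq> A'' \<times> B''}"
        using assms(3,4) by auto
    qed
  qed
  then show ?thesis by simp
qed

lemma keys_plus: "Poly_Mapping.keys a \<subseteq> X \<Longrightarrow> Poly_Mapping.keys b \<subseteq> X \<Longrightarrow> Poly_Mapping.keys (a + b) \<subseteq> X"
  using keys_add[of a b] by (meson Un_least subset_trans)

definition KX where "KX G X = kset (G \<times> lists X)"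

lemma KX_mul: "subgroup G (HH D) \<Longrightarrow> a \<in> KX G X \<Longrightarrow> b \<in> KX G X \<Longrightarrow> a \<star> b \<in> KX G X"
  unfolding KX_def by (rule kset_mul) (auto simp: subgroup.m_closed)

lemma dw_keys:
  assumes "subgroup G (HH D)" "lgrp D ` X \<subseteq> G" "w \<in> lists X"
  shows "Poly_Mapping.keys (dw w) \<subseteq> KX G X \<times> KX G X"
  using assms(3)
proof (induction w)
  case Nil
  then show ?case using subgroup.one_closed[OF assms(1)] by (simp add: KX_def)
next
  case (Cons y w)
  have "Poly_Mapping.keys (Poly_Mapping.single (lett D y, \<one>\<^bsub>skew_mod D\<^esub>) (1::'k) +
     Poly_Mapping.single (grp (lgrp D y), lett D y) 1) \<subseteq> KX G X \<times> KX G X"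
    using assms Cons subgroup.one_closed[OF assms(1)]
    by (intro keys_plus) (auto simp: lett_eq grp_eq KX_def)
  then show ?case using Cons
    by (simp only: delta_word.simps) (rule keys_PM[OF _ Cons.IH], auto simp: KX_mul[OF assms(1)])
qed

lemma Del_keys:
  assumes "subgroup G (HH D)" "lgrp D ` X \<subseteq> G" "a \<in> KX G X"
  shows "Poly_Mapping.keys (Del a) \<subseteq> KX G X \<times> KX G X"
proof -
  have "Del a \<in> {t. Poly_Mapping.keys t \<subseteq> KX G X \<times> KX G X}"
  proof (rule kset_lin_mem[OF assms(3)[unfolded KX_def] lin_Del subspace_keys])
    fix h w assume "(h, w) \<in> G \<times> lists X"
    then have hw: "h \<in> G" "w \<in> lists X" by auto
    have "Poly_Mapping.keys (Poly_Mapping.single (bs h [], bs h []) (1::'k)) \<subseteq> KX G X \<times> KX G X"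
      using hw by (simp add: KX_def)
    then show "Del (bs h w) \<in> {t. Poly_Mapping.keys t \<subseteq> KX G X \<times> KX G X}"
      using keys_PM[OF _ dw_keys[OF assms(1,2) hw(2)] KX_mul[OF assms(1)] KX_mul[OF assms(1)]]
      by (simp add: delta_basis_def grp_eq)
  qed
  then show ?thesis by simp
qed

lemma CS_KX: "CS = KX H (letters D)"
  by (simp add: CS_kset KX_def)

lemma dw_CS: "w \<in> W \<Longrightarrow> Poly_Mapping.keys (dw w) \<subseteq> CS \<times> CS"
  unfolding CS_KX by (rule dw_keys) (auto simp: HG.subgroup_self)

lemma dw_EE_cong: "w \<in> W \<Longrightarrow> (\<And>b. b \<in> CS \<Longrightarrow> \<phi> b = \<psi> b) \<Longrightarrow> EE \<phi> (dw w) = EE \<psi> (dw w)"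
  using dw_CS by (intro EE_cong) blast

lemma dw_EE'_cong: "w \<in> W \<Longrightarrow> (\<And>b. b \<in> CS \<Longrightarrow> \<phi> b = \<psi> b) \<Longrightarrow> EE' \<phi> (dw w) = EE' \<psi> (dw w)"
  using dw_CS by (intro EE'_cong) blast

lemma dw_EE_zero: "w \<in> W \<Longrightarrow> (\<And>b. b \<in> CS \<Longrightarrow> \<phi> b = 0) \<Longrightarrow> EE \<phi> (dw w) = 0"
  using dw_EE_cong[of w \<phi> "\<lambda>_. 0"] by (simp add: EE_zero)

lemma dw_EE'_zero: "w \<in> W \<Longrightarrow> (\<And>b. b \<in> CS \<Longrightarrow> \<phi> b = 0) \<Longrightarrow> EE' \<phi> (dw w) = 0"
  using dw_EE'_cong[of w \<phi> "\<lambda>_. 0"] by (simp add: EE'_zero)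

lemma dw_EE_CS: "w \<in> W \<Longrightarrow> EE \<phi> (dw w) \<in> CS"
  unfolding EE_def using dw_CS[of w] by (intro lin_ext_mem CS_subspace) (auto intro!: CS_scale)

lemma dw_EE'_CS: "w \<in> W \<Longrightarrow> EE' \<phi> (dw w) \<in> CS"
  unfolding EE'_def using dw_CS[of w] by (intro lin_ext_mem CS_subspace) (auto intro!: CS_scale)

lemma EE_Cons:
  assumes "y \<in> letters D" "w \<in> W"
  shows "EE \<phi> (dw (y # w)) = wl [y] \<star> EE \<phi> (dw w) + bs (lgrp D y) [] \<star> EE (\<lambda>b. \<phi> (wl [y] \<star> b)) (dw w)"
proof -
  have "EE (\<lambda>b. \<phi> (wl [] \<star> b)) (dw w) = EE \<phi> (dw w)"
    using assms by (intro dw_EE_cong) auto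
  then show ?thesis
    by (simp add: lin_add[OF lin_PM_left] lin_add[OF lin_EE] EE_PM lett_eq grp_eq)
qed

lemma EE'_Cons:
  assumes "y \<in> letters D" "w \<in> W"
  shows "EE' \<phi> (dw (y # w)) = EE' (\<lambda>b. \<phi> (wl [y] \<star> b)) (dw w) + wl [y] \<star> EE' (\<lambda>b. \<phi> (bs (lgrp D y) [] \<star> b)) (dw w)"
  using assms by (simp add: lin_add[OF lin_PM_left] lin_add[OF lin_EE'] EE'_PM lett_eq grp_eq dw_EE'_CS)

lemma EE_delta: "EE \<phi> (Del (bs h w)) = bs h [] \<star> EE (\<lambda>b. \<phi> (bs h [] \<star> b)) (dw w)"
  by (simp add: delta_basis_def EE_PM grp_eq)

lemma EE'_delta: "EE' \<phi> (Del (bs h w)) = bs h [] \<star> EE' (\<lambda>b. \<phi> (bs h [] \<star> b)) (dw w)"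
  by (simp add: delta_basis_def EE'_PM grp_eq)

section \<open>Contractions that see only part of a word\<close>

lemma lfun_Lmul: "lfun \<phi> \<Longrightarrow> lfun (\<lambda>b. \<phi> (a \<star> b))"
  by (rule lfun_comp[OF _ lin_mul_right])

lemma Lmul_bs: "lfun \<phi> \<Longrightarrow> \<phi> (wl [y] \<star> bs h w) = lchar D y h * \<phi> (bs (eH \<cdot> h) (y # w))"
  using lfun_scale[of \<phi> "lchar D y h" "bs (eH \<cdot> h) (y # w)"] by simp

lemma CS_lfun_zero:
  assumes "a \<in> CS" "lfun f" "\<And>h w. h \<in> H \<Longrightarrow> w \<in> W \<Longrightarrow> f (bs h w) = 0"
  shows "f a = 0"
  using kset_lfun_zero[OF assms(1)[unfolded CS_kset] assms(2)] assms(3) by auto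

text \<open>Words in the second tensor factor of the coproduct of \<open>w\<close> are never longer
  than \<open>w\<close>.\<close>

lemma EE_kill:
  assumes "w \<in> W" "lfun \<phi>" "\<And>h v. h \<in> H \<Longrightarrow> v \<in> W \<Longrightarrow> length v \<le> length w \<Longrightarrow> \<phi> (bs h v) = 0"
  shows "EE \<phi> (dw w) = 0"
  using assms
proof (induction w arbitrary: \<phi>)
  case Nil
  then show ?case using Nil(2)[of eH "[]"] by simp
next
  case (Cons y w)
  then have y: "y \<in> letters D" "w \<in> W" by auto
  have "EE \<phi> (dw w) = 0" using Cons.prems y by (intro Cons.IH) auto
  moreover have "EE (\<lambda>b. \<phi> (wl [y] \<star> b)) (dw w) = 0"
    using Cons.prems y by (intro Cons.IH lfun_Lmul) (auto simp del: bil_ext_single simp: Lmul_bs)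
  ultimately show ?case using y by (simp only: EE_Cons) simp
qed

text \<open>Full length in the second factor is reached only by g_w \<otimes> w, the term in which
  every letter goes there.\<close>

lemma EE_top:
  assumes "w \<in> W" "lfun \<phi>" "\<And>h v. h \<in> H \<Longrightarrow> v \<in> W \<Longrightarrow> length v < length w \<Longrightarrow> \<phi> (bs h v) = 0"
  shows "EE \<phi> (dw w) = pm_scale (\<phi> (wl w)) (bs (wgrp D w) [])"
  using assms
proof (induction w arbitrary: \<phi>)
  case (Cons y w)
  then have y: "y \<in> letters D" "w \<in> W" by auto
  have 1: "EE \<phi> (dw w) = 0" using Cons.prems y by (intro EE_kill) auto
  have 2: "EE (\<lambda>b. \<phi> (wl [y] \<star> b)) (dw w) = pm_scale (\<phi> (wl [y] \<star> wl w)) (bs (wgrp D w) [])"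
    using Cons.prems y by (intro Cons.IH lfun_Lmul) (auto simp del: bil_ext_single simp: Lmul_bs)
  show ?case using y unfolding EE_Cons[OF y] 1 2 by (simp add: mul_scale_right)
qed simp

definition kills where
  "kills \<phi> Z \<longleftrightarrow> lfun \<phi> \<and> (\<forall>h\<in>H. \<forall>w\<in>W. set w \<inter> Z \<noteq> {} \<longrightarrow> \<phi> (bs h w) = 0)"

lemma kills_Lmul: "kills \<phi> Z \<Longrightarrow> y \<in> letters D \<Longrightarrow> kills (\<lambda>b. \<phi> (wl [y] \<star> b)) Z"
  unfolding kills_def by (auto simp: lfun_Lmul Lmul_bs simp del: bil_ext_single)

lemma kills_grp: "kills \<phi> Z \<Longrightarrow> h \<in> H \<Longrightarrow> kills (\<lambda>b. \<phi> (bs h [] \<star> b)) Z"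
  unfolding kills_def by (auto simp: lfun_Lmul)

lemma kills_Lmul_zero: "kills \<phi> Z \<Longrightarrow> y \<in> letters D \<Longrightarrow> y \<in> Z \<Longrightarrow> b \<in> CS \<Longrightarrow> \<phi> (wl [y] \<star> b) = 0"
  by (rule CS_lfun_zero[of b "\<lambda>b. \<phi> (wl [y] \<star> b)"])
    (auto simp: kills_def lfun_Lmul Lmul_bs simp del: bil_ext_single)

text \<open>A letter of \<open>Z\<close> that enters the second factor is killed by \<phi>, so it
  must remain in the first factor; letters of \<open>Z\<close> at the front of the word therefore
  come out unchanged on the left.\<close>

lemma EE_kills_prepend:
  assumes "kills \<phi> Z" "u \<in> W" "set u \<subseteq> Z" "v \<in> W"
  shows "EE \<phi> (dw (u @ v)) = wl u \<star> EE \<phi> (dw v)"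
  using assms(2,3)
proof (induction u)
  case (Cons y u)
  then have y: "y \<in> letters D" "u @ v \<in> W" "u \<in> W" using assms by auto
  have "EE (\<lambda>b. \<phi> (wl [y] \<star> b)) (dw (u @ v)) = 0"
    using y Cons.prems by (intro dw_EE_zero kills_Lmul_zero[OF assms(1)]) auto
  then have "EE \<phi> (dw (y # u @ v)) = wl [y] \<star> (wl u \<star> EE \<phi> (dw v))"
    using EE_Cons[OF y(1,2)] Cons y by simp
  also have "\<dots> = wl (y # u) \<star> EE \<phi> (dw v)"
    using y assms by (subst mul_assoc[symmetric]) (auto simp: dw_EE_CS)
  finally show ?case by simp
qed (use assms in \<open>simp add: dw_EE_CS\<close>)

lemma EE_kills_all:
  assumes "kills \<phi> Z" "v \<in> W" "set v \<subseteq> Z"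
  shows "EE \<phi> (dw v) = pm_scale (\<phi> (wl [])) (wl v)"
  using EE_kills_prepend[OF assms, of "[]"] assms by (simp add: mul_scale_right)

lemma EE_kills_append:
  assumes "kills \<phi> Z" "u \<in> W" "v \<in> W" "set v \<subseteq> Z"
  shows "EE \<phi> (dw (u @ v)) = EE \<phi> (dw u) \<star> wl v"
  using assms(1,2)
proof (induction u arbitrary: \<phi>)
  case Nil
  then show ?case using EE_kills_all[OF Nil(1) assms(3,4)] assms by (simp add: mul_scale_left)
next
  case (Cons y u)
  then have y: "y \<in> letters D" "u @ v \<in> W" "u \<in> W" using assms by auto
  have "EE \<phi> (dw (y # u @ v)) = wl [y] \<star> (EE \<phi> (dw u) \<star> wl v) + bs (lgrp D y) [] \<star> (EE (\<lambda>b. \<phi> (wl [y] \<star> b)) (dw u) \<star> wl v)"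
    unfolding EE_Cons[OF y(1,2)] using Cons.IH[OF Cons.prems(1) y(3)] Cons.IH[OF kills_Lmul[OF Cons.prems(1) y(1)] y(3)] by simp
  also have "\<dots> = EE \<phi> (dw (y # u)) \<star> wl v"
    unfolding EE_Cons[OF y(1,3)] using y assms by (simp add: mul_add_left mul_assoc dw_EE_CS del: bil_ext_single)
  finally show ?case by simp
qed

text \<open>The words in second tensor factors arise from \<open>w\<close> by deleting letters, so
  only the values of the functionals on subsequences matter.\<close>

lemma EE_subseq_cong:
  assumes "w \<in> W" "lfun \<phi>" "lfun \<psi>" "\<And>h v. h \<in> H \<Longrightarrow> subseq v w \<Longrightarrow> \<phi> (bs h v) = \<psi> (bs h v)"
  shows "EE \<phi> (dw w) = EE \<psi> (dw w)"
  using assms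
proof (induction w arbitrary: \<phi> \<psi>)
  case Nil
  then show ?case using Nil(3)[of eH "[]"] by simp
next
  case (Cons y w)
  then have y: "y \<in> letters D" "w \<in> W" by auto
  have 1: "EE \<phi> (dw w) = EE \<psi> (dw w)" using Cons.prems y by (intro Cons.IH) (auto simp: subseq_Cons')
  have 2: "EE (\<lambda>b. \<phi> (wl [y] \<star> b)) (dw w) = EE (\<lambda>b. \<psi> (wl [y] \<star> b)) (dw w)"
    using Cons.prems y by (intro Cons.IH lfun_Lmul) (auto simp del: bil_ext_single simp: Lmul_bs)
  show ?case using y by (simp only: EE_Cons 1 2)
qed

abbreviation cf :: "('g \<times> 'f) set \<Rightarrow> letter list \<Rightarrow> ('g, 'f, 'k) skew_elem \<Rightarrow> 'k" where
  "cf h w b \<equiv> Poly_Mapping.lookup b (h, w)"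

lemma cf_grp_kills: "kills (cf h []) UNIV"
  by (auto simp: kills_def lfun_lookup lookup_single when_def)

lemma CS_lfun_eq:
  assumes "a \<in> CS" "lfun f" "lfun g" "\<And>h w. h \<in> H \<Longrightarrow> w \<in> W \<Longrightarrow> f (bs h w) = g (bs h w)"
  shows "f a = g a"
proof (rule lfun_eq_on_keys[OF assms(2,3)])
  fix s assume "s \<in> Poly_Mapping.keys a"
  then have "fst s \<in> H" "snd s \<in> W" using assms(1) by (auto simp: CS_def)
  then show "f (Poly_Mapping.single s 1) = g (Poly_Mapping.single s 1)"
    using assms(4)[of "fst s" "snd s"] by simp
qed

lemma EE_dR:
  assumes "y \<in> letters D" "w \<in> W"
  shows "EE (cf eH [y]) (dw w) = bs (lgrp D y) [] \<star> dRw y w"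
  using assms(2)
proof (induction w)
  case Nil
  then show ?case by (simp add: lookup_single)
next
  case (Cons z w)
  then have z: "z \<in> letters D" "w \<in> W" by auto
  have wd: "dRw y w \<in> CS" if "w \<in> W" for w
    using that by (induction w) (auto intro!: CS_add CS_scale)
  have "EE (\<lambda>b. cf eH [y] (wl [z] \<star> b)) (dw w) = EE (\<lambda>b. (if z = y then 1 else 0) * cf eH [] b) (dw w)"
  proof (rule dw_EE_cong[OF z(2)])
    fix b assume b: "b \<in> CS"
    show "cf eH [y] (wl [z] \<star> b) = (if z = y then 1 else 0) * cf eH [] b"
    proof (rule CS_lfun_eq[OF b])
      show "lfun (\<lambda>b. cf eH [y] (wl [z] \<star> b))" by (intro lfun_comp[OF lfun_lookup] lin_mul_right)
      show "lfun (\<lambda>b. (if z = y then 1 else 0) * cf eH [] b)" by (intro lfun_mult lfun_lookup)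
    qed (use z in \<open>auto simp: lookup_single when_def\<close>)
  qed
  also have "\<dots> = (if z = y then wl w else 0)"
  proof (cases "z = y")
    case True
    then show ?thesis using EE_kills_all[OF cf_grp_kills, of w eH] z by (simp add: lookup_single)
  qed (simp add: EE_zero)
  finally have 1: "EE (\<lambda>b. cf eH [y] (wl [z] \<star> b)) (dw w) = (if z = y then wl w else 0)" .
  have 2: "wl [z] \<star> (bs (lgrp D y) [] \<star> dRw y w) = pm_scale (lchar D z (lgrp D y)) (bs (lgrp D y) [] \<star> (wl [z] \<star> dRw y w))"
    using z assms wd by (intro mul_left_comm_scale) auto
  show ?case unfolding EE_Cons[OF z] 1 using Cons z assms wd
    by (auto simp: 2 mul_add_right mul_scale_right)
qed

text \<open>The value of the character of y on the group part: this is the weight that arises when y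
  in the first factor is moved past the group elements left by the later letters. The functional
  \<open>lam\<close> reads off y whatever the group element in front of it.\<close>

definition eta where "eta y = fun_ext (\<lambda>(h, w). if w = [] then lchar D y h else 0)"
definition lam :: "letter \<Rightarrow> ('g, 'f, 'k) skew_elem \<Rightarrow> 'k" where
  "lam y = fun_ext (\<lambda>(h, w). if w = [y] then 1 else 0)"

lemma EE'_eta:
  assumes "y \<in> letters D" "w \<in> W"
  shows "EE' (\<lambda>b. eta y b) (dw w) = pm_scale (lchar D y (wgrp D w)) (wl w)"
proof -
  have "EE' (\<lambda>b. c * eta y b) (dw w) = pm_scale (c * lchar D y (wgrp D w)) (wl w)" for c
    using assms(2)
  proof (induction w arbitrary: c)
    case Nil
    then show ?case using assms by (simp add: eta_def)
  next
    case (Cons z w)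
    then have z: "z \<in> letters D" "w \<in> W" by auto
    have "EE' (\<lambda>b. c * eta y (wl [z] \<star> b)) (dw w) = 0"
    proof (rule dw_EE'_zero[OF z(2)])
      fix b assume b: "b \<in> CS"
      show "c * eta y (wl [z] \<star> b) = 0"
        by (rule CS_lfun_zero[OF b]) (auto simp: eta_def intro!: lfun_mult lfun_comp[OF lfun_fun_ext lin_mul_right])
    qed
    moreover have "EE' (\<lambda>b. c * eta y (bs (lgrp D z) [] \<star> b)) (dw w) = EE' (\<lambda>b. c * lchar D y (lgrp D z) * eta y b) (dw w)"
    proof (rule dw_EE'_cong[OF z(2)])
      fix b assume b: "b \<in> CS"
      show "c * eta y (bs (lgrp D z) [] \<star> b) = c * lchar D y (lgrp D z) * eta y b"
        by (rule CS_lfun_eq[OF b])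
          (use assms z in \<open>auto simp: eta_def lchar_mult intro!: lfun_mult lfun_fun_ext lfun_comp[OF lfun_fun_ext lin_mul_right]\<close>)
    qed
    ultimately show ?case unfolding EE'_Cons[OF z]
      using Cons.IH[of "c * lchar D y (lgrp D z)"] z assms
      by (simp add: lchar_mult mult.assoc)
  qed
  from this[of 1] show ?thesis by simp
qed

lemma EE'_dL:
  assumes "y \<in> letters D" "w \<in> W"
  shows "EE' (lam y) (dw w) = dLw y w"
  using assms(2)
proof (induction w)
  case Nil
  then show ?case by (simp add: lam_def)
next
  case (Cons z w)
  then have z: "z \<in> letters D" "w \<in> W" by auto
  have 1: "EE' (\<lambda>b. lam y (wl [z] \<star> b)) (dw w) = (if z = y then pm_scale (lchar D y (wgrp D w)) (wl w) else 0)"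
  proof -
    have "EE' (\<lambda>b. lam y (wl [z] \<star> b)) (dw w) = EE' (if z = y then (\<lambda>b. eta y b) else (\<lambda>_. 0)) (dw w)"
    proof (rule dw_EE'_cong[OF z(2)])
      fix b assume b: "b \<in> CS"
      show "lam y (wl [z] \<star> b) = (if z = y then (\<lambda>b. eta y b) else (\<lambda>_. 0)) b"
        by (rule CS_lfun_eq[OF b])
          (use z in \<open>auto simp: eta_def lam_def intro!: lfun_const0 lfun_fun_ext lfun_comp[OF lfun_fun_ext lin_mul_right]\<close>)
    qed
    then show ?thesis using EE'_eta[OF assms(1) z(2)] by (simp add: EE'_zero)
  qed
  have 2: "EE' (\<lambda>b. lam y (bs (lgrp D z) [] \<star> b)) (dw w) = EE' (lam y) (dw w)"
  proof (rule dw_EE'_cong[OF z(2)])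
    fix b assume b: "b \<in> CS"
    show "lam y (bs (lgrp D z) [] \<star> b) = lam y b"
      by (rule CS_lfun_eq[OF b])
        (use z in \<open>auto simp: lam_def intro!: lfun_fun_ext lfun_comp[OF lfun_fun_ext lin_mul_right]\<close>)
  qed
  show ?case unfolding EE'_Cons[OF z] 1 2 using Cons z by (simp add: add.commute)
qed

text \<open>In the coproduct of h w only the term h w \<otimes> h has a bare group element as second
  factor.\<close>

lemma EE_group_component:
  assumes "a \<in> CS" "h0 \<in> H"
  shows "EE (cf h0 []) (Del a) = restr (\<lambda>(h, w). h = h0) a"
proof (rule CS_lin_eq[OF assms(1)])
  show "lin (\<lambda>a. EE (cf h0 []) (Del a))" by (intro lin_comp[OF lin_EE] lin_Del)
  show "lin (restr (\<lambda>(h, w). h = h0) :: _ \<Rightarrow> ('g, 'f, 'k) skew_elem)" by (rule lin_restr)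
  fix h w assume h: "h \<in> H" "w \<in> W"
  show "EE (cf h0 []) (Del (bs h w)) = restr (\<lambda>(h, w). h = h0) (bs h w)"
    unfolding EE_delta EE_kills_all[OF kills_grp[OF cf_grp_kills h(1)] h(2) subset_UNIV]
    using h by (auto simp: lookup_single mul_scale_right)
qed

text \<open>The coproduct is graded by multisets of letters: every letter goes to exactly one of the
  two factors, and group elements carry no degree.\<close>

lemma EB_degree:
  assumes "w \<in> W" "lfun \<phi>" "lfun \<psi>"
    and "\<And>h v. h \<in> H \<Longrightarrow> v \<in> W \<Longrightarrow> mset v \<noteq> M \<Longrightarrow> \<phi> (bs h v) = 0"
    and "\<And>h v. h \<in> H \<Longrightarrow> v \<in> W \<Longrightarrow> mset v \<noteq> N \<Longrightarrow> \<psi> (bs h v) = 0"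
    and "mset w \<noteq> M + N"
  shows "\<phi> (EE \<psi> (dw w)) = 0"
  using assms
proof (induction w arbitrary: \<phi> \<psi> M N)
  case Nil
  have "\<phi> (wl []) = 0 \<or> \<psi> (wl []) = 0"
  proof (cases "M = {#}")
    case True
    then show ?thesis using Nil(4)[of eH "[]"] Nil(5) by auto
  next
    case False
    then show ?thesis using Nil(3)[of eH "[]"] by auto
  qed
  then show ?case
    using lfun_scale[OF Nil(1), of "\<psi> (wl [])" "wl []"] by (auto simp: lfun_zero[OF Nil(1)])
next
  case (Cons y w)
  then have y: "y \<in> letters D" "w \<in> W" by auto
  have a: "\<phi> (wl [y] \<star> EE \<psi> (dw w)) = 0"
  proof (cases "y \<in># M")
    case True
    show ?thesis
    proof (rule Cons.IH[of "\<lambda>b. \<phi> (wl [y] \<star> b)" \<psi> "M - {#y#}" N])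
      show "mset w \<noteq> M - {#y#} + N" using Cons.prems(5) True by auto
      show "\<phi> (wl [y] \<star> bs h v) = 0" if "h \<in> H" "v \<in> W" "mset v \<noteq> M - {#y#}" for h v
      proof -
        have "mset (y # v) \<noteq> M" using that(3) by auto
        then show ?thesis
          using that y Cons.prems(3)[of h "y # v"] by (simp add: Lmul_bs[OF Cons.prems(1)] del: bil_ext_single)
      qed
    qed (use Cons.prems y in \<open>auto simp: lfun_Lmul\<close>)
  next
    case False
    show ?thesis
    proof (rule CS_lfun_zero[of "EE \<psi> (dw w)" "\<lambda>b. \<phi> (wl [y] \<star> b)"])
      show "\<phi> (wl [y] \<star> bs h v) = 0" if "h \<in> H" "v \<in> W" for h v
      proof -
        have "mset (y # v) \<noteq> M" using False by auto
        then show ?thesis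
          using that y Cons.prems(3)[of h "y # v"] by (simp add: Lmul_bs[OF Cons.prems(1)] del: bil_ext_single)
      qed
    qed (use Cons.prems y in \<open>auto simp: lfun_Lmul dw_EE_CS\<close>)
  qed
  have b: "\<phi> (bs (lgrp D y) [] \<star> EE (\<lambda>b. \<psi> (wl [y] \<star> b)) (dw w)) = 0"
  proof (cases "y \<in># N")
    case True
    show ?thesis
    proof (rule Cons.IH[of "\<lambda>b. \<phi> (bs (lgrp D y) [] \<star> b)" "\<lambda>b. \<psi> (wl [y] \<star> b)" M "N - {#y#}"])
      show "mset w \<noteq> M + (N - {#y#})" using Cons.prems(5) True by auto
      show "\<psi> (wl [y] \<star> bs h v) = 0" if "h \<in> H" "v \<in> W" "mset v \<noteq> N - {#y#}" for h v
      proof -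
        have "mset (y # v) \<noteq> N" using that(3) by auto
        then show ?thesis
          using that y Cons.prems(4)[of h "y # v"] by (simp add: Lmul_bs[OF Cons.prems(2)] del: bil_ext_single)
      qed
      show "\<phi> (bs (lgrp D y) [] \<star> bs h v) = 0" if "h \<in> H" "v \<in> W" "mset v \<noteq> M" for h v
        using that y Cons.prems(3) by simp
    qed (use Cons.prems y in \<open>auto simp: lfun_Lmul\<close>)
  next
    case False
    have "EE (\<lambda>b. \<psi> (wl [y] \<star> b)) (dw w) = 0"
    proof (rule dw_EE_zero[OF y(2)])
      fix b assume b: "b \<in> CS"
      show "\<psi> (wl [y] \<star> b) = 0"
      proof (rule CS_lfun_zero[OF b lfun_Lmul[OF Cons.prems(2)]])
        show "\<psi> (wl [y] \<star> bs h v) = 0" if "h \<in> H" "v \<in> W" for h v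
        proof -
          have "mset (y # v) \<noteq> N" using False by auto
          then show ?thesis
            using that y Cons.prems(4)[of h "y # v"] by (simp add: Lmul_bs[OF Cons.prems(2)] del: bil_ext_single)
        qed
      qed
    qed
    then show ?thesis by (simp add: lfun_zero[OF Cons.prems(1)])
  qed
  show ?case unfolding EE_Cons[OF y] lfun_add[OF Cons.prems(1)] a b by simp
qed

end

section \<open>Maps that are bilinear modulo a subspace\<close>

text \<open>Formal pairs and triples are not linear in their entries; they become so modulo the
  bilinearity relations. This notion allows linear arguments on representatives, with the relations
  as \<open>T\<close>.\<close>

definition modlin :: "('s \<Rightarrow>\<^sub>0 'k::field) set \<Rightarrow> ('t \<Rightarrow>\<^sub>0 'k) set \<Rightarrow> (('s \<Rightarrow>\<^sub>0 'k) \<Rightarrow> ('t \<Rightarrow>\<^sub>0 'k)) \<Rightarrow> bool" where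
  "modlin V T f \<longleftrightarrow> (\<forall>x\<in>V. \<forall>y\<in>V. f (x + y) - f x - f y \<in> T) \<and> (\<forall>c. \<forall>x\<in>V. f (pm_scale c x) - pm_scale c (f x) \<in> T)"

lemma modlin_zero:
  assumes "modlin V T f" "pm.subspace V" shows "f 0 \<in> T"
proof -
  have "f (pm_scale 0 0) - pm_scale 0 (f 0) \<in> T"
    using assms(1) pm.subspace_0[OF assms(2)] unfolding modlin_def by blast
  then show ?thesis by simp
qed

lemma modlin_sum:
  assumes f: "modlin V T f" and T: "pm.subspace T" and V: "pm.subspace V"
    and "\<And>i. i \<in> F \<Longrightarrow> x i \<in> V"
  shows "f (\<Sum>i\<in>F. pm_scale (c i) (x i)) - (\<Sum>i\<in>F. pm_scale (c i) (f (x i))) \<in> T"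
  using assms(4)
proof (induction F rule: infinite_finite_induct)
  case (insert i F)
  let ?a = "pm_scale (c i) (x i)" and ?s = "\<Sum>i\<in>F. pm_scale (c i) (x i)"
  have a: "?a \<in> V" and s: "?s \<in> V"
    using insert.prems by (auto intro!: pm.subspace_scale[OF V] pm.subspace_sum[OF V])
  have 1: "f (?a + ?s) - f ?a - f ?s \<in> T" using f a s unfolding modlin_def by blast
  have 2: "f ?a - pm_scale (c i) (f (x i)) \<in> T" using f insert.prems unfolding modlin_def by blast
  have 3: "f ?s - (\<Sum>i\<in>F. pm_scale (c i) (f (x i))) \<in> T" using insert by auto
  have "(f (?a + ?s) - f ?a - f ?s) + (f ?a - pm_scale (c i) (f (x i))) + (f ?s - (\<Sum>i\<in>F. pm_scale (c i) (f (x i)))) \<in> T"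
    using 1 2 3 T by (intro pm.subspace_add) auto
  then show ?case using insert.hyps by (simp add: algebra_simps)
qed (use modlin_zero[OF f V] in auto)

definition bimod where
  "bimod V W T g \<longleftrightarrow> (\<forall>y\<in>W. modlin V T (\<lambda>x. g x y)) \<and> (\<forall>x\<in>V. modlin W T (g x))"

text \<open>The second entries of \<open>t\<close> are expanded over \<open>F\<close> modulo
  \<open>I\<close> and terms with the same e are collected, so that the first entries become
  contractions of \<open>t\<close>. Membership of a tensor is thereby reduced to membership of
  contractions.\<close>

lemma bimod_contract:
  fixes g :: "('s \<Rightarrow>\<^sub>0 'k::field) \<Rightarrow> ('s \<Rightarrow>\<^sub>0 'k) \<Rightarrow> ('t \<Rightarrow>\<^sub>0 'k)"
  assumes g: "bimod V V T g" and T: "pm.subspace T" and V: "pm.subspace V"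
    and I: "I \<subseteq> V" "\<And>x y. x \<in> V \<Longrightarrow> y \<in> I \<Longrightarrow> g x y \<in> T"
    and E: "\<And>e. e \<in> F \<Longrightarrow> e \<in> V"
    and t: "Poly_Mapping.keys t \<subseteq> V \<times> V"
    and y: "\<And>x y. (x, y) \<in> Poly_Mapping.keys t \<Longrightarrow> y - (\<Sum>e\<in>F. pm_scale (\<phi> e y) e) \<in> I"
  shows "lin_ext (\<lambda>(x, y). g x y) t - (\<Sum>e\<in>F. g (EE (\<phi> e) t) e) \<in> T"
proof -
  let ?R = "\<lambda>t. lin_ext (\<lambda>(x, y). \<Sum>e\<in>F. pm_scale (\<phi> e y) (g x e)) t"
  have 1: "lin_ext (\<lambda>(x, y). g x y) t - ?R t \<in> T"
  proof (rule lin_mem_on_keys[OF lin_minus[OF lin_lin_ext lin_lin_ext] T])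
    fix s assume s: "s \<in> Poly_Mapping.keys t"
    obtain a b where ab: "s = (a, b)" by (cases s)
    have V': "a \<in> V" "b \<in> V" using s ab t by auto
    let ?S = "\<Sum>e\<in>F. pm_scale (\<phi> e b) e"
    have SV: "?S \<in> V" using E by (intro pm.subspace_sum pm.subspace_scale V) auto
    have m: "modlin V T (g a)" using g V' by (auto simp: bimod_def)
    have bI: "b - ?S \<in> I" using y s ab by auto
    have "g a ((b - ?S) + ?S) - g a (b - ?S) - g a ?S \<in> T"
      using m bI I(1) SV unfolding modlin_def by blast
    moreover have "g a (b - ?S) \<in> T" using I(2) V' bI by blast
    moreover have "g a ?S - (\<Sum>e\<in>F. pm_scale (\<phi> e b) (g a e)) \<in> T"
      by (rule modlin_sum[OF m T V]) (rule E)
    ultimately have "(g a ((b - ?S) + ?S) - g a (b - ?S) - g a ?S) + g a (b - ?S) + (g a ?S - (\<Sum>e\<in>F. pm_scale (\<phi> e b) (g a e))) \<in> T"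
      using T by (intro pm.subspace_add) auto
    then show "lin_ext (\<lambda>(x, y). g x y) (Poly_Mapping.single s 1) - ?R (Poly_Mapping.single s 1) \<in> T"
      by (simp add: ab)
  qed
  have 2: "(\<Sum>e\<in>F. g (EE (\<phi> e) t) e) - ?R t \<in> T"
  proof -
    have "g (EE (\<phi> e) t) e - (\<Sum>s\<in>Poly_Mapping.keys t. pm_scale (Poly_Mapping.lookup t s * \<phi> e (snd s)) (g (fst s) e)) \<in> T"
      if "e \<in> F" for e
    proof -
      have m: "modlin V T (\<lambda>x. g x e)" using g E[OF that] by (auto simp: bimod_def)
      have "EE (\<phi> e) t = (\<Sum>s\<in>Poly_Mapping.keys t. pm_scale (Poly_Mapping.lookup t s * \<phi> e (snd s)) (fst s))"
        by (simp add: EE_def lin_ext_def case_prod_beta)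
      moreover have "fst s \<in> V" if "s \<in> Poly_Mapping.keys t" for s
        using that t by auto
      ultimately show ?thesis
        using modlin_sum[OF m T V, of "Poly_Mapping.keys t" fst "\<lambda>s. Poly_Mapping.lookup t s * \<phi> e (snd s)"]
        by simp
    qed
    then have "(\<Sum>e\<in>F. g (EE (\<phi> e) t) e - (\<Sum>s\<in>Poly_Mapping.keys t. pm_scale (Poly_Mapping.lookup t s * \<phi> e (snd s)) (g (fst s) e))) \<in> T"
      by (intro pm.subspace_sum T)
    moreover have "(\<Sum>e\<in>F. \<Sum>s\<in>Poly_Mapping.keys t. pm_scale (Poly_Mapping.lookup t s * \<phi> e (snd s)) (g (fst s) e)) = ?R t"
      by (subst sum.swap) (simp add: lin_ext_def case_prod_beta pm.scale_sum_right)
    ultimately show ?thesis by (simp add: sum_subtractf)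
  qed
  have "(lin_ext (\<lambda>(x, y). g x y) t - ?R t) - ((\<Sum>e\<in>F. g (EE (\<phi> e) t) e) - ?R t) \<in> T"
    by (rule pm.subspace_diff[OF T 1 2])
  then show ?thesis by simp
qed

lemma lin_extend:
  fixes B :: "('s \<Rightarrow>\<^sub>0 'k::field) set" and f :: "('s \<Rightarrow>\<^sub>0 'k) \<Rightarrow> ('t \<Rightarrow>\<^sub>0 'k)"
  assumes "pm.independent B"
  shows "\<exists>g. lin g \<and> (\<forall>x\<in>B. g x = f x)"
proof -
  interpret P: vector_space_pair "pm_scale :: 'k \<Rightarrow> ('s \<Rightarrow>\<^sub>0 'k) \<Rightarrow> _" "pm_scale :: 'k \<Rightarrow> ('t \<Rightarrow>\<^sub>0 'k) \<Rightarrow> _" ..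
  from P.linear_independent_extend[OF assms, of f]
  obtain g where g: "Vector_Spaces.linear pm_scale pm_scale g" "\<forall>x\<in>B. g x = f x" by blast
  from g(1) have "lin g"
    unfolding Vector_Spaces.linear_def module_hom_def module_hom_axioms_def lin_def by blast
  with g(2) show ?thesis by blast
qed

text \<open>A basis of \<open>J\<close> is extended to a basis of \<open>B\<close>; the map kills
  the former and fixes the added vectors.\<close>

lemma complement_projection:
  fixes J B :: "('s \<Rightarrow>\<^sub>0 'k::field) set"
  assumes "pm.subspace J" "pm.subspace B" "J \<subseteq> B"
  obtains p where "lin p" "\<And>x. x \<in> J \<Longrightarrow> p x = 0" "\<And>x. x \<in> B \<Longrightarrow> p x \<in> B \<and> x - p x \<in> J"
proof -
  obtain BJ where BJ: "BJ \<subseteq> J" "pm.independent BJ" "J \<subseteq> pm.span BJ"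
    using pm.maximal_independent_subset[of J] by blast
  obtain BB where BB: "BJ \<subseteq> BB" "BB \<subseteq> B" "pm.independent BB" "B \<subseteq> pm.span BB"
    using pm.maximal_independent_subset_extend[of BJ B] BJ assms(3) by blast
  obtain p where p: "lin p" "\<And>x. x \<in> BB \<Longrightarrow> p x = (if x \<in> BJ then 0 else x)"
    using lin_extend[OF BB(3), of "\<lambda>x. if x \<in> BJ then 0 else x"] by blast
  show thesis
  proof (rule that[OF p(1)])
    show "p x = 0" if "x \<in> J" for x
    proof -
      have "p b \<in> {0}" if "b \<in> BJ" for b using that BB(1) p(2) by auto
      moreover have "x \<in> pm.span BJ" using that BJ(3) by blast
      ultimately show ?thesis using span_lin_mem[OF p(1) pm.subspace_single_0, of BJ x] by blast
    qed
    show "p x \<in> B \<and> x - p x \<in> J" if "x \<in> B" for x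
    proof
      have x: "x \<in> pm.span BB" using that BB(4) by blast
      show "p x \<in> B"
        by (rule span_lin_mem[OF p(1) assms(2) _ x]) (use BB(2) p(2) pm.subspace_0[OF assms(2)] in auto)
      show "x - p x \<in> J"
        by (rule span_lin_mem[OF lin_minus[OF lin_id p(1)] assms(1) _ x])
          (use BJ(1) p(2) pm.subspace_0[OF assms(1)] in auto)
    qed
  qed
qed

section \<open>The biggest Hopf ideals\<close>

context qd
begin

section \<open>Tensors and the coideal condition in terms of functionals\<close>

abbreviation TT where "TT \<equiv> tens_rel (skew D)"

lemma tens_rel_skew_mod: "tens_rel (skew_mod D) = TT"
  by (simp add: tens_rel_def)

lemma tens_class_skew_mod: "tens_class (skew_mod D) = tens_class (skew D)"
  by (simp add: tens_class_def tens_rel_skew_mod fun_eq_iff)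

lemma TT_subspace: "pm.subspace TT"
  unfolding tens_rel_def by (rule pm.subspace_span)

abbreviation tp where "tp x y \<equiv> Poly_Mapping.single (x, y) (1::'k)"

lemma TT_bimod: "bimod CS CS TT (\<lambda>x y. tp x y)"
  unfolding bimod_def modlin_def
proof (intro conjI ballI allI)
  fix x y z :: "('g, 'f, 'k) skew_elem" and c :: 'k
  assume x: "x \<in> CS" and y: "y \<in> CS"
  show "tp (x + z) y - tp x y - tp z y \<in> TT" if z: "z \<in> CS" 
    unfolding tens_rel_def using x y z by (intro pm.span_base UnI1 CollectI exI[of _ x] exI[of _ z] exI[of _ y]) simp
  show "tp y (x + z) - tp y x - tp y z \<in> TT" if z: "z \<in> CS"
    unfolding tens_rel_def using x y z
    by (intro pm.span_base UnI1[OF UnI1[OF UnI2]] CollectI exI[of _ x] exI[of _ z] exI[of _ y]) simp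
  show "tp (pm_scale c x) y - pm_scale c (tp x y) \<in> TT"
    unfolding tens_rel_def using x y
    by (intro pm.span_base UnI1[OF UnI2] CollectI exI[of _ x] exI[of _ c] exI[of _ y]) simp
  show "tp y (pm_scale c x) - pm_scale c (tp y x) \<in> TT"
    unfolding tens_rel_def using x y
    by (intro pm.span_base UnI2 CollectI exI[of _ x] exI[of _ c] exI[of _ y]) simp
qed

lemma TT_EE: assumes "z \<in> TT" "lfun \<phi>" shows "EE \<phi> z = 0" "EE' \<phi> z = 0"
proof -
  note l = lfun_add[OF assms(2)] lfun_scale[OF assms(2)]
  have "EE \<phi> z \<in> {0}"
    by (rule span_lin_mem[OF lin_EE pm.subspace_single_0 _ assms(1)[unfolded tens_rel_def]],
        elim UnE CollectE exE conjE)
      (simp_all add: lin_diff[OF lin_EE] l pm.scale_left_distrib pm.scale_right_distrib mult_ac)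
  then show "EE \<phi> z = 0" by simp
  have "EE' \<phi> z \<in> {0}"
    by (rule span_lin_mem[OF lin_EE' pm.subspace_single_0 _ assms(1)[unfolded tens_rel_def]],
        elim UnE CollectE exE conjE)
      (simp_all add: lin_diff[OF lin_EE'] l pm.scale_left_distrib pm.scale_right_distrib mult_ac)
  then show "EE' \<phi> z = 0" by simp
qed

lemma tens_class_mem: "p \<in> tens_class Q p"
  unfolding tens_class_def tens_rel_def by (rule image_eqI[where x = 0]) (simp_all only: pm.span_zero add_0_right)

lemma tens_class_eqD: "p \<in> tens_class Q r \<Longrightarrow> p - r \<in> tens_rel Q"
  unfolding tens_class_def by (elim imageE) simp

lemma tens_class_eqI: "p - r \<in> tens_rel Q \<Longrightarrow> tens_class Q p = tens_class Q r"
proof -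
  assume a: "p - r \<in> tens_rel Q"
  have s: "pm.subspace (tens_rel Q)" unfolding tens_rel_def by (rule pm.subspace_span)
  show ?thesis unfolding tens_class_def
  proof (intro equalityI subsetI; elim imageE)
    fix x z assume "x = p + z" "z \<in> tens_rel Q"
    then have "x = r + ((p - r) + z)" "(p - r) + z \<in> tens_rel Q" using a pm.subspace_add[OF s] by auto
    then show "x \<in> (+) r ` tens_rel Q" by blast
  next
    fix x z assume "x = r + z" "z \<in> tens_rel Q"
    then have "x = p + (z - (p - r))" "z - (p - r) \<in> tens_rel Q" using a pm.subspace_diff[OF s] by auto
    then show "x \<in> (+) p ` tens_rel Q" by blast
  qed
qed

text \<open>Expansion of the second entries over the finitely many basis elements occurring in them
  leaves first entries that are coordinate contractions, and these are assumed to be zero.\<close>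

lemma TT_zeroI:
  assumes k: "Poly_Mapping.keys u \<subseteq> CS \<times> CS" and z: "\<And>s s'. Poly_Mapping.lookup (EE (\<lambda>b. Poly_Mapping.lookup b s') u) s = 0"
  shows "u \<in> TT"
proof -
  let ?S = "\<Union>(Poly_Mapping.keys ` snd ` Poly_Mapping.keys u)"
  let ?F = "(\<lambda>s. Poly_Mapping.single s 1) ` ?S :: ('g, 'f, 'k) skew_elem set"
  have inj: "inj_on (\<lambda>s. Poly_Mapping.single s (1::'k)) ?S"
    by (rule inj_onI) (metis lookup_single_eq lookup_single_not_eq zero_neq_one)
  define \<phi> where "\<phi> e b = Poly_Mapping.lookup b (the_elem (Poly_Mapping.keys e))" for e b :: "('g, 'f, 'k) skew_elem"
  have \<phi>: "\<phi> (Poly_Mapping.single s 1) = (\<lambda>b. Poly_Mapping.lookup b s)" for s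
    by (simp add: \<phi>_def fun_eq_iff)
  have f1: "lin_ext (\<lambda>(x, y). tp x y) u - (\<Sum>e\<in>?F. tp (EE (\<phi> e) u) e) \<in> TT"
  proof (rule bimod_contract[OF TT_bimod TT_subspace CS_subspace, of "{0}"])
    show "tp x y \<in> TT" if "x \<in> CS" "y \<in> {0}" for x y
    proof -
      have "tp x (pm_scale 0 0) - pm_scale 0 (tp x 0) \<in> TT"
        using TT_bimod that CS_zero unfolding bimod_def modlin_def by blast
      then show ?thesis using that by simp
    qed
    show "e \<in> CS" if "e \<in> ?F" for e
      using that k by (auto simp: CS_def) blast+
    show "Poly_Mapping.keys u \<subseteq> CS \<times> CS" by (rule k)
    show "y - (\<Sum>e\<in>?F. pm_scale (\<phi> e y) e) \<in> {0}" if "(x, y) \<in> Poly_Mapping.keys u" for x y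
    proof -
      have sub: "Poly_Mapping.keys y \<subseteq> ?S" using that by force
      have fin: "finite ?S" by simp
      have "(\<Sum>e\<in>?F. pm_scale (\<phi> e y) e) = (\<Sum>s\<in>?S. pm_scale (Poly_Mapping.lookup y s) (Poly_Mapping.single s 1))"
        by (subst sum.reindex[OF inj]) (simp add: \<phi>)
      also have "\<dots> = lin_ext (\<lambda>s. Poly_Mapping.single s 1) y"
        by (rule lin_ext_superset[OF fin sub, symmetric])
      finally show ?thesis by (simp add: lin_ext_single_id)
    qed
  qed simp
  have "tp (EE (\<phi> e) u) e \<in> TT" if "e \<in> ?F" for e
  proof -
    obtain s where s: "e = Poly_Mapping.single s 1" "s \<in> ?S"
      by (rule imageE[OF \<open>e \<in> ?F\<close>])
    have "EE (\<phi> e) u = 0" by (rule poly_mapping_eqI) (simp add: s(1) \<phi> z)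
    moreover have "e \<in> CS" using s k by (auto simp: CS_def) blast+
    then have "tp 0 e \<in> TT" using modlin_zero[of CS TT "\<lambda>x. tp x e"] TT_bimod CS_subspace by (auto simp: bimod_def)
    ultimately show ?thesis by simp
  qed
  then have f2: "(\<Sum>e\<in>?F. tp (EE (\<phi> e) u) e) \<in> TT" by (rule pm.subspace_sum[OF TT_subspace])
  have f3: "lin_ext (\<lambda>(x, y). tp x y) u = u"
  proof -
    have "(\<lambda>(x, y). tp x y) = (\<lambda>s :: ('g, 'f, 'k) skew_elem \<times> ('g, 'f, 'k) skew_elem. Poly_Mapping.single s 1)"
      by (rule ext) (simp add: split_def)
    then show ?thesis by (simp only: lin_ext_single_id)
  qed
  from pm.subspace_add[OF TT_subspace f1 f2] show ?thesis unfolding f3 by simp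
qed

text \<open>The coideal condition in dual form: J \<otimes> B + B \<otimes> J is the common kernel
  of the products \<phi> \<otimes> \<psi> of functionals vanishing on J. This form passes easily to
  spans and can be split by multidegree.\<close>

definition coid where
  "coid J \<longleftrightarrow> (\<forall>a\<in>J. \<forall>\<phi> \<psi>. lfun \<phi> \<longrightarrow> lfun \<psi> \<longrightarrow> (\<forall>x\<in>J. \<phi> x = 0) \<longrightarrow> (\<forall>x\<in>J. \<psi> x = 0) \<longrightarrow> \<phi> (EE \<psi> (Del a)) = 0)"

lemma comult_skew: "comult (skew D) a = tens_class (skew D) (Del a)"
  by (simp add: tens_class_skew_mod Del_def)

text \<open>With the projection w along J one has x \<otimes> y = (x - w x) \<otimes> y + w x
  \<otimes> (y - w y) + w x \<otimes> w y. The coordinates of the last part are given by functionals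
  that factor through w, hence vanish on J, so that part of the coproduct is zero.\<close>

lemma coidI:
  assumes J: "pm.subspace J" "J \<subseteq> B" and B: "pm.subspace B" "B \<subseteq> CS"
    and k: "Poly_Mapping.keys (Del a) \<subseteq> B \<times> B"
    and c: "\<And>\<phi> \<psi>. lfun \<phi> \<Longrightarrow> lfun \<psi> \<Longrightarrow> (\<forall>x\<in>J. \<phi> x = 0) \<Longrightarrow> (\<forall>x\<in>J. \<psi> x = 0) \<Longrightarrow> \<phi> (EE \<psi> (Del a)) = 0"
  shows "comult (skew D) a \<in> {tens_class (skew D) (p + r) | p r.
        Poly_Mapping.keys p \<subseteq> J \<times> B \<and> Poly_Mapping.keys r \<subseteq> B \<times> J}"
proof -
  obtain w where w: "lin w" "\<And>x. x \<in> J \<Longrightarrow> w x = 0" "\<And>x. x \<in> B \<Longrightarrow> w x \<in> B \<and> x - w x \<in> J"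
    using complement_projection[OF J(1) B(1) J(2)] by blast
  let ?P = "lin_ext (\<lambda>(x, y). tp (x - w x) y)" and ?R = "lin_ext (\<lambda>(x, y). tp (w x) (y - w y))"
    and ?Z = "lin_ext (\<lambda>(x, y). tp (w x) (w y))"
  let ?t = "Del a"
  have keysI: "Poly_Mapping.keys (lin_ext f ?t) \<subseteq> X" if "\<And>x y. (x, y) \<in> B \<times> B \<Longrightarrow> Poly_Mapping.keys (f (x, y)) \<subseteq> X"
    for f :: "_ \<Rightarrow> (('g, 'f, 'k) skew_elem \<times> ('g, 'f, 'k) skew_elem \<Rightarrow>\<^sub>0 'k)" and X
    using lin_ext_mem[OF subspace_keys, of ?t f X] that k by (auto simp: subset_iff) 
  have 1: "?t - (?P ?t + ?R ?t + ?Z ?t) \<in> TT"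
  proof (rule lin_mem_on_keys[of "\<lambda>t. t - (?P t + ?R t + ?Z t)", OF _ TT_subspace])
    show "lin (\<lambda>t. t - (?P t + ?R t + ?Z t))" by (intro lin_minus lin_id lin_plus lin_lin_ext)
    fix s assume "s \<in> Poly_Mapping.keys ?t"
    then obtain x y where s: "s = (x, y)" "x \<in> B" "y \<in> B" using k by auto
    have c: "x - w x \<in> CS" "w x \<in> CS" "y - w y \<in> CS" "w y \<in> CS" "y \<in> CS"
      using w(3) s B J(2) by blast+
    have "tp ((x - w x) + w x) y - tp (x - w x) y - tp (w x) y \<in> TT"
      using TT_bimod c unfolding bimod_def modlin_def by blast
    moreover have "tp (w x) ((y - w y) + w y) - tp (w x) (y - w y) - tp (w x) (w y) \<in> TT"
      using TT_bimod c unfolding bimod_def modlin_def by blast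
    ultimately have "(tp ((x - w x) + w x) y - tp (x - w x) y - tp (w x) y)
       + (tp (w x) ((y - w y) + w y) - tp (w x) (y - w y) - tp (w x) (w y)) \<in> TT"
      by (rule pm.subspace_add[OF TT_subspace])
    then show "Poly_Mapping.single s 1 - (?P (Poly_Mapping.single s 1) + ?R (Poly_Mapping.single s 1) + ?Z (Poly_Mapping.single s 1)) \<in> TT"
      by (simp add: s(1) algebra_simps)
  qed
  have 2: "?Z ?t \<in> TT"
  proof (rule TT_zeroI)
    show "Poly_Mapping.keys (?Z ?t) \<subseteq> CS \<times> CS" using w(3) B by (intro keysI) auto
    fix s s'
    have "EE (\<lambda>b. Poly_Mapping.lookup b s') (?Z ?t) = w (EE (\<lambda>b. Poly_Mapping.lookup (w b) s') ?t)"
      unfolding lin_comp_lin_ext[OF lin_EE]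
      by (subst EE_def, subst lin_comp_lin_ext[OF w(1)])
        (rule lin_ext_cong, auto simp: lin_scale[OF w(1)])
    then show "Poly_Mapping.lookup (EE (\<lambda>b. Poly_Mapping.lookup b s') (?Z ?t)) s = 0"
      using c[OF lfun_comp[OF lfun_lookup w(1)] lfun_comp[OF lfun_lookup w(1)]] w(2) by simp
  qed
  have "?t - (?P ?t + ?R ?t) \<in> TT"
    using pm.subspace_add[OF TT_subspace 1 2] by (simp add: algebra_simps)
  then have "comult (skew D) a = tens_class (skew D) (?P ?t + ?R ?t)"
    unfolding comult_skew by (rule tens_class_eqI)
  moreover have "Poly_Mapping.keys (?P ?t) \<subseteq> J \<times> B" using w(3) by (intro keysI) auto
  moreover have "Poly_Mapping.keys (?R ?t) \<subseteq> B \<times> J" using w(3) by (intro keysI) auto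
  ultimately show ?thesis by blast
qed

text \<open>A functional vanishing on J annihilates one of the summands of J \<otimes> B + B
  \<otimes> J and sends the other one into J.\<close>

lemma coidD:
  assumes J: "pm.subspace J"
    and c: "comult (skew D) a \<in> {tens_class (skew D) (p + r) | p r.
        Poly_Mapping.keys p \<subseteq> J \<times> B \<and> Poly_Mapping.keys r \<subseteq> B \<times> J}"
    and \<psi>: "lfun \<psi>" "\<And>x. x \<in> J \<Longrightarrow> \<psi> x = 0"
  shows "EE \<psi> (Del a) \<in> J" "EE' \<psi> (Del a) \<in> J"
proof -
  from c obtain p r where pr: "tens_class (skew D) (Del a) = tens_class (skew D) (p + r)"
    "Poly_Mapping.keys p \<subseteq> J \<times> B" "Poly_Mapping.keys r \<subseteq> B \<times> J"
    unfolding comult_skew by auto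
  have "Del a - (p + r) \<in> TT"
    using tens_class_mem[of "Del a" "skew D"] unfolding pr(1) by (rule tens_class_eqD)
  from TT_EE[OF this \<psi>(1)] have "EE \<psi> (Del a) = EE \<psi> p + EE \<psi> r" "EE' \<psi> (Del a) = EE' \<psi> p + EE' \<psi> r"
    by (simp_all add: lin_diff[OF lin_EE] lin_diff[OF lin_EE'] lin_add[OF lin_EE] lin_add[OF lin_EE'])
  moreover have "EE \<psi> p \<in> J" "EE' \<psi> r \<in> J"
    unfolding EE_def EE'_def using pr(2,3) by (auto intro!: lin_ext_mem J pm.subspace_scale[OF J])
  moreover have "EE \<psi> r = 0" "EE' \<psi> p = 0"
    using EE_cong[of r \<psi> "\<lambda>_. 0"] EE'_cong[of p \<psi> "\<lambda>_. 0"] pr(2,3) \<psi>(2) by (auto simp: EE_zero EE'_zero)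
  ultimately show "EE \<psi> (Del a) \<in> J" "EE' \<psi> (Del a) \<in> J" by auto
qed

end

context qd
begin

section \<open>Multidegrees, the antipode and the coproduct\<close>

lemma mgr_kset: "a \<in> kset X \<Longrightarrow> mgr M a \<in> kset X"
  unfolding kset_def by (auto simp: keys_mgr)

lemma mgr_kset_hom: "a \<in> kset {(h, w). mset w = N} \<Longrightarrow> mgr M a = (if M = N then a else 0)"
  unfolding mgr_def kset_def by (auto intro!: restr_id restr_none)

lemma mgr_mgr: "mgr M (mgr N a) = (if M = N then mgr N a else 0)"
  by (rule mgr_kset_hom) (auto simp: kset_def keys_mgr)

lemma anti_word_kset: "anti_word D w \<in> kset {(h, v). mset v = mset w}"
proof (induction w)
  case (Cons y w)
  have "grp (inv\<^bsub>HH D\<^esub> (lgrp D y)) \<star> lett D y \<in> kset {(h, v). mset v = {#y#}}"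
    unfolding grp_eq lett_eq by simp
  then have "- (grp (inv\<^bsub>HH D\<^esub> (lgrp D y)) \<star> lett D y) \<in> kset {(h, v). mset v = {#y#}}"
    by (rule pm.subspace_neg[OF kset_subspace])
  then show ?case
    by (simp only: anti_word.simps skew_simps) (rule kset_mul[OF Cons.IH], auto)
qed simp

lemma SA_mgr: assumes "a \<in> CS" shows "lin_ext (anti_basis D) (mgr M a) = mgr M (lin_ext (anti_basis D) a)"
proof (rule CS_lin_eq[OF assms])
  show "lin (\<lambda>a. lin_ext (anti_basis D) (mgr M a))" by (intro lin_comp[OF lin_lin_ext] mgr_lin)
  show "lin (\<lambda>a. mgr M (lin_ext (anti_basis D) a))" by (intro lin_comp[OF mgr_lin] lin_lin_ext)
  fix h w
  have "anti_basis D (h, w) \<in> kset {(h, v). mset v = mset w}"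
    unfolding anti_basis_def grp_eq
    by (simp only: prod.case skew_simps) (rule kset_mul[OF anti_word_kset, of _ "{(inv\<^bsub>HH D\<^esub> h, [])}"], auto)
  then show "lin_ext (anti_basis D) (mgr M (bs h w)) = mgr M (lin_ext (anti_basis D) (bs h w))"
    by (auto simp: mgr_bs mgr_kset_hom)
qed

lemma mgr_mul_left:
  assumes "h \<in> H" "w \<in> W" "a \<in> CS"
  shows "bs h w \<star> mgr M a = mgr (mset w + M) (bs h w \<star> a)"
  by (rule CS_lin_eq[OF assms(3) lin_comp[OF lin_mul_right mgr_lin] lin_comp[OF mgr_lin lin_mul_right]])
    (auto simp: mgr_bs mgr_def)

lemma mgr_mul_right:
  assumes "h \<in> H" "w \<in> W" "a \<in> CS"
  shows "mgr M a \<star> bs h w = mgr (M + mset w) (a \<star> bs h w)"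
  by (rule CS_lin_eq[OF assms(3) lin_comp[OF lin_mul_left mgr_lin] lin_comp[OF mgr_lin lin_mul_left]])
    (auto simp: mgr_bs mgr_def)

lemma Del_degree:
  assumes a: "a \<in> kset {(h, w). h \<in> H \<and> w \<in> W \<and> mset w \<noteq> M + N}" and l: "lfun \<phi>" "lfun \<psi>"
    and M: "\<And>h v. h \<in> H \<Longrightarrow> v \<in> W \<Longrightarrow> mset v \<noteq> M \<Longrightarrow> \<phi> (bs h v) = 0"
    and N: "\<And>h v. h \<in> H \<Longrightarrow> v \<in> W \<Longrightarrow> mset v \<noteq> N \<Longrightarrow> \<psi> (bs h v) = 0"
  shows "\<phi> (EE \<psi> (Del a)) = 0"
proof (rule kset_lfun_zero[OF a])
  show "lfun (\<lambda>a. \<phi> (EE \<psi> (Del a)))" by (intro lfun_comp[OF l(1)] lin_comp[OF lin_EE] lin_Del)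
  fix h w assume "(h, w) \<in> {(h, w). h \<in> H \<and> w \<in> W \<and> mset w \<noteq> M + N}"
  then have h: "h \<in> H" "w \<in> W" "mset w \<noteq> M + N" by auto
  show "\<phi> (EE \<psi> (Del (bs h w))) = 0"
    unfolding EE_delta
    by (rule EB_degree[of w "\<lambda>b. \<phi> (bs h [] \<star> b)" "\<lambda>b. \<psi> (bs h [] \<star> b)" M N])
      (use h l M N in \<open>auto simp: lfun_Lmul\<close>)
qed

text \<open>On the finitely many second entries of \<open>t\<close>, and then on the resulting
  contraction, each functional is the sum of its restrictions to single multidegrees.\<close>

lemma EE_by_degree:
  assumes l: "lfun \<phi>" "lfun \<psi>"
    and z: "\<And>M N. \<phi> (mgr M (EE (\<lambda>b. \<psi> (mgr N b)) t)) = 0"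
  shows "\<phi> (EE \<psi> t) = 0"
proof -
  have dec: "\<exists>T. finite T \<and> (\<forall>T'. finite T' \<and> T \<subseteq> T' \<longrightarrow> (\<Sum>M\<in>T'. mgr M a) = a)" for a
  proof (intro exI conjI allI impI)
    let ?T = "(\<lambda>s. mset (snd s)) ` Poly_Mapping.keys a"
    show "finite ?T" by simp
    fix T' assume "finite T' \<and> ?T \<subseteq> T'"
    then have "(\<Sum>M\<in>T'. restr (\<lambda>s. mset (snd s) = M) a) = a"
      by (intro sum_restr_fibres) auto
    then show "(\<Sum>M\<in>T'. mgr M a) = a" by (simp add: mgr_def case_prod_beta')
  qed
  then obtain T where T: "\<And>a. finite (T a)" "\<And>a T'. finite T' \<Longrightarrow> T a \<subseteq> T' \<Longrightarrow> (\<Sum>M\<in>T'. mgr M a) = a"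
    by metis
  let ?T = "\<Union>(x, y)\<in>Poly_Mapping.keys t. T y"
  have fin: "finite ?T" using T(1) by auto
  have "EE \<psi> t = EE (\<lambda>b. \<Sum>N\<in>?T. \<psi> (mgr N b)) t"
  proof (rule EE_cong)
    fix x y assume "(x, y) \<in> Poly_Mapping.keys t"
    then have "T y \<subseteq> ?T" by auto
    from T(2)[OF fin this] show "\<psi> y = (\<Sum>N\<in>?T. \<psi> (mgr N y))"
      by (simp flip: lfun_sum[OF l(2)])
  qed
  also have "\<dots> = (\<Sum>N\<in>?T. EE (\<lambda>b. \<psi> (mgr N b)) t)"
    by (rule lin_eq_on_keys[OF lin_EE lin_sum_fun[OF lin_EE]]) (auto simp: pm.scale_sum_left)
  finally have 1: "EE \<psi> t = (\<Sum>N\<in>?T. EE (\<lambda>b. \<psi> (mgr N b)) t)" .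
  have "\<phi> (EE (\<lambda>b. \<psi> (mgr N b)) t) = 0" for N
  proof -
    let ?z = "EE (\<lambda>b. \<psi> (mgr N b)) t"
    have "(\<Sum>M\<in>T ?z. mgr M ?z) = ?z" using T by blast
    then have "\<phi> ?z = (\<Sum>M\<in>T ?z. \<phi> (mgr M ?z))" by (metis lfun_sum[OF l(1)])
    then show ?thesis by (simp add: z)
  qed
  then show ?thesis unfolding 1 by (simp add: lfun_sum[OF l(1)])
qed

section \<open>The biggest Hopf ideal of one Borel part\<close>

definition Lam where
  "Lam G L = (GREATEST J. hopf_ideal (skew D) (KX G (L ` idx D)) J \<and>
     J \<subseteq> Idl\<^bsub>(skew D)\<lparr>carrier := KX G (L ` idx D)\<rparr>\<^esub>
       {lett D (L i) \<otimes>\<^bsub>skew D\<^esub> lett D (L j) | i j. i \<in> idx D \<and> j \<in> idx D})"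

lemma GX_KX: "GX D = KX HGs (Pos ` idx D)" and FX_KX: "FX D = KX HFs (Neg ` idx D)"
  by (simp_all add: GX_def FX_def KX_def kset_def)

lemma Lambda_pos_Lam: "Lambda_pos D = Lam HGs Pos"
  and Lambda_neg_Lam: "Lambda_neg D = Lam HFs Neg"
  by (simp_all add: Lambda_pos_def Lambda_neg_def Lam_def GX_KX FX_KX)

context
  fixes G L
  assumes G: "subgroup G (HH D)" and gL: "\<And>i. i \<in> idx D \<Longrightarrow> lgrp D (L i) \<in> G" and L: "L = Pos \<or> L = Neg"
begin

abbreviation (input) B where "B \<equiv> KX G (L ` idx D)"
abbreviation (input) B2 where "B2 \<equiv> kset (G \<times> {w \<in> lists (L ` idx D). 2 \<le> length w})"
abbreviation (input) RB where "RB \<equiv> (skew D)\<lparr>carrier := B\<rparr>"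

lemma GH: "h \<in> G \<Longrightarrow> h \<in> H"
  using subgroup.subset[OF G] by auto

lemma B_subspace: "pm.subspace B" unfolding KX_def by (rule kset_subspace)

lemma B_CS: "B \<subseteq> CS"
  unfolding KX_def CS_kset using GH LW_W[OF L] by (intro kset_mono) auto

lemma B_bs: "h \<in> G \<Longrightarrow> w \<in> lists (L ` idx D) \<Longrightarrow> bs h w \<in> B"
  by (simp add: KX_def)

lemma RB_ring: "ring RB"
proof (rule SR.subring_is_ring[OF SR.subringI])
  show "\<ominus>\<^bsub>skew D\<^esub> h \<in> B" if "h \<in> B" for h
    using that B_CS pm.subspace_neg[OF B_subspace] by (auto simp: a_minus_skew subset_iff)
qed (use B_CS B_bs subgroup.one_closed[OF G] KX_mul[OF G] pm.subspace_add[OF B_subspace] in auto)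

definition idealB where
  "idealB J \<longleftrightarrow> pm.subspace J \<and> J \<subseteq> B \<and> (\<forall>a\<in>J. \<forall>x\<in>B. x \<star> a \<in> J \<and> a \<star> x \<in> J)"

lemma idealB_ideal: "idealB J \<longleftrightarrow> ideal J RB"
proof
  interpret R: ring RB by (rule RB_ring)
  assume J: "idealB J"
  have m: "\<ominus>\<^bsub>RB\<^esub> a = - a" if "a \<in> B" for a
    using R.minus_equality[of "- a" a] that pm.subspace_neg[OF B_subspace that] by simp
  have "subgroup J (add_monoid RB)"
  proof (rule R.add.subgroupI)
    show "\<ominus>\<^bsub>RB\<^esub> a \<in> J" if "a \<in> J" for a
      using that J m pm.subspace_neg by (auto simp: idealB_def subset_iff)
  qed (use J in \<open>auto simp: idealB_def pm.subspace_add dest: pm.subspace_0\<close>)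
  then show "ideal J RB"
    by (rule idealI[OF RB_ring]) (use J in \<open>auto simp: idealB_def\<close>)
next
  assume "ideal J RB"
  then interpret I: ideal J RB .
  have sub: "J \<subseteq> B" using I.a_subset by simp
  have "pm_scale c a \<in> J" if a: "a \<in> J" for c a
  proof -
    have "pm_scale c (wl []) \<in> B"
      using B_bs[of eH "[]"] subgroup.one_closed[OF G] by (intro pm.subspace_scale[OF B_subspace]) auto
    then have "pm_scale c (wl []) \<star> a \<in> J" using I.I_l_closed[OF a] by simp
    moreover have "a \<in> CS" using sub a B_CS by blast
    ultimately show ?thesis unfolding mul_scale_left by simp
  qed
  then have "pm.subspace J"
    using additive_subgroup.zero_closed[OF I.is_additive_subgroup]
      additive_subgroup.a_closed[OF I.is_additive_subgroup]
    by (auto simp: pm.subspace_def)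
  with sub I.I_l_closed I.I_r_closed show "idealB J" by (auto simp: idealB_def)
qed

lemma B2_B: "B2 \<subseteq> B"
  unfolding KX_def by (rule kset_mono) auto

lemma idealB_B2: "idealB B2"
  unfolding idealB_def
proof (intro conjI ballI kset_subspace B2_B)
  fix a x assume a: "a \<in> B2" and x: "x \<in> B"
  note mc = subgroup.m_closed[OF G]
  show "x \<star> a \<in> B2" using x[unfolded KX_def] a by (rule kset_mul) (auto simp: mc)
  show "a \<star> x \<in> B2" using a x[unfolded KX_def] by (rule kset_mul) (auto simp: mc)
qed

lemma Idl_B2: "Idl\<^bsub>RB\<^esub> {lett D (L i) \<otimes>\<^bsub>skew D\<^esub> lett D (L j) | i j. i \<in> idx D \<and> j \<in> idx D} = B2"
  (is "Idl\<^bsub>RB\<^esub> ?S = _")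
proof
  interpret R: ring RB by (rule RB_ring)
  have lW: "L i \<in> letters D" if "i \<in> idx D" for i using that L by auto
  have S: "?S = {wl [L i, L j] | i j. i \<in> idx D \<and> j \<in> idx D}"
    by (intro Collect_cong arg_cong[of _ _ Ex] ext) (auto simp: lett_eq lW)
  have SB: "?S \<subseteq> B2" unfolding S using subgroup.one_closed[OF G] by auto
  then have S': "?S \<subseteq> carrier RB" using B2_B by auto
  show "Idl\<^bsub>RB\<^esub> ?S \<subseteq> B2"
    using idealB_B2 SB unfolding idealB_ideal by (rule R.genideal_minimal)
  have I: "idealB (Idl\<^bsub>RB\<^esub> ?S)" unfolding idealB_ideal by (rule R.genideal_ideal[OF S'])
  have SI: "?S \<subseteq> Idl\<^bsub>RB\<^esub> ?S" by (rule R.genideal_self[OF S'])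
  show "B2 \<subseteq> Idl\<^bsub>RB\<^esub> ?S"
  proof
    fix a assume a: "a \<in> B2"
    show "a \<in> Idl\<^bsub>RB\<^esub> ?S"
    proof (rule kset_lin_mem[OF a lin_id])
      show "pm.subspace (Idl\<^bsub>RB\<^esub> ?S)" using I by (simp add: idealB_def)
      fix h w assume "(h, w) \<in> G \<times> {w \<in> lists (L ` idx D). 2 \<le> length w}"
      then obtain i j v where w: "h \<in> G" "w = L i # L j # v" "i \<in> idx D" "j \<in> idx D" "v \<in> lists (L ` idx D)"
        by (cases w; cases "tl w") auto
      have "wl [L i, L j] \<in> Idl\<^bsub>RB\<^esub> ?S" using SI w unfolding S by blast
      then have "bs h [] \<star> wl [L i, L j] \<in> Idl\<^bsub>RB\<^esub> ?S"
        using I B_bs[OF w(1), of "[]"] unfolding idealB_def by blast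
      then have "bs h [] \<star> wl [L i, L j] \<star> wl v \<in> Idl\<^bsub>RB\<^esub> ?S"
        using I B_bs[OF subgroup.one_closed[OF G] w(5)] unfolding idealB_def by blast
      moreover have "bs h [] \<star> wl [L i, L j] \<star> wl v = bs h w"
        using w lW GH by simp
      ultimately show "bs h w \<in> Idl\<^bsub>RB\<^esub> ?S" by simp
    qed
  qed
qed

definition hJ where
  "hJ J \<longleftrightarrow> idealB J \<and> J \<subseteq> B2 \<and> coid J \<and> (\<forall>a\<in>J. lin_ext (anti_basis D) a \<in> J)"

lemma Del_B: "a \<in> B \<Longrightarrow> Poly_Mapping.keys (Del a) \<subseteq> B \<times> B"
  using gL by (intro Del_keys[OF G]) auto

text \<open>The counit condition is automatic because no word in \<open>B2\<close> is empty, and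
  \<open>coidI\<close>, \<open>coidD\<close> exchange the condition on coproducts for the one on
  functionals.\<close>

lemma hJ_iff: "hopf_ideal (skew D) B J \<and> J \<subseteq> B2 \<longleftrightarrow> hJ J"
proof
  assume a: "hopf_ideal (skew D) B J \<and> J \<subseteq> B2"
  then have id: "idealB J" by (simp add: hopf_ideal_def idealB_ideal)
  then have sub: "pm.subspace J" by (simp add: idealB_def)
  have "coid J"
    unfolding coid_def
  proof (intro ballI allI impI)
    fix x \<phi> \<psi> assume x: "x \<in> J" "lfun \<phi>" "lfun \<psi>" "\<forall>x\<in>J. \<phi> x = 0" "\<forall>x\<in>J. \<psi> x = 0"
    have "comult (skew D) x \<in> {tens_class (skew D) (p + r) | p r.
        Poly_Mapping.keys p \<subseteq> J \<times> B \<and> Poly_Mapping.keys r \<subseteq> B \<times> J}"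
      using a x(1) unfolding hopf_ideal_def by blast
    from coidD(1)[OF sub this x(3)] x show "\<phi> (EE \<psi> (Del x)) = 0" by blast
  qed
  with a id show "hJ J" by (simp add: hJ_def hopf_ideal_def)
next
  assume h: "hJ J"
  then have id: "pm.subspace J" "J \<subseteq> B" by (auto simp: hJ_def idealB_def)
  have "counit (skew D) a = 0" if "a \<in> J" for a
  proof -
    have "a \<in> B2" using h that by (auto simp: hJ_def)
    then show ?thesis by (auto simp: kset_def intro!: sum.neutral)
  qed
  moreover have "comult (skew D) a \<in> {tens_class (skew D) (p + r) | p r.
        Poly_Mapping.keys p \<subseteq> J \<times> B \<and> Poly_Mapping.keys r \<subseteq> B \<times> J}" if "a \<in> J" for a
  proof (rule coidI[OF id B_subspace B_CS Del_B])
    show "a \<in> B" using that id by auto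
    show "\<phi> (EE \<psi> (Del a)) = 0" if "lfun \<phi>" "lfun \<psi>" "\<forall>x\<in>J. \<phi> x = 0" "\<forall>x\<in>J. \<psi> x = 0" for \<phi> \<psi>
      using h that \<open>a \<in> J\<close> unfolding hJ_def coid_def by blast
  qed
  ultimately show "hopf_ideal (skew D) B J \<and> J \<subseteq> B2"
    using h unfolding hopf_ideal_def hJ_def idealB_ideal by auto
qed

text \<open>All multidegree components of all admissible Hopf ideals are collected. The span turns
  out to be admissible itself, so it is the biggest one, and it is closed under taking
  components.\<close>

definition Jgen where "Jgen = {mgr M a | M a J. a \<in> J \<and> hJ J}"
definition Jmax where "Jmax = pm.span Jgen"

lemma hJ_Jmax: assumes "hJ J" shows "J \<subseteq> Jmax"
proof
  fix a assume a: "a \<in> J"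
  obtain T where T: "finite T" "(\<Sum>M\<in>T. mgr M a) = a" using mgr_decomp by blast
  have "mgr M a \<in> Jmax" for M
    unfolding Jmax_def using a assms by (intro pm.span_base) (auto simp: Jgen_def)
  then have "(\<Sum>M\<in>T. mgr M a) \<in> Jmax" unfolding Jmax_def by (intro pm.span_sum) auto
  then show "a \<in> Jmax" by (simp add: T)
qed

lemma Jmax_subspace: "pm.subspace Jmax" unfolding Jmax_def by (rule pm.subspace_span)

lemma Jgen_Jmax: "a \<in> J \<Longrightarrow> hJ J \<Longrightarrow> mgr M a \<in> Jmax"
  unfolding Jmax_def by (intro pm.span_base) (auto simp: Jgen_def)

lemma Jmax_mgr: assumes "a \<in> Jmax" shows "mgr M a \<in> Jmax"
proof (rule span_lin_mem[OF mgr_lin Jmax_subspace _ assms[unfolded Jmax_def]])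
  fix g assume "g \<in> Jgen"
  then obtain N b J where "g = mgr N b" "b \<in> J" "hJ J" by (auto simp: Jgen_def)
  then show "mgr M g \<in> Jmax"
    using Jgen_Jmax[of b J N] pm.subspace_0[OF Jmax_subspace] by (simp add: mgr_mgr)
qed

lemma Jgen_B2: "Jgen \<subseteq> B2"
  unfolding Jgen_def using mgr_kset by (auto simp: hJ_def subset_iff)

lemma Jmax_B2: "Jmax \<subseteq> B2"
  unfolding Jmax_def by (rule pm.span_minimal[OF Jgen_B2 kset_subspace])

text \<open>The coideal condition is the delicate point. If functionals vanish on
  \<open>Jmax\<close>, their parts of multidegrees M1 and M2 vanish on every single admissible
  ideal, so the condition for that ideal applies to them; and only components of multidegree M1 + M2
  are visible to the pair.\<close>

lemma hJ_max: "hJ Jmax"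
  unfolding hJ_def idealB_def
proof (intro conjI ballI Jmax_subspace Jmax_B2)
  show JB: "Jmax \<subseteq> B" using Jmax_B2 B2_B by blast
  fix a x assume a: "a \<in> Jmax" and x: "x \<in> B"
  have gen: "x \<star> g \<in> Jmax \<and> g \<star> x \<in> Jmax" if "g \<in> Jgen" for g
  proof -
    obtain M b J where g: "g = mgr M b" "b \<in> J" "hJ J"
      using \<open>g \<in> Jgen\<close> by (auto simp: Jgen_def)
    have J: "idealB J" using g by (simp add: hJ_def)
    have bC: "b \<in> CS" using J g B_CS by (auto simp: idealB_def)
    have *: "bs h w \<star> g \<in> Jmax \<and> g \<star> bs h w \<in> Jmax" if hw: "(h, w) \<in> G \<times> lists (L ` idx D)" for h w
    proof -
      have "h \<in> H" "w \<in> W" "bs h w \<in> B" using hw GH LW_W[OF L] B_bs by auto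
      then show ?thesis
        using J g bC Jgen_Jmax[OF _ g(3)] unfolding g(1)
        by (auto simp: mgr_mul_left mgr_mul_right idealB_def simp del: bil_ext_single)
    qed
    show ?thesis
      using kset_lin_mem[OF x[unfolded KX_def] lin_mul_left Jmax_subspace, of g]
        kset_lin_mem[OF x[unfolded KX_def] lin_mul_right Jmax_subspace, of g] * by blast
  qed
  show "x \<star> a \<in> Jmax"
    by (rule span_lin_mem[OF lin_mul_right Jmax_subspace _ a[unfolded Jmax_def]]) (use gen in auto)
  show "a \<star> x \<in> Jmax"
    by (rule span_lin_mem[OF lin_mul_left Jmax_subspace _ a[unfolded Jmax_def]]) (use gen in auto)
next
  fix a assume a: "a \<in> Jmax"
  show "lin_ext (anti_basis D) a \<in> Jmax"
  proof (rule span_lin_mem[OF lin_lin_ext Jmax_subspace _ a[unfolded Jmax_def]])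
    fix g assume "g \<in> Jgen"
    then obtain M b J where g: "g = mgr M b" "b \<in> J" "hJ J" by (auto simp: Jgen_def)
    have "b \<in> CS" using g B_CS by (auto simp: hJ_def idealB_def)
    then have "lin_ext (anti_basis D) g = mgr M (lin_ext (anti_basis D) b)" by (simp add: g SA_mgr)
    moreover have "lin_ext (anti_basis D) b \<in> J" using g by (simp add: hJ_def)
    ultimately show "lin_ext (anti_basis D) g \<in> Jmax" using Jgen_Jmax[OF _ g(3)] by simp
  qed
next
  show "coid Jmax"
    unfolding coid_def
  proof (intro ballI allI impI)
    fix a \<phi> \<psi> assume a: "a \<in> Jmax" and l: "lfun \<phi>" "lfun \<psi>" and z: "\<forall>x\<in>Jmax. \<phi> x = 0" "\<forall>x\<in>Jmax. \<psi> x = 0"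
    show "\<phi> (EE \<psi> (Del a)) = 0"
    proof (rule span_lfun_zero[OF lfun_comp[OF l(1) lin_comp[OF lin_EE lin_Del]] _ a[unfolded Jmax_def]])
      fix g assume "g \<in> Jgen"
      then obtain M b J where g: "g = mgr M b" "b \<in> J" "hJ J" by (auto simp: Jgen_def)
      have bC: "b \<in> CS" using g B_CS by (auto simp: hJ_def idealB_def)
      show "\<phi> (EE \<psi> (Del g)) = 0"
      proof (rule EE_by_degree[OF l])
        fix M1 M2
        let ?\<phi> = "\<lambda>b. \<phi> (mgr M1 b)" and ?\<psi> = "\<lambda>b. \<psi> (mgr M2 b)"
        have l': "lfun ?\<phi>" "lfun ?\<psi>" using l by (auto intro: lfun_comp[OF _ mgr_lin])
        have s: "?\<phi> (bs h v) = 0" if "mset v \<noteq> M1" for h v using that by (simp add: mgr_bs lfun_zero[OF l(1)])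
        have s': "?\<psi> (bs h v) = 0" if "mset v \<noteq> M2" for h v using that by (simp add: mgr_bs lfun_zero[OF l(2)])
        show "?\<phi> (EE ?\<psi> (Del g)) = 0"
        proof (cases "M = M1 + M2")
          case False
          then have "g \<in> kset {(h, w). h \<in> H \<and> w \<in> W \<and> mset w \<noteq> M1 + M2}"
            using bC by (auto simp: g kset_def keys_mgr CS_def)
          then show ?thesis by (rule Del_degree[OF _ l']) (use s s' in auto)
        next
          case True
          have "\<forall>x\<in>J. ?\<phi> x = 0" "\<forall>x\<in>J. ?\<psi> x = 0" using z Jgen_Jmax[OF _ g(3)] by auto
          then have 1: "?\<phi> (EE ?\<psi> (Del b)) = 0" using g l' unfolding hJ_def coid_def by blast
          \<comment> \<open>The removed part contains no word with multiset M1 + M2, so the two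
            functionals cannot distinguish b from its component g.\<close>
          have "b - g \<in> kset {(h, w). h \<in> H \<and> w \<in> W \<and> mset w \<noteq> M1 + M2}"
            using bC unfolding g kset_def CS_def mgr_def True
            by (auto simp: in_keys_iff lookup_minus lookup_restr subset_iff split: if_splits)
          then have 2: "?\<phi> (EE ?\<psi> (Del (b - g))) = 0" by (rule Del_degree[OF _ l']) (use s s' in auto)
          have "?\<phi> (EE ?\<psi> (Del (b - g))) = ?\<phi> (EE ?\<psi> (Del b)) - ?\<phi> (EE ?\<psi> (Del g))"
            by (simp only: lin_diff[OF lin_Del] lin_diff[OF lin_EE] lfun_diff[OF l'(1)])
          with 1 2 show ?thesis by simp
        qed
      qed
    qed
  qed
qed

lemma Lam_eq: "Lam G L = Jmax"
  unfolding Lam_def Idl_B2 hJ_iff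
proof (rule Greatest_equality)
  show "hJ Jmax" by (rule hJ_max)
  show "J \<subseteq> Jmax" if "hJ J" for J using that by (rule hJ_Jmax)
qed

definition JV where "JV = Jmax \<inter> VL L"

lemma Jmax_mul: "a \<in> Jmax \<Longrightarrow> x \<in> B \<Longrightarrow> x \<star> a \<in> Jmax \<and> a \<star> x \<in> Jmax"
  using hJ_max by (auto simp: hJ_def idealB_def)

text \<open>A functional that is zero on words of length at least two is zero on
  \<open>Jmax\<close>. The coefficients of single letters and of group elements are of this kind,
  which yields derivations and group components inside the ideal.\<close>

lemma Jmax_EE:
  assumes "a \<in> Jmax" "lfun \<psi>" "\<And>x. x \<in> B2 \<Longrightarrow> \<psi> x = 0"
  shows "EE \<psi> (Del a) \<in> Jmax" "EE' \<psi> (Del a) \<in> Jmax"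
proof -
  have "comult (skew D) a \<in> {tens_class (skew D) (p + r) | p r.
        Poly_Mapping.keys p \<subseteq> Jmax \<times> B \<and> Poly_Mapping.keys r \<subseteq> B \<times> Jmax}"
    using hJ_max[folded hJ_iff] assms(1) unfolding hopf_ideal_def by blast
  from coidD[OF Jmax_subspace this assms(2)] show "EE \<psi> (Del a) \<in> Jmax" "EE' \<psi> (Del a) \<in> Jmax"
    using assms(3) Jmax_B2 by auto
qed

lemma VL_EE_Del:
  assumes r: "r \<in> VL L" and i: "i \<in> idx D"
  shows "EE (cf eH [L i]) (Del r) = bs (lgrp D (L i)) [] \<star> dR (L i) r" "EE' (lam (L i)) (Del r) = dL (L i) r"
proof -
  have Li: "L i \<in> letters D" using L i by auto
  show "EE (cf eH [L i]) (Del r) = bs (lgrp D (L i)) [] \<star> dR (L i) r"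
  proof (rule kset_lin_eq[OF r[unfolded VL_def] lin_comp[OF lin_EE lin_Del] lin_comp[OF lin_mul_right lin_dR]])
    fix h w assume hw: "(h, w) \<in> {eH} \<times> lists (L ` idx D)"
    then have w: "w \<in> W" and h: "h = eH" using LW_W[OF L] by auto
    have "EE (\<lambda>b. cf eH [L i] (wl [] \<star> b)) (dw w) = EE (cf eH [L i]) (dw w)"
      using w by (intro dw_EE_cong) auto
    then show "EE (cf eH [L i]) (Del (bs h w)) = bs (lgrp D (L i)) [] \<star> dR (L i) (bs h w)"
      unfolding EE_delta h mul_one_left[OF dw_EE_CS[OF w]] dR_bs EE_dR[OF Li w] .
  qed
  show "EE' (lam (L i)) (Del r) = dL (L i) r"
  proof (rule kset_lin_eq[OF r[unfolded VL_def] lin_comp[OF lin_EE' lin_Del] lin_dL])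
    fix h w assume hw: "(h, w) \<in> {eH} \<times> lists (L ` idx D)"
    then have w: "w \<in> W" and h: "h = eH" using LW_W[OF L] by auto
    have "EE' (\<lambda>b. lam (L i) (wl [] \<star> b)) (dw w) = EE' (lam (L i)) (dw w)"
      using w by (intro dw_EE'_cong) auto
    then show "EE' (lam (L i)) (Del (bs h w)) = dL (L i) (bs h w)"
      unfolding EE'_delta h mul_one_left[OF dw_EE'_CS[OF w]] dL_bs EE'_dL[OF Li w] .
  qed
qed

lemma dR_VL: "r \<in> VL L \<Longrightarrow> dR y r \<in> VL L" and dL_VL: "r \<in> VL L \<Longrightarrow> dL y r \<in> VL L"
  by (rule kset_lin_mem[of r "{eH} \<times> lists (L ` idx D)", OF _ lin_dR VL_subspace] kset_lin_mem[of r "{eH} \<times> lists (L ` idx D)", OF _ lin_dL VL_subspace];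
      auto simp: VL_def[symmetric] dRw_VL dLw_VL)+

text \<open>Both derivations are contractions with coefficients of a single letter, hence preserve
  the Hopf ideal; the group element that accompanies \<open>dR\<close> is cancelled inside the
  ideal.\<close>

lemma goodJ_JV: "goodJ L JV"
  unfolding goodJ_def
proof (intro conjI ballI allI)
  show "pm.subspace JV" unfolding JV_def by (intro pm.subspace_inter Jmax_subspace VL_subspace)
  show "JV \<subseteq> kset ({eH} \<times> (lists (L ` idx D) - {[]}))"
    unfolding JV_def VL_def using Jmax_B2 unfolding kset_def by fastforce
  fix a assume a: "a \<in> JV"
  show "mgr M a \<in> JV" for M
    using a Jmax_mgr mgr_kset unfolding JV_def VL_def by blast
  fix i assume i: "i \<in> idx D"
  have Li: "L i \<in> letters D" using L i by auto
  have aC: "a \<in> CS" using a VL_CS[OF L] by (auto simp: JV_def)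
  have wB: "wl [L i] \<in> B" using i B_bs subgroup.one_closed[OF G] by auto
  have "wl [L i] \<star> a \<in> VL L" using i a by (intro VL_wl_mul) (auto simp: JV_def)
  then show "wl [L i] \<star> a \<in> JV" using a Jmax_mul[OF _ wB] by (auto simp: JV_def)
  have "a \<star> wl [L i] \<in> VL L"
    using a i unfolding JV_def VL_def by (intro kset_mul[of a _ _ "{(eH, [L i])}"]) auto
  then show "a \<star> wl [L i] \<in> JV" using a Jmax_mul[OF _ wB] by (auto simp: JV_def)
  have "EE (cf eH [L i]) (Del a) \<in> Jmax"
    using a by (intro Jmax_EE lfun_lookup) (auto simp: JV_def kset_def in_keys_iff)
  then have "bs (hinv (lgrp D (L i))) [] \<star> (bs (lgrp D (L i)) [] \<star> dR (L i) a) \<in> Jmax"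
    using VL_EE_Del(1)[of a i] a i Jmax_mul B_bs[of "hinv (lgrp D (L i))" "[]"]
      subgroup.m_inv_closed[OF G gL[OF i]] by (auto simp: JV_def)
  moreover have "dR (L i) a \<in> VL L" using dR_VL a by (auto simp: JV_def)
  moreover from this have "bs (hinv (lgrp D (L i))) [] \<star> (bs (lgrp D (L i)) [] \<star> dR (L i) a) = dR (L i) a"
    using Li VL_CS[OF L] by (subst mul_assoc[symmetric]) auto
  ultimately show "dR (L i) a \<in> JV" by (simp add: JV_def)
  have "EE' (lam (L i)) (Del a) \<in> Jmax"
  proof (rule Jmax_EE)
    show "lfun (lam (L i))" unfolding lam_def by (rule lfun_fun_ext)
    show "lam (L i) x = 0" if "x \<in> B2" for x
      by (rule kset_lfun_zero[OF that]) (auto simp: lam_def lfun_fun_ext)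
  qed (use a in \<open>auto simp: JV_def\<close>)
  then show "dL (L i) a \<in> JV" using VL_EE_Del(2)[of a i] a i dL_VL by (auto simp: JV_def)
qed

text \<open>Contraction with the coefficient of a group element h0 splits an element of the Hopf
  ideal into its group components, and each component is h0 times an element of
  \<open>JV\<close>.\<close>

lemma Lam_in_ideal:
  assumes "ideal2 I" "JV \<subseteq> I" shows "Lam G L \<subseteq> I"
proof
  fix r assume "r \<in> Lam G L"
  then have r: "r \<in> Jmax" by (simp add: Lam_eq)
  have rB2: "r \<in> B2" using Jmax_B2 r by auto
  then have rC: "r \<in> CS" using B2_B B_CS by auto
  have comp: "restr (\<lambda>(h, w). h = h0) r \<in> I" if h0: "h0 \<in> G" for h0
  proof -
    let ?r = "restr (\<lambda>(h, w). h = h0) r"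
    have "EE (cf h0 []) (Del r) \<in> Jmax"
      using r by (intro Jmax_EE lfun_lookup) (auto simp: kset_def in_keys_iff)
    then have J: "?r \<in> Jmax" using EE_group_component[OF rC GH[OF h0]] by simp
    have k: "?r \<in> kset ({h0} \<times> lists (L ` idx D))"
      using rB2 by (auto simp: kset_def keys_restr)
    let ?s = "bs (hinv h0) [] \<star> ?r"
    have "?s \<in> Jmax" using Jmax_mul[OF J] B_bs[of "hinv h0" "[]"] subgroup.m_inv_closed[OF G h0] by auto
    moreover have "?s \<in> VL L" unfolding VL_def
      using GH[OF h0] by (intro kset_mul[OF _ k, of _ "{(hinv h0, [])}"]) auto
    ultimately have "?s \<in> I" using assms(2) by (auto simp: JV_def)
    then have "bs h0 [] \<star> ?s \<in> I" using assms(1) GH[OF h0] by (auto simp: ideal2_def)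
    moreover have "?r \<in> CS" using J Jmax_B2 B2_B B_CS by auto
    then have "bs h0 [] \<star> ?s = ?r" using GH[OF h0] by (subst mul_assoc[symmetric]) auto
    ultimately show ?thesis by simp
  qed
  have "(\<Sum>h\<in>fst ` Poly_Mapping.keys r. restr (\<lambda>s. fst s = h) r) = r"
    by (rule sum_restr_fibres) auto
  moreover have "(\<Sum>h\<in>fst ` Poly_Mapping.keys r. restr (\<lambda>s. fst s = h) r) \<in> I"
  proof (rule pm.subspace_sum)
    show "pm.subspace I" using assms(1) by (simp add: ideal2_def)
    fix h assume "h \<in> fst ` Poly_Mapping.keys r"
    then have "h \<in> G" using rB2 by (auto simp: kset_def)
    from comp[OF this] show "restr (\<lambda>s. fst s = h) r \<in> I" by (simp add: case_prod_beta')
  qed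
  ultimately show "r \<in> I" by simp
qed

lemma JV_Lam: "JV \<subseteq> Lam G L"
  by (auto simp: JV_def Lam_eq)

lemma Lam_CS: "Lam G L \<subseteq> CS"
  using Jmax_B2 B2_B B_CS by (auto simp: Lam_eq)

end

definition "Lp = JV HGs Pos"
definition "Lm = JV HFs Neg"

lemma gLp: "i \<in> idx D \<Longrightarrow> lgrp D (Pos i) \<in> HGs" and gLm: "i \<in> idx D \<Longrightarrow> lgrp D (Neg i) \<in> HFs"
  using gel_closed fel_closed by auto

lemma uq_ideal_II: "uq_ideal D = qJ.II D Lm Lp"
  and qJ_uq: "qJ D Lm Lp"
proof -
  note p = HGs_subgroup gLp and m = HFs_subgroup gLm
  show q: "qJ D Lm Lp"
    using goodJ_JV[of HGs Pos, OF p] goodJ_JV[of HFs Neg, OF m]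
    by unfold_locales (auto simp: Lp_def Lm_def)
  interpret qJ D Lm Lp by (rule q)
  have "Lambda_pos D \<subseteq> II" "Lambda_neg D \<subseteq> II"
    unfolding Lambda_pos_Lam Lambda_neg_Lam
    using Lam_in_ideal[of HGs Pos, OF p _ ideal2_II] Lam_in_ideal[of HFs Neg, OF m _ ideal2_II] Jp_II Jm_II
    by (auto simp: Lp_def Lm_def)
  moreover have c: "mixed_rels D \<union> Lambda_pos D \<union> Lambda_neg D \<subseteq> CS"
    using Lam_CS[of HGs Pos, OF p] Lam_CS[of HFs Neg, OF m] mixed_rels_closed
    by (auto simp: Lambda_pos_Lam Lambda_neg_Lam)
  moreover have "mixed_rels D \<subseteq> II"
    using mixr_I0 I0_II by (auto simp: mixed_rels_eq)
  moreover have "Lp \<subseteq> Lambda_pos D" "Lm \<subseteq> Lambda_neg D"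
    using JV_Lam[of HGs Pos, OF p] JV_Lam[of HFs Neg, OF m] by (auto simp: Lp_def Lm_def Lambda_pos_Lam Lambda_neg_Lam)
  moreover have "mixed_rels D \<union> Lambda_pos D \<union> Lambda_neg D \<subseteq> Idl\<^bsub>skew D\<^esub> (mixed_rels D \<union> Lambda_pos D \<union> Lambda_neg D)"
    using c by (intro SR.genideal_self) simp
  ultimately show "uq_ideal D = II"
    unfolding uq_ideal_def by (intro Idl_eq_II) auto
qed

end

section \<open>The quantum Serre relations\<close>

context qd
begin

text \<open>The twisted Leibniz rule; the twist is the character of the first word at g_y.\<close>

lemma dRw_append:
  assumes "u \<in> W" "v \<in> W" "y \<in> letters D"
  shows "dRw y (u @ v) = pm_scale (wchar D u (lgrp D y)) (wl u \<star> dRw y v) + dRw y u \<star> wl v"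
  using assms(1)
proof (induction u)
  have C: "dRw y w \<in> CS" if "w \<in> W" for w
    using that by (induction w) (auto intro!: CS_add CS_scale)
  case Nil
  then show ?case using assms C by simp
next
  have C: "dRw y w \<in> CS" if "w \<in> W" for w
    using that by (induction w) (auto intro!: CS_add CS_scale)
  case (Cons z u)
  have z: "z \<in> letters D" "u \<in> W" using Cons by auto
  have 1: "wl [z] \<star> (wl u \<star> dRw y v) = wl (z # u) \<star> dRw y v"
    using z assms C by (subst mul_assoc[symmetric]) auto
  have 2: "wl [z] \<star> (dRw y u \<star> wl v) = wl [z] \<star> dRw y u \<star> wl v"
    using z assms C by (subst mul_assoc[symmetric]) auto
  show ?case using Cons z assms
    by (simp add: mul_add_right mul_add_left mul_scale_right mul_scale_left 1 2 pm.scale_right_distrib algebra_simps)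
qed

lemma dLw_append:
  assumes "u \<in> W" "v \<in> W" "y \<in> letters D"
  shows "dLw y (u @ v) = wl u \<star> dLw y v + pm_scale (lchar D y (wgrp D v)) (dLw y u \<star> wl v)"
  using assms(1)
proof (induction u)
  have C: "dLw y w \<in> CS" if "w \<in> W" for w
    using that assms(3) by (induction w) (auto intro!: CS_add CS_scale)
  case Nil
  then show ?case using assms C by simp
next
  have C: "dLw y w \<in> CS" if "w \<in> W" for w
    using that assms(3) by (induction w) (auto intro!: CS_add CS_scale)
  case (Cons z u)
  have z: "z \<in> letters D" "u \<in> W" using Cons by auto
  have 1: "wl [z] \<star> (wl u \<star> dLw y v) = wl (z # u) \<star> dLw y v"
    using z assms C by (subst mul_assoc[symmetric]) auto
  have 2: "wl [z] \<star> (dLw y u \<star> wl v) = wl [z] \<star> dLw y u \<star> wl v"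
    using z assms C by (subst mul_assoc[symmetric]) auto
  show ?case using Cons z assms
    by (simp add: mul_add_right mul_add_left mul_scale_right mul_scale_left 1 2 pm.scale_right_distrib
        wgrp_append lchar_mult algebra_simps)
qed

abbreviation pl where "pl a b \<equiv> lchar D a (lgrp D b)"

text \<open>The expanded forms of [[a, b], b] and, below, of [a, [a, b]] and [a, b].\<close>

definition ser1 where
  "ser1 a b = wl [a, b, b] - pm_scale (pl a b * (1 + pl b b)) (wl [b, a, b]) + pm_scale (pl a b * pl a b * pl b b) (wl [b, b, a])"
definition ser2 where
  "ser2 a b = wl [a, a, b] - pm_scale (pl a b * (1 + pl a a)) (wl [a, b, a]) + pm_scale (pl a b * pl a b * pl a a) (wl [b, a, a])"
definition ser3 where
  "ser3 a b = wl [a, b] - pm_scale (pl a b) (wl [b, a])"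

lemma bracket_bs:
  assumes "u \<in> W" "v \<in> W"
  shows "bracket D (wl u) (wl v) = wl (u @ v) - pm_scale (wchar D u (wgrp D v)) (wl (v @ u))"
  using assms by (simp add: bracket_def)

lemma lin_bracket_left: "lin (\<lambda>p. bracket D p q)" and lin_bracket_right: "lin (\<lambda>q. bracket D p q)"
  unfolding bracket_def by (rule lin_bil_left lin_bil_right)+

lemmas bracket_lin = lin_diff[OF lin_bracket_left] lin_diff[OF lin_bracket_right]
  lin_scale[OF lin_bracket_left] lin_scale[OF lin_bracket_right]

lemma bracket_eq:
  assumes "a \<in> letters D" "b \<in> letters D"
  shows "bracket D (lett D a) (lett D b) = ser3 a b"
    "bracket D (bracket D (lett D a) (lett D b)) (lett D b) = ser1 a b"
    "bracket D (lett D a) (bracket D (lett D a) (lett D b)) = ser2 a b"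
proof -
  have k: "[a] \<in> W" "[b] \<in> W" "[a, b] \<in> W" "[b, a] \<in> W" using assms by auto
  show "bracket D (lett D a) (lett D b) = ser3 a b"
    using assms by (simp add: lett_eq bracket_bs k ser3_def)
  show "bracket D (bracket D (lett D a) (lett D b)) (lett D b) = ser1 a b"
    unfolding lett_eq bracket_bs[OF k(1,2)] bracket_lin bracket_bs[OF k(3,2)] bracket_bs[OF k(4,2)]
      append.simps
    using assms
    by (intro poly_mapping_eqI)
      (simp add: ser1_def lookup_minus lookup_add lookup_pm_scale lookup_single when_def algebra_simps bracket_lin
        bracket_bs[OF k(3,2)] bracket_bs[OF k(4,2)] del: pm_scale_single)
  show "bracket D (lett D a) (bracket D (lett D a) (lett D b)) = ser2 a b"
    unfolding lett_eq bracket_bs[OF k(1,2)] bracket_lin bracket_bs[OF k(1,3)] bracket_bs[OF k(1,4)]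
      append.simps
    using assms
    by (intro poly_mapping_eqI)
      (simp add: ser2_def lookup_minus lookup_add lookup_pm_scale lookup_single when_def algebra_simps lchar_mult
         del: pm_scale_single)
qed

lemma bracket_ser3:
  assumes "a \<in> letters D" "b \<in> letters D"
  shows "bracket D (ser3 a b) (lett D b) = ser1 a b" "bracket D (lett D a) (ser3 a b) = ser2 a b"
  using bracket_eq(2,3)[OF assms] unfolding bracket_eq(1)[OF assms] by auto

lemma serre_rels_eq:
  assumes "L = Pos \<or> L = Neg"
  shows "serre_rels D L = {ser1 (L i) (L (i + 1)) | i. i \<in> idx D \<and> i + 1 \<in> idx D}
   \<union> {ser2 (L i) (L (i + 1)) | i. i \<in> idx D \<and> i + 1 \<in> idx D}
   \<union> {ser3 (L i) (L j) | i j. i \<in> idx D \<and> j \<in> idx D \<and> \<bar>int i - int j\<bar> > 1}"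
proof -
  have l: "L i \<in> letters D" if "i \<in> idx D" for i using assms that by auto
  note e = bracket_eq(1)[OF l l] bracket_ser3[OF l l]
  show ?thesis
    unfolding serre_rels_def Let_def
    by (intro arg_cong2[of _ _ _ _ "(\<union>)"] Collect_cong arg_cong[of _ _ Ex] ext iffI; elim conjE; simp only: e simp_thms)
qed

text \<open>After the deletion of a letter, the coefficient of each remaining word either cancels
  identically or is a multiple of 1 - q p p' with p = p_ab and p' = p_ba, which is zero. For
  instance, deleting a from \<open>ser1\<close> by \<open>dR\<close> leaves the word b b with
  coefficient (1 - p p')(1 - q p p').\<close>

lemma ser_derivs:
  assumes a: "a \<in> letters D" and b: "b \<in> letters D" and ab: "a \<noteq> b" and y: "y \<in> letters D"
    and q: "pl a a = q" "pl b b = q" "q \<noteq> 0" and p: "pl a b * pl b a = inverse q"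
  shows "dR y (ser1 a b) = 0" "dL y (ser1 a b) = 0" "dR y (ser2 a b) = 0" "dL y (ser2 a b) = 0"
proof -
  have p': "pl a b * (q * pl b a) = 1" using p q(3) by (simp add: field_simps)
  have k: "pl a b * (pl b a * x) = inverse q * x" "pl a b * (q * (pl b a * x)) = x" 
     "pl b a * (pl a b * x) = inverse q * x" for x
    using p p' by (metis mult.assoc, metis mult.assoc mult_1, metis mult.assoc mult.commute)
  note s = lin_add[OF lin_dR] lin_diff[OF lin_dR] lin_scale[OF lin_dR] lin_add[OF lin_dL] lin_diff[OF lin_dL] lin_scale[OF lin_dL]
  have pk: "pl a b = inverse q * inverse (pl b a)" "pl b a \<noteq> 0" using p q(3) a b by (auto simp: field_simps)
  show "dR y (ser1 a b) = 0"
    unfolding ser1_def s dR_bs using a b ab y q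
    by (intro poly_mapping_eqI) (auto simp: mul_add_right lookup_minus lookup_add lookup_pm_scale lookup_single when_def pk(1); use pk in \<open>simp add: field_simps\<close>)
  show "dR y (ser2 a b) = 0"
    unfolding ser2_def s dR_bs using a b ab y q
    by (intro poly_mapping_eqI) (auto simp: mul_add_right lookup_minus lookup_add lookup_pm_scale lookup_single when_def pk(1); use pk in \<open>simp add: field_simps\<close>)
  show "dL y (ser1 a b) = 0"
    unfolding ser1_def s dL_bs using a b ab y q
    by (intro poly_mapping_eqI) (auto simp: mul_add_right lchar_mult lookup_minus lookup_add lookup_pm_scale lookup_single when_def pk(1); use pk in \<open>simp add: field_simps\<close>)
  show "dL y (ser2 a b) = 0"
    unfolding ser2_def s dL_bs using a b ab y q
    by (intro poly_mapping_eqI) (auto simp: mul_add_right lchar_mult lookup_minus lookup_add lookup_pm_scale lookup_single when_def pk(1); use pk in \<open>simp add: field_simps\<close>)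
qed

lemma ser3_derivs:
  assumes a: "a \<in> letters D" and b: "b \<in> letters D" and ab: "a \<noteq> b" and y: "y \<in> letters D"
    and p: "pl a b * pl b a = 1"
  shows "dR y (ser3 a b) = 0" "dL y (ser3 a b) = 0"
proof -
  note s = lin_diff[OF lin_dR] lin_scale[OF lin_dR] lin_diff[OF lin_dL] lin_scale[OF lin_dL]
  show "dR y (ser3 a b) = 0"
    unfolding ser3_def s dR_bs using a b ab y p
    by (intro poly_mapping_eqI) (auto simp: lookup_minus lookup_add lookup_pm_scale lookup_single when_def)
  show "dL y (ser3 a b) = 0"
    unfolding ser3_def s dL_bs using a b ab y p
    by (intro poly_mapping_eqI) (auto simp: lookup_minus lookup_add lookup_pm_scale lookup_single when_def)
qed

lemma serre_props:
  assumes L: "L = Pos \<or> L = Neg" and s: "s \<in> serre_rels D L"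
  obtains M where "s \<in> kset ({eH} \<times> {w \<in> lists (L ` idx D). mset w = M \<and> w \<noteq> []})"
    "\<And>k. k \<in> idx D \<Longrightarrow> dR (L k) s = 0" "\<And>k. k \<in> idx D \<Longrightarrow> dL (L k) s = 0"
proof -
  have l: "L i \<in> letters D" if "i \<in> idx D" for i using L that by auto
  have inj: "i \<noteq> j \<Longrightarrow> L i \<noteq> L j" for i j using L by auto
  \<comment> \<open>For negative letters the matrix of characters is replaced by its transpose with
    inverted entries, so the same relations hold with q^-1 in place of q.\<close>
  define q where "q = (if L = Pos then qpar D else inverse (qpar D))"
  have q0: "q \<noteq> 0" using q_nz by (simp add: q_def)
  have pn: "pl (Neg i) (Neg j) = inverse (pp D j i)" "pl (Pos i) (Pos j) = pp D i j" if "i \<in> idx D" "j \<in> idx D" for i j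
    using that by simp_all
  have PN: "(Neg :: nat \<Rightarrow> letter) \<noteq> Pos" by (auto simp: fun_eq_iff)
  have diag: "pl (L i) (L i) = q" if "i \<in> idx D" for i
    using L that pp_diag[OF that] PN by (elim disjE) (simp_all add: q_def pn del: lchar.simps lgrp.simps)
  have adj: "pl (L i) (L (i + 1)) * pl (L (i + 1)) (L i) = inverse q" if "i \<in> idx D" "i + 1 \<in> idx D" for i
    using L pp_adj[OF that] PN
    by (elim disjE) (simp_all add: q_def pn that inverse_mult_distrib[symmetric] mult.commute del: lchar.simps lgrp.simps Suc_eq_plus1_left One_nat_def add_Suc_right inverse_mult_distrib)
  have far: "pl (L i) (L j) * pl (L j) (L i) = 1" if "i \<in> idx D" "j \<in> idx D" "\<bar>int i - int j\<bar> > 1" for i j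
    using L pp_far[OF that]
    by (elim disjE) (simp_all add: pn that inverse_mult_distrib[symmetric] mult.commute del: lchar.simps lgrp.simps inverse_mult_distrib)
  consider i where "s = ser1 (L i) (L (i + 1))" "i \<in> idx D" "i + 1 \<in> idx D"
    | i where "s = ser2 (L i) (L (i + 1))" "i \<in> idx D" "i + 1 \<in> idx D"
    | i j where "s = ser3 (L i) (L j)" "i \<in> idx D" "j \<in> idx D" "\<bar>int i - int j\<bar> > 1"
    using s unfolding serre_rels_eq[OF L] by blast
  then show thesis
  proof cases
    case 1
    show thesis
    proof (rule that[of "{#L i, L (i + 1), L (i + 1)#}"])
      show "s \<in> kset ({eH} \<times> {w \<in> lists (L ` idx D). mset w = {#L i, L (i + 1), L (i + 1)#} \<and> w \<noteq> []})"
        unfolding 1(1) ser1_def using 1(2,3)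
        by (intro pm.subspace_add[OF kset_subspace] pm.subspace_diff[OF kset_subspace] pm.subspace_scale[OF kset_subspace] kset_single) auto
    qed (use 1 l ser_derivs[OF l[OF 1(2)] l[OF 1(3)] inj[of i "i+1"] _ diag[OF 1(2)] diag[OF 1(3)] q0 adj[OF 1(2,3)]] in auto)
  next
    case 2
    show thesis
    proof (rule that[of "{#L i, L i, L (i + 1)#}"])
      show "s \<in> kset ({eH} \<times> {w \<in> lists (L ` idx D). mset w = {#L i, L i, L (i + 1)#} \<and> w \<noteq> []})"
        unfolding 2(1) ser2_def using 2(2,3)
        by (intro pm.subspace_add[OF kset_subspace] pm.subspace_diff[OF kset_subspace] pm.subspace_scale[OF kset_subspace] kset_single) auto
    qed (use 2 l ser_derivs[OF l[OF 2(2)] l[OF 2(3)] inj[of i "i+1"] _ diag[OF 2(2)] diag[OF 2(3)] q0 adj[OF 2(2,3)]] in auto)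
  next
    case 3
    have "i \<noteq> j" using 3 by auto
    show thesis
    proof (rule that[of "{#L i, L j#}"])
      show "s \<in> kset ({eH} \<times> {w \<in> lists (L ` idx D). mset w = {#L i, L j#} \<and> w \<noteq> []})"
        unfolding 3(1) ser3_def using 3(2,3)
        by (intro pm.subspace_diff[OF kset_subspace] pm.subspace_scale[OF kset_subspace] kset_single) auto
    qed (use 3 l ser3_derivs[OF l[OF 3(2)] l[OF 3(3)] inj[OF \<open>i \<noteq> j\<close>] _ far[OF 3(2-4)]] in auto)
  qed
qed

lemma serre_props_ex:
  assumes "L = Pos \<or> L = Neg" "s \<in> serre_rels D L"
  shows "\<exists>M. s \<in> kset ({eH} \<times> {w \<in> lists (L ` idx D). mset w = M \<and> w \<noteq> []}) \<and>
    (\<forall>k\<in>idx D. dR (L k) s = 0) \<and> (\<forall>k\<in>idx D. dL (L k) s = 0)"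
  by (rule serre_props[OF assms]) blast

definition SJ where
  "SJ L = pm.span {wl u \<star> s \<star> wl v | u s v. u \<in> lists (L ` idx D) \<and> s \<in> serre_rels D L \<and> v \<in> lists (L ` idx D)}"

context
  fixes L assumes L: "L = Pos \<or> L = Neg"
begin

lemma SJ_subspace: "pm.subspace (SJ L)" unfolding SJ_def by (rule pm.subspace_span)

lemma serre_CS: "s \<in> serre_rels D L \<Longrightarrow> s \<in> CS"
proof -
  assume "s \<in> serre_rels D L"
  then obtain M where "s \<in> kset ({eH} \<times> {w \<in> lists (L ` idx D). mset w = M \<and> w \<noteq> []})"
    using serre_props_ex[OF L] by blast
  moreover have "{eH} \<times> {w \<in> lists (L ` idx D). mset w = M \<and> w \<noteq> []} \<subseteq> H \<times> W"
    using LW_W[OF L] by auto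
  ultimately show ?thesis using kset_mono unfolding CS_kset by blast
qed

lemma SJ_base: "u \<in> lists (L ` idx D) \<Longrightarrow> s \<in> serre_rels D L \<Longrightarrow> v \<in> lists (L ` idx D) \<Longrightarrow> wl u \<star> s \<star> wl v \<in> SJ L"
  unfolding SJ_def by (rule pm.span_base) blast

lemma SJ_mem:
  assumes "d \<in> VL L" "s \<in> serre_rels D L" "d' \<in> VL L"
  shows "d \<star> s \<star> d' \<in> SJ L"
proof (rule kset_lin_mem[OF assms(1)[unfolded VL_def] _ SJ_subspace])
  show "lin (\<lambda>d. d \<star> s \<star> d')" by (intro lin_comp[OF lin_mul_left] lin_mul_left)
  fix h u assume hu: "(h, u) \<in> {eH} \<times> lists (L ` idx D)"
  show "bs h u \<star> s \<star> d' \<in> SJ L"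
    by (rule kset_lin_mem[OF assms(3)[unfolded VL_def] lin_mul_right SJ_subspace])
      (use hu SJ_base assms(2) in auto)
qed

lemma SJ_closed:
  assumes f: "lin f" and T: "pm.subspace T"
    and g: "\<And>u s v. u \<in> lists (L ` idx D) \<Longrightarrow> s \<in> serre_rels D L \<Longrightarrow> v \<in> lists (L ` idx D) \<Longrightarrow> f (wl u \<star> s \<star> wl v) \<in> T"
    and a: "a \<in> SJ L"
  shows "f a \<in> T"
  by (rule span_lin_mem[OF f T _ a[unfolded SJ_def]]) (use g in auto)

text \<open>By the twisted Leibniz rule a derivative of u s v has three terms. The one containing
  the derivative of the Serre element s is zero, and in the other two s survives as a
  factor.\<close>

lemma goodJ_SJ: "goodJ L (SJ L)"
  unfolding goodJ_def
proof (intro conjI ballI allI SJ_subspace)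
  note LW = LW_W[OF L]
  show "SJ L \<subseteq> kset ({eH} \<times> (lists (L ` idx D) - {[]}))"
  proof
    fix a assume a: "a \<in> SJ L"
    show "a \<in> kset ({eH} \<times> (lists (L ` idx D) - {[]}))"
    proof (rule SJ_closed[OF lin_id kset_subspace _ a])
      fix u s v assume u: "u \<in> lists (L ` idx D)" and s: "s \<in> serre_rels D L" and v: "v \<in> lists (L ` idx D)"
      obtain M where M: "s \<in> kset ({eH} \<times> {w \<in> lists (L ` idx D). mset w = M \<and> w \<noteq> []})"
        using serre_props_ex[OF L s] by blast
      have "wl u \<star> s \<in> kset ({eH} \<times> (lists (L ` idx D) - {[]}))"
        using u by (intro kset_mul[OF _ M, of _ "{(eH, u)}"]) auto
      then show "wl u \<star> s \<star> wl v \<in> kset ({eH} \<times> (lists (L ` idx D) - {[]}))"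
        by (rule kset_mul[of _ _ _ "{(eH, v)}"]) (use v in auto)
    qed
  qed
  fix a assume a: "a \<in> SJ L"
  show "mgr N a \<in> SJ L" for N
  proof (rule SJ_closed[OF mgr_lin SJ_subspace _ a])
    fix u s v assume u: "u \<in> lists (L ` idx D)" and s: "s \<in> serre_rels D L" and v: "v \<in> lists (L ` idx D)"
    obtain M where M: "s \<in> kset ({eH} \<times> {w \<in> lists (L ` idx D). mset w = M \<and> w \<noteq> []})"
      using serre_props_ex[OF L s] by blast
    have "wl u \<star> s \<in> kset {(h, w). mset w = mset u + M}"
      by (intro kset_mul[OF _ M, of _ "{(eH, u)}"]) auto
    then have "wl u \<star> s \<star> wl v \<in> kset {(h, w). mset w = mset u + M + mset v}"
      by (rule kset_mul[of _ _ _ "{(eH, v)}"]) auto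
    then show "mgr N (wl u \<star> s \<star> wl v) \<in> SJ L"
      using SJ_base[OF u s v] pm.subspace_0[OF SJ_subspace] by (simp add: mgr_kset_hom)
  qed
  fix i assume i: "i \<in> idx D"
  have Li: "L i \<in> letters D" using i L by auto
  show "wl [L i] \<star> a \<in> SJ L"
  proof (rule SJ_closed[OF lin_mul_right SJ_subspace _ a])
    fix u s v assume u: "u \<in> lists (L ` idx D)" and s: "s \<in> serre_rels D L" and v: "v \<in> lists (L ` idx D)"
    have "wl [L i] \<star> (wl u \<star> s \<star> wl v) = (wl [L i] \<star> wl u) \<star> s \<star> wl v"
      using Li LW[OF u] LW[OF v] serre_CS[OF s] by (simp add: mul_assoc del: bil_ext_single)
    also have "wl [L i] \<star> wl u = wl (L i # u)" using Li LW[OF u] by simp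
    finally show "wl [L i] \<star> (wl u \<star> s \<star> wl v) \<in> SJ L" using SJ_base[of "L i # u" s v] i u s v by simp
  qed
  show "a \<star> wl [L i] \<in> SJ L"
  proof (rule SJ_closed[OF lin_mul_left SJ_subspace _ a])
    fix u s v assume u: "u \<in> lists (L ` idx D)" and s: "s \<in> serre_rels D L" and v: "v \<in> lists (L ` idx D)"
    have "wl u \<star> s \<star> wl v \<star> wl [L i] = wl u \<star> s \<star> (wl v \<star> wl [L i])"
      using Li LW[OF u] LW[OF v] serre_CS[OF s] by (simp add: mul_assoc del: bil_ext_single)
    also have "wl v \<star> wl [L i] = wl (v @ [L i])" using Li LW[OF v] by simp
    finally show "wl u \<star> s \<star> wl v \<star> wl [L i] \<in> SJ L" using SJ_base[of u s "v @ [L i]"] i u s v by simp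
  qed
  show "dR (L i) a \<in> SJ L"
  proof (rule SJ_closed[OF lin_dR SJ_subspace _ a])
    fix u s v assume u: "u \<in> lists (L ` idx D)" and s: "s \<in> serre_rels D L" and v: "v \<in> lists (L ` idx D)"
    obtain M where M: "s \<in> kset ({eH} \<times> {w \<in> lists (L ` idx D). mset w = M \<and> w \<noteq> []})"
      and d: "dR (L i) s = 0"
      using serre_props_ex[OF L s] i by blast
    obtain w0 where w0: "\<And>w. w \<in> lists (L ` idx D) \<Longrightarrow> mset w = M \<Longrightarrow> wchar D w (lgrp D (L i)) = wchar D w0 (lgrp D (L i))"
      using wchar_mset by metis
    let ?g = "lgrp D (L i)" and ?y = "L i"
    have dC: "dRw ?y w \<in> CS" if "w \<in> lists (L ` idx D)" for w using dRw_VL[OF that] VL_CS[OF L] by auto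
    let ?r = "\<lambda>s. pm_scale (wchar D u ?g * wchar D w0 ?g) (wl u \<star> s \<star> dRw ?y v)
        + pm_scale (wchar D u ?g) (wl u \<star> dR ?y s \<star> wl v) + dRw ?y u \<star> s \<star> wl v"
    have "dR ?y (wl u \<star> s \<star> wl v) = ?r s"
    proof (rule kset_lin_eq[OF M])
      show "lin (\<lambda>s. dR ?y (wl u \<star> s \<star> wl v))"
        by (intro lin_comp[OF lin_dR] lin_comp[OF lin_mul_left] lin_mul_right)
      show "lin ?r"
        by (intro lin_plus lin_scaled lin_comp[OF lin_mul_left] lin_mul_right lin_comp[OF lin_mul_right] lin_dR)
      fix h w assume "(h, w) \<in> {eH} \<times> {w \<in> lists (L ` idx D). mset w = M \<and> w \<noteq> []}"
      then have w: "h = eH" "w \<in> lists (L ` idx D)" "mset w = M" by auto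
      have "dR ?y (wl u \<star> bs h w \<star> wl v) = dRw ?y (u @ w @ v)"
        using LW[OF u] LW[OF v] LW[OF w(2)] by (simp add: w(1))
      also have "\<dots> = pm_scale (wchar D u ?g) (wl u \<star> (pm_scale (wchar D w ?g) (wl w \<star> dRw ?y v) + dRw ?y w \<star> wl v)) + dRw ?y u \<star> wl (w @ v)"
        using LW[OF u] LW[OF v] LW[OF w(2)] Li by (simp add: dRw_append)
      also have "wl (w @ v) = wl w \<star> wl v" using LW[OF v] LW[OF w(2)] by simp
      also have "pm_scale (wchar D u ?g) (wl u \<star> (pm_scale (wchar D w ?g) (wl w \<star> dRw ?y v) + dRw ?y w \<star> wl v)) + dRw ?y u \<star> (wl w \<star> wl v) = ?r (bs h w)"
        using LW[OF u] LW[OF v] LW[OF w(2)] dC[OF u] dC[OF v] dC[OF w(2)]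
        by (simp add: w(1) w0[OF w(2,3)] mul_add_right mul_scale_right mul_assoc pm.scale_right_distrib del: bil_ext_single)
      finally show "dR ?y (wl u \<star> bs h w \<star> wl v) = ?r (bs h w)" .
    qed
    also have "\<dots> = pm_scale (wchar D u ?g * wchar D w0 ?g) (wl u \<star> s \<star> dRw ?y v) + dRw ?y u \<star> s \<star> wl v"
      by (simp add: d)
    also have "\<dots> \<in> SJ L"
      using u v s by (intro pm.subspace_add[OF SJ_subspace] pm.subspace_scale[OF SJ_subspace] SJ_mem dRw_VL VL_wl)
    finally show "dR ?y (wl u \<star> s \<star> wl v) \<in> SJ L" .
  qed
  show "dL (L i) a \<in> SJ L"
  proof (rule SJ_closed[OF lin_dL SJ_subspace _ a])
    fix u s v assume u: "u \<in> lists (L ` idx D)" and s: "s \<in> serre_rels D L" and v: "v \<in> lists (L ` idx D)"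
    obtain M where M: "s \<in> kset ({eH} \<times> {w \<in> lists (L ` idx D). mset w = M \<and> w \<noteq> []})"
      and d: "dL (L i) s = 0"
      using serre_props_ex[OF L s] i by blast
    obtain w0 where w0: "\<And>w. w \<in> lists (L ` idx D) \<Longrightarrow> mset w = M \<Longrightarrow> wgrp D w = wgrp D w0"
      using wgrp_mset LW by metis
    let ?y = "L i"
    have dC: "dLw ?y w \<in> CS" if "w \<in> lists (L ` idx D)" for w using dLw_VL[OF that] VL_CS[OF L] by auto
    let ?c = "lchar D ?y (wgrp D v)" and ?c' = "lchar D ?y (wgrp D w0)"
    let ?r = "\<lambda>s. wl u \<star> s \<star> dLw ?y v + pm_scale ?c (wl u \<star> dL ?y s \<star> wl v)
       + pm_scale (?c' * ?c) (dLw ?y u \<star> s \<star> wl v)"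
    have "dL ?y (wl u \<star> s \<star> wl v) = ?r s"
    proof (rule kset_lin_eq[OF M])
      show "lin (\<lambda>s. dL ?y (wl u \<star> s \<star> wl v))"
        by (intro lin_comp[OF lin_dL] lin_comp[OF lin_mul_left] lin_mul_right)
      show "lin ?r"
        by (intro lin_plus lin_scaled lin_comp[OF lin_mul_left] lin_mul_right lin_comp[OF lin_mul_right] lin_dL)
      fix h w assume "(h, w) \<in> {eH} \<times> {w \<in> lists (L ` idx D). mset w = M \<and> w \<noteq> []}"
      then have w: "h = eH" "w \<in> lists (L ` idx D)" "mset w = M" by auto
      have "dL ?y (wl u \<star> bs h w \<star> wl v) = dLw ?y (u @ w @ v)"
        using LW[OF u] LW[OF v] LW[OF w(2)] by (simp add: w(1))
      also have "\<dots> = wl u \<star> (wl w \<star> dLw ?y v + pm_scale ?c (dLw ?y w \<star> wl v)) + pm_scale (lchar D ?y (wgrp D w) * ?c) (dLw ?y u \<star> wl (w @ v))"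
        using LW[OF u] LW[OF v] LW[OF w(2)] Li by (simp add: dLw_append wgrp_append lchar_mult)
      also have "wl (w @ v) = wl w \<star> wl v" using LW[OF v] LW[OF w(2)] by simp
      also have "wl u \<star> (wl w \<star> dLw ?y v + pm_scale ?c (dLw ?y w \<star> wl v)) + pm_scale (lchar D ?y (wgrp D w) * ?c) (dLw ?y u \<star> (wl w \<star> wl v)) = ?r (bs h w)"
        using LW[OF u] LW[OF v] LW[OF w(2)] dC[OF u] dC[OF v] dC[OF w(2)]
        by (simp add: w(1) w0[OF w(2,3)] mul_add_right mul_scale_right mul_assoc del: bil_ext_single)
      finally show "dL ?y (wl u \<star> bs h w \<star> wl v) = ?r (bs h w)" .
    qed
    also have "\<dots> = wl u \<star> s \<star> dLw ?y v + pm_scale (?c' * ?c) (dLw ?y u \<star> s \<star> wl v)"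
      by (simp add: d)
    also have "\<dots> \<in> SJ L"
      using u v s by (intro pm.subspace_add[OF SJ_subspace] pm.subspace_scale[OF SJ_subspace] SJ_mem dLw_VL VL_wl)
    finally show "dL ?y (wl u \<star> s \<star> wl v) \<in> SJ L" .
  qed
qed

lemma serre_SJ: "serre_rels D L \<subseteq> SJ L"
proof
  fix s assume s: "s \<in> serre_rels D L"
  show "s \<in> SJ L" using SJ_base[OF _ s, of "[]" "[]"] serre_CS[OF s] by simp
qed

lemma SJ_ideal:
  assumes "ideal2 I" "serre_rels D L \<subseteq> I" shows "SJ L \<subseteq> I"
  unfolding SJ_def
proof (rule pm.span_minimal)
  show "pm.subspace I" using assms by (simp add: ideal2_def)
  have "wl u \<star> s \<star> wl v \<in> I" if "u \<in> lists (L ` idx D)" "s \<in> serre_rels D L" "v \<in> lists (L ` idx D)" for u s v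
    using that assms LW_W[OF L] CS_single[of eH u 1] CS_single[of eH v 1] unfolding ideal2_def by blast
  then show "{wl u \<star> s \<star> wl v |u s v. u \<in> lists (L ` idx D) \<and> s \<in> serre_rels D L \<and> v \<in> lists (L ` idx D)} \<subseteq> I"
    by blast
qed

end

lemma Uq_ideal_II: "Uq_ideal D = qJ.II D (SJ Neg) (SJ Pos)"
  and qJ_Uq: "qJ D (SJ Neg) (SJ Pos)"
proof -
  show q: "qJ D (SJ Neg) (SJ Pos)"
    using goodJ_SJ[of Neg] goodJ_SJ[of Pos] by unfold_locales auto
  interpret qJ D "SJ Neg" "SJ Pos" by (rule q)
  let ?R = "serre_rels D Pos \<union> serre_rels D Neg \<union> mixed_rels D"
  have c: "?R \<subseteq> CS" using serre_CS[of Pos] serre_CS[of Neg] mixed_rels_closed by auto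
  have id: "ideal2 (Idl\<^bsub>skew D\<^esub> ?R)" unfolding ideal2_ideal using c by (intro SR.genideal_ideal) simp
  have sub: "?R \<subseteq> Idl\<^bsub>skew D\<^esub> ?R" using c by (intro SR.genideal_self) simp
  show "Uq_ideal D = II"
    unfolding Uq_ideal_def
  proof (rule Idl_eq_II[OF c])
    show "?R \<subseteq> II"
      using serre_SJ[of Pos] serre_SJ[of Neg] Jp_II Jm_II mixr_I0 I0_II by (auto simp: mixed_rels_eq)
    show "SJ Neg \<subseteq> Idl\<^bsub>skew D\<^esub> ?R" using sub by (intro SJ_ideal[OF _ id]) auto
    show "SJ Pos \<subseteq> Idl\<^bsub>skew D\<^esub> ?R" using sub by (intro SJ_ideal[OF _ id]) auto
  qed auto
qed

end

text \<open>The finite supports are fixed once and for all, and the expansion remains valid on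
  larger finite sets, so that finitely many vectors can be expanded over a common one.\<close>

lemma relative_dual_basis_supports:
  fixes W V :: "('s \<Rightarrow>\<^sub>0 'k::field) set"
  assumes W: "pm.subspace W"
  obtains E \<phi> S where "E \<subseteq> V" "\<And>e. lfun (\<phi> e)" "\<And>e w. e \<in> E \<Longrightarrow> w \<in> W \<Longrightarrow> \<phi> e w = 0"
    "\<And>e e'. e \<in> E \<Longrightarrow> e' \<in> E \<Longrightarrow> \<phi> e e' = (if e = e' then 1 else 0)"
    "\<And>v. v \<in> V \<Longrightarrow> finite (S v) \<and> S v \<subseteq> E"
    "\<And>v F. \<lbrakk>v \<in> V; finite F; S v \<subseteq> F; F \<subseteq> E\<rbrakk> \<Longrightarrow> v - (\<Sum>e\<in>F. pm_scale (\<phi> e v) e) \<in> W"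
proof -
  obtain E \<phi> where E: "E \<subseteq> V" "\<And>e. lfun (\<phi> e)" "\<And>e w. e \<in> E \<Longrightarrow> w \<in> W \<Longrightarrow> \<phi> e w = 0"
    "\<And>e e'. e \<in> E \<Longrightarrow> e' \<in> E \<Longrightarrow> \<phi> e e' = (if e = e' then 1 else 0)"
    "\<And>v. v \<in> V \<Longrightarrow> \<exists>F. finite F \<and> F \<subseteq> E \<and> (\<forall>e\<in>E - F. \<phi> e v = 0) \<and> v - (\<Sum>e\<in>F. pm_scale (\<phi> e v) e) \<in> W"
    by (rule relative_dual_basis[OF W, of V]) (rule that)
  define S where "S v = (SOME F. finite F \<and> F \<subseteq> E \<and> (\<forall>e\<in>E - F. \<phi> e v = 0) \<and> v - (\<Sum>e\<in>F. pm_scale (\<phi> e v) e) \<in> W)" for v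
  have S: "finite (S v) \<and> S v \<subseteq> E \<and> (\<forall>e\<in>E - S v. \<phi> e v = 0) \<and> v - (\<Sum>e\<in>S v. pm_scale (\<phi> e v) e) \<in> W" if "v \<in> V" for v
    unfolding S_def by (rule someI_ex) (rule E(5)[OF that])
  show thesis
  proof (rule that[OF E(1-4)])
    show "finite (S v) \<and> S v \<subseteq> E" if "v \<in> V" for v using S[OF that] by blast
    show "v - (\<Sum>e\<in>F. pm_scale (\<phi> e v) e) \<in> W" if "v \<in> V" "finite F" "S v \<subseteq> F" "F \<subseteq> E" for v F
    proof -
      have "(\<Sum>e\<in>F. pm_scale (\<phi> e v) e) = (\<Sum>e\<in>S v. pm_scale (\<phi> e v) e)"
        using S[OF that(1)] that by (intro sum.mono_neutral_right) auto
      then show ?thesis using S[OF that(1)] by simp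
    qed
  qed
qed

section \<open>Quotients by ideals\<close>

locale qI = qd D for D :: "('g, 'f, 'k::field) datum" +
  fixes I :: "('g, 'f, 'k) skew_elem set"
  assumes I2: "ideal2 I"
begin

sublocale Id: ideal I "skew D"
  using I2 by (simp add: ideal2_ideal)

abbreviation Q where "Q \<equiv> skew_quot D I"
definition cl :: "('g, 'f, 'k) skew_elem \<Rightarrow> ('g, 'f, 'k) skew_elem set" where
  "cl a = I +>\<^bsub>skew D\<^esub> a"

lemma I_subspace: "pm.subspace I" and I_CS: "I \<subseteq> CS"
  and I_left: "a \<in> I \<Longrightarrow> x \<in> CS \<Longrightarrow> x \<star> a \<in> I" and I_right: "a \<in> I \<Longrightarrow> x \<in> CS \<Longrightarrow> a \<star> x \<in> I"
  using I2 by (auto simp: ideal2_def)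

lemma cl_alt: "cl a = (\<lambda>i. i + a) ` I"
  by (auto simp: cl_def a_r_coset_def r_coset_def)

lemma cl_mem: "x \<in> cl a \<longleftrightarrow> x - a \<in> I"
  unfolding cl_alt by (auto intro!: image_eqI[of x _ "x - a"])

lemma cl_eq: "cl a = cl b \<longleftrightarrow> a - b \<in> I"
proof
  assume "cl a = cl b"
  moreover have "a \<in> cl a" by (simp add: cl_mem pm.subspace_0[OF I_subspace])
  ultimately show "a - b \<in> I" by (simp add: cl_mem)
next
  assume ab: "a - b \<in> I"
  have "x - a \<in> I \<longleftrightarrow> x - b \<in> I" for x
  proof
    assume "x - a \<in> I"
    from pm.subspace_add[OF I_subspace this ab] show "x - b \<in> I" by simp
  next
    assume "x - b \<in> I"
    from pm.subspace_diff[OF I_subspace this ab] show "x - a \<in> I" by simp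
  qed
  then show "cl a = cl b" by (auto simp: cl_mem)
qed

lemma cl_self: "a \<in> cl a"
  by (simp add: cl_mem pm.subspace_0[OF I_subspace])

lemma Q_simps:
  "carrier Q = a_rcosets\<^bsub>skew D\<^esub> I" "monoid.mult Q = rcoset_mult (skew D) I" "one Q = I +>\<^bsub>skew D\<^esub> \<one>\<^bsub>skew D\<^esub>"
  "ring.zero Q = I" "add Q = set_add (skew D)" "smult Q = (\<lambda>c C. \<Union>a\<in>C. I +>\<^bsub>skew D\<^esub> (pm_scale c a))"
  "comult Q = (\<lambda>C. \<Union>a\<in>C. \<Union>t\<in>comult (skew D) a.
       tens_class (quot_mod (skew D) I) (lin_ext (\<lambda>(b, b'). Poly_Mapping.single (I +>\<^bsub>skew D\<^esub> b, I +>\<^bsub>skew D\<^esub> b') 1) t))"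
  by (simp_all add: skew_quot_def quot_hopf_def quot_mod_def FactRing_def module.extend_def ring.extend_def
      module.fields_def hopf.fields_def del: skew_simps(13,14,15))

lemma tens_rel_quot_mod: "tens_rel (quot_mod (skew D) I) = tens_rel Q"
  by (simp add: tens_rel_def skew_quot_def quot_hopf_def module.extend_def)

lemma Q_carrier: "carrier Q = cl ` CS"
  by (auto simp: Q_simps A_RCOSETS_def' cl_def)

lemma Q_mult: "a \<in> CS \<Longrightarrow> b \<in> CS \<Longrightarrow> cl a \<otimes>\<^bsub>Q\<^esub> cl b = cl (a \<star> b)"
  using Id.rcoset_mult_add[of a b] by (simp add: Q_simps cl_def)

lemma Q_add: "a \<in> CS \<Longrightarrow> b \<in> CS \<Longrightarrow> cl a \<oplus>\<^bsub>Q\<^esub> cl b = cl (a + b)"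
  using Id.a_rcos_sum[of a b] by (simp add: Q_simps cl_def)

lemma Q_one: "\<one>\<^bsub>Q\<^esub> = cl (wl [])" by (simp add: Q_simps cl_def)

lemma Q_zero: "\<zero>\<^bsub>Q\<^esub> = cl 0" by (simp add: Q_simps cl_alt)

lemma Q_smult: "c \<odot>\<^bsub>Q\<^esub> cl a = cl (pm_scale c a)"
proof -
  have "cl (pm_scale c x) = cl (pm_scale c a)" if "x \<in> cl a" for x
    using that pm.subspace_scale[OF I_subspace, of "x - a" c]
    by (simp add: cl_mem cl_eq pm.scale_right_diff_distrib)
  then have "(\<Union>x\<in>cl a. cl (pm_scale c x)) = cl (pm_scale c a)"
    by (intro UN_constant_eq[OF cl_self]) blast
  then show ?thesis unfolding Q_simps(6) cl_def[symmetric] .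
qed

lemma Q_ring: "ring Q"
proof (rule ringI)
  show "abelian_group Q"
  proof (rule abelian_groupI)
    fix x assume "x \<in> carrier Q"
    then obtain a where a: "a \<in> CS" "x = cl a" by (auto simp: Q_carrier)
    then have "cl (- a) \<in> carrier Q" "cl (- a) \<oplus>\<^bsub>Q\<^esub> x = \<zero>\<^bsub>Q\<^esub>"
      by (auto simp: Q_carrier Q_add Q_zero CS_neg)
    then show "\<exists>y\<in>carrier Q. y \<oplus>\<^bsub>Q\<^esub> x = \<zero>\<^bsub>Q\<^esub>" by blast
  qed (auto simp: Q_carrier Q_add Q_zero CS_add algebra_simps)
  show "Group.monoid Q"
    by (rule monoidI) (auto simp: Q_carrier Q_mult Q_one mul_assoc)
qed (auto simp: Q_carrier Q_mult Q_add CS_add mul_add_left mul_add_right)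

sublocale QR: ring Q by (rule Q_ring)

lemma Q_minus: "a \<in> CS \<Longrightarrow> \<ominus>\<^bsub>Q\<^esub> cl a = cl (- a)"
  using QR.minus_equality[of "cl (- a)" "cl a"] by (simp add: Q_carrier Q_add Q_zero CS_neg)

definition hat :: "('g, 'f, 'k) skew_elem set set \<Rightarrow> ('g, 'f, 'k) skew_elem set" where
  "hat U = {a \<in> CS. cl a \<in> U}"

lemma subalg_hat:
  assumes "subalg Q U"
  shows "pm.subspace (hat U)" "wl [] \<in> hat U" "\<And>a b. a \<in> hat U \<Longrightarrow> b \<in> hat U \<Longrightarrow> a \<star> b \<in> hat U"
    "I \<subseteq> hat U" "U = cl ` hat U"
proof -
  have sr: "subring U Q" and sc: "\<And>c b. b \<in> U \<Longrightarrow> c \<odot>\<^bsub>Q\<^esub> b \<in> U" using assms by (auto simp: subalg_def)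
  note sub = subringE[OF sr]
  have z: "cl 0 \<in> U" using sub(2) by (simp add: Q_zero)
  show "pm.subspace (hat U)"
    unfolding pm.subspace_def hat_def
  proof (intro conjI ballI allI)
    show "0 \<in> {a \<in> CS. cl a \<in> U}" using z by simp
    show "x + y \<in> {a \<in> CS. cl a \<in> U}" if "x \<in> {a \<in> CS. cl a \<in> U}" "y \<in> {a \<in> CS. cl a \<in> U}" for x y
      using that sub(7)[of "cl x" "cl y"] by (auto simp: Q_add CS_add)
    show "pm_scale c x \<in> {a \<in> CS. cl a \<in> U}" if "x \<in> {a \<in> CS. cl a \<in> U}" for c x
      using that sc[of "cl x" c] by (auto simp: Q_smult CS_scale)
  qed
  show "wl [] \<in> hat U" using sub(3) by (simp add: Q_one hat_def)
  show "a \<star> b \<in> hat U" if "a \<in> hat U" "b \<in> hat U" for a b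
    using that sub(6)[of "cl a" "cl b"] by (auto simp: hat_def Q_mult)
  show "I \<subseteq> hat U"
  proof
    fix i assume i: "i \<in> I"
    then have "cl i = cl 0" by (simp add: cl_eq)
    with z i I_CS show "i \<in> hat U" by (auto simp: hat_def)
  qed
  show "U = cl ` hat U" using sub(1) by (auto simp: hat_def Q_carrier)
qed

lemma subalg_image:
  assumes "pm.subspace V" "V \<subseteq> CS" "wl [] \<in> V" "\<And>a b. a \<in> V \<Longrightarrow> b \<in> V \<Longrightarrow> a \<star> b \<in> V"
  shows "subalg Q (cl ` V)"
  unfolding subalg_def
proof (intro conjI allI ballI)
  show "subring (cl ` V) Q"
    by (rule QR.subringI)
      (use assms in \<open>auto simp: Q_carrier Q_one Q_minus Q_mult Q_add subset_iff pm.subspace_neg pm.subspace_add\<close>)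
  show "c \<odot>\<^bsub>Q\<^esub> b \<in> cl ` V" if "b \<in> cl ` V" for c b
    using that pm.subspace_scale[OF assms(1)] by (auto simp: Q_smult)
qed

lemma subalg_Int: "subalg Q U \<Longrightarrow> subalg Q V \<Longrightarrow> subalg Q (U \<inter> V)"
  unfolding subalg_def using QR.subring_inter by auto

definition rep where "rep X = (SOME a. a \<in> CS \<and> X = cl a)"

lemma rep: "X \<in> carrier Q \<Longrightarrow> rep X \<in> CS \<and> X = cl (rep X)"
  unfolding rep_def by (rule someI_ex) (auto simp: Q_carrier)

lemma rep_cl: "a \<in> CS \<Longrightarrow> rep (cl a) - a \<in> I"
  using rep[of "cl a"] by (auto simp: Q_carrier cl_eq[symmetric])

section \<open>Tensors over the quotient and their contractions\<close>

abbreviation TQ where "TQ \<equiv> tens_rel Q"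

lemma TQ_subspace: "pm.subspace TQ"
  unfolding tens_rel_def by (rule pm.subspace_span)

abbreviation tq where "tq x y \<equiv> Poly_Mapping.single (cl x, cl y) (1::'k)"

lemma TQ_bimod: "bimod CS CS TQ (\<lambda>x y. tq x y)"
  unfolding bimod_def modlin_def
proof (intro conjI ballI allI)
  fix x y z :: "('g, 'f, 'k) skew_elem" and c :: 'k
  assume x: "x \<in> CS" and y: "y \<in> CS"
  show "tq (x + z) y - tq x y - tq z y \<in> TQ" if z: "z \<in> CS" 
    unfolding tens_rel_def Q_carrier using x y z
    by (intro pm.span_base UnI1 CollectI exI[of _ "cl x"] exI[of _ "cl z"] exI[of _ "cl y"]) (auto simp: Q_add)
  show "tq y (x + z) - tq y x - tq y z \<in> TQ" if z: "z \<in> CS"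
    unfolding tens_rel_def Q_carrier using x y z
    by (intro pm.span_base UnI1[OF UnI1[OF UnI2]] CollectI exI[of _ "cl x"] exI[of _ "cl z"] exI[of _ "cl y"]) (auto simp: Q_add)
  show "tq (pm_scale c x) y - pm_scale c (tq x y) \<in> TQ"
    unfolding tens_rel_def Q_carrier using x y
    by (intro pm.span_base UnI1[OF UnI2] CollectI exI[of _ "cl x"] exI[of _ c] exI[of _ "cl y"]) (auto simp: Q_smult)
  show "tq y (pm_scale c x) - pm_scale c (tq y x) \<in> TQ"
    unfolding tens_rel_def Q_carrier using x y
    by (intro pm.span_base UnI2 CollectI exI[of _ "cl x"] exI[of _ c] exI[of _ "cl y"]) (auto simp: Q_smult)
qed

lemma tq_I: "x \<in> CS \<Longrightarrow> y \<in> I \<Longrightarrow> tq x y \<in> TQ"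
proof -
  assume x: "x \<in> CS" and y: "y \<in> I"
  have "cl y = cl 0" using y by (simp add: cl_eq)
  moreover have "modlin CS TQ (tq x)" using TQ_bimod x by (simp add: bimod_def)
  from modlin_zero[OF this CS_subspace] have "tq x 0 \<in> TQ" .
  ultimately show ?thesis by simp
qed

text \<open>Contraction of formal tensors of classes, computed on chosen representatives. When
  \<phi> vanishes on \<open>I\<close>, the result modulo \<open>I\<close> respects the bilinearity
  relations of the quotient.\<close>

definition EQ :: "(('g, 'f, 'k) skew_elem \<Rightarrow> 'k) \<Rightarrow>
   (('g, 'f, 'k) skew_elem set \<times> ('g, 'f, 'k) skew_elem set \<Rightarrow>\<^sub>0 'k) \<Rightarrow> ('g, 'f, 'k) skew_elem" where
  "EQ \<phi> = lin_ext (\<lambda>(X, Y). pm_scale (\<phi> (rep Y)) (rep X))"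

lemma lin_EQ: "lin (EQ \<phi>)" unfolding EQ_def by (rule lin_lin_ext)

lemma EQ_single [simp]: "EQ \<phi> (Poly_Mapping.single (X, Y) c) = pm_scale (c * \<phi> (rep Y)) (rep X)"
  by (simp add: EQ_def)

lemma rep_add: "X \<in> carrier Q \<Longrightarrow> Y \<in> carrier Q \<Longrightarrow> rep (X \<oplus>\<^bsub>Q\<^esub> Y) - rep X - rep Y \<in> I"
proof -
  assume X: "X \<in> carrier Q" and Y: "Y \<in> carrier Q"
  have c: "rep X + rep Y \<in> CS" using rep[OF X] rep[OF Y] by (simp add: CS_add)
  have "X \<oplus>\<^bsub>Q\<^esub> Y = cl (rep X + rep Y)"
    using rep[OF X] rep[OF Y] Q_add[of "rep X" "rep Y"] by simp
  then show ?thesis using rep_cl[OF c] by (simp add: algebra_simps)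
qed

lemma rep_smult: "X \<in> carrier Q \<Longrightarrow> rep (c \<odot>\<^bsub>Q\<^esub> X) - pm_scale c (rep X) \<in> I"
proof -
  assume X: "X \<in> carrier Q"
  have c: "pm_scale c (rep X) \<in> CS" using rep[OF X] by (simp add: CS_scale)
  have "c \<odot>\<^bsub>Q\<^esub> X = cl (pm_scale c (rep X))"
    using rep[OF X] Q_smult[of c "rep X"] by simp
  then show ?thesis using rep_cl[OF c] by simp
qed

lemma lfun_congI: "lfun \<phi> \<Longrightarrow> (\<And>x. x \<in> I \<Longrightarrow> \<phi> x = 0) \<Longrightarrow> a - b \<in> I \<Longrightarrow> \<phi> a = \<phi> b"
  using lfun_diff[of \<phi> a b] by simp

lemma EQ_TQ:
  assumes "t \<in> TQ" "lfun \<phi>" "\<And>x. x \<in> I \<Longrightarrow> \<phi> x = 0"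
  shows "EQ \<phi> t \<in> I"
proof (rule span_lin_mem[OF lin_EQ I_subspace _ assms(1)[unfolded tens_rel_def]], elim UnE CollectE exE conjE)
  fix t :: "_ \<Rightarrow>\<^sub>0 'k" and x x' y assume t: "t = Poly_Mapping.single (x \<oplus>\<^bsub>Q\<^esub> x', y) (1::'k) - Poly_Mapping.single (x, y) 1 - Poly_Mapping.single (x', y) 1"
    and c: "x \<in> carrier Q" "x' \<in> carrier Q" "y \<in> carrier Q"
  have "EQ \<phi> t = pm_scale (\<phi> (rep y)) (rep (x \<oplus>\<^bsub>Q\<^esub> x') - rep x - rep x')"
    by (simp add: t lin_diff[OF lin_EQ] pm.scale_right_diff_distrib)
  then show "EQ \<phi> t \<in> I" using rep_add[OF c(1,2)] pm.subspace_scale[OF I_subspace] by simp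
next
  fix t :: "_ \<Rightarrow>\<^sub>0 'k" and x y y' assume t: "t = Poly_Mapping.single (x, y \<oplus>\<^bsub>Q\<^esub> y') (1::'k) - Poly_Mapping.single (x, y) 1 - Poly_Mapping.single (x, y') 1"
    and c: "x \<in> carrier Q" "y \<in> carrier Q" "y' \<in> carrier Q"
  have "\<phi> (rep (y \<oplus>\<^bsub>Q\<^esub> y')) = \<phi> (rep y + rep y')"
    using rep_add[OF c(2,3)] by (intro lfun_congI assms) (auto simp: algebra_simps)
  then show "EQ \<phi> t \<in> I"
    using pm.subspace_0[OF I_subspace]
    by (simp add: t lin_diff[OF lin_EQ] lfun_add[OF assms(2)] pm.scale_left_distrib)
next
  fix t :: "_ \<Rightarrow>\<^sub>0 'k" and c x y assume t: "t = Poly_Mapping.single (c \<odot>\<^bsub>Q\<^esub> x, y) (1::'k) - Poly_Mapping.single (x, y) c"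
    and c: "x \<in> carrier Q" "y \<in> carrier Q"
  have "EQ \<phi> t = pm_scale (\<phi> (rep y)) (rep (c \<odot>\<^bsub>Q\<^esub> x) - pm_scale c (rep x))"
    by (simp add: t lin_diff[OF lin_EQ] pm.scale_right_diff_distrib mult.commute)
  then show "EQ \<phi> t \<in> I" using rep_smult[OF c(1)] pm.subspace_scale[OF I_subspace] by simp
next
  fix t :: "_ \<Rightarrow>\<^sub>0 'k" and c x y assume t: "t = Poly_Mapping.single (x, c \<odot>\<^bsub>Q\<^esub> y) (1::'k) - Poly_Mapping.single (x, y) c"
    and c: "x \<in> carrier Q" "y \<in> carrier Q"
  have "\<phi> (rep (c \<odot>\<^bsub>Q\<^esub> y)) = \<phi> (pm_scale c (rep y))"
    using rep_smult[OF c(2)] by (intro lfun_congI assms) auto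
  then show "EQ \<phi> t \<in> I"
    using pm.subspace_0[OF I_subspace] by (simp add: t lin_diff[OF lin_EQ] lfun_scale[OF assms(2)])
qed

abbreviation clt where "clt \<equiv> lin_ext (\<lambda>(b, b'). tq b b')"

text \<open>The coproduct of a class is defined as a union over all representatives. Once this union
  is a single tensor class, as the coideal property guarantees, it is the class of the image of
  \<open>Del a\<close>, because that image belongs to the union.\<close>

lemma comult_Q_class:
  assumes "comult Q (cl a) = tens_class Q p"
  shows "clt (Del a) - p \<in> TQ" "comult Q (cl a) = tens_class Q (clt (Del a))"
proof -
  have tm: "tens_class (quot_mod (skew D) I) = tens_class Q"
    by (simp add: tens_class_def tens_rel_quot_mod fun_eq_iff)
  have "Del a \<in> comult (skew D) a" unfolding comult_skew by (rule tens_class_mem)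
  moreover have "clt (Del a) \<in> tens_class Q (clt (Del a))" by (rule tens_class_mem)
  ultimately have "clt (Del a) \<in> comult Q (cl a)"
    unfolding Q_simps(7) tm cl_def[symmetric] using cl_self by blast
  then show 1: "clt (Del a) - p \<in> TQ" unfolding assms by (rule tens_class_eqD)
  show "comult Q (cl a) = tens_class Q (clt (Del a))"
    unfolding assms using tens_class_eqI[OF 1] by simp
qed

lemma EQ_clt:
  assumes "Poly_Mapping.keys t \<subseteq> CS \<times> CS" "lfun \<phi>" "\<And>x. x \<in> I \<Longrightarrow> \<phi> x = 0"
  shows "EQ \<phi> (clt t) - EE \<phi> t \<in> I"
proof (rule lin_mem_on_keys[of "\<lambda>t. EQ \<phi> (clt t) - EE \<phi> t", OF _ I_subspace])
  show "lin (\<lambda>t. EQ \<phi> (clt t) - EE \<phi> t)" by (intro lin_minus lin_comp[OF lin_EQ] lin_lin_ext lin_EE)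
  fix s assume "s \<in> Poly_Mapping.keys t"
  then obtain x y where s: "s = (x, y)" "x \<in> CS" "y \<in> CS" using assms(1) by auto
  have "\<phi> (rep (cl y)) = \<phi> y" using rep_cl[OF s(3)] by (intro lfun_congI assms)
  then have "EQ \<phi> (clt (Poly_Mapping.single s 1)) - EE \<phi> (Poly_Mapping.single s 1) = pm_scale (\<phi> y) (rep (cl x) - x)"
    by (simp add: s(1) pm.scale_right_diff_distrib)
  then show "EQ \<phi> (clt (Poly_Mapping.single s 1)) - EE \<phi> (Poly_Mapping.single s 1) \<in> I"
    using rep_cl[OF s(2)] pm.subspace_scale[OF I_subspace] by simp
qed

lemma Del_CS: "a \<in> CS \<Longrightarrow> Poly_Mapping.keys (Del a) \<subseteq> CS \<times> CS"
  unfolding CS_KX by (rule Del_keys[OF HG.subgroup_self]) auto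

text \<open>Two formal tensors represent the coproduct: the image of \<open>Del a\<close>, and one
  with first entries in \<open>U\<close>. Their difference is a bilinearity relation, which
  \<open>EQ\<close> sends into the ideal, and the ideal is contained in the preimage of
  \<open>U\<close>.\<close>

lemma coideal_EE:
  assumes U: "right_coideal_subalg Q (carrier Q) U" and a: "a \<in> hat U"
    and \<phi>: "lfun \<phi>" "\<And>x. x \<in> I \<Longrightarrow> \<phi> x = 0"
  shows "EE \<phi> (Del a) \<in> hat U"
proof -
  have sa: "subalg Q U" and co: "\<And>u. u \<in> U \<Longrightarrow> comult Q u \<in> tens Q U (carrier Q)"
    using U by (auto simp: right_coideal_subalg_def)
  note h = subalg_hat[OF sa]
  have aC: "a \<in> CS" "cl a \<in> U" using a by (auto simp: hat_def)
  obtain p where p: "comult Q (cl a) = tens_class Q p" "Poly_Mapping.keys p \<subseteq> U \<times> carrier Q"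
    using co[OF aC(2)] by (auto simp: tens_def)
  have "EQ \<phi> (clt (Del a)) - EQ \<phi> p \<in> I"
    using EQ_TQ[OF comult_Q_class(1)[OF p(1)] \<phi>] by (simp add: lin_diff[OF lin_EQ])
  moreover have "EQ \<phi> (clt (Del a)) - EE \<phi> (Del a) \<in> I" by (rule EQ_clt[OF Del_CS[OF aC(1)] \<phi>])
  ultimately have "EQ \<phi> (clt (Del a)) - EQ \<phi> p - (EQ \<phi> (clt (Del a)) - EE \<phi> (Del a)) \<in> I"
    by (rule pm.subspace_diff[OF I_subspace])
  then have 1: "EE \<phi> (Del a) - EQ \<phi> p \<in> hat U" using h(4) by auto
  have "EQ \<phi> p \<in> hat U"
    unfolding EQ_def
  proof (rule lin_ext_mem[OF h(1)])
    fix s assume "s \<in> Poly_Mapping.keys p"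
    then obtain X Y where s: "s = (X, Y)" "X \<in> U" using p(2) by auto
    have "X \<in> carrier Q" using s(2) U by (auto simp: right_coideal_subalg_def)
    then have "rep X \<in> hat U" using rep[of X] s(2) by (auto simp: hat_def)
    then show "(case s of (X, Y) \<Rightarrow> pm_scale (\<phi> (rep Y)) (rep X)) \<in> hat U"
      using pm.subspace_scale[OF h(1)] by (simp add: s(1))
  qed
  from pm.subspace_add[OF h(1) 1 this] show ?thesis by simp
qed

section \<open>The two Borel parts of the quotient\<close>

context
  fixes G X
  assumes G: "subgroup G (HH D)" and X: "X \<subseteq> letters D" "lgrp D ` X \<subseteq> G"
begin

lemma KX_CS: "KX G X \<subseteq> CS"
proof -
  have "lists X \<subseteq> W" by (rule lists_mono[OF X(1)])
  moreover have "G \<subseteq> H" by (rule subgroup.subset[OF G])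
  ultimately show ?thesis unfolding KX_def CS_kset by (intro kset_mono) auto
qed

lemma KX_subspace: "pm.subspace (KX G X)"
  unfolding KX_def by (rule kset_subspace)

lemma KX_one: "wl [] \<in> KX G X"
  using subgroup.one_closed[OF G] by (simp add: KX_def)

lemma subalg_KX: "subalg Q (cl ` KX G X)"
  by (rule subalg_image[OF KX_subspace KX_CS KX_one KX_mul[OF G]])

lemma gen_subalg_KX: "gen_subalg Q (cl ` (grp ` G \<union> lett D ` X)) = cl ` KX G X"
proof
  have "cl ` (grp ` G \<union> lett D ` X) \<subseteq> cl ` KX G X"
    using subgroup.one_closed[OF G] by (intro image_mono) (auto simp: KX_def grp_eq lett_eq)
  then show "gen_subalg Q (cl ` (grp ` G \<union> lett D ` X)) \<subseteq> cl ` KX G X"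
    unfolding gen_subalg_def using subalg_KX by (intro hull_minimal)
  show "cl ` KX G X \<subseteq> gen_subalg Q (cl ` (grp ` G \<union> lett D ` X))"
    unfolding gen_subalg_def hull_def
  proof (intro Inter_greatest, elim CollectE conjE)
    fix T assume T: "subalg Q T" "cl ` (grp ` G \<union> lett D ` X) \<subseteq> T"
    note h = subalg_hat[OF T(1)]
    have g: "bs h [] \<in> hat T" if "h \<in> G" for h
      using that T(2) subgroup.subset[OF G] by (auto simp: hat_def grp_eq)
    have l: "wl [y] \<in> hat T" if "y \<in> X" for y
      using that T(2) X by (auto simp: hat_def lett_eq)
    have w: "wl w \<in> hat T" if "w \<in> lists X" for w
      using that
    proof (induction w)
      case (Cons y w)
      have wW: "w \<in> W" "y \<in> letters D" using Cons X lists_mono[OF X(1)] by auto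
      have "wl [y] \<star> wl w \<in> hat T" using h(3)[OF l Cons.IH] Cons by simp
      then show ?case using wW by simp
    qed (use h(2) in simp)
    have "KX G X \<subseteq> hat T"
    proof
      fix a assume a: "a \<in> KX G X"
      show "a \<in> hat T"
      proof (rule kset_lin_mem[OF a[unfolded KX_def] lin_id h(1)])
        fix k v assume kv: "(k, v) \<in> G \<times> lists X"
        then have "bs k [] \<star> wl v \<in> hat T" using h(3)[OF g w] by simp
        moreover have "v \<in> W" using kv lists_mono[OF X(1)] by auto
        moreover have "k \<in> H" using kv subgroup.subset[OF G] by auto
        ultimately show "bs k v \<in> hat T" by simp
      qed
    qed
    then show "cl ` KX G X \<subseteq> T" by (auto simp: hat_def)
  qed
qed

text \<open>The second entries of the coproduct are expanded over a basis of the Borel part B modulo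
  the ideal. The first entries are then contractions, which lie in \<open>U\<close> by
  \<open>coideal_EE\<close> and in B because B is closed under the coproduct; so the coproduct lies
  in (U \<inter> B) \<otimes> B.\<close>

lemma coideal_KX:
  assumes U: "right_coideal_subalg Q (carrier Q) U"
  shows "right_coideal_subalg Q (cl ` KX G X) (U \<inter> cl ` KX G X)"
  unfolding right_coideal_subalg_def
proof (intro conjI ballI)
  have sa: "subalg Q U" and co: "\<And>u. u \<in> U \<Longrightarrow> comult Q u \<in> tens Q U (carrier Q)"
    using U by (auto simp: right_coideal_subalg_def)
  note h = subalg_hat[OF sa]
  show "subalg Q (U \<inter> cl ` KX G X)" by (rule subalg_Int[OF sa subalg_KX])
  fix u assume u: "u \<in> U \<inter> cl ` KX G X"
  then obtain a where a: "a \<in> KX G X" "u = cl a" by auto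
  then have aU: "a \<in> hat U" using u KX_CS by (auto simp: hat_def)
  have aC: "a \<in> CS" using a KX_CS by auto
  obtain p where "comult Q (cl a) = tens_class Q p"
    using co[of u] u a by (auto simp: tens_def)
  from comult_Q_class(2)[OF this] have eq: "comult Q u = tens_class Q (clt (Del a))" by (simp add: a)
  obtain E \<phi> Fv where E: "E \<subseteq> KX G X" "\<And>e. lfun (\<phi> e)" "\<And>e w. e \<in> E \<Longrightarrow> w \<in> I \<Longrightarrow> \<phi> e w = 0"
    "\<And>e e'. e \<in> E \<Longrightarrow> e' \<in> E \<Longrightarrow> \<phi> e e' = (if e = e' then 1 else 0)"
    "\<And>v. v \<in> KX G X \<Longrightarrow> finite (Fv v) \<and> Fv v \<subseteq> E"
    "\<And>v F. \<lbrakk>v \<in> KX G X; finite F; Fv v \<subseteq> F; F \<subseteq> E\<rbrakk> \<Longrightarrow> v - (\<Sum>e\<in>F. pm_scale (\<phi> e v) e) \<in> I"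
    by (rule relative_dual_basis_supports[OF I_subspace, of "KX G X"]) (rule that)
  have keys: "Poly_Mapping.keys (Del a) \<subseteq> KX G X \<times> KX G X" by (rule Del_keys[OF G X(2) a(1)])
  let ?F = "\<Union>s\<in>Poly_Mapping.keys (Del a). Fv (snd s)"
  have sndK: "snd s \<in> KX G X" if "s \<in> Poly_Mapping.keys (Del a)" for s using that keys by auto
  have F: "finite ?F" "?F \<subseteq> E" using E(5)[OF sndK] by auto
  have d: "clt (Del a) - (\<Sum>e\<in>?F. tq (EE (\<phi> e) (Del a)) e) \<in> TQ"
  proof (rule bimod_contract[OF TQ_bimod TQ_subspace CS_subspace I_CS])
    show "tq x y \<in> TQ" if "x \<in> CS" "y \<in> I" for x y by (rule tq_I[OF that])
    show "e \<in> CS" if "e \<in> ?F" for e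
      by (rule subsetD[OF KX_CS subsetD[OF E(1) subsetD[OF F(2) that]]])
    show "Poly_Mapping.keys (Del a) \<subseteq> CS \<times> CS" by (rule Del_CS[OF aC])
    fix x y assume s: "(x, y) \<in> Poly_Mapping.keys (Del a)"
    then have y: "y \<in> KX G X" using keys by auto
    have y': "Fv y \<subseteq> ?F" using s by force
    show "y - (\<Sum>e\<in>?F. pm_scale (\<phi> e y) e) \<in> I" by (rule E(6)[OF y F(1) y' F(2)])
  qed
  let ?p = "\<Sum>e\<in>?F. tq (EE (\<phi> e) (Del a)) e"
  have eq2: "comult Q u = tens_class Q ?p" unfolding eq by (rule tens_class_eqI[OF d])
  have "?p \<in> {p. Poly_Mapping.keys p \<subseteq> (U \<inter> cl ` KX G X) \<times> cl ` KX G X}"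
  proof (rule pm.subspace_sum[OF subspace_keys])
    fix e assume e: "e \<in> ?F"
    then have eE: "e \<in> E" by (rule subsetD[OF F(2)])
    have "EE (\<phi> e) (Del a) \<in> hat U" by (rule coideal_EE[OF U aU E(2) E(3)[OF eE]])
    moreover have "EE (\<phi> e) (Del a) \<in> KX G X"
      unfolding EE_def using keys by (intro lin_ext_mem KX_subspace) (auto intro!: pm.subspace_scale[OF KX_subspace])
    ultimately have "cl (EE (\<phi> e) (Del a)) \<in> U \<inter> cl ` KX G X" by (auto simp: hat_def)
    moreover have "cl e \<in> cl ` KX G X" using eE E(1) by auto
    ultimately show "tq (EE (\<phi> e) (Del a)) e \<in> {p. Poly_Mapping.keys p \<subseteq> (U \<inter> cl ` KX G X) \<times> cl ` KX G X}"
      by auto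
  qed
  then show "comult Q u \<in> tens Q (U \<inter> cl ` KX G X) (cl ` KX G X)"
    unfolding eq2 tens_def by blast
qed auto

end

lemma pos_part_eq: "pos_part D I = cl ` KX HGs (Pos ` idx D)"
  unfolding pos_part_def cl_def[symmetric, abs_def]
  by (subst gen_subalg_KX[symmetric]) (use HGs_subgroup gLp in \<open>auto simp: cl_def[abs_def] image_Un image_image\<close>)

lemma neg_part_eq: "neg_part D I = cl ` KX HFs (Neg ` idx D)"
  unfolding neg_part_def cl_def[symmetric, abs_def]
  by (subst gen_subalg_KX[symmetric]) (use HFs_subgroup gLm in \<open>auto simp: cl_def[abs_def] image_Un image_image\<close>)

lemma grp_alg_eq: "grp_alg D I G = cl ` kset (G \<times> {[]})"
  unfolding grp_alg_def kset_def cl_def by auto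

lemma finsum_cl:
  assumes "finite T" "\<And>s. s \<in> T \<Longrightarrow> f s \<in> CS"
  shows "finsum Q (\<lambda>s. cl (f s)) T = cl (\<Sum>s\<in>T. f s)"
  using assms
proof (induction T)
  case (insert s T)
  have "finsum Q (\<lambda>s. cl (f s)) (insert s T) = cl (f s) \<oplus>\<^bsub>Q\<^esub> finsum Q (\<lambda>s. cl (f s)) T"
    using insert by (intro QR.finsum_insert) (auto simp: Q_carrier)
  then show ?case using insert by (simp add: Q_add CS_sum)
qed (simp add: Q_zero)

text \<open>A linear lift of the multiplication of formal triples to the skew group algebra;
  choosing representatives affects it only modulo the ideal.\<close>

definition LP :: "(('g, 'f, 'k) skew_elem set \<times> ('g, 'f, 'k) skew_elem set \<times> ('g, 'f, 'k) skew_elem set \<Rightarrow>\<^sub>0 'k) \<Rightarrow> ('g, 'f, 'k) skew_elem" where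
  "LP = lin_ext (\<lambda>(x, y, z). rep x \<star> rep y \<star> rep z)"

lemma lin_LP: "lin LP" unfolding LP_def by (rule lin_lin_ext)

lemma mult3_formal_eq:
  assumes "Poly_Mapping.keys p \<subseteq> carrier Q \<times> carrier Q \<times> carrier Q"
  shows "mult3_formal Q p = cl (LP p)" "LP p \<in> CS"
proof -
  let ?f = "\<lambda>(x, y, z). pm_scale (Poly_Mapping.lookup p (x, y, z)) (rep x \<star> rep y \<star> rep z)"
  have k: "?f s \<in> CS \<and> (case s of (x, y, z) \<Rightarrow> Poly_Mapping.lookup p (x, y, z) \<odot>\<^bsub>Q\<^esub> (x \<otimes>\<^bsub>Q\<^esub> y \<otimes>\<^bsub>Q\<^esub> z)) = cl (?f s)"
    if "s \<in> Poly_Mapping.keys p" for s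
  proof -
    obtain x y z where s: "s = (x, y, z)" "x \<in> carrier Q" "y \<in> carrier Q" "z \<in> carrier Q"
      using \<open>s \<in> Poly_Mapping.keys p\<close> assms by auto
    note r = rep[OF s(2)] rep[OF s(3)] rep[OF s(4)]
    have "x \<otimes>\<^bsub>Q\<^esub> y \<otimes>\<^bsub>Q\<^esub> z = cl (rep x) \<otimes>\<^bsub>Q\<^esub> cl (rep y) \<otimes>\<^bsub>Q\<^esub> cl (rep z)" using r by metis
    also have "\<dots> = cl (rep x \<star> rep y \<star> rep z)" using r[THEN conjunct1] by (simp add: Q_mult)
    finally show ?thesis using r[THEN conjunct1] by (simp add: s(1) Q_smult CS_scale)
  qed
  have LPs: "LP p = (\<Sum>s\<in>Poly_Mapping.keys p. ?f s)"
    unfolding LP_def lin_ext_def by (intro sum.cong refl) auto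
  have "mult3_formal Q p = finsum Q (\<lambda>s. cl (?f s)) (Poly_Mapping.keys p)"
    unfolding mult3_formal_def
    by (rule QR.finsum_cong') (use k in \<open>auto simp: Q_carrier\<close>)
  also have "\<dots> = cl (LP p)" unfolding LPs using k by (intro finsum_cl) auto
  finally show "mult3_formal Q p = cl (LP p)" .
  show "LP p \<in> CS" unfolding LPs using k by (intro CS_sum) auto
qed

end

section \<open>Extraction of the factors\<close>

text \<open>
  A tensor all of whose contractions with functionals vanishing on \<open>J1\<close>, resp. \<open>J2\<close>, lie in \<open>U2\<close>,
  resp. \<open>U1\<close>, lies in \<open>U1 \<otimes> U2\<close> modulo \<open>J1 \<otimes> V2 + V1 \<otimes> J2\<close>.
\<close>

lemma tensor_extract:
  fixes g :: "('s \<Rightarrow>\<^sub>0 'k::field) \<Rightarrow> ('s \<Rightarrow>\<^sub>0 'k) \<Rightarrow> ('t \<Rightarrow>\<^sub>0 'k)"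
  assumes T: "finite T" and J: "pm.subspace J1" "pm.subspace J2" and U: "pm.subspace U2" and N: "pm.subspace N"
    and uv: "\<And>s. s \<in> T \<Longrightarrow> u s \<in> V1" "\<And>s. s \<in> T \<Longrightarrow> v s \<in> V2" and U2: "U2 \<subseteq> V2"
    and g: "\<And>y. lin (\<lambda>x. g x y)" "\<And>x. lin (g x)"
    and gN: "\<And>x y. x \<in> J1 \<Longrightarrow> y \<in> V2 \<Longrightarrow> g x y \<in> N" "\<And>x y. x \<in> V1 \<Longrightarrow> y \<in> J2 \<Longrightarrow> g x y \<in> N"
    and Y: "\<And>\<psi>. lfun \<psi> \<Longrightarrow> (\<And>x. x \<in> J1 \<Longrightarrow> \<psi> x = 0) \<Longrightarrow> (\<Sum>s\<in>T. pm_scale (c s * \<psi> (u s)) (v s)) \<in> U2"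
    and Z: "\<And>\<theta>. lfun \<theta> \<Longrightarrow> (\<And>x. x \<in> J2 \<Longrightarrow> \<theta> x = 0) \<Longrightarrow> (\<Sum>s\<in>T. pm_scale (c s * \<theta> (v s)) (u s)) \<in> U1"
  shows "(\<Sum>s\<in>T. pm_scale (c s) (g (u s) (v s))) \<in> pm.span (N \<union> {g x y | x y. x \<in> U1 \<and> y \<in> U2})"
    (is "_ \<in> pm.span (N \<union> ?G)")
proof -
  \<comment> \<open>\<open>E1\<close> is taken from all of \<open>V1\<close>, but \<open>E2\<close>
    only from \<open>U2\<close>: contraction of the first factors already lands in
    \<open>U2\<close>, so only elements of \<open>U2\<close> have to be expanded as second
    factors.\<close>
  obtain E1 \<phi>1 S1 where E1: "E1 \<subseteq> V1" "\<And>e. lfun (\<phi>1 e)" "\<And>e w. e \<in> E1 \<Longrightarrow> w \<in> J1 \<Longrightarrow> \<phi>1 e w = 0"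
    "\<And>e e'. e \<in> E1 \<Longrightarrow> e' \<in> E1 \<Longrightarrow> \<phi>1 e e' = (if e = e' then 1 else 0)"
    "\<And>v. v \<in> V1 \<Longrightarrow> finite (S1 v) \<and> S1 v \<subseteq> E1"
    "\<And>v F. \<lbrakk>v \<in> V1; finite F; S1 v \<subseteq> F; F \<subseteq> E1\<rbrakk> \<Longrightarrow> v - (\<Sum>e\<in>F. pm_scale (\<phi>1 e v) e) \<in> J1"
    by (rule relative_dual_basis_supports[OF J(1), of V1]) (rule that)
  obtain E2 \<phi>2 S2 where E2: "E2 \<subseteq> U2" "\<And>e. lfun (\<phi>2 e)" "\<And>e w. e \<in> E2 \<Longrightarrow> w \<in> J2 \<Longrightarrow> \<phi>2 e w = 0"
    "\<And>e e'. e \<in> E2 \<Longrightarrow> e' \<in> E2 \<Longrightarrow> \<phi>2 e e' = (if e = e' then 1 else 0)"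
    "\<And>v. v \<in> U2 \<Longrightarrow> finite (S2 v) \<and> S2 v \<subseteq> E2"
    "\<And>v F. \<lbrakk>v \<in> U2; finite F; S2 v \<subseteq> F; F \<subseteq> E2\<rbrakk> \<Longrightarrow> v - (\<Sum>e\<in>F. pm_scale (\<phi>2 e v) e) \<in> J2"
    by (rule relative_dual_basis_supports[OF J(2), of U2]) (rule that)
  define F1 where "F1 = (\<Union>s\<in>T. S1 (u s))"
  have F1: "finite F1" "F1 \<subseteq> E1" unfolding F1_def using T E1(5)[OF uv(1)] by auto
  define y where "y e = (\<Sum>s\<in>T. pm_scale (c s * \<phi>1 e (u s)) (v s))" for e
  have yU: "y e \<in> U2" if "e \<in> F1" for e
    unfolding y_def using that F1(2) by (intro Y E1(2) E1(3)[of e]) auto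
  define F2 where "F2 = (\<Union>e\<in>F1. S2 (y e))"
  have F2: "finite F2" "F2 \<subseteq> E2" unfolding F2_def using F1(1) E2(5)[OF yU] by auto
  define z where "z d = (\<Sum>s\<in>T. pm_scale (c s * \<phi>2 d (v s)) (u s))" for d
  have zU: "z d \<in> U1" if "d \<in> F2" for d
    unfolding z_def using that F2(2) by (intro Z E2(2) E2(3)[of d]) auto
  define r where "r s = u s - (\<Sum>e\<in>F1. pm_scale (\<phi>1 e (u s)) e)" for s
  have rJ: "r s \<in> J1" if s: "s \<in> T" for s
    unfolding r_def by (rule E1(6)[OF uv(1)[OF s] F1(1) _ F1(2)]) (use s in \<open>auto simp: F1_def\<close>)
  define r' where "r' e = y e - (\<Sum>d\<in>F2. pm_scale (\<phi>2 d (y e)) d)" for e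
  have rJ': "r' e \<in> J2" if e: "e \<in> F1" for e
    unfolding r'_def by (rule E2(6)[OF yU[OF e] F2(1) _ F2(2)]) (use e in \<open>auto simp: F2_def\<close>)
  note gs = lin_sum[OF g(1)] lin_sum[OF g(2)] lin_scale[OF g(1)] lin_scale[OF g(2)] lin_diff[OF g(1)] lin_diff[OF g(2)]
  have 1: "(\<Sum>s\<in>T. pm_scale (c s) (g (u s) (v s))) = (\<Sum>s\<in>T. pm_scale (c s) (g (r s) (v s))) + (\<Sum>e\<in>F1. g e (y e))"
  proof -
    have "(\<Sum>e\<in>F1. g e (y e)) = (\<Sum>s\<in>T. \<Sum>e\<in>F1. pm_scale (c s * \<phi>1 e (u s)) (g e (v s)))"
      by (subst sum.swap) (simp add: y_def gs)
    then show ?thesis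
      by (simp add: r_def gs pm.scale_right_diff_distrib sum_subtractf pm.scale_sum_right)
  qed
  have 2: "(\<Sum>e\<in>F1. g e (y e)) = (\<Sum>e\<in>F1. g e (r' e)) + (\<Sum>d\<in>F2. g (\<Sum>e\<in>F1. pm_scale (\<phi>2 d (y e)) e) d)"
  proof -
    have "(\<Sum>d\<in>F2. g (\<Sum>e\<in>F1. pm_scale (\<phi>2 d (y e)) e) d) = (\<Sum>e\<in>F1. \<Sum>d\<in>F2. pm_scale (\<phi>2 d (y e)) (g e d))"
      by (subst sum.swap) (simp add: gs)
    then show ?thesis by (simp add: r'_def gs sum_subtractf)
  qed
  \<comment> \<open>The vectors \<open>y e\<close> were formed from the coordinates of
    \<open>u s\<close> in \<open>E1\<close>, which miss only the remainder \<open>r s\<close> in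
    \<open>J1\<close>. Hence the coefficient of d is the contraction \<open>z d\<close> in
    \<open>U1\<close>, up to \<open>J1\<close>.\<close>
  have 3: "(\<Sum>e\<in>F1. pm_scale (\<phi>2 d (y e)) e) = z d - (\<Sum>s\<in>T. pm_scale (c s * \<phi>2 d (v s)) (r s))" for d
  proof -
    have "\<phi>2 d (y e) = (\<Sum>s\<in>T. c s * \<phi>1 e (u s) * \<phi>2 d (v s))" for e
      by (simp add: y_def lfun_sum[OF E2(2)] lfun_scale[OF E2(2)])
    then have "(\<Sum>e\<in>F1. pm_scale (\<phi>2 d (y e)) e) = (\<Sum>s\<in>T. \<Sum>e\<in>F1. pm_scale (c s * \<phi>1 e (u s) * \<phi>2 d (v s)) e)"
      by (subst sum.swap) (simp add: pm.scale_sum_left)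
    then show ?thesis
      by (simp add: z_def r_def pm.scale_right_diff_distrib sum_subtractf pm.scale_sum_right mult_ac)
  qed
  have sp: "N \<subseteq> pm.span (N \<union> ?G)" "?G \<subseteq> pm.span (N \<union> ?G)" using pm.span_superset[of "N \<union> ?G"] by auto
  have a: "(\<Sum>s\<in>T. pm_scale (c s) (g (r s) (v s))) \<in> pm.span (N \<union> ?G)"
    using gN(1)[OF rJ uv(2)] sp(1) by (intro pm.span_sum pm.span_scale) auto
  have b: "(\<Sum>e\<in>F1. g e (r' e)) \<in> pm.span (N \<union> ?G)"
  proof (rule pm.span_sum)
    fix e assume e: "e \<in> F1"
    show "g e (r' e) \<in> pm.span (N \<union> ?G)"
      by (rule subsetD[OF sp(1) gN(2)[OF subsetD[OF E1(1) subsetD[OF F1(2) e]] rJ'[OF e]]])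
  qed
  have c': "(\<Sum>d\<in>F2. g (\<Sum>e\<in>F1. pm_scale (\<phi>2 d (y e)) e) d) \<in> pm.span (N \<union> ?G)"
  proof (rule pm.span_sum)
    fix d assume d: "d \<in> F2"
    have dU: "d \<in> U2" using d F2(2) E2(1) by blast
    have "(\<Sum>s\<in>T. pm_scale (c s * \<phi>2 d (v s)) (r s)) \<in> J1"
      using rJ by (intro pm.subspace_sum pm.subspace_scale J)
    then have "g (\<Sum>s\<in>T. pm_scale (c s * \<phi>2 d (v s)) (r s)) d \<in> N" using dU U2 by (intro gN) auto
    moreover have "g (z d) d \<in> ?G" using zU[OF d] dU by blast
    ultimately show "g (\<Sum>e\<in>F1. pm_scale (\<phi>2 d (y e)) e) d \<in> pm.span (N \<union> ?G)"
      unfolding 3 lin_diff[OF g(1)] using sp by (intro pm.span_diff) auto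
  qed
  show ?thesis unfolding 1 2 using a b c' by (intro pm.span_add)
qed

section \<open>Index multisets of the negative and of the positive letters\<close>

fun nI :: "letter list \<Rightarrow> nat multiset" where
  "nI [] = {#}" | "nI (Neg i # w) = add_mset i (nI w)" | "nI (Pos i # w) = nI w"
fun pI :: "letter list \<Rightarrow> nat multiset" where
  "pI [] = {#}" | "pI (Pos i # w) = add_mset i (pI w)" | "pI (Neg i # w) = pI w"
fun isNeg where "isNeg (Neg i) = True" | "isNeg (Pos i) = False"

abbreviation ng where "ng w \<equiv> filter isNeg w"
abbreviation ps where "ps w \<equiv> filter (\<lambda>y. \<not> isNeg y) w"

lemma wdeg_lookup: "Poly_Mapping.lookup (sum_list (map ldeg w)) i = int (count (pI w) i) - int (count (nI w) i)"
  by (induction w rule: nI.induct) (auto simp: lookup_add lookup_minus lookup_single when_def)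

text \<open>The degree records the difference of the two index multisets, so at a fixed degree each
  of them determines the other. The equation is arranged with sums to avoid truncated subtraction of
  multisets.\<close>

lemma wdeg_eqD:
  assumes "sum_list (map ldeg w) = sum_list (map ldeg w')" shows "pI w + nI w' = pI w' + nI w"
proof (rule multiset_eqI)
  fix i
  show "count (pI w + nI w') i = count (pI w' + nI w) i"
    using wdeg_lookup[of w i] wdeg_lookup[of w' i] assms by simp
qed

lemma mset_ng: "mset (ng w) = image_mset Neg (nI w)"
  by (induction w rule: nI.induct) auto

lemma mset_ps: "mset (ps w) = image_mset Pos (pI w)"
  by (induction w rule: pI.induct) auto

lemma length_ng: "length (ng w) = size (nI w)" and length_ps: "length (ps w) = size (pI w)"
  using mset_ng[of w] mset_ps[of w] by (metis size_image_mset size_mset)+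

lemma image_mset_inj_eq:
  assumes "inj f" shows "image_mset f A = image_mset f B \<longleftrightarrow> A = B"
proof -
  have "image_mset (the_inv f) (image_mset f C) = C" for C
    using assms by (simp add: multiset.map_comp comp_def the_inv_f_f)
  then show ?thesis by metis
qed

context qJ
begin

sublocale qI D II
  by unfold_locales (rule ideal2_II)

lemma TW_split: "w \<in> TW \<Longrightarrow> ng w \<in> NW \<and> ps w \<in> PW \<and> ng w @ ps w = w"
proof -
  assume "w \<in> TW"
  then obtain u v where w: "w = u @ v" "u \<in> NW" "v \<in> PW" by (auto simp: TW_def)
  have u: "ng u = u \<and> ps u = []" using w(2) by (induction u) auto
  have v: "ps v = v \<and> ng v = []" using w(3) by (induction v) auto
  show ?thesis using w u v by simp
qed

lemma TW_subseq: assumes w: "w \<in> TW" and v: "subseq v w" shows "v \<in> TW"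
proof -
  from w obtain a b where ab: "w = a @ b" "a \<in> NW" "b \<in> PW" by (auto simp: TW_def)
  with v obtain v1 v2 where v12: "v = v1 @ v2" "subseq v1 a" "subseq v2 b"
    by (auto simp: subseq_append_iff[of v] elim!: subseq_appendE)
  have "set v1 \<subseteq> set a" "set v2 \<subseteq> set b"
    using v12 by (auto dest: list_emb_set)
  then have "v1 \<in> NW" "v2 \<in> PW" using ab unfolding in_lists_conv_set by auto
  then show ?thesis using v12 by (auto simp: TW_def)
qed

text \<open>Fixing the multiset \<open>M\<close> makes characters and group elements of the words
  seen by the functional constant, while \<psi> remains free to be any functional vanishing on
  \<open>Jm\<close> or \<open>Jp\<close>.\<close>

definition theta where
  "theta L h0 M \<psi> = fun_ext (\<lambda>(h, w). if h = h0 \<and> w \<in> lists (L ` idx D) \<and> mset w = M then \<psi> (wl w) else 0)"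

lemma lfun_theta: "lfun (theta L h0 M \<psi>)"
  unfolding theta_def by (rule lfun_fun_ext)

lemma theta_bs [simp]: "theta L h0 M \<psi> (bs h w) = (if h = h0 \<and> w \<in> lists (L ` idx D) \<and> mset w = M then \<psi> (wl w) else 0)"
  by (simp add: theta_def)

lemma kset_lfun_eq:
  assumes "a \<in> kset X" "lfun f" "lfun g" "\<And>h w. (h, w) \<in> X \<Longrightarrow> f (bs h w) = g (bs h w)"
  shows "f a = g a"
proof (rule lfun_eq_on_keys[OF assms(2,3)])
  fix s assume "s \<in> Poly_Mapping.keys a"
  then have "s \<in> X" using assms(1) by (auto simp: kset_def)
  then show "f (Poly_Mapping.single s 1) = g (Poly_Mapping.single s 1)"
    using assms(4)[of "fst s" "snd s"] by simp
qed

lemma theta_grp: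
  assumes "h \<in> H" "r \<in> VL L" "lfun \<psi>"
  shows "theta L h0 M \<psi> (bs h [] \<star> r) = (if h = h0 then \<psi> (mgr M r) else 0)"
proof (rule kset_lfun_eq[OF assms(2)[unfolded VL_def] lfun_comp[OF lfun_theta lin_mul_right]])
  show "lfun (\<lambda>r. if h = h0 then \<psi> (mgr M r) else 0)"
    using lfun_comp[OF assms(3) mgr_lin] lfun_const0 by (cases "h = h0") auto
qed (use assms in \<open>auto simp: mgr_bs lfun_zero\<close>)

lemma disj_words:
  "w \<in> NW \<Longrightarrow> w \<in> PW \<Longrightarrow> w = []"
  by (cases w) auto

text \<open>A generator h r v of \<open>K\<close> has purely negative words only if v is empty, and
  then \<psi> is applied to a component of r, which lies in \<open>Jm\<close>. In a generator h u r
  with r in \<open>Jp\<close> every word has a positive letter, because \<open>goodJ\<close>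
  excludes the empty word.\<close>

lemma theta_K_Neg:
  assumes \<psi>: "lfun \<psi>" "\<And>x. x \<in> Jm \<Longrightarrow> \<psi> x = 0" and k: "k \<in> K"
  shows "theta Neg h0 M \<psi> k = 0"
proof (rule span_lfun_zero[OF lfun_theta _ k[unfolded K_def]])
  fix x assume "x \<in> Kgen"
  then consider h r v where "x = bs h [] \<star> r \<star> wl v" "h \<in> H" "r \<in> Jm" "v \<in> PW"
    | h u r where "x = bs h [] \<star> wl u \<star> r" "h \<in> H" "u \<in> NW" "r \<in> Jp"
    unfolding Kgen_def by blast
  then show "theta Neg h0 M \<psi> x = 0"
  proof cases
    case 1
    have rV: "r \<in> VL Neg" using 1 good_VL[OF Jm] by auto
    show ?thesis
    proof (cases "v = []")
      case True
      have "mgr M r \<in> Jm" using good_mgr[OF Jm] 1 by auto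
      then show ?thesis
        using 1 True theta_grp[OF 1(2) rV \<psi>(1)] \<psi>(2) Jm_CS[OF 1(3)] by simp
    next
      case False
      have "bs h [] \<star> r \<in> kset (UNIV \<times> NW)"
        by (rule kset_mul[OF _ rV[unfolded VL_def], of _ "{(h, [])}"]) auto
      then have "x \<in> kset (UNIV \<times> {u @ v | u. u \<in> NW})"
        unfolding 1(1) by (rule kset_mul[of _ _ _ "{(eH, v)}"]) auto
      then show ?thesis
        by (rule kset_lfun_zero[OF _ lfun_theta]) (use False 1(4) disj_words in auto)
    qed
  next
    case 2
    have rV: "r \<in> kset ({eH} \<times> (PW - {[]}))" using 2 good_kset[OF Jp] by auto
    have "x \<in> kset (UNIV \<times> {u @ v | u v. v \<in> PW - {[]}})"
      unfolding 2(1) by (rule kset_mul[OF _ rV, of _ UNIV]) (auto simp: kset_def)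
    then show ?thesis
      by (rule kset_lfun_zero[OF _ lfun_theta]) (use disj_words in auto)
  qed
qed

lemma theta_K_Pos:
  assumes \<psi>: "lfun \<psi>" "\<And>x. x \<in> Jp \<Longrightarrow> \<psi> x = 0" and k: "k \<in> K"
  shows "theta Pos h0 M \<psi> k = 0"
proof (rule span_lfun_zero[OF lfun_theta _ k[unfolded K_def]])
  fix x assume "x \<in> Kgen"
  then consider h r v where "x = bs h [] \<star> r \<star> wl v" "h \<in> H" "r \<in> Jm" "v \<in> PW"
    | h u r where "x = bs h [] \<star> wl u \<star> r" "h \<in> H" "u \<in> NW" "r \<in> Jp"
    unfolding Kgen_def by blast
  then show "theta Pos h0 M \<psi> x = 0"
  proof cases
    case 2
    have rV: "r \<in> VL Pos" using 2 good_VL[OF Jp] by auto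
    show ?thesis
    proof (cases "u = []")
      case True
      have "mgr M r \<in> Jp" using good_mgr[OF Jp] 2 by auto
      then show ?thesis
        using 2 True theta_grp[OF 2(2) rV \<psi>(1)] \<psi>(2) by simp
    next
      case False
      have "x \<in> kset (UNIV \<times> {u @ v | v. v \<in> PW})"
        unfolding 2(1) by (rule kset_mul[OF _ rV[unfolded VL_def], of _ "UNIV \<times> {u}"]) auto
      then show ?thesis
        by (rule kset_lfun_zero[OF _ lfun_theta]) (use False 2(3) disj_words in auto)
    qed
  next
    case 1
    have rV: "r \<in> kset ({eH} \<times> (NW - {[]}))" using 1 good_kset[OF Jm] by auto
    have "bs h [] \<star> r \<in> kset (UNIV \<times> (NW - {[]}))"
      by (rule kset_mul[OF _ rV, of _ "{(h, [])}"]) auto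
    then have "x \<in> kset (UNIV \<times> {u @ v | u v. u \<in> NW - {[]}})"
      unfolding 1(1) by (rule kset_mul[of _ _ _ "UNIV"]) (auto simp: kset_def)
    then show ?thesis
      by (rule kset_lfun_zero[OF _ lfun_theta]) (use disj_words in auto)
  qed
qed

lemma lfun_theta_nu: "lfun (\<lambda>a. theta L h0 M \<psi> (nu a))"
  by (rule lfun_comp[OF lfun_theta lin_nu])

lemma nu_grp_bs: "h \<in> H \<Longrightarrow> h' \<in> H \<Longrightarrow> w \<in> TW \<Longrightarrow> nu (bs h [] \<star> bs h' w) = bs h [] \<star> bs h' w"
  by (simp add: nu_tri_bs)

text \<open>Subsequences of a triangular word are triangular, so \<open>nu\<close> is the identity
  on all second tensor factors that occur.\<close>

lemma EE_nu:
  assumes l: "lfun \<theta>" and h: "h \<in> H" and w: "w \<in> TW"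
  shows "EE (\<lambda>b. \<theta> (nu b)) (Del (bs h w)) = bs h [] \<star> EE (\<lambda>b. \<theta> (bs h [] \<star> b)) (dw w)"
proof -
  have "EE (\<lambda>b. \<theta> (nu (bs h [] \<star> b))) (dw w) = EE (\<lambda>b. \<theta> (bs h [] \<star> b)) (dw w)"
    by (rule EE_subseq_cong[OF TW_W[OF w] lfun_Lmul[OF lfun_comp[OF l lin_nu]] lfun_Lmul[OF l]])
      (use h TW_subseq[OF w] nu_grp_bs in \<open>auto simp del: bil_ext_single\<close>)
  then show ?thesis unfolding EE_delta by simp
qed

text \<open>The functional kills positive letters in the second factor, so v stays in the first. As
  u is not longer than \<open>M\<close> allows, it counts only if it moves to the second factor
  completely, leaving its group element behind.\<close>

lemma EE_theta_Neg:
  assumes h: "h \<in> H" and u: "u \<in> NW" and v: "v \<in> PW" and len: "length u \<le> size M"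
  shows "EE (\<lambda>b. theta Neg h0 M \<psi> (nu b)) (Del (bs h (u @ v))) =
    (if h = h0 \<and> mset u = M then pm_scale (\<psi> (wl u)) (bs (h \<cdot> wgrp D u) [] \<star> wl v) else 0)"
proof -
  let ?\<theta> = "\<lambda>b. theta Neg h0 M \<psi> (bs h [] \<star> b)"
  have uv: "u @ v \<in> TW" using u v by (auto simp: TW_def)
  have k: "kills ?\<theta> (range Pos)"
    using h unfolding kills_def by (auto simp: lfun_Lmul lfun_theta in_lists_conv_set)
  have E: "EE ?\<theta> (dw (u @ v)) = EE ?\<theta> (dw u) \<star> wl v"
    by (rule EE_kills_append[OF k NW_W[OF u] PW_W[OF v]]) (use v in \<open>auto simp: in_lists_conv_set\<close>)
  have l: "lfun ?\<theta>" by (intro lfun_Lmul lfun_theta)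
  have z: "?\<theta> (bs h' w) = 0" if "h' \<in> H" "length w \<noteq> size M" for h' w
    using that h by auto
  have "EE ?\<theta> (dw u) = (if h = h0 \<and> mset u = M then pm_scale (\<psi> (wl u)) (bs (wgrp D u) []) else 0)"
  proof (cases "length u = size M")
    case True
    have "EE ?\<theta> (dw u) = pm_scale (?\<theta> (wl u)) (bs (wgrp D u) [])"
      by (rule EE_top[OF NW_W[OF u] l]) (use True z in auto)
    then show ?thesis using h u by (auto split: if_splits)
  next
    case False
    have "EE ?\<theta> (dw u) = 0"
      by (rule EE_kill[OF NW_W[OF u] l]) (use False len z in auto)
    then show ?thesis using False by auto
  qed
  then show ?thesis
    unfolding EE_nu[OF lfun_theta h uv] E using h NW_W[OF u] PW_W[OF v]
    by (auto simp: mul_scale_left mul_scale_right)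
qed

text \<open>The same with the signs exchanged: u stays in the first factor, and the group element
  left by v stands to the right of u.\<close>

lemma EE_theta_Pos:
  assumes h: "h \<in> H" and u: "u \<in> NW" and v: "v \<in> PW" and len: "length v \<le> size M"
  shows "EE (\<lambda>b. theta Pos h0 M \<psi> (nu b)) (Del (bs h (u @ v))) =
    (if h = h0 \<and> mset v = M then pm_scale (\<psi> (wl v)) (bs h [] \<star> wl u \<star> bs (wgrp D v) []) else 0)"
proof -
  let ?\<theta> = "\<lambda>b. theta Pos h0 M \<psi> (bs h [] \<star> b)"
  have uv: "u @ v \<in> TW" using u v by (auto simp: TW_def)
  have k: "kills ?\<theta> (range Neg)"
    using h unfolding kills_def by (auto simp: lfun_Lmul lfun_theta in_lists_conv_set)
  have E: "EE ?\<theta> (dw (u @ v)) = wl u \<star> EE ?\<theta> (dw v)"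
    by (rule EE_kills_prepend[OF k NW_W[OF u] _ PW_W[OF v]]) (use u in \<open>auto simp: in_lists_conv_set\<close>)
  have l: "lfun ?\<theta>" by (intro lfun_Lmul lfun_theta)
  have z: "?\<theta> (bs h' w) = 0" if "h' \<in> H" "length w \<noteq> size M" for h' w
    using that h by auto
  have "EE ?\<theta> (dw v) = (if h = h0 \<and> mset v = M then pm_scale (\<psi> (wl v)) (bs (wgrp D v) []) else 0)"
  proof (cases "length v = size M")
    case True
    have "EE ?\<theta> (dw v) = pm_scale (?\<theta> (wl v)) (bs (wgrp D v) [])"
      by (rule EE_top[OF PW_W[OF v] l]) (use True z in auto)
    then show ?thesis using h v by (auto split: if_splits)
  next
    case False
    have "EE ?\<theta> (dw v) = 0"
      by (rule EE_kill[OF PW_W[OF v] l]) (use False len z in auto)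
    then show ?thesis using False by auto
  qed
  then show ?thesis
    unfolding EE_nu[OF lfun_theta h uv] E using h NW_W[OF u] PW_W[OF v]
    by (cases "h = h0 \<and> mset v = M")
      (auto simp: mul_scale_left mul_scale_right mul_assoc simp del: bil_ext_single pm_scale_single)
qed

section \<open>A right coideal subalgebra containing k[H]\<close>

context
  fixes U
  assumes U: "right_coideal_subalg Q (carrier Q) U" and kHU: "kH D II \<subseteq> U"
begin

abbreviation (input) Uh where "Uh \<equiv> hat U"
abbreviation (input) Umi where "Umi \<equiv> hat U \<inter> VL Neg"
abbreviation (input) Upl where "Upl \<equiv> hat U \<inter> VL Pos"

lemma U_subalg: "subalg Q U" using U by (simp add: right_coideal_subalg_def)

lemmas Uh_facts = subalg_hat[OF U_subalg]

lemma Uh_grp: "h \<in> H \<Longrightarrow> bs h [] \<in> Uh"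
proof -
  assume h: "h \<in> H"
  have "cl (bs h []) \<in> kH D II" unfolding grp_alg_eq using h by auto
  then show ?thesis using kHU h by (auto simp: hat_def)
qed

lemma Uh_CS: "a \<in> Uh \<Longrightarrow> a \<in> CS" by (simp add: hat_def)

lemma Uh_cancel_left:
  assumes "h \<in> H" "a \<in> CS" "bs h [] \<star> a \<in> Uh" shows "a \<in> Uh"
proof -
  have "bs (hinv h) [] \<star> (bs h [] \<star> a) \<in> Uh"
    by (rule Uh_facts(3)[OF Uh_grp assms(3)]) (use assms in simp)
  moreover have "bs (hinv h) [] \<star> (bs h [] \<star> a) = a" using assms by (subst mul_assoc[symmetric]) auto
  ultimately show ?thesis by simp
qed

lemma Uh_cancel_right:
  assumes "h \<in> H" "a \<in> CS" "a \<star> bs h [] \<in> Uh" shows "a \<in> Uh"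
proof -
  have "a \<star> bs h [] \<star> bs (hinv h) [] \<in> Uh"
    by (rule Uh_facts(3)[OF assms(3) Uh_grp]) (use assms in simp)
  moreover have "a \<star> bs h [] \<star> bs (hinv h) [] = a" using assms by (subst mul_assoc) auto
  ultimately show ?thesis by simp
qed

lemma Uh_theta_Neg:
  assumes "a \<in> Uh" "lfun \<psi>" "\<And>x. x \<in> Jm \<Longrightarrow> \<psi> x = 0"
  shows "EE (\<lambda>b. theta Neg h0 M \<psi> (nu b)) (Del a) \<in> Uh"
  by (rule coideal_EE[OF U assms(1) lfun_theta_nu]) (rule theta_K_Neg[OF assms(2,3) nu_II])

lemma Uh_theta_Pos:
  assumes "a \<in> Uh" "lfun \<psi>" "\<And>x. x \<in> Jp \<Longrightarrow> \<psi> x = 0"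
  shows "EE (\<lambda>b. theta Pos h0 M \<psi> (nu b)) (Del a) \<in> Uh"
  by (rule coideal_EE[OF U assms(1) lfun_theta_nu]) (rule theta_K_Pos[OF assms(2,3) nu_II])

text \<open>The preimage of the space of products H U^- U^+, with U^- and U^+ represented by
  elements without group factors. The aim is to show that it exhausts the preimage of
  \<open>U\<close>.\<close>

definition Zs where "Zs = pm.span (II \<union> (\<Union>h\<in>H. {bs h [] \<star> x \<star> y | x y. x \<in> Umi \<and> y \<in> Upl}))"

lemma Zs_subspace: "pm.subspace Zs" unfolding Zs_def by (rule pm.subspace_span)

lemma Zs_Uh: "Zs \<subseteq> Uh"
  unfolding Zs_def
  by (rule pm.span_minimal[OF _ Uh_facts(1)]) (use Uh_facts(3,4) Uh_grp in auto)

text \<open>At a fixed group element, the terms with the index multiset of maximal size form a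
  tensor in negative and positive words. Contractions by \<open>theta\<close> of either sign produce
  its partial contractions up to group factors, which can be cancelled in \<open>U\<close>; then
  \<open>tensor_extract\<close> applies.\<close>

lemma extract_component:
  assumes a: "a \<in> Uh" "a \<in> TR"
    and deg: "\<And>h w. (h, w) \<in> Poly_Mapping.keys a \<Longrightarrow> wdeg w = \<gamma>"
    and s0: "(h1, w1) \<in> Poly_Mapping.keys a"
    and mx: "\<And>h w. (h, w) \<in> Poly_Mapping.keys a \<Longrightarrow> size (nI w) \<le> size (nI w1)"
    and h0: "h0 \<in> H"
  shows "restr (\<lambda>(h, w). h = h0 \<and> nI w = nI w1) a \<in> Zs"
proof -
  let ?M = "nI w1" and ?P = "pI w1"
  \<comment> \<open>Since the degree is fixed, maximality of the negative part carries over to the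
    positive part. This supplies the length bounds for both kinds of contraction and shows that both
    select the same terms.\<close>
  have key: "h \<in> H \<and> ng w \<in> NW \<and> ps w \<in> PW \<and> ng w @ ps w = w \<and> size (nI w) \<le> size ?M \<and> size (pI w) \<le> size ?P \<and>
     (nI w = ?M \<longleftrightarrow> pI w = ?P)"
    if "(h, w) \<in> Poly_Mapping.keys a" for h w
  proof -
    have hw: "h \<in> H" "w \<in> TW" using that a(2) by (auto simp: TR_def kset_def)
    have e: "pI w + nI w1 = pI w1 + nI w" using deg[OF that] deg[OF s0] by (intro wdeg_eqD) simp
    then have "size (pI w) + size (nI w1) = size (pI w1) + size (nI w)" by (metis size_union)
    with mx[OF that] have "size (pI w) \<le> size ?P" by simp
    moreover have "nI w = ?M \<longleftrightarrow> pI w = ?P" using e by (metis add.commute add_left_cancel)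
    ultimately show ?thesis using TW_split[OF hw(2)] hw mx[OF that] by blast
  qed
  let ?t = "restr (\<lambda>(h, w). h = h0 \<and> nI w = ?M) a"
  let ?T = "Poly_Mapping.keys ?t"
  have T: "h = h0 \<and> nI w = ?M \<and> (h, w) \<in> Poly_Mapping.keys a" if "(h, w) \<in> ?T" for h w
    using that by (auto simp: keys_restr)
  let ?u = "\<lambda>s. wl (ng (snd s))" and ?v = "\<lambda>s. wl (ps (snd s))" and ?c = "Poly_Mapping.lookup ?t"
  have Tk: "snd s \<in> TW \<and> ng (snd s) \<in> NW \<and> ps (snd s) \<in> PW \<and> fst s = h0 \<and> nI (snd s) = ?M \<and> pI (snd s) = ?P \<and> ng (snd s) @ ps (snd s) = snd s"
    if s: "s \<in> ?T" for s
  proof -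
    obtain h w where hw: "s = (h, w)" by (cases s)
    then have k: "(h, w) \<in> Poly_Mapping.keys a" "h = h0" "nI w = ?M" using T[of h w] s by auto
    have "w \<in> TW" using k(1) a(2) by (auto simp: TR_def kset_def)
    then show ?thesis using key[OF k(1)] k(2,3) hw by simp
  qed
  let ?g = "\<lambda>x y. bs h0 [] \<star> x \<star> y"
  have t: "?t = (\<Sum>s\<in>?T. pm_scale (?c s) (?g (?u s) (?v s)))"
  proof -
    have "?t = (\<Sum>s\<in>?T. Poly_Mapping.single s (?c s))" by (rule pm_expand)
    also have "\<dots> = (\<Sum>s\<in>?T. pm_scale (?c s) (?g (?u s) (?v s)))"
    proof (rule sum.cong[OF refl])
      fix s assume "s \<in> ?T"
      note k = Tk[OF this]
      have "?g (?u s) (?v s) = bs h0 (ng (snd s) @ ps (snd s))"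
        using h0 NW_W[of "ng (snd s)"] PW_W[of "ps (snd s)"] k by simp
      then have "?g (?u s) (?v s) = Poly_Mapping.single s 1" using k by (metis prod.collapse)
      then show "Poly_Mapping.single s (?c s) = pm_scale (?c s) (?g (?u s) (?v s))" by simp
    qed
    finally show ?thesis .
  qed
  let ?gM = "wgrp D (ng w1)" and ?gP = "wgrp D (ps w1)"
  have w1: "ng w1 \<in> NW" "ps w1 \<in> PW" using key[OF s0] by auto
  have gM: "wgrp D (ng w) = ?gM" if "nI w = ?M" "ng w \<in> NW" for w
    by (rule wgrp_mset[OF _ NW_W[OF that(2)]]) (simp only: mset_ng that(1))
  have gP: "wgrp D (ps w) = ?gP" if "pI w = ?P" "ps w \<in> PW" for w
    by (rule wgrp_mset[OF _ PW_W[OF that(2)]]) (simp only: mset_ps that(1))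
  have gH: "?gM \<in> H" "?gP \<in> H" using w1 NW_W PW_W by auto
  have Y: "(\<Sum>s\<in>?T. pm_scale (?c s * \<psi> (?u s)) (?v s)) \<in> Upl"
    if \<psi>: "lfun \<psi>" "\<And>x. x \<in> Jm \<Longrightarrow> \<psi> x = 0" for \<psi>
  proof -
    let ?y = "\<lambda>b. lin_ext (\<lambda>(h, w). pm_scale (\<psi> (wl (ng w))) (wl (ps w))) (restr (\<lambda>(h, w). h = h0 \<and> nI w = ?M) b)"
    have y: "(\<Sum>s\<in>?T. pm_scale (?c s * \<psi> (?u s)) (?v s)) = ?y a"
      by (simp add: lin_ext_def case_prod_beta)
    have yV: "?y a \<in> VL Pos"
    proof (rule lin_ext_mem[OF VL_subspace])
      fix s assume "s \<in> ?T"
      from Tk[OF this] have "wl (ps (snd s)) \<in> VL Pos" by (intro VL_wl) blast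
      then show "(case s of (h, w) \<Rightarrow> pm_scale (\<psi> (wl (ng w))) (wl (ps w))) \<in> VL Pos"
        unfolding case_prod_beta by (rule pm.subspace_scale[OF VL_subspace])
    qed
    \<comment> \<open>Terms with another group element or another index multiset contribute nothing.
      The selected ones share the group factor h0 g_u, because g_u depends only on the
      multiset.\<close>
    have "EE (\<lambda>b. theta Neg h0 (image_mset Neg ?M) \<psi> (nu b)) (Del a) = bs (h0 \<cdot> ?gM) [] \<star> ?y a"
    proof (rule lin_eq_on_keys[OF lin_comp[OF lin_EE lin_Del] lin_comp[OF lin_mul_right lin_comp[OF lin_lin_ext lin_restr]]])
      fix s assume s: "s \<in> Poly_Mapping.keys a"
      obtain h w where hw: "s = (h, w)" by (cases s)
      note k = key[of h w, OF s[unfolded hw]]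
      have m: "mset (ng w) = image_mset Neg ?M \<longleftrightarrow> nI w = ?M"
        unfolding mset_ng by (rule image_mset_inj_eq) (simp add: inj_def)
      have "EE (\<lambda>b. theta Neg h0 (image_mset Neg ?M) \<psi> (nu b)) (Del (bs h (ng w @ ps w))) =
         (if h = h0 \<and> nI w = ?M then pm_scale (\<psi> (wl (ng w))) (bs (h \<cdot> wgrp D (ng w)) [] \<star> wl (ps w)) else 0)"
        using EE_theta_Neg[of h "ng w" "ps w" "image_mset Neg ?M" h0 \<psi>] k by (simp add: m length_ng del: bil_ext_single pm_scale_single mset_filter)
      also have "ng w @ ps w = w" using k by simp
      finally show "EE (\<lambda>b. theta Neg h0 (image_mset Neg ?M) \<psi> (nu b)) (Del (Poly_Mapping.single s 1)) = bs (h0 \<cdot> ?gM) [] \<star> ?y (Poly_Mapping.single s 1)"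
        using gM[of w] k by (simp add: hw mul_scale_right del: bil_ext_single pm_scale_single)
    qed
    then have m1: "bs (h0 \<cdot> ?gM) [] \<star> ?y a \<in> Uh"
      using Uh_theta_Neg[OF a(1) \<psi>, of h0 "image_mset Neg ?M"] by simp
    have m2: "?y a \<in> CS" by (rule subsetD[OF VL_CS yV]) simp
    have "?y a \<in> Uh" by (rule Uh_cancel_left[OF HG.m_closed[OF h0 gH(1)] m2 m1])
    with yV show ?thesis unfolding y by blast
  qed
  have Z: "(\<Sum>s\<in>?T. pm_scale (?c s * \<psi> (?v s)) (?u s)) \<in> Umi"
    if \<psi>: "lfun \<psi>" "\<And>x. x \<in> Jp \<Longrightarrow> \<psi> x = 0" for \<psi>
  proof -
    let ?y = "\<lambda>b. lin_ext (\<lambda>(h, w). pm_scale (\<psi> (wl (ps w))) (wl (ng w))) (restr (\<lambda>(h, w). h = h0 \<and> nI w = ?M) b)"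
    have y: "(\<Sum>s\<in>?T. pm_scale (?c s * \<psi> (?v s)) (?u s)) = ?y a"
      by (simp add: lin_ext_def case_prod_beta)
    have yV: "?y a \<in> VL Neg"
    proof (rule lin_ext_mem[OF VL_subspace])
      fix s assume "s \<in> ?T"
      from Tk[OF this] have "wl (ng (snd s)) \<in> VL Neg" by (intro VL_wl) blast
      then show "(case s of (h, w) \<Rightarrow> pm_scale (\<psi> (wl (ps w))) (wl (ng w))) \<in> VL Neg"
        unfolding case_prod_beta by (rule pm.subspace_scale[OF VL_subspace])
    qed
    have "EE (\<lambda>b. theta Pos h0 (image_mset Pos ?P) \<psi> (nu b)) (Del a) = bs h0 [] \<star> ?y a \<star> bs ?gP []"
    proof (rule lin_eq_on_keys[OF lin_comp[OF lin_EE lin_Del] lin_comp[OF lin_mul_left lin_comp[OF lin_mul_right lin_comp[OF lin_lin_ext lin_restr]]]])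
      fix s assume s: "s \<in> Poly_Mapping.keys a"
      obtain h w where hw: "s = (h, w)" by (cases s)
      note k = key[of h w, OF s[unfolded hw]]
      have m: "mset (ps w) = image_mset Pos ?P \<longleftrightarrow> nI w = ?M"
        using k unfolding mset_ps by (subst image_mset_inj_eq) (auto simp: inj_def)
      have "EE (\<lambda>b. theta Pos h0 (image_mset Pos ?P) \<psi> (nu b)) (Del (bs h (ng w @ ps w))) =
         (if h = h0 \<and> nI w = ?M then pm_scale (\<psi> (wl (ps w))) (bs h [] \<star> wl (ng w) \<star> bs (wgrp D (ps w)) []) else 0)"
        using EE_theta_Pos[of h "ng w" "ps w" "image_mset Pos ?P" h0 \<psi>] k by (simp add: m length_ps del: bil_ext_single pm_scale_single mset_filter)
      also have "ng w @ ps w = w" using k by simp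
      finally show "EE (\<lambda>b. theta Pos h0 (image_mset Pos ?P) \<psi> (nu b)) (Del (Poly_Mapping.single s 1)) = bs h0 [] \<star> ?y (Poly_Mapping.single s 1) \<star> bs ?gP []"
        using gP[of w] k by (simp add: hw mul_scale_right mul_scale_left del: bil_ext_single pm_scale_single)
    qed
    then have m1: "bs h0 [] \<star> ?y a \<star> bs ?gP [] \<in> Uh"
      using Uh_theta_Pos[OF a(1) \<psi>, of h0 "image_mset Pos ?P"] by simp
    have yC: "?y a \<in> CS" by (rule subsetD[OF VL_CS yV]) simp
    have "bs h0 [] \<star> ?y a \<in> Uh"
      by (rule Uh_cancel_right[OF gH(2) mul_closed[OF CS_single[OF h0] yC] m1]) simp
    then have "?y a \<in> Uh" by (rule Uh_cancel_left[OF h0 yC])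
    with yV show ?thesis unfolding y by blast
  qed
  have "(\<Sum>s\<in>?T. pm_scale (?c s) (?g (?u s) (?v s))) \<in> pm.span (II \<union> {?g x y | x y. x \<in> Umi \<and> y \<in> Upl})"
  proof (rule tensor_extract[where ?V1.0 = "VL Neg" and ?V2.0 = "VL Pos" and ?J1.0 = Jm and ?J2.0 = Jp])
    show "pm.subspace Upl" by (rule pm.subspace_inter[OF Uh_facts(1) VL_subspace])
    show "?u s \<in> VL Neg" if "s \<in> ?T" for s using Tk[OF that] by (intro VL_wl) blast
    show "?v s \<in> VL Pos" if "s \<in> ?T" for s using Tk[OF that] by (intro VL_wl) blast
    show "?g x y \<in> II" if "x \<in> Jm" "y \<in> VL Pos" for x y by (rule K_II[OF K1[OF h0 that]])
    show "?g x y \<in> II" if "x \<in> VL Neg" "y \<in> Jp" for x y by (rule K_II[OF K2[OF h0 that(2,1)]])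
    show "lin (\<lambda>x. ?g x y)" for y by (intro lin_comp[OF lin_mul_left] lin_mul_right)
    show "lin (?g x)" for x by (rule lin_mul_right)
    show "(\<Sum>s\<in>?T. pm_scale (?c s * \<psi> (?u s)) (?v s)) \<in> Upl"
      if "lfun \<psi>" "\<And>x. x \<in> Jm \<Longrightarrow> \<psi> x = 0" for \<psi> using that by (rule Y)
    show "(\<Sum>s\<in>?T. pm_scale (?c s * \<psi> (?v s)) (?u s)) \<in> Umi"
      if "lfun \<psi>" "\<And>x. x \<in> Jp \<Longrightarrow> \<psi> x = 0" for \<psi> using that by (rule Z)
  qed (simp_all add: Jm_subspace Jp_subspace II_subspace)
  also have "\<dots> \<subseteq> Zs" unfolding Zs_def using h0 by (intro pm.span_mono) auto
  finally show ?thesis by (simp only: t[symmetric])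
qed

text \<open>Induction on the number of index multisets of negative parts that occur: one of maximal
  size is removed, which may leave others of the same size for later.\<close>

lemma homogeneous_Zs:
  assumes "a \<in> Uh" "a \<in> TR" "\<And>h w. (h, w) \<in> Poly_Mapping.keys a \<Longrightarrow> wdeg w = \<gamma>"
  shows "a \<in> Zs"
  using assms
proof (induction "card ((\<lambda>(h, w). nI w) ` Poly_Mapping.keys a)" arbitrary: a rule: less_induct)
  case less
  show ?case
  proof (cases "a = 0")
    case True
    then show ?thesis using pm.subspace_0[OF Zs_subspace] by simp
  next
    case False
    let ?S = "(\<lambda>(h, w). nI w) ` Poly_Mapping.keys a"
    have S: "?S \<noteq> {}" "finite ?S" using False by auto
    have "Max (size ` ?S) \<in> size ` ?S" using S by (intro Max_in) auto
    then obtain M where M0: "M \<in> ?S" "size M = Max (size ` ?S)"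
      by (elim imageE) (metis imageI)
    have M: "M \<in> ?S" "\<And>N. N \<in> ?S \<Longrightarrow> size N \<le> size M"
      using S M0 by simp_all
    obtain h1 w1 where s0: "(h1, w1) \<in> Poly_Mapping.keys a" "M = nI w1" using M0(1) by auto
    have mx: "size (nI w) \<le> size (nI w1)" if "(h, w) \<in> Poly_Mapping.keys a" for h w
      using M(2)[of "nI w"] that s0(2) by force
    let ?top = "restr (\<lambda>(h, w). nI w = nI w1) a"
    have "?top = (\<Sum>h\<in>fst ` Poly_Mapping.keys ?top. restr (\<lambda>s. fst s = h) ?top)"
      by (rule sum_restr_fibres[symmetric]) auto
    also have "\<dots> \<in> Zs"
    proof (rule pm.subspace_sum[OF Zs_subspace])
      fix h assume "h \<in> fst ` Poly_Mapping.keys ?top"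
      then have "h \<in> H" using less.prems(2) by (auto simp: keys_restr TR_def kset_def)
      from extract_component[OF less.prems(1,2,3) s0(1) mx this]
      show "restr (\<lambda>s. fst s = h) ?top \<in> Zs" by (simp add: restr_restr case_prod_beta')
    qed
    finally have top: "?top \<in> Zs" .
    \<comment> \<open>All words with this index multiset go at once, over every group element, so
      the number of multisets drops.\<close>
    let ?b = "a - ?top"
    have kb: "Poly_Mapping.keys ?b = {s \<in> Poly_Mapping.keys a. nI (snd s) \<noteq> nI w1}"
      by (auto simp: in_keys_iff lookup_minus lookup_restr split: if_splits)
    have "?b \<in> Zs"
    proof (rule less.hyps)
      have "(\<lambda>(h, w). nI w) ` Poly_Mapping.keys ?b \<subset> ?S"
      proof
        show "(\<lambda>(h, w). nI w) ` Poly_Mapping.keys ?b \<subseteq> ?S" unfolding kb by auto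
        have "nI w1 \<notin> (\<lambda>(h, w). nI w) ` Poly_Mapping.keys ?b" unfolding kb by auto
        moreover have "nI w1 \<in> ?S" using M(1) s0(2) by simp
        ultimately show "(\<lambda>(h, w). nI w) ` Poly_Mapping.keys ?b \<noteq> ?S" by blast
      qed
      then show "card ((\<lambda>(h, w). nI w) ` Poly_Mapping.keys ?b) < card ?S"
        by (intro psubset_card_mono) auto
      show "?b \<in> Uh" using less.prems(1) top Zs_Uh by (intro pm.subspace_diff[OF Uh_facts(1)]) auto
      show "?b \<in> TR" using less.prems(2) kb by (auto simp: TR_def kset_def)
      show "wdeg w = \<gamma>" if "(h, w) \<in> Poly_Mapping.keys ?b" for h w
        using that kb less.prems(3) by auto
    qed
    from pm.subspace_add[OF Zs_subspace this top] show ?thesis by simp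
  qed
qed

text \<open>The normal form is triangular, has the same degree and differs from the element by a
  member of the ideal.\<close>

lemma homogeneous_Zs_CS:
  assumes "a \<in> Uh" "\<And>h w. (h, w) \<in> Poly_Mapping.keys a \<Longrightarrow> wdeg w = \<gamma>"
  shows "a \<in> Zs"
proof -
  have aC: "a \<in> CS" using assms(1) by (rule Uh_CS)
  have d: "nu a - a \<in> II" using nu_congr[OF aC] by (rule I0_II)
  have n: "nu a \<in> TRd \<gamma>" by (rule nu_TRd[OF aC assms(2)])
  have "(nu a - a) + a \<in> Uh" using d assms(1) Uh_facts(4) by (intro pm.subspace_add[OF Uh_facts(1)]) auto
  then have "nu a \<in> Zs"
    using n TRd_TR by (intro homogeneous_Zs[where \<gamma> = \<gamma>]) (auto simp: TRd_def kset_def)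
  moreover have "nu a - a \<in> Zs" unfolding Zs_def using d by (intro pm.span_base) auto
  ultimately have "nu a - (nu a - a) \<in> Zs" by (rule pm.subspace_diff[OF Zs_subspace])
  then show ?thesis by simp
qed

text \<open>The plain coefficient of a group element need not vanish on the ideal, since the mixed
  relations contain 1 - g_i f_i. Composed with \<open>nu\<close>, as \<open>theta\<close> for the
  empty multiset, it does, and on negative words it still reads off group components.\<close>

lemma group_component_Neg:
  assumes a: "a \<in> Uh" "a \<in> kset (H \<times> NW)" and f: "f \<in> H"
  shows "restr (\<lambda>(h, w). h = f) a \<in> Uh"
proof -
  let ?\<psi> = "cf eH []"
  have z: "?\<psi> x = 0" if "x \<in> Jp" for x
  proof -
    have "x \<in> kset ({eH} \<times> (PW - {[]}))" using that good_kset[OF Jp] by auto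
    then show ?thesis by (rule kset_lfun_zero[OF _ lfun_lookup]) (auto simp: lookup_single when_def)
  qed
  have "EE (\<lambda>b. theta Pos f {#} ?\<psi> (nu b)) (Del a) = restr (\<lambda>(h, w). h = f) a"
  proof (rule kset_lin_eq[OF a(2) lin_comp[OF lin_EE lin_Del] lin_restr])
    fix h w assume hw: "(h, w) \<in> H \<times> NW"
    then show "EE (\<lambda>b. theta Pos f {#} ?\<psi> (nu b)) (Del (bs h w)) = restr (\<lambda>(h, w). h = f) (bs h w)"
      using EE_theta_Pos[of h w "[]" "{#}" f ?\<psi>] NW_W[of w] by auto
  qed
  with Uh_theta_Pos[OF a(1) lfun_lookup z, of f "{#}"] show ?thesis by simp
qed

lemma group_component_Pos:
  assumes a: "a \<in> Uh" "a \<in> kset (H \<times> PW)" and f: "f \<in> H"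
  shows "restr (\<lambda>(h, w). h = f) a \<in> Uh"
proof -
  let ?\<psi> = "cf eH []"
  have z: "?\<psi> x = 0" if "x \<in> Jm" for x
  proof -
    have "x \<in> kset ({eH} \<times> (NW - {[]}))" using that good_kset[OF Jm] by auto
    then show ?thesis by (rule kset_lfun_zero[OF _ lfun_lookup]) (auto simp: lookup_single when_def)
  qed
  have "EE (\<lambda>b. theta Neg f {#} ?\<psi> (nu b)) (Del a) = restr (\<lambda>(h, w). h = f) a"
  proof (rule kset_lin_eq[OF a(2) lin_comp[OF lin_EE lin_Del] lin_restr])
    fix h w assume hw: "(h, w) \<in> H \<times> PW"
    then show "EE (\<lambda>b. theta Neg f {#} ?\<psi> (nu b)) (Del (bs h w)) = restr (\<lambda>(h, w). h = f) (bs h w)"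
      using EE_theta_Neg[of h "[]" w "{#}" f ?\<psi>] PW_W[of w] by auto
  qed
  with Uh_theta_Neg[OF a(1) lfun_lookup z, of f "{#}"] show ?thesis by simp
qed

end

end

section \<open>The balanced tensor product\<close>

lemma coset_eqI:
  fixes W :: "('s \<Rightarrow>\<^sub>0 'k::field) set"
  assumes s: "pm.subspace W" and a: "p - r \<in> W" shows "(+) p ` W = (+) r ` W"
proof (intro equalityI subsetI; elim imageE)
  fix x z assume "x = p + z" "z \<in> W"
  then have "x = r + ((p - r) + z)" "(p - r) + z \<in> W" using a pm.subspace_add[OF s] by auto
  then show "x \<in> (+) r ` W" by blast
next
  fix x z assume "x = r + z" "z \<in> W"
  then have "x = p + (z - (p - r))" "z - (p - r) \<in> W" using a pm.subspace_diff[OF s] by auto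
  then show "x \<in> (+) p ` W" by blast
qed

locale qU = qJ D Jm Jp for D :: "('g, 'f, 'k::field) datum" and Jm Jp +
  fixes U
  assumes U: "right_coideal_subalg (skew_quot D II) (carrier (skew_quot D II)) U"
    and kHU: "kH D II \<subseteq> U"
begin

lemmas hU = Uh_facts[OF U kHU]

abbreviation KN where "KN \<equiv> KX HFs (Neg ` idx D)"
abbreviation KP where "KP \<equiv> KX HGs (Pos ` idx D)"
abbreviation AN where "AN \<equiv> hat U \<inter> KN"
abbreviation AP where "AP \<equiv> hat U \<inter> KP"
abbreviation BH where "BH \<equiv> kset (H \<times> {[]})"
abbreviation Um0 where "Um0 \<equiv> hat U \<inter> VL Neg"
abbreviation Up0 where "Up0 \<equiv> hat U \<inter> VL Pos"
abbreviation UM where "UM \<equiv> U \<inter> neg_part D II"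
abbreviation UP where "UP \<equiv> U \<inter> pos_part D II"
abbreviation R3 where "R3 \<equiv> tens3_rel Q (kF D II) (kG D II) UM (kH D II) UP"
abbreviation KEYS where "KEYS \<equiv> {p. Poly_Mapping.keys p \<subseteq> UM \<times> kH D II \<times> UP} :: (_ \<Rightarrow>\<^sub>0 'k) set"
abbreviation tq3 where "tq3 a b c \<equiv> Poly_Mapping.single (cl a, cl b, cl c) (1::'k)"

lemma letN: "Neg ` idx D \<subseteq> letters D" "lgrp D ` Neg ` idx D \<subseteq> HFs"
  and letP: "Pos ` idx D \<subseteq> letters D" "lgrp D ` Pos ` idx D \<subseteq> HGs"
  using gLm gLp by auto

lemma AN_CS: "a \<in> AN \<Longrightarrow> a \<in> CS" and AP_CS: "a \<in> AP \<Longrightarrow> a \<in> CS" and BH_CS: "b \<in> BH \<Longrightarrow> b \<in> CS"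
proof -
  show "b \<in> BH \<Longrightarrow> b \<in> CS" using kset_mono[of "H \<times> {[]}" "H \<times> W"] unfolding CS_kset by auto
qed (auto simp: hat_def)

lemma BH_KX: "BH = KX H {}" by (simp add: KX_def)

lemma HFH: "f \<in> HFs \<Longrightarrow> f \<in> H" and HGH: "g \<in> HGs \<Longrightarrow> g \<in> H"
  using inF_closed inG_closed by auto

lemma kF_BH: "kset (HFs \<times> {[]}) \<subseteq> BH" and kG_BH: "kset (HGs \<times> {[]}) \<subseteq> BH"
  using HFH HGH by (auto intro!: kset_mono)

lemma BH_hat: "BH \<subseteq> hat U"
proof
  fix b assume b: "b \<in> BH"
  show "b \<in> hat U"
    by (rule kset_lin_mem[OF b lin_id hU(1)]) (use Uh_grp[OF U kHU] in auto)
qed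

lemma kF_AN: "kset (HFs \<times> {[]}) \<subseteq> AN" and kG_AP: "kset (HGs \<times> {[]}) \<subseteq> AP"
  using kF_BH kG_BH BH_hat kset_mono[of "HFs \<times> {[]}" "HFs \<times> NW"] kset_mono[of "HGs \<times> {[]}" "HGs \<times> PW"]
  unfolding KX_def by auto

lemma UM_eq: "UM = cl ` AN" and UP_eq: "UP = cl ` AP"
  unfolding neg_part_eq pos_part_eq using KX_CS[OF HFs_subgroup letN] KX_CS[OF HGs_subgroup letP]
  by (auto simp: hat_def)

lemma kH_eq: "kH D II = cl ` BH" and kF_eq: "kF D II = cl ` kset (HFs \<times> {[]})" and kG_eq: "kG D II = cl ` kset (HGs \<times> {[]})"
  by (rule grp_alg_eq)+

lemma AN_subspace: "pm.subspace AN" and AP_subspace: "pm.subspace AP" and BH_subspace: "pm.subspace BH"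
  unfolding KX_def by (auto intro!: pm.subspace_inter hU kset_subspace)

lemma AN_mul: "a \<in> AN \<Longrightarrow> b \<in> AN \<Longrightarrow> a \<star> b \<in> AN" and AP_mul: "a \<in> AP \<Longrightarrow> b \<in> AP \<Longrightarrow> a \<star> b \<in> AP"
  and BH_mul: "a \<in> BH \<Longrightarrow> b \<in> BH \<Longrightarrow> a \<star> b \<in> BH"
  using hU(3) KX_mul[OF HFs_subgroup] KX_mul[OF HGs_subgroup] KX_mul[OF HG.subgroup_self] unfolding BH_KX by auto

lemma R3_subspace: "pm.subspace R3"
  unfolding tens3_rel_def by (rule pm.subspace_span)

lemma kF_CS: "r \<in> kset (HFs \<times> {[]}) \<Longrightarrow> r \<in> CS" and kG_CS: "r \<in> kset (HGs \<times> {[]}) \<Longrightarrow> r \<in> CS"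
  using kF_BH kG_BH BH_CS by blast+

lemma R3_add1: "a \<in> AN \<Longrightarrow> a' \<in> AN \<Longrightarrow> b \<in> BH \<Longrightarrow> c \<in> AP \<Longrightarrow> tq3 (a + a') b c - tq3 a b c - tq3 a' b c \<in> R3"
  unfolding tens3_rel_def UM_eq UP_eq kH_eq kF_eq kG_eq
  by (rule pm.span_base, rule UnI1[OF UnI1[OF UnI1[OF UnI1[OF UnI1[OF UnI1[OF UnI1]]]]]], rule CollectI, rule exI[of _ "cl a"], rule exI[of _ "cl a'"], rule exI[of _ "cl b"], rule exI[of _ "cl c"], intro conjI)
    (auto simp del: Int_iff simp: Q_add AN_CS)

lemma R3_add2: "a \<in> AN \<Longrightarrow> b \<in> BH \<Longrightarrow> b' \<in> BH \<Longrightarrow> c \<in> AP \<Longrightarrow> tq3 a (b + b') c - tq3 a b c - tq3 a b' c \<in> R3"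
  unfolding tens3_rel_def UM_eq UP_eq kH_eq kF_eq kG_eq
  by (rule pm.span_base, rule UnI1[OF UnI1[OF UnI1[OF UnI1[OF UnI1[OF UnI1[OF UnI2]]]]]], rule CollectI, rule exI[of _ "cl a"], rule exI[of _ "cl b"], rule exI[of _ "cl b'"], rule exI[of _ "cl c"], intro conjI)
    (auto simp del: Int_iff simp: Q_add BH_CS)

lemma R3_add3: "a \<in> AN \<Longrightarrow> b \<in> BH \<Longrightarrow> c \<in> AP \<Longrightarrow> c' \<in> AP \<Longrightarrow> tq3 a b (c + c') - tq3 a b c - tq3 a b c' \<in> R3"
  unfolding tens3_rel_def UM_eq UP_eq kH_eq kF_eq kG_eq
  by (rule pm.span_base, rule UnI1[OF UnI1[OF UnI1[OF UnI1[OF UnI1[OF UnI2]]]]], rule CollectI, rule exI[of _ "cl a"], rule exI[of _ "cl b"], rule exI[of _ "cl c"], rule exI[of _ "cl c'"], intro conjI)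
    (auto simp del: Int_iff simp: Q_add AP_CS)

lemma R3_scale1: "a \<in> AN \<Longrightarrow> b \<in> BH \<Longrightarrow> c \<in> AP \<Longrightarrow> tq3 (pm_scale k a) b c - pm_scale k (tq3 a b c) \<in> R3"
  unfolding tens3_rel_def UM_eq UP_eq kH_eq kF_eq kG_eq
  by (rule pm.span_base, rule UnI1[OF UnI1[OF UnI1[OF UnI1[OF UnI2]]]], rule CollectI, rule exI[of _ "k"], rule exI[of _ "cl a"], rule exI[of _ "cl b"], rule exI[of _ "cl c"], intro conjI)
    (auto simp del: Int_iff simp: Q_smult)

lemma R3_scale2: "a \<in> AN \<Longrightarrow> b \<in> BH \<Longrightarrow> c \<in> AP \<Longrightarrow> tq3 a (pm_scale k b) c - pm_scale k (tq3 a b c) \<in> R3"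
  unfolding tens3_rel_def UM_eq UP_eq kH_eq kF_eq kG_eq
  by (rule pm.span_base, rule UnI1[OF UnI1[OF UnI1[OF UnI2]]], rule CollectI, rule exI[of _ "k"], rule exI[of _ "cl a"], rule exI[of _ "cl b"], rule exI[of _ "cl c"], intro conjI)
    (auto simp del: Int_iff simp: Q_smult)

lemma R3_scale3: "a \<in> AN \<Longrightarrow> b \<in> BH \<Longrightarrow> c \<in> AP \<Longrightarrow> tq3 a b (pm_scale k c) - pm_scale k (tq3 a b c) \<in> R3"
  unfolding tens3_rel_def UM_eq UP_eq kH_eq kF_eq kG_eq
  by (rule pm.span_base, rule UnI1[OF UnI1[OF UnI2]], rule CollectI, rule exI[of _ "k"], rule exI[of _ "cl a"], rule exI[of _ "cl b"], rule exI[of _ "cl c"], intro conjI)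
    (auto simp del: Int_iff simp: Q_smult)

lemma R3_bal1: "a \<in> AN \<Longrightarrow> b \<in> BH \<Longrightarrow> c \<in> AP \<Longrightarrow> r \<in> kset (HFs \<times> {[]}) \<Longrightarrow> tq3 (a \<star> r) b c - tq3 a (r \<star> b) c \<in> R3"
  unfolding tens3_rel_def UM_eq UP_eq kH_eq kF_eq kG_eq
  by (rule pm.span_base, rule UnI1[OF UnI2], rule CollectI, rule exI[of _ "cl a"], rule exI[of _ "cl b"], rule exI[of _ "cl c"], rule exI[of _ "cl r"], intro conjI)
    (auto simp del: Int_iff simp: Q_mult AN_CS BH_CS kF_CS)

lemma R3_bal2: "a \<in> AN \<Longrightarrow> b \<in> BH \<Longrightarrow> c \<in> AP \<Longrightarrow> r \<in> kset (HGs \<times> {[]}) \<Longrightarrow> tq3 a (b \<star> r) c - tq3 a b (r \<star> c) \<in> R3"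
  unfolding tens3_rel_def UM_eq UP_eq kH_eq kF_eq kG_eq
  by (rule pm.span_base, rule UnI2, rule CollectI, rule exI[of _ "cl a"], rule exI[of _ "cl b"], rule exI[of _ "cl c"], rule exI[of _ "cl r"], intro conjI)
    (auto simp del: Int_iff simp: Q_mult AP_CS BH_CS kG_CS)

lemma R3_minimal:
  assumes V: "pm.subspace V"
    and "\<And>a a' b c. a \<in> AN \<Longrightarrow> a' \<in> AN \<Longrightarrow> b \<in> BH \<Longrightarrow> c \<in> AP \<Longrightarrow> tq3 (a + a') b c - tq3 a b c - tq3 a' b c \<in> V"
    and "\<And>a b b' c. a \<in> AN \<Longrightarrow> b \<in> BH \<Longrightarrow> b' \<in> BH \<Longrightarrow> c \<in> AP \<Longrightarrow> tq3 a (b + b') c - tq3 a b c - tq3 a b' c \<in> V"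
    and "\<And>a b c c'. a \<in> AN \<Longrightarrow> b \<in> BH \<Longrightarrow> c \<in> AP \<Longrightarrow> c' \<in> AP \<Longrightarrow> tq3 a b (c + c') - tq3 a b c - tq3 a b c' \<in> V"
    and "\<And>k a b c. a \<in> AN \<Longrightarrow> b \<in> BH \<Longrightarrow> c \<in> AP \<Longrightarrow> tq3 (pm_scale k a) b c - Poly_Mapping.single (cl a, cl b, cl c) k \<in> V"
    and "\<And>k a b c. a \<in> AN \<Longrightarrow> b \<in> BH \<Longrightarrow> c \<in> AP \<Longrightarrow> tq3 a (pm_scale k b) c - Poly_Mapping.single (cl a, cl b, cl c) k \<in> V"
    and "\<And>k a b c. a \<in> AN \<Longrightarrow> b \<in> BH \<Longrightarrow> c \<in> AP \<Longrightarrow> tq3 a b (pm_scale k c) - Poly_Mapping.single (cl a, cl b, cl c) k \<in> V"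
    and "\<And>a b c r. a \<in> AN \<Longrightarrow> b \<in> BH \<Longrightarrow> c \<in> AP \<Longrightarrow> r \<in> kset (HFs \<times> {[]}) \<Longrightarrow> tq3 (a \<star> r) b c - tq3 a (r \<star> b) c \<in> V"
    and "\<And>a b c r. a \<in> AN \<Longrightarrow> b \<in> BH \<Longrightarrow> c \<in> AP \<Longrightarrow> r \<in> kset (HGs \<times> {[]}) \<Longrightarrow> tq3 a (b \<star> r) c - tq3 a b (r \<star> c) \<in> V"
  shows "R3 \<subseteq> V"
  unfolding tens3_rel_def UM_eq UP_eq kH_eq kF_eq kG_eq
  by (rule pm.span_minimal[OF _ V], intro Un_least subsetI; elim CollectE exE conjE imageE; hypsubst;
      simp only: Q_add[OF AN_CS AN_CS] Q_add[OF BH_CS BH_CS] Q_add[OF AP_CS AP_CS] Q_smult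
        Q_mult[OF AN_CS kF_CS] Q_mult[OF kF_CS BH_CS] Q_mult[OF BH_CS kG_CS] Q_mult[OF kG_CS AP_CS];
      rule assms(2-9); assumption)

lemma LP_single:
  assumes "a \<in> CS" "b \<in> CS" "c \<in> CS"
  shows "LP (Poly_Mapping.single (cl a, cl b, cl c) k) - pm_scale k (a \<star> b \<star> c) \<in> II"
proof -
  have r: "rep (cl x) \<in> CS \<and> cl (rep (cl x)) = cl x" if "x \<in> CS" for x
    using rep[of "cl x"] that by (auto simp: Q_carrier)
  note r = r[OF assms(1)] r[OF assms(2)] r[OF assms(3)]
  have "cl (rep (cl a) \<star> rep (cl b) \<star> rep (cl c)) = cl (rep (cl a)) \<otimes>\<^bsub>Q\<^esub> cl (rep (cl b)) \<otimes>\<^bsub>Q\<^esub> cl (rep (cl c))"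
    using r[THEN conjunct1] by (simp add: Q_mult)
  also have "\<dots> = cl (a \<star> b \<star> c)" using r[THEN conjunct2] assms by (simp add: Q_mult)
  finally have "rep (cl a) \<star> rep (cl b) \<star> rep (cl c) - a \<star> b \<star> c \<in> II" by (simp add: cl_eq)
  from pm.subspace_scale[OF II_subspace this, of k] show ?thesis
    by (simp add: LP_def pm.scale_right_diff_distrib)
qed

lemma R3_LP: "R3 \<subseteq> {p. LP p \<in> II}"
proof (rule R3_minimal)
  show "pm.subspace {p. LP p \<in> II}" by (rule subspace_vimage[OF lin_LP II_subspace])
  note D = lin_diff[OF lin_LP]
  have key: "LP p - x \<in> II \<Longrightarrow> x = 0 \<Longrightarrow> p \<in> {p. LP p \<in> II}" for p x by simp
  note C = AN_CS BH_CS AP_CS kF_CS kG_CS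
  fix a b c assume abc: "a \<in> AN" "b \<in> BH" "c \<in> AP"
  note S = LP_single[OF AN_CS BH_CS AP_CS] and m = AN_CS[OF abc(1)] BH_CS[OF abc(2)] AP_CS[OF abc(3)]
  have comb3: "LP p - x \<in> II \<Longrightarrow> LP q - y \<in> II \<Longrightarrow> LP r - z \<in> II \<Longrightarrow> x = y + z \<Longrightarrow> p - q - r \<in> {p. LP p \<in> II}" for p q r x y z
    using II_diff[OF II_diff[of "LP p - x" "LP q - y"], of "LP r - z"] by (simp add: D lin_add[OF lin_LP] algebra_simps)
  have comb2: "LP p - x \<in> II \<Longrightarrow> LP q - y \<in> II \<Longrightarrow> x = y \<Longrightarrow> p - q \<in> {p. LP p \<in> II}" for p q x y
    using II_diff[of "LP p - x" "LP q - y"] by (simp add: D algebra_simps)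
  show "tq3 (a + a') b c - tq3 a b c - tq3 a' b c \<in> {p. LP p \<in> II}" if "a' \<in> AN" for a'
    using AN_CS[OF that] m by (intro comb3[OF LP_single LP_single LP_single]) (auto simp: CS_add mul_add_left)
  show "tq3 a (b + b') c - tq3 a b c - tq3 a b' c \<in> {p. LP p \<in> II}" if "b' \<in> BH" for b'
    using BH_CS[OF that] m by (intro comb3[OF LP_single LP_single LP_single]) (auto simp: CS_add mul_add_left mul_add_right)
  show "tq3 a b (c + c') - tq3 a b c - tq3 a b c' \<in> {p. LP p \<in> II}" if "c' \<in> AP" for c'
    using AP_CS[OF that] m by (intro comb3[OF LP_single LP_single LP_single]) (auto simp: CS_add mul_add_right)
  show "tq3 (pm_scale k a) b c - Poly_Mapping.single (cl a, cl b, cl c) k \<in> {p. LP p \<in> II}" for k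
    using m by (intro comb2[OF LP_single LP_single]) (auto simp: CS_scale mul_scale_left)
  show "tq3 a (pm_scale k b) c - Poly_Mapping.single (cl a, cl b, cl c) k \<in> {p. LP p \<in> II}" for k
    using m by (intro comb2[OF LP_single LP_single]) (auto simp: CS_scale mul_scale_left mul_scale_right)
  show "tq3 a b (pm_scale k c) - Poly_Mapping.single (cl a, cl b, cl c) k \<in> {p. LP p \<in> II}" for k
    using m by (intro comb2[OF LP_single LP_single]) (auto simp: CS_scale mul_scale_right)
  show "tq3 (a \<star> r) b c - tq3 a (r \<star> b) c \<in> {p. LP p \<in> II}" if "r \<in> kset (HFs \<times> {[]})" for r
    using m kF_CS[OF that] by (intro comb2[OF LP_single LP_single]) (auto simp: mul_assoc)
  show "tq3 a (b \<star> r) c - tq3 a b (r \<star> c) \<in> {p. LP p \<in> II}" if "r \<in> kset (HGs \<times> {[]})" for r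
    using m kG_CS[OF that] by (intro comb2[OF LP_single LP_single]) (auto simp: mul_assoc)
qed

lemma KEYS_subspace: "pm.subspace KEYS"
  by (rule subspace_keys)

lemma KEYS_single: "a \<in> AN \<Longrightarrow> b \<in> BH \<Longrightarrow> c \<in> AP \<Longrightarrow> Poly_Mapping.single (cl a, cl b, cl c) k \<in> KEYS"
  unfolding UM_eq UP_eq kH_eq by auto

lemma R3_KEYS: "R3 \<subseteq> KEYS"
  by (rule R3_minimal[OF KEYS_subspace];
      intro pm.subspace_diff[OF KEYS_subspace] KEYS_single pm.subspace_add[OF AN_subspace] pm.subspace_add[OF BH_subspace]
        pm.subspace_add[OF AP_subspace] pm.subspace_scale[OF AN_subspace] pm.subspace_scale[OF BH_subspace]
        pm.subspace_scale[OF AP_subspace] AN_mul[OF _ subsetD[OF kF_AN]] BH_mul[OF subsetD[OF kF_BH]]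
        BH_mul[OF _ subsetD[OF kG_BH]] AP_mul[OF subsetD[OF kG_AP]]; assumption)

lemma mult3_class:
  assumes p: "p \<in> KEYS" shows "mult3 Q ((+) p ` R3) = cl (LP p)"
proof -
  have "U \<subseteq> carrier Q" using U by (auto simp: right_coideal_subalg_def)
  then have sub: "UM \<times> kH D II \<times> UP \<subseteq> carrier Q \<times> carrier Q \<times> carrier Q" using kHU by auto
  have f: "mult3_formal Q q = cl (LP q)" if "q \<in> KEYS" for q
    using that sub by (intro mult3_formal_eq) auto
  have "mult3_formal Q (p + r) = cl (LP p)" if "r \<in> R3" for r
  proof -
    have "p + r \<in> KEYS" using p that R3_KEYS by (intro pm.subspace_add[OF KEYS_subspace]) auto
    moreover have "LP r \<in> II" using R3_LP that by auto
    ultimately show ?thesis by (simp add: f cl_eq lin_add[OF lin_LP])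
  qed
  then have "mult3_formal Q ` ((+) p ` R3) = {cl (LP p)}"
    using pm.subspace_0[OF R3_subspace] by (auto simp: image_image)
  then show ?thesis by (simp add: mult3_def)
qed

lemma LP_hat: assumes p: "p \<in> KEYS" shows "LP p \<in> hat U"
  unfolding LP_def
proof (rule lin_ext_mem[OF hU(1)])
  fix s assume "s \<in> Poly_Mapping.keys p"
  with p have m: "s \<in> UM \<times> kH D II \<times> UP" by blast
  obtain x y z where xyz: "s = (x, y, z)" by (cases s)
  have "x \<in> U" "y \<in> kH D II" "z \<in> U" using m unfolding xyz by simp_all
  with kHU xyz have s: "s = (x, y, z)" "x \<in> U" "y \<in> U" "z \<in> U" by blast+
  have "rep x \<in> hat U" if "x \<in> U" for x
    using rep[of x] that U by (auto simp: hat_def right_coideal_subalg_def)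
  then show "(case s of (x, y, z) \<Rightarrow> rep x \<star> rep y \<star> rep z) \<in> hat U"
    using s by (simp add: hU(3))
qed

lemma VL_conj: "h \<in> H \<Longrightarrow> d \<in> VL L \<Longrightarrow> bs h [] \<star> d \<star> bs (hinv h) [] \<in> VL L"
proof -
  assume h: "h \<in> H" and d: "d \<in> VL L"
  have "bs h [] \<star> d \<in> kset ({h} \<times> lists (L ` idx D))"
    using h by (intro kset_mul[OF _ d[unfolded VL_def], of _ "{(h, [])}"]) auto
  then show ?thesis unfolding VL_def
    by (rule kset_mul[of _ _ _ "{(hinv h, [])}"]) (use h in auto)
qed

lemma Um0_AN: "Um0 \<subseteq> AN" and Up0_AP: "Up0 \<subseteq> AP"
proof -
  have "eH \<in> HFs" "eH \<in> HGs" using subgroup.one_closed[OF HFs_subgroup] subgroup.one_closed[OF HGs_subgroup] by auto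
  then have "VL Neg \<subseteq> KN" "VL Pos \<subseteq> KP"
    unfolding VL_def KX_def by (auto intro!: kset_mono)
  then show "Um0 \<subseteq> AN" "Up0 \<subseteq> AP" by auto
qed

text \<open>The product h x y is the image of h x h^-1 \<otimes> h \<otimes> y: conjugation places
  the group element between the two signs without leaving \<open>U\<close>.\<close>

lemma LP_surj:
  assumes "a \<in> Zs U" shows "\<exists>p\<in>KEYS. LP p - a \<in> II"
proof -
  let ?V = "{a. \<exists>p\<in>KEYS. LP p - a \<in> II}"
  have V: "pm.subspace ?V"
    unfolding pm.subspace_def
  proof (intro conjI ballI allI)
    have "LP 0 - 0 \<in> II" using pm.subspace_0[OF II_subspace] by (simp add: lin_zero[OF lin_LP])
    then show "0 \<in> ?V" using pm.subspace_0[OF KEYS_subspace] by blast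
    fix x y assume "x \<in> ?V" "y \<in> ?V"
    then obtain p q where pq: "p \<in> KEYS" "LP p - x \<in> II" "q \<in> KEYS" "LP q - y \<in> II" by blast
    have "p + q \<in> KEYS" by (rule pm.subspace_add[OF KEYS_subspace pq(1,3)])
    moreover have "LP (p + q) - (x + y) \<in> II"
      using II_add[OF pq(2,4)] by (simp add: lin_add[OF lin_LP] algebra_simps)
    ultimately show "x + y \<in> ?V" by blast
  next
    fix c x assume "x \<in> ?V"
    then obtain p where pq: "p \<in> KEYS" "LP p - x \<in> II" by blast
    have "pm_scale c p \<in> KEYS" by (rule pm.subspace_scale[OF KEYS_subspace pq(1)])
    moreover have "LP (pm_scale c p) - pm_scale c x \<in> II"
      using II_scale[OF pq(2), of c] by (simp add: lin_scale[OF lin_LP] pm.scale_right_diff_distrib)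
    ultimately show "pm_scale c x \<in> ?V" by blast
  qed
  have "Zs U \<subseteq> ?V"
    unfolding Zs_def[OF U kHU]
  proof (rule pm.span_minimal[OF _ V], intro Un_least UN_least subsetI)
    fix x assume "x \<in> II"
    then have "LP 0 - x \<in> II" using pm.subspace_neg[OF II_subspace] by (simp add: lin_zero[OF lin_LP])
    then show "x \<in> ?V" using pm.subspace_0[OF KEYS_subspace] by blast
  next
    fix h z assume h: "h \<in> H" and "z \<in> {bs h [] \<star> x \<star> y | x y. x \<in> Um0 \<and> y \<in> Up0}"
    then obtain x y where z: "z = bs h [] \<star> x \<star> y" "x \<in> Um0" "y \<in> Up0" by blast
    let ?x = "bs h [] \<star> x \<star> bs (hinv h) []"
    have g: "bs h [] \<in> hat U" "bs (hinv h) [] \<in> hat U" using Uh_grp[OF U kHU] h by auto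
    have "?x \<in> hat U" using z(2) by (intro hU(3)[OF hU(3)[OF g(1)] g(2)]) auto
    moreover have "?x \<in> VL Neg" using z(2) by (intro VL_conj[OF h]) auto
    ultimately have x: "?x \<in> AN" using Um0_AN by auto
    have b: "bs h [] \<in> BH" using h by auto
    have y: "y \<in> AP" using z(3) Up0_AP by auto
    have xC: "x \<in> CS" using z(2) by (auto simp: hat_def)
    have inv: "bs (hinv h) [] \<star> bs h [] = wl []" using h by simp
    have "?x \<star> bs h [] = bs h [] \<star> x \<star> (bs (hinv h) [] \<star> bs h [])"
      using h xC by (intro mul_assoc) auto
    also have "\<dots> = bs h [] \<star> x" unfolding inv using h xC by (intro mul_one_right) auto
    finally have "?x \<star> bs h [] \<star> y = z" by (simp add: z(1))
    then have "LP (tq3 ?x (bs h []) y) - z \<in> II"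
      using LP_single[OF AN_CS[OF x] BH_CS[OF b] AP_CS[OF y], of 1] by simp
    then show "z \<in> ?V" using KEYS_single[OF x b y, of 1] by blast
  qed
  with assms show ?thesis by blast
qed

end

lemma modlin_lift:
  assumes "modlin V R f" "pm.subspace R" "pm.subspace V" "pm.subspace N" "R \<subseteq> N"
    "\<And>i. i \<in> F \<Longrightarrow> x i \<in> V" "\<And>i. i \<in> F \<Longrightarrow> f (x i) \<in> N"
  shows "f (\<Sum>i\<in>F. pm_scale (c i) (x i)) \<in> N"
proof -
  let ?S = "\<Sum>i\<in>F. pm_scale (c i) (f (x i))"
  have "f (\<Sum>i\<in>F. pm_scale (c i) (x i)) - ?S \<in> N"
    using modlin_sum[OF assms(1-3), of F x c] assms(5,6) by blast
  moreover have "?S \<in> N" using assms(7) by (intro pm.subspace_sum[OF assms(4)] pm.subspace_scale[OF assms(4)])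
  ultimately have "(f (\<Sum>i\<in>F. pm_scale (c i) (x i)) - ?S) + ?S \<in> N" by (rule pm.subspace_add[OF assms(4)])
  then show ?thesis by simp
qed

section \<open>Injectivity of the multiplication map\<close>

context qJ
begin

text \<open>The product of functionals on the two tensor factors of a triangular element with group
  part \<open>h0\<close>. It vanishes on \<open>K\<close> if f vanishes on \<open>Jm\<close> and g
  on \<open>Jp\<close>, so it detects triangular elements outside the ideal.\<close>

definition Phi where
  "Phi h0 f g = fun_ext (\<lambda>(h, w). if h = h0 then f (wl (ng w)) * g (wl (ps w)) else 0)"

lemma lfun_Phi: "lfun (Phi h0 f g)"
  unfolding Phi_def by (rule lfun_fun_ext)

lemma Phi_prod:
  assumes "h \<in> H" "r \<in> VL Neg" "d \<in> VL Pos" "lfun f" "lfun g"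
  shows "Phi h0 f g (bs h [] \<star> r \<star> d) = (if h = h0 then f r * g d else 0)"
proof (rule kset_lfun_eq[OF assms(2)[unfolded VL_def], of "\<lambda>r. Phi h0 f g (bs h [] \<star> r \<star> d)" "\<lambda>r. if h = h0 then f r * g d else 0"])
  show "lfun (\<lambda>r. Phi h0 f g (bs h [] \<star> r \<star> d))"
    by (intro lfun_comp[OF lfun_Phi] lin_comp[OF lin_mul_left] lin_mul_right)
  show "lfun (\<lambda>r. if h = h0 then f r * g d else 0)"
    using lfun_mult[OF assms(4), of "g d"] by (cases "h = h0") (auto simp: mult.commute lfun_def)
  fix h' u assume hu: "(h', u) \<in> {eH} \<times> NW"
  show "Phi h0 f g (bs h [] \<star> bs h' u \<star> d) = (if h = h0 then f (bs h' u) * g d else 0)"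
  proof (rule kset_lfun_eq[OF assms(3)[unfolded VL_def], of "\<lambda>d. Phi h0 f g (bs h [] \<star> bs h' u \<star> d)" "\<lambda>d. if h = h0 then f (bs h' u) * g d else 0"])
    show "lfun (\<lambda>d. Phi h0 f g (bs h [] \<star> bs h' u \<star> d))"
      by (intro lfun_comp[OF lfun_Phi] lin_mul_right)
    show "lfun (\<lambda>d. if h = h0 then f (bs h' u) * g d else 0)"
      using lfun_mult[OF assms(5), of "f (bs h' u)"] by (cases "h = h0") (auto simp: lfun_def)
    fix h'' v assume hv: "(h'', v) \<in> {eH} \<times> PW"
    have w: "u \<in> NW" "v \<in> PW" using hu hv by auto
    have u: "ng u = u \<and> ps u = []" using w(1) by (induction u) auto
    have v: "ps v = v \<and> ng v = []" using w(2) by (induction v) auto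
    have "bs h [] \<star> bs h' u \<star> bs h'' v = bs h (u @ v)"
      using hu hv assms(1) NW_W[OF w(1)] by simp
    then show "Phi h0 f g (bs h [] \<star> bs h' u \<star> bs h'' v) = (if h = h0 then f (bs h' u) * g (bs h'' v) else 0)"
      using hu hv u v by (auto simp: Phi_def)
  qed
qed

lemma Phi_K:
  assumes "lfun f" "\<And>x. x \<in> Jm \<Longrightarrow> f x = 0" "lfun g" "\<And>x. x \<in> Jp \<Longrightarrow> g x = 0" and k: "k \<in> K"
  shows "Phi h0 f g k = 0"
proof (rule span_lfun_zero[OF lfun_Phi _ k[unfolded K_def]])
  fix x assume "x \<in> Kgen"
  then consider h r v where "x = bs h [] \<star> r \<star> wl v" "h \<in> H" "r \<in> Jm" "v \<in> PW"
    | h u r where "x = bs h [] \<star> wl u \<star> r" "h \<in> H" "u \<in> NW" "r \<in> Jp"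
    unfolding Kgen_def by blast
  then show "Phi h0 f g x = 0"
  proof cases
    case 1
    have "r \<in> VL Neg" "wl v \<in> VL Pos" using 1 good_VL[OF Jm] by (auto simp: VL_def)
    then show ?thesis using assms(2)[OF 1(3)] Phi_prod[OF 1(2) _ _ assms(1,3)] unfolding 1(1) by simp
  next
    case 2
    have "wl u \<in> VL Neg" "r \<in> VL Pos" using 2 good_VL[OF Jp] by (auto simp: VL_def)
    from Phi_prod[OF 2(2) this assms(1,3), of h0] show ?thesis
      unfolding 2(1) assms(4)[OF 2(4)] by (simp del: bil_ext_single)
  qed
qed

lemma II_mul_left: "a \<in> II \<Longrightarrow> x \<in> CS \<Longrightarrow> x \<star> a \<in> II"
  and II_mul_right: "a \<in> II \<Longrightarrow> x \<in> CS \<Longrightarrow> a \<star> x \<in> II"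
  using ideal2_II unfolding ideal2_def by auto

lemma VL_prod_TR: "h \<in> H \<Longrightarrow> r \<in> VL Neg \<Longrightarrow> d \<in> VL Pos \<Longrightarrow> bs h [] \<star> r \<star> d \<in> TR"
  unfolding TR_def VL_def
  by (rule kset_mul[of _ "{h} \<times> NW" _ "{eH} \<times> PW"], rule kset_mul[of _ "{(h, [])}" _ "{eH} \<times> NW"])
    (auto simp: TW_def)

lemma grp_cancel: "h \<in> H \<Longrightarrow> x \<in> CS \<Longrightarrow> bs h [] \<star> (bs (hinv h) [] \<star> x) = x"
  and grp_cancel': "h \<in> H \<Longrightarrow> x \<in> CS \<Longrightarrow> bs (hinv h) [] \<star> (bs h [] \<star> x) = x"
  by (simp_all add: mul_assoc[symmetric])

lemma conj_cancel: "h \<in> H \<Longrightarrow> x \<in> CS \<Longrightarrow> bs h [] \<star> (bs (hinv h) [] \<star> x \<star> bs h []) \<star> bs (hinv h) [] = x"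
  by (simp add: mul_assoc grp_cancel)

end

context qU
begin

lemma modlin1: "b \<in> BH \<Longrightarrow> c \<in> AP \<Longrightarrow> modlin AN R3 (\<lambda>a. tq3 a b c)"
  unfolding modlin_def by (intro conjI ballI allI R3_add1 R3_scale1)

lemma modlin2: "a \<in> AN \<Longrightarrow> c \<in> AP \<Longrightarrow> modlin BH R3 (\<lambda>b. tq3 a b c)"
  unfolding modlin_def by (intro conjI ballI allI R3_add2 R3_scale2)

lemma modlin3: "a \<in> AN \<Longrightarrow> b \<in> BH \<Longrightarrow> modlin AP R3 (\<lambda>c. tq3 a b c)"
  unfolding modlin_def by (intro conjI ballI allI R3_add3 R3_scale3)

lemma Um0_conj: "h \<in> H \<Longrightarrow> a \<in> Um0 \<Longrightarrow> bs h [] \<star> a \<star> bs (hinv h) [] \<in> Um0"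
  using VL_conj[of h a Neg] hU(3)[OF hU(3)[OF Uh_grp[OF U kHU]] Uh_grp[OF U kHU], of h a "hinv h"] by auto

text \<open>Group components stay in the preimage of \<open>U\<close> by
  \<open>group_component_Pos\<close>, and their group elements can be cancelled because k[H] is
  contained in \<open>U\<close>.\<close>

lemma AP_component:
  assumes c: "c \<in> AP" and g: "g \<in> HGs"
  shows "\<exists>d\<in>Up0. restr (\<lambda>s. fst s = g) c = bs g [] \<star> d"
proof -
  let ?r = "restr (\<lambda>s. fst s = g) c"
  have gH: "g \<in> H" using HGH[OF g] .
  have k: "c \<in> kset (HGs \<times> PW)" using c by (simp add: KX_def)
  have "c \<in> kset (H \<times> PW)" using k kset_mono[of "HGs \<times> PW" "H \<times> PW"] HGH by blast
  then have r: "?r \<in> hat U"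
    using group_component_Pos[OF U kHU _ _ gH, of c] c by (simp add: case_prod_unfold)
  have rk: "?r \<in> kset ({g} \<times> PW)" using k by (auto simp: kset_def keys_restr)
  let ?d = "bs (hinv g) [] \<star> ?r"
  have "?d \<in> hat U" using gH by (intro hU(3)[OF Uh_grp[OF U kHU] r]) simp
  moreover have "?d \<in> VL Pos"
    unfolding VL_def by (rule kset_mul[OF _ rk, of _ "{(hinv g, [])}"]) (use gH in auto)
  moreover have "?r = bs g [] \<star> ?d" using r gH by (simp add: grp_cancel hat_def)
  ultimately show ?thesis by blast
qed

lemma AN_component:
  assumes c: "c \<in> AN" and g: "g \<in> HFs"
  shows "\<exists>d\<in>Um0. restr (\<lambda>s. fst s = g) c = d \<star> bs g []"
proof -
  let ?r = "restr (\<lambda>s. fst s = g) c"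
  have gH: "g \<in> H" using HFH[OF g] .
  have k: "c \<in> kset (HFs \<times> NW)" using c by (simp add: KX_def)
  have "c \<in> kset (H \<times> NW)" using k kset_mono[of "HFs \<times> NW" "H \<times> NW"] HFH by blast
  then have r: "?r \<in> hat U"
    using group_component_Neg[OF U kHU _ _ gH, of c] c by (simp add: case_prod_unfold)
  have rk: "?r \<in> kset ({g} \<times> NW)" using k by (auto simp: kset_def keys_restr)
  let ?d = "?r \<star> bs (hinv g) []"
  have "?d \<in> hat U" using gH by (intro hU(3)[OF r Uh_grp[OF U kHU]]) simp
  moreover have "?d \<in> VL Neg"
    unfolding VL_def by (rule kset_mul[OF rk, of _ "{(hinv g, [])}"]) (use gH in auto)
  moreover have "?r = ?d \<star> bs g []" using r gH by (simp add: mul_assoc hat_def)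
  ultimately show ?thesis by blast
qed

text \<open>Balancing moves the group elements of the outer factors into the middle one. What
  remains is spanned by h e h^-1 \<otimes> h \<otimes> d with e and d from families spanning modulo
  the ideal; the conjugation makes the product equal to h e d, with the group element in front as in
  the normal form.\<close>

lemma span_KEYS:
  assumes N: "pm.subspace N" "R3 \<subseteq> N"
    and E: "E1 \<subseteq> Um0" "E2 \<subseteq> Up0"
    and base: "\<And>h e d. h \<in> H \<Longrightarrow> e \<in> E1 \<Longrightarrow> d \<in> E2 \<Longrightarrow> tq3 (bs h [] \<star> e \<star> bs (hinv h) []) (bs h []) d \<in> N"
    and m1: "\<And>a. a \<in> Um0 \<Longrightarrow> \<exists>F c. F \<subseteq> E1 \<and> a - (\<Sum>e\<in>F. pm_scale (c e) e) \<in> II"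
    and m2: "\<And>a. a \<in> Up0 \<Longrightarrow> \<exists>F c. F \<subseteq> E2 \<and> a - (\<Sum>e\<in>F. pm_scale (c e) e) \<in> II"
  shows "KEYS \<subseteq> N"
proof -
  note lift = modlin_lift[OF _ R3_subspace _ N]
  have B: "bs h [] \<in> BH" if "h \<in> H" for h using that by auto
  have comb: "x \<in> N" if "x - y \<in> R3" "y \<in> N" for x y
  proof -
    have "(x - y) + y \<in> N" using that N(2) by (intro pm.subspace_add[OF N(1)]) auto
    then show ?thesis by simp
  qed
  \<comment> \<open>Each of \<open>s1\<close> to \<open>s5\<close> enlarges the admissible range of
    one factor, by linearity modulo the relations or, in the last two, by balancing.\<close>
  have s1: "tq3 (bs h [] \<star> e \<star> bs (hinv h) []) (bs h []) c \<in> N" if h: "h \<in> H" and e: "e \<in> E1" and c: "c \<in> Up0" for h e c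
  proof -
    obtain F k where F: "F \<subseteq> E2" "c - (\<Sum>e\<in>F. pm_scale (k e) e) \<in> II" using m2[OF c] by blast
    have a: "bs h [] \<star> e \<star> bs (hinv h) [] \<in> AN" using Um0_conj[OF h] e E(1) Um0_AN by blast
    have "tq3 (bs h [] \<star> e \<star> bs (hinv h) []) (bs h []) (\<Sum>d\<in>F. pm_scale (k d) d) \<in> N"
    proof (rule lift[OF modlin3[OF a B[OF h]] AP_subspace])
      fix d assume "d \<in> F"
      then show "d \<in> AP" using F(1) E(2) Up0_AP by blast
      show "tq3 (bs h [] \<star> e \<star> bs (hinv h) []) (bs h []) d \<in> N" using base[OF h e] \<open>d \<in> F\<close> F(1) by blast
    qed
    moreover have "cl c = cl (\<Sum>d\<in>F. pm_scale (k d) d)" using F(2) by (simp add: cl_eq)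
    ultimately show ?thesis by simp
  qed
  have s2: "tq3 a (bs h []) c \<in> N" if h: "h \<in> H" and a: "a \<in> Um0" and c: "c \<in> Up0" for h a c
  proof -
    \<comment> \<open>The first factor is conjugated back before it is expanded over
      \<open>E1\<close>, so that after conjugation with h the expansion is one over the elements h e
      h^-1.\<close>
    let ?a = "bs (hinv h) [] \<star> a \<star> bs h []"
    let ?j = "\<lambda>x. bs h [] \<star> x \<star> bs (hinv h) []"
    have lj: "lin ?j" by (intro lin_comp[OF lin_mul_left] lin_mul_right)
    have aC: "a \<in> CS" using a by (simp add: hat_def)
    have "?a \<in> Um0" using Um0_conj[of "hinv h" a] h a by simp
    then obtain F k where F: "F \<subseteq> E1" "?a - (\<Sum>e\<in>F. pm_scale (k e) e) \<in> II" using m1 by blast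
    have "?j (?a - (\<Sum>e\<in>F. pm_scale (k e) e)) \<in> II"
      using h by (intro II_mul_right[OF II_mul_left[OF F(2)]]) auto
    moreover have "?j (?a - (\<Sum>e\<in>F. pm_scale (k e) e)) = a - (\<Sum>e\<in>F. pm_scale (k e) (?j e))"
      using conj_cancel[OF h aC] by (simp only: lin_diff[OF lj] lin_sum[OF lj] lin_scale[OF lj])
    ultimately have "cl a = cl (\<Sum>e\<in>F. pm_scale (k e) (?j e))" by (simp add: cl_eq)
    moreover have "tq3 (\<Sum>e\<in>F. pm_scale (k e) (?j e)) (bs h []) c \<in> N"
    proof (rule lift[OF modlin1[OF B[OF h]] AN_subspace])
      show "c \<in> AP" using c Up0_AP by blast
      fix e assume "e \<in> F"
      then show "?j e \<in> AN" using Um0_conj[OF h] F(1) E(1) Um0_AN by blast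
      show "tq3 (?j e) (bs h []) c \<in> N" using s1[OF h _ c] \<open>e \<in> F\<close> F(1) by blast
    qed
    ultimately show ?thesis by simp
  qed
  have s3: "tq3 a b c \<in> N" if b: "b \<in> BH" and a: "a \<in> Um0" and c: "c \<in> Up0" for a b c
  proof -
    have ac: "a \<in> AN" "c \<in> AP" using a c Um0_AN Up0_AP by blast+
    have "tq3 a (\<Sum>s\<in>Poly_Mapping.keys b. pm_scale (Poly_Mapping.lookup b s) (Poly_Mapping.single s 1)) c \<in> N"
    proof (rule lift[OF modlin2[OF ac] BH_subspace])
      fix s assume "s \<in> Poly_Mapping.keys b"
      then obtain h where s: "s = (h, [])" "h \<in> H" using b by (auto simp: kset_def)
      show "Poly_Mapping.single s 1 \<in> BH" using B[OF s(2)] by (simp add: s(1))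
      show "tq3 a (Poly_Mapping.single s 1) c \<in> N" using s2[OF s(2) a c] by (simp add: s(1))
    qed
    moreover have "(\<Sum>s\<in>Poly_Mapping.keys b. pm_scale (Poly_Mapping.lookup b s) (Poly_Mapping.single s 1)) = b"
      using lin_ext_single_id[of b] by (simp only: lin_ext_def)
    ultimately show ?thesis by simp
  qed
  have s4: "tq3 a b c \<in> N" if b: "b \<in> BH" and a: "a \<in> Um0" and c: "c \<in> AP" for a b c
  proof -
    have aN: "a \<in> AN" using a Um0_AN by blast
    let ?T = "fst ` Poly_Mapping.keys c"
    have T: "?T \<subseteq> HGs" using c by (auto simp: KX_def kset_def)
    have m: "\<exists>d\<in>Up0. restr (\<lambda>s. fst s = g) c = bs g [] \<star> d" if "g \<in> ?T" for g
      using AP_component[OF c] T that by blast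
    have "tq3 a b (\<Sum>g\<in>?T. pm_scale 1 (restr (\<lambda>s. fst s = g) c)) \<in> N"
    proof (rule lift[OF modlin3[OF aN b] AP_subspace])
      fix g assume g: "g \<in> ?T"
      obtain d where d: "d \<in> Up0" "restr (\<lambda>s. fst s = g) c = bs g [] \<star> d" using m[OF g] by blast
      have gk: "bs g [] \<in> kset (HGs \<times> {[]})" using g T by auto
      have dP: "d \<in> AP" using d(1) Up0_AP by blast
      show "restr (\<lambda>s. fst s = g) c \<in> AP" unfolding d(2) by (rule AP_mul[OF subsetD[OF kG_AP gk] dP])
      have "tq3 a (b \<star> bs g []) d \<in> N" using s3[OF BH_mul[OF b subsetD[OF kG_BH gk]] a d(1)] .
      moreover have "- (tq3 a (b \<star> bs g []) d - tq3 a b (bs g [] \<star> d)) \<in> R3"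
        by (rule pm.subspace_neg[OF R3_subspace R3_bal2[OF aN b dP gk]])
      then have "tq3 a b (bs g [] \<star> d) - tq3 a (b \<star> bs g []) d \<in> R3" by (simp only: minus_diff_eq)
      ultimately show "tq3 a b (restr (\<lambda>s. fst s = g) c) \<in> N"
        unfolding d(2) by (rule comb[rotated])
    qed
    moreover have "(\<Sum>g\<in>?T. pm_scale 1 (restr (\<lambda>s. fst s = g) c)) = c"
      using sum_restr_fibres[of ?T c fst] by simp
    ultimately show ?thesis by simp
  qed
  have s5: "tq3 a b c \<in> N" if b: "b \<in> BH" and a: "a \<in> AN" and c: "c \<in> AP" for a b c
  proof -
    let ?T = "fst ` Poly_Mapping.keys a"
    have T: "?T \<subseteq> HFs" using a by (auto simp: KX_def kset_def)
    have m: "\<exists>d\<in>Um0. restr (\<lambda>s. fst s = g) a = d \<star> bs g []" if "g \<in> ?T" for g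
      using AN_component[OF a] T that by blast
    have "tq3 (\<Sum>g\<in>?T. pm_scale 1 (restr (\<lambda>s. fst s = g) a)) b c \<in> N"
    proof (rule lift[OF modlin1[OF b c] AN_subspace])
      fix g assume g: "g \<in> ?T"
      obtain d where d: "d \<in> Um0" "restr (\<lambda>s. fst s = g) a = d \<star> bs g []" using m[OF g] by blast
      have gk: "bs g [] \<in> kset (HFs \<times> {[]})" using g T by auto
      have dP: "d \<in> AN" using d(1) Um0_AN by blast
      show "restr (\<lambda>s. fst s = g) a \<in> AN" unfolding d(2) by (rule AN_mul[OF dP subsetD[OF kF_AN gk]])
      have "tq3 d (bs g [] \<star> b) c \<in> N" using s4[OF BH_mul[OF subsetD[OF kF_BH gk] b] d(1) c] .
      then show "tq3 (restr (\<lambda>s. fst s = g) a) b c \<in> N"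
        unfolding d(2) by (rule comb[OF R3_bal1[OF dP b c gk]])
    qed
    moreover have "(\<Sum>g\<in>?T. pm_scale 1 (restr (\<lambda>s. fst s = g) a)) = a"
      using sum_restr_fibres[of ?T a fst] by simp
    ultimately show ?thesis by simp
  qed
  show ?thesis
  proof
    fix p assume p: "p \<in> KEYS"
    have "lin_ext (\<lambda>s. Poly_Mapping.single s 1) p \<in> N"
    proof (rule lin_ext_mem[OF N(1)])
      fix s assume "s \<in> Poly_Mapping.keys p"
      with p have "s \<in> UM \<times> kH D II \<times> UP" by blast
      then obtain a b c where "s = (cl a, cl b, cl c)" "a \<in> AN" "b \<in> BH" "c \<in> AP"
        unfolding UM_eq UP_eq kH_eq by blast
      then show "Poly_Mapping.single s 1 \<in> N" using s5 by simp
    qed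
    then show "p \<in> N" by (simp only: lin_ext_single_id)
  qed
qed

text \<open>Modulo the relations the tensor is a combination q of elements h e h^-1 \<otimes> h
  \<otimes> d. Its product, a combination of the h e d, is triangular and lies in the ideal, hence
  in \<open>K\<close>; the functionals \<open>Phi\<close> built from the dual bases then show that
  every coefficient of q is zero.\<close>

lemma LP_inj:
  assumes p: "p \<in> KEYS" and LPp: "LP p \<in> II" shows "p \<in> R3"
proof -
  obtain E1 \<phi>1 S1 where E1: "E1 \<subseteq> Um0" "\<And>e. lfun (\<phi>1 e)" "\<And>e w. e \<in> E1 \<Longrightarrow> w \<in> Jm \<Longrightarrow> \<phi>1 e w = 0"
    "\<And>e e'. e \<in> E1 \<Longrightarrow> e' \<in> E1 \<Longrightarrow> \<phi>1 e e' = (if e = e' then 1 else 0)"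
    "\<And>v. v \<in> Um0 \<Longrightarrow> finite (S1 v) \<and> S1 v \<subseteq> E1"
    "\<And>v F. \<lbrakk>v \<in> Um0; finite F; S1 v \<subseteq> F; F \<subseteq> E1\<rbrakk> \<Longrightarrow> v - (\<Sum>e\<in>F. pm_scale (\<phi>1 e v) e) \<in> Jm"
    by (rule relative_dual_basis_supports[OF Jm_subspace, of Um0]) (rule that)
  obtain E2 \<phi>2 S2 where E2: "E2 \<subseteq> Up0" "\<And>e. lfun (\<phi>2 e)" "\<And>e w. e \<in> E2 \<Longrightarrow> w \<in> Jp \<Longrightarrow> \<phi>2 e w = 0"
    "\<And>e e'. e \<in> E2 \<Longrightarrow> e' \<in> E2 \<Longrightarrow> \<phi>2 e e' = (if e = e' then 1 else 0)"
    "\<And>v. v \<in> Up0 \<Longrightarrow> finite (S2 v) \<and> S2 v \<subseteq> E2"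
    "\<And>v F. \<lbrakk>v \<in> Up0; finite F; S2 v \<subseteq> F; F \<subseteq> E2\<rbrakk> \<Longrightarrow> v - (\<Sum>e\<in>F. pm_scale (\<phi>2 e v) e) \<in> Jp"
    by (rule relative_dual_basis_supports[OF Jp_subspace, of Up0]) (rule that)
  define Nq :: "_ \<Rightarrow> (_ \<Rightarrow>\<^sub>0 'k)" where "Nq = lin_ext (\<lambda>(h, e, d). tq3 (bs h [] \<star> e \<star> bs (hinv h) []) (bs h []) d)"
  define Lq :: "_ \<Rightarrow> (_ \<Rightarrow>\<^sub>0 'k)" where "Lq = lin_ext (\<lambda>(h, e, d). bs h [] \<star> e \<star> d)"
  define QK where "QK = {q :: _ \<Rightarrow>\<^sub>0 'k. Poly_Mapping.keys q \<subseteq> H \<times> E1 \<times> E2}"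
  have QK: "pm.subspace QK" unfolding QK_def by (rule subspace_keys)
  have lN: "lin Nq" and lL: "lin Lq" unfolding Nq_def Lq_def by (rule lin_lin_ext)+
  define N where "N = {p. \<exists>q\<in>QK. p - Nq q \<in> R3}"
  have R3N: "R3 \<subseteq> N"
  proof
    fix r assume "r \<in> R3"
    then have "r - Nq 0 \<in> R3" by (simp add: lin_zero[OF lN])
    then show "r \<in> N" unfolding N_def using pm.subspace_0[OF QK] by blast
  qed
  have N: "pm.subspace N"
    unfolding pm.subspace_def
  proof (intro conjI ballI allI)
    show "0 \<in> N" using R3N pm.subspace_0[OF R3_subspace] by blast
    fix x y assume "x \<in> N" "y \<in> N"
    then obtain q r where qr: "q \<in> QK" "x - Nq q \<in> R3" "r \<in> QK" "y - Nq r \<in> R3" unfolding N_def by blast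
    have "(x + y) - Nq (q + r) \<in> R3"
      using pm.subspace_add[OF R3_subspace qr(2,4)] by (simp add: lin_add[OF lN] algebra_simps)
    then show "x + y \<in> N" unfolding N_def using pm.subspace_add[OF QK qr(1,3)] by blast
  next
    fix c x assume "x \<in> N"
    then obtain q where q: "q \<in> QK" "x - Nq q \<in> R3" unfolding N_def by blast
    have "pm_scale c x - Nq (pm_scale c q) \<in> R3"
      using pm.subspace_scale[OF R3_subspace q(2), of c] by (simp add: lin_scale[OF lN] pm.scale_right_diff_distrib)
    then show "pm_scale c x \<in> N" unfolding N_def using pm.subspace_scale[OF QK q(1)] by blast
  qed
  have "KEYS \<subseteq> N"
  proof (rule span_KEYS[OF N R3N E1(1) E2(1)])
    fix h e d assume hed: "h \<in> H" "e \<in> E1" "d \<in> E2"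
    let ?s = "Poly_Mapping.single (h, e, d) (1::'k)"
    have "?s \<in> QK" using hed by (simp add: QK_def)
    moreover have "tq3 (bs h [] \<star> e \<star> bs (hinv h) []) (bs h []) d - Nq ?s \<in> R3"
      using pm.subspace_0[OF R3_subspace] by (simp add: Nq_def)
    ultimately show "tq3 (bs h [] \<star> e \<star> bs (hinv h) []) (bs h []) d \<in> N" unfolding N_def by blast
  next
    fix a assume a: "a \<in> Um0"
    have "a - (\<Sum>e\<in>S1 a. pm_scale (\<phi>1 e a) e) \<in> Jm" using E1(5)[OF a] by (intro E1(6)[OF a]) auto
    from conjI[OF conjunct2[OF E1(5)[OF a]] Jm_II[OF this]]
    show "\<exists>F c. F \<subseteq> E1 \<and> a - (\<Sum>e\<in>F. pm_scale (c e) e) \<in> II" by (intro exI)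
  next
    fix a assume a: "a \<in> Up0"
    have "a - (\<Sum>e\<in>S2 a. pm_scale (\<phi>2 e a) e) \<in> Jp" using E2(5)[OF a] by (intro E2(6)[OF a]) auto
    from conjI[OF conjunct2[OF E2(5)[OF a]] Jp_II[OF this]]
    show "\<exists>F c. F \<subseteq> E2 \<and> a - (\<Sum>e\<in>F. pm_scale (c e) e) \<in> II" by (intro exI)
  qed
  then obtain q where q: "q \<in> QK" "p - Nq q \<in> R3" using p unfolding N_def by blast
  have key: "\<exists>h e d. s = (h, e, d) \<and> h \<in> H \<and> e \<in> E1 \<and> d \<in> E2 \<and> e \<in> Um0 \<and> d \<in> Up0 \<and> e \<in> CS \<and> d \<in> CS"
    if "s \<in> Poly_Mapping.keys q" for s
  proof -
    obtain h e d where s: "s = (h, e, d)" by (cases s)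
    have "s \<in> H \<times> E1 \<times> E2" using that q(1) unfolding QK_def by blast
    then have "h \<in> H" "e \<in> E1" "d \<in> E2" unfolding s by simp_all
    moreover from this have "e \<in> Um0" "d \<in> Up0" using E1(1) E2(1) by blast+
    moreover from this have "e \<in> CS" "d \<in> CS" by (simp_all add: hat_def)
    ultimately show ?thesis using s by simp
  qed
  have NL: "LP (Nq q) - Lq q \<in> II"
  proof (rule lin_mem_on_keys[OF lin_minus[OF lin_comp[OF lin_LP lN] lL] II_subspace])
    fix s assume "s \<in> Poly_Mapping.keys q"
    then obtain h e d where s: "s = (h, e, d)" "h \<in> H" "e \<in> CS" "d \<in> CS" using key by blast
    have "bs h [] \<star> e \<star> bs (hinv h) [] \<star> bs h [] \<star> d = bs h [] \<star> e \<star> d"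
      using s by (simp add: mul_assoc grp_cancel')
    moreover have "LP (tq3 (bs h [] \<star> e \<star> bs (hinv h) []) (bs h []) d) -
      pm_scale 1 (bs h [] \<star> e \<star> bs (hinv h) [] \<star> bs h [] \<star> d) \<in> II"
      using s by (intro LP_single) auto
    ultimately show "LP (Nq (Poly_Mapping.single s 1)) - Lq (Poly_Mapping.single s 1) \<in> II"
      by (simp add: s(1) Nq_def Lq_def)
  qed
  have "LP (p - Nq q) \<in> II" using R3_LP q(2) by blast
  from II_diff[OF II_diff[OF LPp this] NL]
  have LII: "Lq q \<in> II" by (simp add: lin_diff[OF lin_LP])
  have "Lq q \<in> TR"
    unfolding Lq_def
  proof (rule lin_ext_mem[OF TR_subspace])
    fix s assume "s \<in> Poly_Mapping.keys q"
    then obtain h e d where s: "s = (h, e, d)" "h \<in> H" "e \<in> Um0" "d \<in> Up0" using key by blast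
    then show "(case s of (h, e, d) \<Rightarrow> bs h [] \<star> e \<star> d) \<in> TR" by (simp add: VL_prod_TR)
  qed
  then have LK: "Lq q \<in> K" using nu_II[OF LII] by (simp add: nu_tri)
  have "q = 0"
  proof (rule poly_mapping_eqI)
    fix s
    show "Poly_Mapping.lookup q s = Poly_Mapping.lookup 0 s"
    proof (cases "s \<in> Poly_Mapping.keys q")
      case True
      then obtain h0 e0 d0 where s: "s = (h0, e0, d0)" "e0 \<in> E1" "d0 \<in> E2" using key by blast
      let ?P = "Phi h0 (\<phi>1 e0) (\<phi>2 d0)"
      have "?P (Lq q) = Poly_Mapping.lookup q s"
      proof (rule lfun_eq_on_keys[OF lfun_comp[OF lfun_Phi lL] lfun_lookup])
        fix t assume "t \<in> Poly_Mapping.keys q"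
        then obtain h e d where t: "t = (h, e, d)" "h \<in> H" "e \<in> E1" "d \<in> E2" "e \<in> VL Neg" "d \<in> VL Pos" using key by blast
        show "?P (Lq (Poly_Mapping.single t 1)) = Poly_Mapping.lookup (Poly_Mapping.single t 1) s"
          using Phi_prod[OF t(2,5,6) E1(2) E2(2), of h0 e0 d0] E1(4)[OF s(2) t(3)] E2(4)[OF s(3) t(4)]
          by (auto simp: Lq_def t(1) s(1) lookup_single when_def)
      qed
      moreover have "?P (Lq q) = 0"
        by (rule Phi_K[OF E1(2) E1(3)[OF s(2)] E2(2) E2(3)[OF s(3)] LK])
      ultimately show ?thesis by simp
    qed (simp add: in_keys_iff)
  qed
  then show ?thesis using q(2) by (simp add: lin_zero[OF lN])
qed

text \<open>U^- and U^+ are the intersections of \<open>U\<close> with the negative and the positive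
  part. The hypothesis gives surjectivity through \<open>LP_surj\<close>, and injectivity is
  \<open>LP_inj\<close>.\<close>

lemma triangular_decomp:
  assumes Z: "hat U \<subseteq> Zs U" shows "has_triangular_decomp D II U"
  unfolding has_triangular_decomp_def
proof (intro exI conjI)
  show "right_coideal_subalg (skew_quot D II) (neg_part D II) UM"
    using coideal_KX[OF HFs_subgroup letN U] unfolding neg_part_eq .
  show "right_coideal_subalg (skew_quot D II) (pos_part D II) UP"
    using coideal_KX[OF HGs_subgroup letP U] unfolding pos_part_eq .
  show "kF D II \<subseteq> UM" unfolding UM_eq kF_eq by (rule image_mono[OF kF_AN])
  show "kG D II \<subseteq> UP" unfolding UP_eq kG_eq by (rule image_mono[OF kG_AP])
  show "bij_betw (mult3 (skew_quot D II)) (tens3 (skew_quot D II) (kF D II) (kG D II) UM (kH D II) UP) U"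
    unfolding tens3_def bij_betw_def
  proof (rule conjI[OF inj_onI equalityI[OF subsetI subsetI]])
    fix x y
    assume "x \<in> {(+) p ` R3 | p. Poly_Mapping.keys p \<subseteq> UM \<times> kH D II \<times> UP}"
      and "y \<in> {(+) p ` R3 | p. Poly_Mapping.keys p \<subseteq> UM \<times> kH D II \<times> UP}"
    then obtain p r where pr: "x = (+) p ` R3" "p \<in> KEYS" "y = (+) r ` R3" "r \<in> KEYS" by blast
    assume "mult3 Q x = mult3 Q y"
    then have "cl (LP p) = cl (LP r)" unfolding pr(1,3) mult3_class[OF pr(2)] mult3_class[OF pr(4)] .
    then have "LP (p - r) \<in> II" by (simp add: cl_eq lin_diff[OF lin_LP])
    then have "p - r \<in> R3" by (rule LP_inj[OF pm.subspace_diff[OF KEYS_subspace pr(2,4)]])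
    then show "x = y" unfolding pr(1,3) by (rule coset_eqI[OF R3_subspace])
  next
    fix x assume "x \<in> mult3 Q ` {(+) p ` R3 | p. Poly_Mapping.keys p \<subseteq> UM \<times> kH D II \<times> UP}"
    then obtain p where p: "x = mult3 Q ((+) p ` R3)" "p \<in> KEYS" by blast
    then show "x \<in> U" using LP_hat[OF p(2)] by (simp add: mult3_class hat_def)
  next
    fix x assume x: "x \<in> U"
    then have "x \<in> carrier Q" using U by (auto simp: right_coideal_subalg_def)
    then have r: "rep x \<in> CS" "cl (rep x) = x" using rep[of x] by auto
    then have "rep x \<in> Zs U" using x Z by (auto simp: hat_def)
    then obtain p where p: "p \<in> KEYS" "LP p - rep x \<in> II" using LP_surj by blast
    have "mult3 Q ((+) p ` R3) = x" using p r(2) by (simp only: mult3_class) (simp flip: cl_eq)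
    then show "x \<in> mult3 Q ` {(+) p ` R3 | p. Poly_Mapping.keys p \<subseteq> UM \<times> kH D II \<times> UP}" using p(1) by blast
  qed
qed

end

section \<open>Homogeneity\<close>

lemma powi_eq_one_imp:
  fixes q :: "'k::field"
  assumes q: "\<forall>m::nat. m > 0 \<longrightarrow> q ^ m \<noteq> 1" and k: "q powi k = 1"
  shows "k = 0"
proof (rule ccontr)
  assume "k \<noteq> 0"
  then have "nat \<bar>k\<bar> > 0" by simp
  moreover have "q ^ nat \<bar>k\<bar> = 1"
    using k by (cases "k \<ge> 0") (auto simp: power_int_def power_inverse)
  ultimately show False using q by blast
qed

text \<open>The recursion forces m to be linear in the index, and a linear function that vanishes at
  0 and at n + 1 is zero. This is the invertibility over the rationals of the Cartan matrix of type
  A_n.\<close>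

lemma harmonic_zero:
  fixes m :: "nat \<Rightarrow> int"
  assumes "m 0 = 0" "m (Suc n) = 0" "\<And>j. 1 \<le> j \<Longrightarrow> j \<le> n \<Longrightarrow> 2 * m j = m (j - 1) + m (j + 1)"
    and i: "i \<le> n"
  shows "m i = 0"
proof -
  have lin: "i \<le> n \<Longrightarrow> m i = int i * m 1 \<and> m (Suc i) = int (Suc i) * m 1" for i
  proof (induction i)
    case (Suc i)
    then have "m i = int i * m 1" "m (Suc i) = int (Suc i) * m 1" by simp_all
    then show ?case using assms(3)[of "Suc i"] Suc.prems by (simp add: algebra_simps)
  qed (use assms(1) in simp)
  have "int (Suc n) * m 1 = 0" using lin[of n] assms(2) by simp
  then have "m 1 = 0" by (metis mult_eq_0_iff of_nat_eq_0_iff nat.distinct(1))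
  then show ?thesis using lin[OF i] by simp
qed

context qd
begin

lemma chiH_nz: "i \<in> idx D \<Longrightarrow> h \<in> H \<Longrightarrow> chiH D i h \<noteq> 0"
  using lchar_nz[of "Pos i" h] by simp

abbreviation chiM where "chiM M h \<equiv> prod_mset (image_mset (\<lambda>i. chiH D i h) M)"

text \<open>The character of a word is the quotient of the values for its positive and negative
  indices. The form without division fits the equation between sums of multisets in
  \<open>wdeg_eqD\<close>.\<close>

lemma wchar_chiM:
  assumes "w \<in> W" "h \<in> H"
  shows "wchar D w h * chiM (nI w) h = chiM (pI w) h" "chiM (nI w) h \<noteq> 0"
  using assms(1)
proof (induction w rule: nI.induct)
  case (2 i w)
  { case 1 then have "i \<in> idx D" "w \<in> W" by auto
    with 2 assms(2) chiH_nz[of i h] show ?case by (simp add: field_simps) }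
  { case 2 then show ?case using "2.IH"(2) chiH_nz[of i h] assms(2) by auto }
qed auto

lemma wchar_wdeg:
  assumes "w \<in> W" "w' \<in> W" "h \<in> H" "wdeg w = wdeg w'"
  shows "wchar D w h = wchar D w' h"
proof -
  let ?N = "chiM (nI w) h * chiM (nI w') h"
  have "chiM (pI w + nI w') h = chiM (pI w' + nI w) h" using wdeg_eqD[OF assms(4)] by simp
  then have "wchar D w h * ?N = wchar D w' h * ?N"
    by (simp add: wchar_chiM(1)[OF assms(1,3), symmetric] wchar_chiM(1)[OF assms(2,3), symmetric] mult_ac)
  then show ?thesis using wchar_chiM(2)[OF assms(1,3)] wchar_chiM(2)[OF assms(2,3)] by simp
qed

text \<open>The exponents are the entries 2, -1 and 0 of the Cartan matrix of type A_n. Indices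
  start at 1, so for j = 1 the truncated \<open>j - 1\<close> is 0 and matches no letter.\<close>

lemma chiH_gf:
  assumes "i \<in> idx D" "j \<in> idx D"
  shows "chiH D i (gf j) = qpar D powi (2 * (if j = i then 1 else 0) - (if j - 1 = i then 1 else 0) - (if j + 1 = i then 1 else 0))"
proof -
  have c: "chiH D i (gf j) = pp D i j * pp D j i"
    using assms by (simp add: chiH_mult inG_closed inF_closed gel_closed fel_closed)
  have j1: "j \<ge> 1" "i \<ge> 1" using assms by (auto simp: idx_def)
  consider "j = i" | "j = i + 1" | "i = j + 1" | "\<bar>int i - int j\<bar> > 1" by linarith
  then show ?thesis
  proof cases
    case 1
    have "i - 1 \<noteq> i" using j1 by simp
    then show ?thesis using c assms unfolding 1 by (simp add: pp_diag power2_eq_square)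
  next
    case 2
    then show ?thesis using c assms pp_adj[of i] unfolding 2 by (simp add: power_int_minus mult.commute)
  next
    case 3
    have "j - 1 \<noteq> j + 1" by simp
    then show ?thesis using c assms pp_adj[of j] unfolding 3 by (simp add: power_int_minus mult.commute)
  next
    case 4
    then have "j \<noteq> i" "j - 1 \<noteq> i" "j + 1 \<noteq> i" using j1 by auto
    then show ?thesis using assms pp_far[of i j] 4 by (simp add: c)
  qed
qed

text \<open>Row j of the Cartan matrix applied to a degree. The neighbours 0 and n + 1 of the index
  range carry no letters, so degrees of words are zero there.\<close>

abbreviation cart where
  "cart j \<gamma> \<equiv> 2 * Poly_Mapping.lookup \<gamma> j - Poly_Mapping.lookup \<gamma> (j - 1) - Poly_Mapping.lookup \<gamma> (j + 1)"

lemma lchar_gf: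
  assumes "y \<in> letters D" "j \<in> idx D"
  shows "lchar D y (gf j) = qpar D powi cart j (ldeg y)"
proof (cases y)
  case (Pos i)
  then have "i \<in> idx D" using assms(1) by (auto simp: letters_def)
  then show ?thesis using chiH_gf[OF _ assms(2), of i] Pos by (simp add: lookup_single when_def eq_commute[of i])
next
  case (Neg i)
  then have "i \<in> idx D" using assms(1) by (auto simp: letters_def)
  moreover have "cart j (ldeg y) = - cart j (ldeg (Pos i))" using Neg by (simp add: lookup_minus)
  ultimately show ?thesis
    using chiH_gf[OF _ assms(2), of i] Neg
    by (simp only: power_int_minus) (simp add: lookup_single when_def eq_commute[of i])
qed

lemma wchar_gf:
  assumes "w \<in> W" "j \<in> idx D"
  shows "wchar D w (gf j) = qpar D powi cart j (wdeg w)"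
  using assms(1)
proof (induction w)
  case (Cons y w)
  then have IH: "wchar D w (gf j) = qpar D powi cart j (wdeg w)" and y: "y \<in> letters D" by auto
  have "cart j (wdeg (y # w)) = cart j (ldeg y) + cart j (wdeg w)" by (simp add: lookup_add)
  then have "qpar D powi cart j (wdeg (y # w)) = qpar D powi cart j (ldeg y) * qpar D powi cart j (wdeg w)"
    by (simp only: power_int_add[OF disjI1[OF q_nz]])
  then show ?case using lchar_gf[OF y assms(2)] IH by (simp only: wchar_Cons)
qed simp

lemma lookup_wdeg_outside: "w \<in> W \<Longrightarrow> i \<notin> idx D \<Longrightarrow> Poly_Mapping.lookup (wdeg w) i = 0"
proof (induction w)
  case (Cons y w)
  then show ?case by (auto elim!: letters_cases simp: lookup_add lookup_minus lookup_single when_def)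
qed simp

text \<open>
  The values at the elements \<open>g\<^sub>jf\<^sub>j\<close> are the powers of \<open>q\<close> whose exponents form the image of the
  degree under the Cartan matrix, which is invertible.
\<close>

lemma wdeg_separated:
  assumes q: "\<forall>m::nat. m > 0 \<longrightarrow> qpar D ^ m \<noteq> 1"
    and w: "w \<in> W" "w' \<in> W" and eq: "\<And>h. h \<in> H \<Longrightarrow> wchar D w h = wchar D w' h"
  shows "wdeg w = wdeg w'"
proof (rule poly_mapping_eqI)
  define m where "m i = Poly_Mapping.lookup (wdeg w) i - Poly_Mapping.lookup (wdeg w') i" for i
  have out: "m i = 0" if "i \<notin> idx D" for i using lookup_wdeg_outside w that by (simp add: m_def)
  \<comment> \<open>The characters of the two words are compared at g_j f_j; as q is not a root of
    unity, equality of powers of q gives equality of exponents.\<close>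
  have step: "2 * m j = m (j - 1) + m (j + 1)" if "1 \<le> j" "j \<le> rk D" for j
  proof -
    have j: "j \<in> idx D" using that by (simp add: idx_def)
    have "qpar D powi cart j (wdeg w) = qpar D powi cart j (wdeg w')"
      using eq[OF gf_closed[OF j]] unfolding wchar_gf[OF w(1) j] wchar_gf[OF w(2) j] .
    then have "qpar D powi (cart j (wdeg w) - cart j (wdeg w')) = 1"
      using q_nz by (subst power_int_diff) (simp_all add: power_int_eq_0_iff)
    from powi_eq_one_imp[OF q this] show ?thesis by (simp add: m_def)
  qed
  fix i
  have "m i = 0"
  proof (cases "i \<le> rk D")
    case True
    show ?thesis by (rule harmonic_zero[OF _ _ step True]) (auto intro!: out simp: idx_def)
  next
    case False
    then show ?thesis by (intro out) (simp add: idx_def)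
  qed
  then show "Poly_Mapping.lookup (wdeg w) i = Poly_Mapping.lookup (wdeg w') i" by (simp add: m_def)
qed

end

context qJ
begin

lemma lookup_conj:
  assumes a: "a \<in> CS" and h: "h \<in> H"
  shows "Poly_Mapping.lookup (bs (hinv h) [] \<star> a \<star> bs h []) s = wchar D (snd s) h * Poly_Mapping.lookup a s"
proof (rule kset_lfun_eq[OF a[unfolded CS_kset], of "\<lambda>a. Poly_Mapping.lookup (bs (hinv h) [] \<star> a \<star> bs h []) s" "\<lambda>a. wchar D (snd s) h * Poly_Mapping.lookup a s"])
  show "lfun (\<lambda>a. Poly_Mapping.lookup (bs (hinv h) [] \<star> a \<star> bs h []) s)"
    by (intro lfun_comp[OF lfun_lookup] lin_comp[OF lin_mul_left] lin_mul_right)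
  show "lfun (\<lambda>a. wchar D (snd s) h * Poly_Mapping.lookup a s)" by (rule lfun_mult[OF lfun_lookup])
  fix k w assume kw: "(k, w) \<in> H \<times> W"
  then have "hinv h \<cdot> k \<cdot> h = k" using h by (simp add: HG.m_comm[of "hinv h" k] HG.m_assoc)
  then show "Poly_Mapping.lookup (bs (hinv h) [] \<star> bs k w \<star> bs h []) s = wchar D (snd s) h * Poly_Mapping.lookup (bs k w) s"
    using kw h by (auto simp: lookup_single when_def)
qed

end

section \<open>From homogeneous elements to the whole subalgebra\<close>

context qU
begin

lemma II_Zs: "a \<in> II \<Longrightarrow> a \<in> Zs U"
  unfolding Zs_def[OF U kHU] by (intro pm.span_base) simp

lemma hat_Zs_homogeneous:
  assumes G: "Gamma_homogeneous D II U" shows "hat U \<subseteq> Zs U"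
proof
  fix a assume a: "a \<in> hat U"
  then have clU: "cl a \<in> U" and aC: "a \<in> CS" by (auto simp: hat_def)
  from bspec[OF G[unfolded Gamma_homogeneous_def] clU] obtain S v where
    S0: "finite S \<and> S \<subseteq> carrier (free_Abelian_group (idx D)) \<and> (\<forall>\<gamma>\<in>S. v \<gamma> \<in> U \<inter> homog_comp D II \<gamma>) \<and> cl a = finsum Q v S"
    by (elim exE) (rule that)
  have S: "finite S" "\<And>\<gamma>. \<gamma> \<in> S \<Longrightarrow> v \<gamma> \<in> U \<inter> homog_comp D II \<gamma>" "cl a = finsum Q v S"
    using S0 by simp_all
  have "\<forall>\<gamma>\<in>S. \<exists>b. v \<gamma> = cl b \<and> b \<in> CS \<and> (\<forall>(h, w)\<in>Poly_Mapping.keys b. wdeg w = \<gamma>)"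
  proof
    fix \<gamma> assume "\<gamma> \<in> S"
    from S(2)[OF this] show "\<exists>b. v \<gamma> = cl b \<and> b \<in> CS \<and> (\<forall>(h, w)\<in>Poly_Mapping.keys b. wdeg w = \<gamma>)"
      unfolding homog_comp_def by (simp add: cl_def)
  qed
  from bchoice[OF this] obtain b where
    b0: "\<forall>\<gamma>\<in>S. v \<gamma> = cl (b \<gamma>) \<and> b \<gamma> \<in> CS \<and> (\<forall>(h, w)\<in>Poly_Mapping.keys (b \<gamma>). wdeg w = \<gamma>)"
    by (elim exE) (rule that)
  note b = bspec[OF b0]
  have bC: "\<And>\<gamma>. \<gamma> \<in> S \<Longrightarrow> b \<gamma> \<in> CS" using b by blast
  have "finsum Q v S = finsum Q (\<lambda>\<gamma>. cl (b \<gamma>)) S"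
    using b by (intro QR.finsum_cong') (auto simp: Q_carrier)
  then have "cl a = cl (\<Sum>\<gamma>\<in>S. b \<gamma>)" using S(3) finsum_cl[OF S(1), of b, OF bC] by simp
  then have d: "a - (\<Sum>\<gamma>\<in>S. b \<gamma>) \<in> Zs U" by (intro II_Zs) (simp add: cl_eq)
  have "(\<Sum>\<gamma>\<in>S. b \<gamma>) \<in> Zs U"
  proof (rule pm.subspace_sum[OF Zs_subspace[OF U kHU]])
    fix \<gamma> assume g: "\<gamma> \<in> S"
    have "b \<gamma> \<in> hat U" using b[OF g] S(2)[OF g] by (simp add: hat_def)
    moreover have "wdeg w = \<gamma>" if "(h, w) \<in> Poly_Mapping.keys (b \<gamma>)" for h w
      using bspec[OF conjunct2[OF conjunct2[OF b[OF g]]] that] by simp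
    ultimately show "b \<gamma> \<in> Zs U" by (rule homogeneous_Zs_CS[OF U kHU])
  qed
  from pm.subspace_add[OF Zs_subspace[OF U kHU] d this] show "a \<in> Zs U" by simp
qed

text \<open>Induction on the number of degrees that occur. For h separating two of them, the
  conjugate of a by h minus the eigenvalue of one degree times a lacks that degree, so it lies in
  \<open>Zs U\<close>. This holds for either degree, and the difference of the two elements is a
  nonzero multiple of a.\<close>

lemma hat_Zs_generic:
  assumes q: "\<forall>m::nat. m > 0 \<longrightarrow> qpar D ^ m \<noteq> 1" shows "hat U \<subseteq> Zs U"
proof
  fix a assume "a \<in> hat U"
  then show "a \<in> Zs U"
  proof (induction "card ((\<lambda>s. wdeg (snd s)) ` Poly_Mapping.keys a)" arbitrary: a rule: less_induct)
    case less
    let ?d = "\<lambda>s::('g \<times> 'f) set \<times> letter list. wdeg (snd s)"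
    have aC: "a \<in> CS" using less.prems by (simp add: hat_def)
    then have kW: "snd s \<in> W" if "s \<in> Poly_Mapping.keys a" for s using that by (auto simp: CS_kset kset_def)
    show ?case
    proof (cases "\<exists>s\<in>Poly_Mapping.keys a. \<exists>t\<in>Poly_Mapping.keys a. ?d s \<noteq> ?d t")
      case True
      then obtain s t where st: "s \<in> Poly_Mapping.keys a" "t \<in> Poly_Mapping.keys a" "?d s \<noteq> ?d t" by blast
      have "\<exists>h\<in>H. wchar D (snd s) h \<noteq> wchar D (snd t) h"
        by (rule ccontr) (use wdeg_separated[OF q kW[OF st(1)] kW[OF st(2)]] st(3) in blast)
      then obtain h where h: "h \<in> H" "wchar D (snd s) h \<noteq> wchar D (snd t) h" by blast
      let ?j = "bs (hinv h) [] \<star> a \<star> bs h []"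
      have j: "?j \<in> hat U"
        using h(1) by (intro hU(3)[OF hU(3)[OF Uh_grp[OF U kHU] less.prems] Uh_grp[OF U kHU]]) auto
      have sub: "?j - pm_scale (wchar D (snd r) h) a \<in> Zs U" if r: "r \<in> Poly_Mapping.keys a" for r
      proof (rule less.hyps)
        let ?b = "?j - pm_scale (wchar D (snd r) h) a"
        show "?b \<in> hat U" using j less.prems by (intro pm.subspace_diff[OF hU(1)] pm.subspace_scale[OF hU(1)])
        have l: "Poly_Mapping.lookup ?b x = (wchar D (snd x) h - wchar D (snd r) h) * Poly_Mapping.lookup a x" for x
          by (simp only: lookup_minus lookup_conj[OF aC h(1)] lookup_pm_scale left_diff_distrib)
        have kb: "x \<in> Poly_Mapping.keys a \<and> ?d x \<noteq> ?d r" if "x \<in> Poly_Mapping.keys ?b" for x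
        proof -
          have x: "x \<in> Poly_Mapping.keys a" "wchar D (snd x) h \<noteq> wchar D (snd r) h"
            using that unfolding in_keys_iff l by auto
          then show ?thesis using wchar_wdeg[OF kW[OF x(1)] kW[OF r] h(1)] by blast
        qed
        have "?d ` Poly_Mapping.keys ?b \<subseteq> ?d ` Poly_Mapping.keys a - {?d r}"
        proof (rule image_subsetI)
          fix x assume "x \<in> Poly_Mapping.keys ?b"
          note x = kb[OF this]
          show "?d x \<in> ?d ` Poly_Mapping.keys a - {?d r}"
            using imageI[OF conjunct1[OF x], of ?d] conjunct2[OF x] by simp
        qed
        moreover have "?d r \<in> ?d ` Poly_Mapping.keys a" using r by (rule imageI)
        moreover have psub: "A \<subset> B" if "A \<subseteq> B - {z}" "z \<in> B" for A B :: "(nat \<Rightarrow>\<^sub>0 int) set" and z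
          using that by blast
        ultimately have "?d ` Poly_Mapping.keys ?b \<subset> ?d ` Poly_Mapping.keys a" by (intro psub)
        then show "card (?d ` Poly_Mapping.keys ?b) < card (?d ` Poly_Mapping.keys a)"
          by (rule psubset_card_mono[OF finite_imageI[OF finite_keys]])
      qed
      let ?c = "wchar D (snd t) h - wchar D (snd s) h"
      have "pm_scale (inverse ?c) ((?j - pm_scale (wchar D (snd s) h) a) - (?j - pm_scale (wchar D (snd t) h) a)) \<in> Zs U"
        by (rule pm.subspace_scale[OF Zs_subspace[OF U kHU] pm.subspace_diff[OF Zs_subspace[OF U kHU] sub[OF st(1)] sub[OF st(2)]]])
      moreover have "(j - x) - (j - y) = y - x" for j x y :: "('g \<times> 'f) set \<times> letter list \<Rightarrow>\<^sub>0 'k" by simp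
      ultimately have "pm_scale (inverse ?c) (pm_scale ?c a) \<in> Zs U"
        by (simp only: pm.scale_left_diff_distrib)
      moreover have "pm_scale (inverse ?c) (pm_scale ?c a) = a" using h(2) by simp
      ultimately show ?thesis by (simp only:)
    next
      case False
      show ?thesis
      proof (cases "Poly_Mapping.keys a = {}")
        case True
        then show ?thesis using pm.subspace_0[OF Zs_subspace[OF U kHU]] by simp
      next
        case False2: False
        then obtain s where s: "s \<in> Poly_Mapping.keys a" by blast
        have eq: "\<forall>x\<in>Poly_Mapping.keys a. \<forall>t\<in>Poly_Mapping.keys a. ?d x = ?d t" using False by blast
        have "wdeg w = ?d s" if "(h, w) \<in> Poly_Mapping.keys a" for h w
          using bspec[OF bspec[OF eq that] s] by simp
        then show ?thesis by (rule homogeneous_Zs_CS[OF U kHU less.prems])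
      qed
    qed
  qed
qed

end

context qd
begin

lemma Uq_triangular_decomp:
  assumes "\<forall>m::nat. m > 0 \<longrightarrow> qpar D ^ m \<noteq> 1"
    and "right_coideal_subalg (Uq D) (carrier (Uq D)) U" "kH D (Uq_ideal D) \<subseteq> U"
  shows "has_triangular_decomp D (Uq_ideal D) U"
proof -
  have "qU D (SJ Neg) (SJ Pos) U"
    using assms(2,3) unfolding Uq_ideal_II by (intro qU.intro qJ_Uq qU_axioms.intro)
  from qU.triangular_decomp[OF this qU.hat_Zs_generic[OF this assms(1)]]
  show ?thesis unfolding Uq_ideal_II .
qed

lemma uq_triangular_decomp:
  assumes "Gamma_homogeneous D (uq_ideal D) U"
    and "right_coideal_subalg (uq D) (carrier (uq D)) U" "kH D (uq_ideal D) \<subseteq> U"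
  shows "has_triangular_decomp D (uq_ideal D) U"
proof -
  have "qU D Lm Lp U"
    using assms(2,3) unfolding uq_ideal_II by (intro qU.intro qJ_uq qU_axioms.intro)
  from qU.triangular_decomp[OF this qU.hat_Zs_homogeneous[OF this assms(1)[unfolded uq_ideal_II]]]
  show ?thesis unfolding uq_ideal_II .
qed

end

theorem lemma9p1:
  fixes D :: "('g, 'f, 'k::field) datum"
  assumes "quantum_datum D"
  shows "((\<forall>m::nat. m > 0 \<longrightarrow> qpar D ^ m \<noteq> 1) \<longrightarrow>
      (\<forall>U. right_coideal_subalg (Uq D) (carrier (Uq D)) U \<and> kH D (Uq_ideal D) \<subseteq> U \<longrightarrow>
         has_triangular_decomp D (Uq_ideal D) U))
    \<and> (\<forall>t::nat. t > 2 \<and> qpar D ^ t = 1 \<and> (\<forall>m. 0 < m \<and> m < t \<longrightarrow> qpar D ^ m \<noteq> 1) \<longrightarrow>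
      (\<forall>U. right_coideal_subalg (uq D) (carrier (uq D)) U \<and> kH D (uq_ideal D) \<subseteq> U
           \<and> Gamma_homogeneous D (uq_ideal D) U \<longrightarrow>
         has_triangular_decomp D (uq_ideal D) U))"
proof -
  interpret qd D by unfold_locales (rule assms)
  show ?thesis using Uq_triangular_decomp uq_triangular_decomp by blast
qed

end
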